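(* Let $\varepsilon>0$ be a fixed constant and $\delta=n^{-(1/3+\varepsilon)}$, and let $N=O(\log n)$ (with a suitably large constant). There is an algorithm FindEnd with the following input and output. Input: (i) a location $r\in[0:3n/4]$, (ii) a string $u\in\{0,1\}^{r+m+1}$, (iii) a multiset of strings $\{y^1,\dots,y^N\}$ from $\{0,1\}^{\le n}$, and (iv) sample access to $\mathrm{Del}_\delta(x)$ for some unknown $x\in\{0,1\}^n$. Output: an integer $b$ and an integer $\ell_i$ for each $i\in[N]$. FindEnd draws $\tilde O(n^{2/3-\varepsilon})$ independent traces from $\mathrm{Del}_\delta(x)$, runs in $O(n^{5/3})$ time, and has the following guarantee: suppose $r$ is the first location that is deep in some desert of $x$, $u=x_{[0:r+m]}$, the end $\mathsf{end}$ of the desert to which $x_r$ belongs satisfies $\mathsf{end}\le 3n/4$, and $y^1,\dots,y^N$ are independent traces drawn from $\mathrm{Del}_\delta(x)$. Then with probability at least $1-1/n^2$, $b=\mathsf{end}$ and $\ell_i=\mathrm{last}(y^i)$ for at least a $0.9$ fraction of $i\in[N]$.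
   Context: Strings are indexed from $0$: $x=(x_0,\dots,x_{n-1})$, and $x_{[a:b]}=(x_a,\dots,x_b)$; $[a:b]=\{a,\dots,b\}$. $\mathrm{Del}_\delta(x)$ is the distribution of the string obtained from $x$ by deleting each bit independently with probability $\delta$ and concatenating the survivors (a trace). Let $C=\lceil 100/\varepsilon\rceil$, $m=n^{1/3}$, $M=2m+1$. For $s\in\{0,1\}^{\le C}$, a string is an $s$-desert if it is a prefix of $sss\cdots$ and has length at least $M$; a desert is an $s$-desert for some such $s$. A location $i$ is deep in a desert if $x_{[i-m:i+m]}$ is a desert. If $r$ is deep in a desert, let $s$ be the shortest string with $|s|\le C$ such that $x_{[r-m:r+m]}$ is an $s$-desert, $k=|s|$, and define the end of the desert to which $x_r$ belongs as $\mathsf{end}$ = the smallest integer $\ge r+m$ with $x_{\mathsf{end}+1}\ne x_{\mathsf{end}-k+1}$. For a trace $y$ of $x$, $\mathrm{last}(y)$ is the location $\ell$ in $y$ such that $y_\ell$ corresponds to the last bit of $x_{[0:\mathsf{end}]}$ that survives in $y$ ($\mathrm{last}(y)=-1$ if all of $x_{[0:\mathsf{end}]}$ is deleted). *)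

theory Defs
  imports
    "HOL-Probability.Probability"
    "HOL-Library.Landau_Symbols"
    "HOL-Library.Sublist"
begin

section \<open>Deserts\<close>

text \<open>Strings over \<open>{0,1}\<close> are boolean lists, indexed from 0.\<close>

type_synonym bits = "bool list"

definition substring :: "'a list \<Rightarrow> nat \<Rightarrow> nat \<Rightarrow> 'a list" where
  "substring x a b = take (b + 1 - a) (drop a x)"

text \<open>The half-width \<open>m = n\<^sup>1\<^sup>/\<^sup>3\<close>, rounded down when \<open>n\<close> is not a perfect cube.\<close>

definition half_width :: "nat \<Rightarrow> nat" where
  "half_width n = nat \<lfloor>root 3 (real n)\<rfloor>"

text \<open>
  Below, \<open>C\<close> is the bound on the length of the repeated pattern, and the minimal length of a desert
  is \<open>M = 2 * m + 1\<close>. As \<open>M > 0\<close>, the empty pattern yields no desert.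
\<close>

definition desert_of :: "nat \<Rightarrow> 'a list \<Rightarrow> 'a list \<Rightarrow> bool" where
  "desert_of m s z \<longleftrightarrow> (\<exists>j. prefix z (concat (replicate j s))) \<and> length z \<ge> 2 * m + 1"

definition desert :: "nat \<Rightarrow> nat \<Rightarrow> 'a list \<Rightarrow> bool" where
  "desert C m z \<longleftrightarrow> (\<exists>s. length s \<le> C \<and> desert_of m s z)"

definition deep :: "nat \<Rightarrow> nat \<Rightarrow> 'a list \<Rightarrow> nat \<Rightarrow> bool" where
  "deep C m x i \<longleftrightarrow> m \<le> i \<and> i + m < length x \<and> desert C m (substring x (i - m) (i + m))"

definition first_deep :: "nat \<Rightarrow> nat \<Rightarrow> 'a list \<Rightarrow> nat \<Rightarrow> bool" where
  "first_deep C m x r \<longleftrightarrow> deep C m x r \<and> (\<forall>i<r. \<not> deep C m x i)"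

definition pattern :: "nat \<Rightarrow> nat \<Rightarrow> 'a list \<Rightarrow> nat \<Rightarrow> 'a list" where
  "pattern C m x r =
     (ARG_MIN length s. length s \<le> C \<and> desert_of m s (substring x (r - m) (r + m)))"

text \<open>
  \<open>desert_end C m x r e\<close>: the end of the desert to which location \<open>r\<close> of \<open>x\<close> belongs exists and is
  \<open>e\<close>. It does not exist if the repetition continues up to the last symbol of \<open>x\<close>.
  The subtraction does not truncate when \<open>r\<close> is deep: then \<open>k \<le> 2 * m + 1 \<le> e + 1\<close>.
\<close>

definition breaks_at :: "'a list \<Rightarrow> nat \<Rightarrow> nat \<Rightarrow> bool" where
  "breaks_at x k e \<longleftrightarrow> e + 1 < length x \<and> x ! (e + 1) \<noteq> x ! (e + 1 - k)"

definition desert_end :: "nat \<Rightarrow> nat \<Rightarrow> 'a list \<Rightarrow> nat \<Rightarrow> nat \<Rightarrow> bool" where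
  "desert_end C m x r e \<longleftrightarrow>
     (let k = length (pattern C m x r)
      in r + m \<le> e \<and> breaks_at x k e \<and> (\<forall>e'. r + m \<le> e' \<and> e' < e \<longrightarrow> \<not> breaks_at x k e'))"


section \<open>The deletion channel\<close>

text \<open>
  A deletion pattern is a boolean list whose \<open>i\<close>th entry says whether the \<open>i\<close>th bit survives. The
  patterns are kept apart from the traces because \<open>last_loc\<close> depends on which bits survived and not
  only on the resulting string.
\<close>

definition survival_pmf :: "real \<Rightarrow> nat \<Rightarrow> bool list pmf" where
  "survival_pmf \<delta> n = replicate_pmf n (bernoulli_pmf (1 - \<delta>))"

definition survivors :: "bool list \<Rightarrow> nat list" where
  "survivors b = filter (\<lambda>i. b ! i) [0..<length b]"

definition trace_of :: "'a list \<Rightarrow> bool list \<Rightarrow> 'a list" where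
  "trace_of x b = map (\<lambda>i. x ! i) (survivors b)"

definition Del :: "real \<Rightarrow> 'a list \<Rightarrow> 'a list pmf" where
  "Del \<delta> x = map_pmf (trace_of x) (survival_pmf \<delta> (length x))"

text \<open>
  Position \<open>l\<close> of the trace holds the source bit number \<open>survivors b ! l\<close>.
\<close>

definition last_loc :: "nat \<Rightarrow> bool list \<Rightarrow> int" where
  "last_loc e b =
     (let L = {l. l < length (survivors b) \<and> survivors b ! l \<le> e}
      in if L = {} then -1 else int (Max L))"


section \<open>Algorithms\<close>

text \<open>
  Algorithms are while programs on a word RAM with sample access. There are registers (finitely many
  occur in a program) and a memory addressed by words. Words are signed in two's complement: with
  parameter \<open>w\<close> they range over \<open>{-2^w ..< 2^w}\<close> and arithmetic wraps around. Elementary operations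
  and tests take one step each. Drawing a sample takes one step plus one step for each symbol
  of the sample, which is written to memory.
\<close>

type_synonym reg = nat

datatype arith_op = Plus | Minus | Times | Quot | Rem

datatype instr =
    Const reg int
  | Arith arith_op reg reg reg
  | Load reg reg
  | Store reg reg
  | Draw reg reg

datatype com =
    Skip
  | Instr instr
  | Seq com com
  | IfLess reg reg com com
  | WhileLess reg reg com

text \<open>
  \<open>pending\<close> is the list of the samples that have not been drawn yet. Drawing when none is left
  has no result, so a program that terminates when started with \<open>T\<close> samples draws at most \<open>T\<close>.
\<close>

record config =
  regs :: "reg \<Rightarrow> int"
  mem :: "int \<Rightarrow> int"
  pending :: "bits list"

fun arith :: "arith_op \<Rightarrow> int \<Rightarrow> int \<Rightarrow> int" where
  "arith Plus a b = a + b"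
| "arith Minus a b = a - b"
| "arith Times a b = a * b"
| "arith Quot a b = a div b"
| "arith Rem a b = a mod b"

definition set_reg :: "nat \<Rightarrow> reg \<Rightarrow> int \<Rightarrow> config \<Rightarrow> config" where
  "set_reg w d v s = s\<lparr>regs := (regs s)(d := signed_take_bit w v)\<rparr>"

definition write_bits :: "int \<Rightarrow> bits \<Rightarrow> (int \<Rightarrow> int) \<Rightarrow> (int \<Rightarrow> int)" where
  "write_bits a z M =
     (\<lambda>i. if a \<le> i \<and> i < a + int (length z) then of_bool (z ! nat (i - a)) else M i)"

text \<open>
  The result consists of the number of steps and the new configuration. \<open>Draw d a\<close> writes the next
  sample to memory from the address in register \<open>a\<close> on, and its length to register \<open>d\<close>.
\<close>

fun instr_sem :: "nat \<Rightarrow> instr \<Rightarrow> config \<Rightarrow> (nat \<times> config) option" where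
  "instr_sem w (Const d v) s = Some (1, set_reg w d v s)"
| "instr_sem w (Arith f d a b) s = Some (1, set_reg w d (arith f (regs s a) (regs s b)) s)"
| "instr_sem w (Load d a) s = Some (1, set_reg w d (mem s (regs s a)) s)"
| "instr_sem w (Store a b) s = Some (1, s\<lparr>mem := (mem s)(regs s a := regs s b)\<rparr>)"
| "instr_sem w (Draw d a) s =
     (case pending s of
        [] \<Rightarrow> None
      | z # zs \<Rightarrow>
          Some (1 + length z,
                set_reg w d (int (length z))
                  (s\<lparr>mem := write_bits (regs s a) z (mem s), pending := zs\<rparr>)))"

text \<open>\<open>exec w c s t s'\<close>: started in \<open>s\<close>, \<open>c\<close> terminates after \<open>t\<close> steps in \<open>s'\<close>.\<close>

inductive exec :: "nat \<Rightarrow> com \<Rightarrow> config \<Rightarrow> nat \<Rightarrow> config \<Rightarrow> bool" for w :: nat where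
  exec_Skip: "exec w Skip s 0 s"
| exec_Instr: "instr_sem w i s = Some (t, s') \<Longrightarrow> exec w (Instr i) s t s'"
| exec_Seq: "exec w c s t s' \<Longrightarrow> exec w c' s' t' s'' \<Longrightarrow> exec w (Seq c c') s (t + t') s''"
| exec_IfTrue: "regs s a < regs s b \<Longrightarrow> exec w c s t s' \<Longrightarrow> exec w (IfLess a b c c') s (1 + t) s'"
| exec_IfFalse:
    "\<not> regs s a < regs s b \<Longrightarrow> exec w c' s t s' \<Longrightarrow> exec w (IfLess a b c c') s (1 + t) s'"
| exec_WhileFalse: "\<not> regs s a < regs s b \<Longrightarrow> exec w (WhileLess a b c) s 1 s"
| exec_WhileTrue:
    "regs s a < regs s b \<Longrightarrow> exec w c s t s' \<Longrightarrow> exec w (WhileLess a b c) s' t' s''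
     \<Longrightarrow> exec w (WhileLess a b c) s (1 + t + t') s''"

inductive_cases exec_SkipE: "exec w Skip s t s'"
inductive_cases exec_InstrE: "exec w (Instr i) s t s'"
inductive_cases exec_SeqE: "exec w (Seq c c') s t s'"
inductive_cases exec_IfE: "exec w (IfLess a b c c') s t s'"
inductive_cases exec_WhileE: "exec w (WhileLess a b c) s t s'"

lemma exec_deterministic:
  assumes "exec w c s t s'" and "exec w c s u v"
  shows "t = u \<and> s' = v"
  using assms
proof (induction arbitrary: u v rule: exec.induct)
  case (exec_Skip s)
  then show ?case by (auto elim: exec_SkipE)
next
  case (exec_Instr i s t s')
  then show ?case by (auto elim: exec_InstrE)
next
  case (exec_Seq c s t s' c' t' s'')
  from exec_Seq.prems show ?case by (rule exec_SeqE) (metis exec_Seq.IH)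
next
  case (exec_IfTrue s a b c t s' c')
  from exec_IfTrue.prems show ?case
    by (rule exec_IfE) (metis plus_1_eq_Suc exec_IfTrue.IH exec_IfTrue.hyps(1))+
next
  case (exec_IfFalse s a b c' t s' c)
  from exec_IfFalse.prems show ?case
    by (rule exec_IfE) (metis plus_1_eq_Suc exec_IfFalse.IH exec_IfFalse.hyps(1))+
next
  case (exec_WhileFalse s a b c)
  from exec_WhileFalse.prems show ?case
    by (rule exec_WhileE) (metis One_nat_def exec_WhileFalse.hyps)+
next
  case (exec_WhileTrue s a b c t s' t' s'')
  from exec_WhileTrue.prems show ?case
    by (rule exec_WhileE) (metis plus_1_eq_Suc add_Suc exec_WhileTrue.IH exec_WhileTrue.hyps(1))+
qed

definition initial :: "nat \<Rightarrow> int list \<Rightarrow> bits list \<Rightarrow> config" where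
  "initial w inp zs =
     \<lparr>regs = (\<lambda>_. 0),
      mem = (\<lambda>i. if 0 \<le> i \<and> i < int (length inp) then signed_take_bit w (inp ! nat i) else 0),
      pending = zs\<rparr>"

text \<open>A word size that is linear in \<open>log n\<close>; the factor belongs to the algorithm.\<close>

definition word_size :: "nat \<Rightarrow> nat \<Rightarrow> nat" where
  "word_size \<kappa> n = \<kappa> * nat \<lceil>log 2 (real n)\<rceil>"

definition encode_bits :: "bits \<Rightarrow> int list" where
  "encode_bits z = int (length z) # map of_bool z"

text \<open>
  The deletion rate is known to the algorithm. It is supplied as a fixed-point number with \<open>w\<close>
  fractional bits, since it may be irrational.
\<close>

definition find_end_input ::
    "nat \<Rightarrow> nat \<Rightarrow> real \<Rightarrow> nat \<Rightarrow> bits \<Rightarrow> bits list \<Rightarrow> int list" where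
  "find_end_input w n \<delta> r u ys =
     [int n, \<lfloor>\<delta> * 2 ^ w\<rfloor>, int r, int (length ys)] @ concat (map encode_bits (u # ys))"

text \<open>The output is left in memory: \<open>b\<close> in cell 0, followed by one cell for each given trace.\<close>

definition out_b :: "config \<Rightarrow> int" where
  "out_b s = mem s 0"

definition out_l :: "config \<Rightarrow> nat \<Rightarrow> int" where
  "out_l s i = mem s (int i + 1)"

end

theory Submission
  imports Defs "HOL-Real_Asymp.Real_Asymp"
begin

text \<open>
  The first location at which some trace leaves the period of the desert and whose surrounding window
  occurs at nearly the same location in most of the given traces is the image of the end of the
  desert in that trace: among those traces, one is free of deletions near this location and near the
  end, so the window is a substring of \<open>x\<close> that leaves the period at its centre, which happens
  nowhere before the end. Searching this window in every trace finds the image of the end whenever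
  there is no deletion nearby.

  The end is recovered from the average of the locations found in \<open>N + T\<close> traces, which
  concentrates within less than half a position. A single deletion near the end is too likely for
  its effect on this average to be neglected. However, a trace with a bounded number of deletions
  there is misread only if one of boundedly many fragile positions is deleted, and whether the window
  survives intact otherwise depends only on the deletions near the end, hence not on the number of
  deletions before it.
\<close>

subsection \<open>An expression language for the word RAM\<close>

text \<open>The location of the end in a trace fluctuates by about
  \<open>sqrt (n * \<delta>)\<close>, that is n^(1/3 - \<epsilon>/2). Averaging it to within half a
  position therefore takes about n * \<delta> = n^(2/3 - \<epsilon>) traces up to logarithms, which
  fixes the number \<open>T\<close> of samples. A deletion within distance \<open>m\<close> of the
  end has probability about n^(-\<epsilon>) and could shift a reading by about the tolerance
  \<open>q\<close>; the product, about n^(1/3 - 3\<epsilon>/2), need not be small. Boundedly many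
  fragile positions contribute only \<open>q * \<delta>\<close>, and more than J =
  ceil(1/\<epsilon>) deletions near the end have probability O(1/n), which even the factor
  \<open>q\<close> does not spoil. The offset of the found location is known if the 2m bits up to
  the end survive; the location before them has mean proportional to 1 - \<delta>. Solving for the
  end and rounding gives the output. For \<epsilon> > 2/3 the expected number of deletions in the
  whole string tends to 0, and a union bound over all bits replaces the Chernoff bound.\<close>

definition words :: "nat \<Rightarrow> int set" where
  "words w = {- (2 ^ w)..<2 ^ w}"

lemma signed_take_bit_words: "v \<in> words w \<Longrightarrow> signed_take_bit w v = v"
  by (simp add: words_def signed_take_bit_int_eq_self)

lemma zero_words [simp]: "0 \<in> words w"
  by (simp add: words_def)

text \<open>The value of a bounded search loop. Failure shows as the value \<open>hi\<close>, and an
  empty range gives \<open>lo\<close>, so the search is total and loop bounds need no side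
  condition.\<close>

definition first_from :: "int \<Rightarrow> int \<Rightarrow> (int \<Rightarrow> bool) \<Rightarrow> int" where
  "first_from lo hi P = lo + int (LEAST d. hi \<le> lo + int d \<or> P (lo + int d))"

lemma first_from_stop: "hi \<le> first_from lo hi P \<or> P (first_from lo hi P)"
proof -
  have "hi \<le> lo + int (nat (hi - lo)) \<or> P (lo + int (nat (hi - lo)))" by auto
  then show ?thesis unfolding first_from_def by (rule LeastI)
qed

lemma first_from_ge: "lo \<le> first_from lo hi P"
  by (simp add: first_from_def)

lemma first_from_least:
  assumes "lo \<le> j" "j < first_from lo hi P"
  shows "j < hi \<and> \<not> P j"
proof -
  have "nat (j - lo) < (LEAST d. hi \<le> lo + int d \<or> P (lo + int d))"
    using assms unfolding first_from_def by linarith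
  from not_less_Least[OF this] assms(1) show ?thesis by auto
qed

lemma first_from_le: "lo \<le> hi \<Longrightarrow> first_from lo hi P \<le> hi"
  by (meson first_from_least linorder_not_less order_less_irrefl)

lemma first_from_empty: "hi \<le> lo \<Longrightarrow> first_from lo hi P = lo"
proof -
  assume "hi \<le> lo"
  then have "(LEAST d. hi \<le> lo + int d \<or> P (lo + int d)) = 0" by (intro Least_equality) auto
  then show ?thesis by (simp add: first_from_def)
qed

lemma first_from_eqI:
  assumes "lo \<le> v" "hi \<le> v \<or> P v" "\<And>j. lo \<le> j \<Longrightarrow> j < v \<Longrightarrow> j < hi \<and> \<not> P j"
  shows "first_from lo hi P = v"
proof (rule antisym)
  show "first_from lo hi P \<le> v"
    using first_from_least[of lo v hi P] assms(1,2) by force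
  show "v \<le> first_from lo hi P"
    using assms(3)[of "first_from lo hi P"] first_from_ge[of lo hi P] first_from_stop[of hi lo P]
    by force
qed

lemma first_from_step:
  assumes "lo < hi"
  shows "first_from lo hi P = (if P lo then lo else first_from (lo + 1) hi P)"
proof (cases "P lo")
  case True
  then show ?thesis using assms by (auto intro: first_from_eqI)
next
  case False
  have "first_from lo hi P = first_from (lo + 1) hi P"
  proof (rule first_from_eqI)
    show "lo \<le> first_from (lo + 1) hi P" using first_from_ge[of "lo + 1" hi P] by linarith
    fix j assume "lo \<le> j" "j < first_from (lo + 1) hi P"
    then show "j < hi \<and> \<not> P j" using False assms first_from_least[of "lo + 1" j hi P]
      by (cases "j = lo") auto
  qed (rule first_from_stop)
  with False show ?thesis by simp
qed

lemma first_from_cong: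
  assumes "\<And>j. lo \<le> j \<Longrightarrow> j < hi \<Longrightarrow> P j = Q j"
  shows "first_from lo hi P = first_from lo hi Q"
proof (rule first_from_eqI[OF first_from_ge])
  show "hi \<le> first_from lo hi Q \<or> P (first_from lo hi Q)"
    using first_from_stop[of hi lo Q] first_from_ge[of lo hi Q] assms by force
qed (use assms first_from_least[of lo _ hi Q] in auto)

text \<open>
  An expression is compiled to code whose temporaries are the registers from a level \<open>B\<close> on and
  which leaves its value in register \<open>B\<close>. \<open>Total\<close> and \<open>First\<close> bind a loop variable, which is passed
  to the body as the number of its register; hence the evaluation depends on the level.
\<close>

datatype expr =
    Num int
  | Var reg
  | Bin arith_op expr expr
  | Mem expr
  | Cond expr expr expr expr
  | Total expr expr "reg \<Rightarrow> expr"
  | First expr expr "reg \<Rightarrow> expr"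

primrec compile :: "expr \<Rightarrow> nat \<Rightarrow> com" where
  "compile (Num v) = (\<lambda>B. Instr (Const B v))"
| "compile (Var r) = (\<lambda>B. Seq (Instr (Const B 0)) (Instr (Arith Plus B r B)))"
| "compile (Bin f a b) =
     (\<lambda>B. Seq (compile a B) (Seq (compile b (B + 1)) (Instr (Arith f B B (B + 1)))))"
| "compile (Mem a) = (\<lambda>B. Seq (compile a B) (Instr (Load B B)))"
| "compile (Cond a b c d) =
     (\<lambda>B. Seq (compile a B) (Seq (compile b (B + 1)) (IfLess B (B + 1) (compile c B) (compile d B))))"
| "compile (Total lo hi f) =
     (\<lambda>B. Seq (compile lo (B + 1)) (Seq (compile hi (B + 2)) (Seq (Instr (Const B 0))
       (WhileLess (B + 1) (B + 2)
         (Seq (compile (f (B + 1)) (B + 3)) (Seq (Instr (Arith Plus B B (B + 3)))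
           (Seq (Instr (Const (B + 3) 1)) (Instr (Arith Plus (B + 1) (B + 1) (B + 3))))))))))"
| "compile (First lo hi f) =
     (\<lambda>B. Seq (compile lo B) (Seq (compile hi (B + 1))
       (WhileLess B (B + 1)
         (Seq (compile (f B) (B + 2)) (Seq (Instr (Const (B + 3) 0))
           (IfLess (B + 3) (B + 2)
             (Instr (Arith Plus (B + 1) B (B + 3)))
             (Seq (Instr (Const (B + 3) 1)) (Instr (Arith Plus B B (B + 3))))))))))"

primrec eval :: "(int \<Rightarrow> int) \<Rightarrow> expr \<Rightarrow> nat \<Rightarrow> (reg \<Rightarrow> int) \<Rightarrow> int" where
  "eval M (Num v) = (\<lambda>B \<rho>. v)"
| "eval M (Var r) = (\<lambda>B \<rho>. \<rho> r)"
| "eval M (Bin f a b) = (\<lambda>B \<rho>. arith f (eval M a B \<rho>) (eval M b (B + 1) \<rho>))"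
| "eval M (Mem a) = (\<lambda>B \<rho>. M (eval M a B \<rho>))"
| "eval M (Cond a b c d) =
     (\<lambda>B \<rho>. if eval M a B \<rho> < eval M b (B + 1) \<rho> then eval M c B \<rho> else eval M d B \<rho>)"
| "eval M (Total lo hi f) =
     (\<lambda>B \<rho>. \<Sum>j\<in>{eval M lo (B + 1) \<rho>..<eval M hi (B + 2) \<rho>}.
        eval M (f (B + 1)) (B + 3) (\<rho>(B + 1 := j)))"
| "eval M (First lo hi f) =
     (\<lambda>B \<rho>. first_from (eval M lo B \<rho>) (eval M hi (B + 1) \<rho>)
        (\<lambda>j. 0 < eval M (f B) (B + 2) (\<rho>(B := j))))"

text \<open>An upper bound on the steps rather than their number: \<open>Cond\<close> is charged for
  both branches and \<open>First\<close> for its whole range, so the bound does not depend on the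
  outcome of tests.\<close>

primrec cost :: "(int \<Rightarrow> int) \<Rightarrow> expr \<Rightarrow> nat \<Rightarrow> (reg \<Rightarrow> int) \<Rightarrow> nat" where
  "cost M (Num v) = (\<lambda>B \<rho>. 1)"
| "cost M (Var r) = (\<lambda>B \<rho>. 2)"
| "cost M (Bin f a b) = (\<lambda>B \<rho>. cost M a B \<rho> + cost M b (B + 1) \<rho> + 1)"
| "cost M (Mem a) = (\<lambda>B \<rho>. cost M a B \<rho> + 1)"
| "cost M (Cond a b c d) =
     (\<lambda>B \<rho>. cost M a B \<rho> + cost M b (B + 1) \<rho> + cost M c B \<rho> + cost M d B \<rho> + 1)"
| "cost M (Total lo hi f) =
     (\<lambda>B \<rho>. cost M lo (B + 1) \<rho> + cost M hi (B + 2) \<rho> + 2 +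
        (\<Sum>j\<in>{eval M lo (B + 1) \<rho>..<eval M hi (B + 2) \<rho>}.
           cost M (f (B + 1)) (B + 3) (\<rho>(B + 1 := j)) + 4))"
| "cost M (First lo hi f) =
     (\<lambda>B \<rho>. cost M lo B \<rho> + cost M hi (B + 1) \<rho> + 1 +
        (\<Sum>j\<in>{eval M lo B \<rho>..<eval M hi (B + 1) \<rho>}.
           cost M (f B) (B + 2) (\<rho>(B := j)) + 5))"

text \<open>
  \<open>fits w M e B A \<rho>\<close>: all intermediate values are words, so that no operation wraps around, and
  all free variables are in \<open>A\<close>.
\<close>

primrec fits :: "nat \<Rightarrow> (int \<Rightarrow> int) \<Rightarrow> expr \<Rightarrow> nat \<Rightarrow> reg set \<Rightarrow> (reg \<Rightarrow> int) \<Rightarrow> bool" where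
  "fits w M (Num v) = (\<lambda>B A \<rho>. v \<in> words w)"
| "fits w M (Var r) = (\<lambda>B A \<rho>. r \<in> A \<and> \<rho> r \<in> words w)"
| "fits w M (Bin f a b) = (\<lambda>B A \<rho>. fits w M a B A \<rho> \<and> fits w M b (B + 1) A \<rho> \<and>
     arith f (eval M a B \<rho>) (eval M b (B + 1) \<rho>) \<in> words w)"
| "fits w M (Mem a) = (\<lambda>B A \<rho>. fits w M a B A \<rho> \<and> M (eval M a B \<rho>) \<in> words w)"
| "fits w M (Cond a b c d) = (\<lambda>B A \<rho>. fits w M a B A \<rho> \<and> fits w M b (B + 1) A \<rho> \<and>
     fits w M c B A \<rho> \<and> fits w M d B A \<rho>)"
| "fits w M (Total lo hi f) = (\<lambda>B A \<rho>. fits w M lo (B + 1) A \<rho> \<and> fits w M hi (B + 2) A \<rho> \<and>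
     (\<forall>j\<in>{eval M lo (B + 1) \<rho>..<eval M hi (B + 2) \<rho>}.
        fits w M (f (B + 1)) (B + 3) (insert (B + 1) A) (\<rho>(B + 1 := j))) \<and>
     (\<forall>h\<in>{eval M lo (B + 1) \<rho>..eval M hi (B + 2) \<rho>}.
        (\<Sum>j\<in>{eval M lo (B + 1) \<rho>..<h}. eval M (f (B + 1)) (B + 3) (\<rho>(B + 1 := j))) \<in> words w))"
| "fits w M (First lo hi f) = (\<lambda>B A \<rho>. fits w M lo B A \<rho> \<and> fits w M hi (B + 1) A \<rho> \<and>
     (\<forall>j\<in>{eval M lo B \<rho>..<eval M hi (B + 1) \<rho>}.
        fits w M (f B) (B + 2) (insert B A) (\<rho>(B := j))))"

text \<open>Only the loops need an argument. The condition on partial sums in \<open>fits\<close>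
  includes the total, and a search ends between its two bounds or at its lower one.\<close>

lemma fits_words: "fits w M e B A \<rho> \<Longrightarrow> eval M e B \<rho> \<in> words w"
proof (induction e arbitrary: B A \<rho>)
  case (Total lo hi f)
  show ?case
  proof (cases "eval M lo (B + 1) \<rho> \<le> eval M hi (B + 2) \<rho>")
    case True
    then show ?thesis using Total.prems by force
  qed simp
next
  case (First lo hi f)
  let ?lo = "eval M lo B \<rho>" and ?hi = "eval M hi (B + 1) \<rho>"
  let ?v = "eval M (First lo hi f) B \<rho>"
  have "?lo \<in> words w" "?hi \<in> words w" using First by auto
  moreover have "?lo \<le> ?v" by (simp add: first_from_ge)
  moreover have "?v \<le> max ?lo ?hi"
    by (cases "?lo \<le> ?hi") (simp_all add: first_from_le first_from_empty max_def)
  ultimately show ?case unfolding words_def by (auto simp: max_def split: if_splits)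
qed auto

text \<open>The frame conditions are what makes code compose: a second operand can be computed at
  level \<open>B + 1\<close> without losing the first one in register \<open>B\<close>.\<close>

definition computes ::
    "nat \<Rightarrow> com \<Rightarrow> nat \<Rightarrow> reg set \<Rightarrow> (reg \<Rightarrow> int) \<Rightarrow> (int \<Rightarrow> int) \<Rightarrow> nat \<Rightarrow> int \<Rightarrow> bool" where
  "computes w c B A \<rho> M b v \<longleftrightarrow>
     (\<forall>s. (\<forall>r\<in>A. regs s r = \<rho> r) \<and> mem s = M \<longrightarrow>
       (\<exists>t s'. exec w c s t s' \<and> t \<le> b \<and> regs s' B = v \<and> (\<forall>r<B. regs s' r = regs s r) \<and>
          mem s' = M \<and> pending s' = pending s))"

lemma computesD:
  assumes "computes w c B A \<rho> M b v" "\<And>r. r \<in> A \<Longrightarrow> regs s r = \<rho> r" "mem s = M"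
  obtains t s' where "exec w c s t s'" "t \<le> b" "regs s' B = v"
    "\<And>r. r < B \<Longrightarrow> regs s' r = regs s r" "mem s' = M" "pending s' = pending s"
  using assms unfolding computes_def by blast

lemma exec_Const: "v \<in> words w \<Longrightarrow> exec w (Instr (Const d v)) s 1 (s\<lparr>regs := (regs s)(d := v)\<rparr>)"
  by (rule exec_Instr) (simp add: set_reg_def signed_take_bit_words)

lemma exec_Arith:
  "arith f (regs s a) (regs s b) \<in> words w \<Longrightarrow>
   exec w (Instr (Arith f d a b)) s 1 (s\<lparr>regs := (regs s)(d := arith f (regs s a) (regs s b))\<rparr>)"
  by (rule exec_Instr) (simp add: set_reg_def signed_take_bit_words)

lemma exec_Load:
  "mem s (regs s a) \<in> words w \<Longrightarrow>
   exec w (Instr (Load d a)) s 1 (s\<lparr>regs := (regs s)(d := mem s (regs s a))\<rparr>)"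
  by (rule exec_Instr) (simp add: set_reg_def signed_take_bit_words)

lemma one_words: "0 < w \<Longrightarrow> 1 \<in> words w"
  unfolding words_def using order_trans[of "-1::int" 0 "2 ^ w"] by auto

text \<open>Induction on the remaining rounds, with the partial sum up to \<open>h\<close> in
  register \<open>B\<close>. Every partial sum has to be a word because the accumulator is updated
  in each round. The alternative \<open>h = lo\<close> admits a range whose upper bound is below the
  lower one.\<close>

lemma total_loop:
  assumes body: "\<And>j. lo \<le> j \<Longrightarrow> j < hi \<Longrightarrow>
      computes w c (B + 3) (insert (B + 1) A) (\<rho>(B + 1 := j)) M (b j) (v j)"
    and A: "A \<subseteq> {..<B}" and w: "0 < w"
    and range: "lo \<in> words w" "hi \<in> words w"
      "\<And>h. lo \<le> h \<Longrightarrow> h \<le> hi \<Longrightarrow> (\<Sum>j\<in>{lo..<h}. v j) \<in> words w"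
    and s: "lo \<le> h" "h \<le> hi \<or> h = lo" "regs s (B + 1) = h" "regs s (B + 2) = hi"
      "regs s B = (\<Sum>j\<in>{lo..<h}. v j)" "mem s = M" "\<And>r. r \<in> A \<Longrightarrow> regs s r = \<rho> r"
  shows "\<exists>t s'. exec w (WhileLess (B + 1) (B + 2)
         (Seq c (Seq (Instr (Arith Plus B B (B + 3)))
           (Seq (Instr (Const (B + 3) 1)) (Instr (Arith Plus (B + 1) (B + 1) (B + 3))))))) s t s' \<and>
     t \<le> 1 + (\<Sum>j\<in>{h..<hi}. b j + 4) \<and> regs s' B = (\<Sum>j\<in>{lo..<hi}. v j) \<and>
     (\<forall>r<B. regs s' r = regs s r) \<and> mem s' = M \<and> pending s' = pending s"
  using s
proof (induction "nat (hi - h)" arbitrary: h s)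
  case 0
  then have "hi \<le> h" by simp
  then have "\<not> regs s (B + 1) < regs s (B + 2)" using 0 by simp
  from exec_WhileFalse[OF this] show ?case using 0 \<open>hi \<le> h\<close>
    by (intro exI[of _ 1] exI[of _ s]) auto
next
  case (Suc d)
  then have h: "h < hi" by linarith
  note c = body[OF Suc.prems(1) h]
  have agree: "regs s r = (\<rho>(B + 1 := h)) r" if "r \<in> insert (B + 1) A" for r
    using that Suc.prems(3,7) A by auto
  obtain t1 s1 where 1: "exec w c s t1 s1" "t1 \<le> b h" "regs s1 (B + 3) = v h"
    "\<And>r. r < B + 3 \<Longrightarrow> regs s1 r = regs s r" "mem s1 = M" "pending s1 = pending s"
    using computesD[OF c agree Suc.prems(6)] by blast
  have split: "{lo..<h + 1} = insert h {lo..<h}" using Suc.prems(1) by auto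
  have sum: "regs s1 B + v h = (\<Sum>j\<in>{lo..<h + 1}. v j)"
    using 1(4)[of B] Suc.prems(5) unfolding split by simp
  define s2 where "s2 = s1\<lparr>regs := (regs s1)(B := regs s1 B + v h)\<rparr>"
  define s3 where "s3 = s2\<lparr>regs := (regs s2)(B + 3 := 1)\<rparr>"
  define s4 where "s4 = s3\<lparr>regs := (regs s3)(B + 1 := h + 1)\<rparr>"
  have 2: "exec w (Instr (Arith Plus B B (B + 3))) s1 1 s2"
    using exec_Arith[of Plus s1 B "B + 3" w B] 1(3) range(3)[of "h + 1"] h Suc.prems(1) sum
    unfolding s2_def by simp
  have 3: "exec w (Instr (Const (B + 3) 1)) s2 1 s3"
    unfolding s3_def by (rule exec_Const[OF one_words[OF w]])
  have "h + 1 \<in> words w" using range(1,2) h Suc.prems(1) unfolding words_def by auto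
  moreover have "regs s3 (B + 1) = h" "regs s3 (B + 3) = 1"
    using 1(4)[of "B + 1"] Suc.prems(3) unfolding s3_def s2_def by auto
  ultimately have 4: "exec w (Instr (Arith Plus (B + 1) (B + 1) (B + 3))) s3 1 s4"
    using exec_Arith[of Plus s3 "B + 1" "B + 3" w "B + 1"] unfolding s4_def by simp
  have keep: "regs s4 r = regs s r" if "r < B" for r
    using that 1(4)[of r] unfolding s4_def s3_def s2_def by simp
  have m4: "mem s4 = M" "pending s4 = pending s" using 1(5,6) unfolding s4_def s3_def s2_def by simp_all
  have "d = nat (hi - (h + 1))" using Suc.hyps(2) by simp
  moreover have "regs s4 (B + 1) = h + 1" by (simp add: s4_def)
  moreover have "regs s4 (B + 2) = hi"
    using 1(4)[of "B + 2"] Suc.prems(4) unfolding s4_def s3_def s2_def by simp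
  moreover have "regs s4 B = (\<Sum>j\<in>{lo..<h + 1}. v j)"
    using sum unfolding s4_def s3_def s2_def by simp
  moreover have "regs s4 r = \<rho> r" if "r \<in> A" for r
    using keep[of r] that A Suc.prems(7) by auto
  ultimately obtain t5 s5 where 5: "exec w (WhileLess (B + 1) (B + 2)
         (Seq c (Seq (Instr (Arith Plus B B (B + 3)))
           (Seq (Instr (Const (B + 3) 1)) (Instr (Arith Plus (B + 1) (B + 1) (B + 3))))))) s4 t5 s5"
     "t5 \<le> 1 + (\<Sum>j\<in>{h + 1..<hi}. b j + 4)" "regs s5 B = (\<Sum>j\<in>{lo..<hi}. v j)"
     "\<forall>r<B. regs s5 r = regs s4 r" "mem s5 = M" "pending s5 = pending s4"
    using Suc.hyps(1)[of "h + 1" s4] h Suc.prems(1) m4 by auto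
  have less: "regs s (B + 1) < regs s (B + 2)" using Suc.prems(3,4) h by simp
  have "{h..<hi} = insert h {h + 1..<hi}" using h by auto
  then have "(\<Sum>j\<in>{h..<hi}. b j + 4) = b h + 4 + (\<Sum>j\<in>{h + 1..<hi}. b j + 4)" by simp
  then have "1 + (t1 + (1 + (1 + 1))) + t5 \<le> 1 + (\<Sum>j\<in>{h..<hi}. b j + 4)"
    using 1(2) 5(2) by linarith
  with exec_WhileTrue[OF less exec_Seq[OF 1(1) exec_Seq[OF 2 exec_Seq[OF 3 4]]] 5(1)] 5(3-6) keep m4
  show ?case by (metis (no_types, lifting))
qed

text \<open>A hit overwrites the upper bound in register \<open>B + 1\<close> by the counter. The
  next test then fails and leaves the hit in register \<open>B\<close>, so no jump out of the loop
  is required.\<close>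

lemma first_loop:
  assumes body: "\<And>j. lo \<le> j \<Longrightarrow> j < hi \<Longrightarrow>
      computes w c (B + 2) (insert B A) (\<rho>(B := j)) M (b j) (v j)"
    and A: "A \<subseteq> {..<B}" and w: "0 < w"
    and range: "lo \<in> words w" "hi \<in> words w"
    and s: "lo \<le> h" "regs s B = h" "regs s (B + 1) = hi"
      "mem s = M" "\<And>r. r \<in> A \<Longrightarrow> regs s r = \<rho> r"
  shows "\<exists>t s'. exec w (WhileLess B (B + 1)
         (Seq c (Seq (Instr (Const (B + 3) 0))
           (IfLess (B + 3) (B + 2)
             (Instr (Arith Plus (B + 1) B (B + 3)))
             (Seq (Instr (Const (B + 3) 1)) (Instr (Arith Plus B B (B + 3)))))))) s t s' \<and>
     t \<le> 1 + (\<Sum>j\<in>{h..<hi}. b j + 5) \<and> regs s' B = first_from h hi (\<lambda>j. 0 < v j) \<and>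
     (\<forall>r<B. regs s' r = regs s r) \<and> mem s' = M \<and> pending s' = pending s"
    (is "\<exists>t s'. exec w ?W s t s' \<and> _")
  using s
proof (induction "nat (hi - h)" arbitrary: h s)
  case 0
  then have "hi \<le> h" by simp
  then have "\<not> regs s B < regs s (B + 1)" using 0 by simp
  from exec_WhileFalse[OF this] show ?case using 0 \<open>hi \<le> h\<close>
    by (intro exI[of _ 1] exI[of _ s]) (auto simp: first_from_empty)
next
  case (Suc d)
  then have h: "h < hi" by linarith
  note c = body[OF Suc.prems(1) h]
  have agree: "regs s r = (\<rho>(B := h)) r" if "r \<in> insert B A" for r
    using that Suc.prems(2,5) A by auto
  obtain t1 s1 where 1: "exec w c s t1 s1" "t1 \<le> b h" "regs s1 (B + 2) = v h"
    "\<And>r. r < B + 2 \<Longrightarrow> regs s1 r = regs s r" "mem s1 = M" "pending s1 = pending s"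
    using computesD[OF c agree Suc.prems(4)] by blast
  define s2 where "s2 = s1\<lparr>regs := (regs s1)(B + 3 := 0)\<rparr>"
  have 2: "exec w (Instr (Const (B + 3) 0)) s1 1 s2"
    unfolding s2_def by (rule exec_Const) simp
  have s2: "regs s2 B = h" "regs s2 (B + 1) = hi" "regs s2 (B + 2) = v h" "regs s2 (B + 3) = 0"
    using 1(3) 1(4)[of B] 1(4)[of "B + 1"] Suc.prems(2,3) unfolding s2_def by auto
  have hw: "h \<in> words w" "h + 1 \<in> words w" using range h Suc.prems(1) unfolding words_def by auto
  have less: "regs s B < regs s (B + 1)" using Suc.prems(2,3) h by simp
  have split: "{h..<hi} = insert h {h + 1..<hi}" using h by auto
  have sum: "(\<Sum>j\<in>{h..<hi}. b j + 5) = b h + 5 + (\<Sum>j\<in>{h + 1..<hi}. b j + 5)"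
    unfolding split by simp
  show ?case
  proof (cases "0 < v h")
    case True
    define s4 where "s4 = s2\<lparr>regs := (regs s2)(B + 1 := h)\<rparr>"
    have 4: "exec w (Instr (Arith Plus (B + 1) B (B + 3))) s2 1 s4"
      using exec_Arith[of Plus s2 B "B + 3" w "B + 1"] s2 hw unfolding s4_def by simp
    have if4: "exec w (IfLess (B + 3) (B + 2) (Instr (Arith Plus (B + 1) B (B + 3)))
             (Seq (Instr (Const (B + 3) 1)) (Instr (Arith Plus B B (B + 3))))) s2 (1 + 1) s4"
      by (rule exec_IfTrue[OF _ 4]) (use s2 True in simp)
    have "\<not> regs s4 B < regs s4 (B + 1)" using s2 by (simp add: s4_def)
    note 5 = exec_WhileFalse[OF this]
    have keep: "regs s4 r = regs s r" if "r < B" for r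
      using that 1(4)[of r] unfolding s4_def s2_def by simp
    have m4: "mem s4 = M" "pending s4 = pending s" using 1(5,6) unfolding s4_def s2_def by simp_all
    have "regs s4 B = first_from h hi (\<lambda>j. 0 < v j)"
      using True s2 by (simp add: s4_def first_from_step[OF h])
    moreover have "1 + (t1 + (1 + (1 + 1))) + 1 \<le> 1 + (\<Sum>j\<in>{h..<hi}. b j + 5)"
      unfolding sum using 1(2) by linarith
    ultimately show ?thesis
      using exec_WhileTrue[OF less exec_Seq[OF 1(1) exec_Seq[OF 2 if4]] 5] keep m4
      by (metis (no_types, lifting))
  next
    case False
    define s3 where "s3 = s2\<lparr>regs := (regs s2)(B + 3 := 1)\<rparr>"
    define s4 where "s4 = s3\<lparr>regs := (regs s3)(B := h + 1)\<rparr>"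
    have 3: "exec w (Instr (Const (B + 3) 1)) s2 1 s3"
      unfolding s3_def by (rule exec_Const[OF one_words[OF w]])
    have 4: "exec w (Instr (Arith Plus B B (B + 3))) s3 1 s4"
      using exec_Arith[of Plus s3 B "B + 3" w B] s2 hw unfolding s4_def s3_def by simp
    have if4: "exec w (IfLess (B + 3) (B + 2) (Instr (Arith Plus (B + 1) B (B + 3)))
             (Seq (Instr (Const (B + 3) 1)) (Instr (Arith Plus B B (B + 3))))) s2 (1 + (1 + 1)) s4"
      by (rule exec_IfFalse[OF _ exec_Seq[OF 3 4]]) (use s2 False in simp)
    have keep: "regs s4 r = regs s r" if "r < B" for r
      using that 1(4)[of r] unfolding s4_def s3_def s2_def by simp
    have m4: "mem s4 = M" "pending s4 = pending s"
      using 1(5,6) unfolding s4_def s3_def s2_def by simp_all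
    have "d = nat (hi - (h + 1))" using Suc.hyps(2) by simp
    moreover have "regs s4 B = h + 1" by (simp add: s4_def)
    moreover have "regs s4 (B + 1) = hi" using s2 unfolding s4_def s3_def by simp
    moreover have "regs s4 r = \<rho> r" if "r \<in> A" for r
      using keep[of r] that A Suc.prems(5) by auto
    ultimately obtain t5 s5 where 5: "exec w ?W s4 t5 s5"
       "t5 \<le> 1 + (\<Sum>j\<in>{h + 1..<hi}. b j + 5)" "regs s5 B = first_from (h + 1) hi (\<lambda>j. 0 < v j)"
       "\<forall>r<B. regs s5 r = regs s4 r" "mem s5 = M" "pending s5 = pending s4"
      using Suc.hyps(1)[of "h + 1" s4] Suc.prems(1) m4 by auto
    have "regs s5 B = first_from h hi (\<lambda>j. 0 < v j)"
      using False 5(3) by (simp add: first_from_step[OF h])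
    moreover have "1 + (t1 + (1 + (1 + (1 + 1)))) + t5 \<le> 1 + (\<Sum>j\<in>{h..<hi}. b j + 5)"
      unfolding sum using 1(2) 5(2) by linarith
    ultimately show ?thesis
      using exec_WhileTrue[OF less exec_Seq[OF 1(1) exec_Seq[OF 2 if4]] 5(1)] 5(4-6) keep m4
      by (metis (no_types, lifting))
  qed
qed

text \<open>Structural induction with level, variables and environment generalised, since the body
  of a loop runs at a higher level with its loop variable added to the environment. The condition on
  \<open>A\<close> separates variables from temporaries.\<close>

lemma compile_correct:
  assumes "fits w M e B A \<rho>" "A \<subseteq> {..<B}" "0 < w"
  shows "computes w (compile e B) B A \<rho> M (cost M e B \<rho>) (eval M e B \<rho>)"
  using assms(1,2)
proof (induction e arbitrary: B A \<rho>)
  case (Num v)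
  show ?case unfolding computes_def
  proof (intro allI impI, elim conjE)
    fix s :: config assume "mem s = M"
    then show "\<exists>t s'. exec w (compile (Num v) B) s t s' \<and> t \<le> cost M (Num v) B \<rho> \<and>
          regs s' B = eval M (Num v) B \<rho> \<and> (\<forall>r<B. regs s' r = regs s r) \<and>
          mem s' = M \<and> pending s' = pending s"
      using exec_Const[of v w B s] Num by (intro exI[of _ 1] exI) auto
  qed
next
  case (Var r)
  show ?case unfolding computes_def
  proof (intro allI impI, elim conjE)
    fix s :: config assume s: "\<forall>r\<in>A. regs s r = \<rho> r" "mem s = M"
    define s1 where "s1 = s\<lparr>regs := (regs s)(B := 0)\<rparr>"
    \<comment> \<open>A variable is read by clearing register \<open>B\<close> and adding the
      variable to it, so the variable must not be \<open>B\<close> itself.\<close>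
    have "r < B" using Var by auto
    then have r: "regs s1 r = \<rho> r" "regs s1 B = 0" using Var s(1) by (auto simp: s1_def)
    have 1: "exec w (Instr (Const B 0)) s 1 s1" unfolding s1_def by (rule exec_Const) simp
    have 2: "exec w (Instr (Arith Plus B r B)) s1 1 (s1\<lparr>regs := (regs s1)(B := \<rho> r)\<rparr>)"
      using exec_Arith[of Plus s1 r B w B] r Var by simp
    show "\<exists>t s'. exec w (compile (Var r) B) s t s' \<and> t \<le> cost M (Var r) B \<rho> \<and>
          regs s' B = eval M (Var r) B \<rho> \<and> (\<forall>r<B. regs s' r = regs s r) \<and>
          mem s' = M \<and> pending s' = pending s"
      using exec_Seq[OF 1 2] s(2) by (intro exI[of _ "1 + 1"] exI) (auto simp: s1_def)
  qed
next
  case (Bin f a b)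
  show ?case unfolding computes_def
  proof (intro allI impI, elim conjE)
    fix s :: config assume s: "\<forall>r\<in>A. regs s r = \<rho> r" "mem s = M"
    have "A \<subseteq> {..<B + 1}" using Bin.prems(2) by auto
    with Bin.prems have IH1: "computes w (compile a B) B A \<rho> M (cost M a B \<rho>) (eval M a B \<rho>)"
      and IH2: "computes w (compile b (B + 1)) (B + 1) A \<rho> M (cost M b (B + 1) \<rho>) (eval M b (B + 1) \<rho>)"
      using Bin.IH(1)[of B A \<rho>] Bin.IH(2)[of "B + 1" A \<rho>] by auto
    obtain t1 s1 where 1: "exec w (compile a B) s t1 s1" "t1 \<le> cost M a B \<rho>" "regs s1 B = eval M a B \<rho>"
      "\<And>r. r < B \<Longrightarrow> regs s1 r = regs s r" "mem s1 = M" "pending s1 = pending s"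
      using computesD[OF IH1, of s] s by blast
    have "regs s1 r = \<rho> r" if "r \<in> A" for r using that 1(4)[of r] s Bin.prems(2) by auto
    then obtain t2 s2 where 2: "exec w (compile b (B + 1)) s1 t2 s2" "t2 \<le> cost M b (B + 1) \<rho>"
      "regs s2 (B + 1) = eval M b (B + 1) \<rho>"
      "\<And>r. r < B + 1 \<Longrightarrow> regs s2 r = regs s1 r" "mem s2 = M" "pending s2 = pending s1"
      using computesD[OF IH2, of s1] 1(5) by blast
    have v: "regs s2 B = eval M a B \<rho>" using 2(4)[of B] 1(3) by simp
    have 3: "exec w (Instr (Arith f B B (B + 1))) s2 1
       (s2\<lparr>regs := (regs s2)(B := eval M (Bin f a b) B \<rho>)\<rparr>)"
      using exec_Arith[of f s2 B "B + 1" w B] v 2(3) Bin.prems(1) by simp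
    show "\<exists>t s'. exec w (compile (Bin f a b) B) s t s' \<and> t \<le> cost M (Bin f a b) B \<rho> \<and>
          regs s' B = eval M (Bin f a b) B \<rho> \<and> (\<forall>r<B. regs s' r = regs s r) \<and>
          mem s' = M \<and> pending s' = pending s"
      using exec_Seq[OF 1(1) exec_Seq[OF 2(1) 3]] 1 2
      by (intro exI[of _ "t1 + (t2 + 1)"] exI) auto
  qed
next
  case (Mem a)
  show ?case unfolding computes_def
  proof (intro allI impI, elim conjE)
    fix s :: config assume s: "\<forall>r\<in>A. regs s r = \<rho> r" "mem s = M"
    have IH: "computes w (compile a B) B A \<rho> M (cost M a B \<rho>) (eval M a B \<rho>)"
      using Mem.prems Mem.IH[of B A \<rho>] by auto
    obtain t1 s1 where 1: "exec w (compile a B) s t1 s1" "t1 \<le> cost M a B \<rho>" "regs s1 B = eval M a B \<rho>"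
      "\<And>r. r < B \<Longrightarrow> regs s1 r = regs s r" "mem s1 = M" "pending s1 = pending s"
      using computesD[OF IH, of s] s by blast
    have 3: "exec w (Instr (Load B B)) s1 1
       (s1\<lparr>regs := (regs s1)(B := eval M (expr.Mem a) B \<rho>)\<rparr>)"
      using exec_Load[of s1 B w B] 1 Mem.prems(1) by simp
    show "\<exists>t s'. exec w (compile (expr.Mem a) B) s t s' \<and> t \<le> cost M (expr.Mem a) B \<rho> \<and>
          regs s' B = eval M (expr.Mem a) B \<rho> \<and> (\<forall>r<B. regs s' r = regs s r) \<and>
          mem s' = M \<and> pending s' = pending s"
      using exec_Seq[OF 1(1) 3] 1 by (intro exI[of _ "t1 + 1"] exI) auto
  qed
next
  case (Cond a b c d)
  show ?case unfolding computes_def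
  proof (intro allI impI, elim conjE)
    fix s :: config assume s: "\<forall>r\<in>A. regs s r = \<rho> r" "mem s = M"
    \<comment> \<open>Only the branch that is taken is executed; naming it treats both outcomes of
      the test at once.\<close>
    define e where "e = (if eval M a B \<rho> < eval M b (B + 1) \<rho> then c else d)"
    have "A \<subseteq> {..<B + 1}" using Cond.prems(2) by auto
    with Cond.prems have IH1: "computes w (compile a B) B A \<rho> M (cost M a B \<rho>) (eval M a B \<rho>)"
      and IH2: "computes w (compile b (B + 1)) (B + 1) A \<rho> M (cost M b (B + 1) \<rho>) (eval M b (B + 1) \<rho>)"
      and IH3: "computes w (compile e B) B A \<rho> M (cost M e B \<rho>) (eval M e B \<rho>)"
      using Cond.IH(1)[of B A \<rho>] Cond.IH(2)[of "B + 1" A \<rho>]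
        Cond.IH(3)[of B A \<rho>] Cond.IH(4)[of B A \<rho>] by (auto simp: e_def)
    obtain t1 s1 where 1: "exec w (compile a B) s t1 s1" "t1 \<le> cost M a B \<rho>" "regs s1 B = eval M a B \<rho>"
      "\<And>r. r < B \<Longrightarrow> regs s1 r = regs s r" "mem s1 = M" "pending s1 = pending s"
      using computesD[OF IH1, of s] s by blast
    have "regs s1 r = \<rho> r" if "r \<in> A" for r using that 1(4)[of r] s Cond.prems(2) by auto
    then obtain t2 s2 where 2: "exec w (compile b (B + 1)) s1 t2 s2" "t2 \<le> cost M b (B + 1) \<rho>"
      "regs s2 (B + 1) = eval M b (B + 1) \<rho>"
      "\<And>r. r < B + 1 \<Longrightarrow> regs s2 r = regs s1 r" "mem s2 = M" "pending s2 = pending s1"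
      using computesD[OF IH2, of s1] 1(5) by blast
    have v: "regs s2 B = eval M a B \<rho>" using 2(4)[of B] 1(3) by simp
    have s2: "regs s2 r = regs s r" if "r < B" for r using that 1(4)[of r] 2(4)[of r] by simp
    have "regs s2 r = \<rho> r" if "r \<in> A" for r using that s2[of r] s Cond.prems(2) by auto
    then obtain t3 s3 where 3: "exec w (compile e B) s2 t3 s3" "t3 \<le> cost M e B \<rho>"
      "regs s3 B = eval M e B \<rho>" "\<And>r. r < B \<Longrightarrow> regs s3 r = regs s2 r" "mem s3 = M"
      "pending s3 = pending s2"
      using computesD[OF IH3, of s2] 2(5) by blast
    have "exec w (IfLess B (B + 1) (compile c B) (compile d B)) s2 (1 + t3) s3"
      using 3(1) v 2(3) by (cases "eval M a B \<rho> < eval M b (B + 1) \<rho>")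
        (auto simp: e_def intro: exec_IfTrue[simplified] exec_IfFalse[simplified])
    note 4 = exec_Seq[OF 1(1) exec_Seq[OF 2(1) this]]
    have "t3 \<le> cost M c B \<rho> + cost M d B \<rho>" using 3(2) by (auto simp: e_def split: if_splits)
    moreover have "eval M e B \<rho> = eval M (Cond a b c d) B \<rho>" by (simp add: e_def)
    ultimately show "\<exists>t s'. exec w (compile (Cond a b c d) B) s t s' \<and> t \<le> cost M (Cond a b c d) B \<rho> \<and>
          regs s' B = eval M (Cond a b c d) B \<rho> \<and> (\<forall>r<B. regs s' r = regs s r) \<and>
          mem s' = M \<and> pending s' = pending s"
      using 4 1(2,6) 2(2,6) 3(3-6) s2
      by (intro exI[of _ "t1 + (t2 + (1 + t3))"] exI[of _ s3]) auto
  qed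
next
  case (Total lo hi f)
  let ?lo = "eval M lo (B + 1) \<rho>" and ?hi = "eval M hi (B + 2) \<rho>"
  show ?case unfolding computes_def
  proof (intro allI impI, elim conjE)
    fix s :: config assume s: "\<forall>r\<in>A. regs s r = \<rho> r" "mem s = M"
    have fl: "fits w M lo (B + 1) A \<rho>" and fh: "fits w M hi (B + 2) A \<rho>" using Total.prems by auto
    have IH1: "computes w (compile lo (B + 1)) (B + 1) A \<rho> M (cost M lo (B + 1) \<rho>) ?lo"
      using Total.prems(2) by (intro Total.IH(1)[OF fl]) auto
    have IH2: "computes w (compile hi (B + 2)) (B + 2) A \<rho> M (cost M hi (B + 2) \<rho>) ?hi"
      using Total.prems(2) by (intro Total.IH(2)[OF fh]) auto
    have IH3: "computes w (compile (f (B + 1)) (B + 3)) (B + 3) (insert (B + 1) A) (\<rho>(B + 1 := j)) M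
        (cost M (f (B + 1)) (B + 3) (\<rho>(B + 1 := j))) (eval M (f (B + 1)) (B + 3) (\<rho>(B + 1 := j)))"
      if "?lo \<le> j" "j < ?hi" for j
    proof (rule Total.IH(3)[OF rangeI])
      show "fits w M (f (B + 1)) (B + 3) (insert (B + 1) A) (\<rho>(B + 1 := j))"
        using Total.prems(1) that unfolding fits.simps by simp
    qed (use Total.prems(2) in auto)
    obtain t1 s1 where 1: "exec w (compile lo (B + 1)) s t1 s1" "t1 \<le> cost M lo (B + 1) \<rho>"
      "regs s1 (B + 1) = ?lo"
      "\<And>r. r < B + 1 \<Longrightarrow> regs s1 r = regs s r" "mem s1 = M" "pending s1 = pending s"
      using computesD[OF IH1, of s] s by blast
    have "regs s1 r = \<rho> r" if "r \<in> A" for r using that 1(4)[of r] s Total.prems(2) by auto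
    then obtain t2 s2 where 2: "exec w (compile hi (B + 2)) s1 t2 s2" "t2 \<le> cost M hi (B + 2) \<rho>"
      "regs s2 (B + 2) = ?hi"
      "\<And>r. r < B + 2 \<Longrightarrow> regs s2 r = regs s1 r" "mem s2 = M" "pending s2 = pending s1"
      using computesD[OF IH2, of s1] 1(5) by blast
    define s3 where "s3 = s2\<lparr>regs := (regs s2)(B := 0)\<rparr>"
    have 3: "exec w (Instr (Const B 0)) s2 1 s3"
      unfolding s3_def by (rule exec_Const) simp
    have keep: "regs s3 r = regs s r" if "r < B" for r
      using that 1(4)[of r] 2(4)[of r] by (simp add: s3_def)
    have s3: "regs s3 (B + 1) = ?lo" "regs s3 (B + 2) = ?hi" "mem s3 = M"
      "regs s3 B = (\<Sum>j\<in>{?lo..<?lo}. eval M (f (B + 1)) (B + 3) (\<rho>(B + 1 := j)))"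
      using 1(3) 2(3,5) 2(4)[of "B + 1"] by (auto simp: s3_def)
    have s3A: "regs s3 r = \<rho> r" if "r \<in> A" for r using that keep[of r] s Total.prems(2) by auto
    have "(\<Sum>j\<in>{?lo..<h}. eval M (f (B + 1)) (B + 3) (\<rho>(B + 1 := j))) \<in> words w"
      if "?lo \<le> h" "h \<le> ?hi" for h
      using that Total.prems(1) by auto
    from total_loop[OF IH3 Total.prems(2) assms(3) fits_words[OF fl] fits_words[OF fh] this
        order_refl disjI2[OF refl] s3(1,2,4,3) s3A]
    obtain t4 s4 where 4: "exec w (WhileLess (B + 1) (B + 2)
         (Seq (compile (f (B + 1)) (B + 3)) (Seq (Instr (Arith Plus B B (B + 3)))
           (Seq (Instr (Const (B + 3) 1)) (Instr (Arith Plus (B + 1) (B + 1) (B + 3))))))) s3 t4 s4"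
     "t4 \<le> 1 + (\<Sum>j\<in>{?lo..<?hi}. cost M (f (B + 1)) (B + 3) (\<rho>(B + 1 := j)) + 4)"
     "regs s4 B = eval M (Total lo hi f) B \<rho>"
     "\<forall>r<B. regs s4 r = regs s3 r" "mem s4 = M" "pending s4 = pending s3"
      by auto
    show "\<exists>t s'. exec w (compile (Total lo hi f) B) s t s' \<and> t \<le> cost M (Total lo hi f) B \<rho> \<and>
          regs s' B = eval M (Total lo hi f) B \<rho> \<and> (\<forall>r<B. regs s' r = regs s r) \<and>
          mem s' = M \<and> pending s' = pending s"
      using exec_Seq[OF 1(1) exec_Seq[OF 2(1) exec_Seq[OF 3 4(1)]]] 1(2,6) 2(2,6) 4(2-6) keep
      by (intro exI[of _ "t1 + (t2 + (1 + t4))"] exI[of _ s4]) (auto simp: s3_def)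
  qed
next
  case (First lo hi f)
  let ?lo = "eval M lo B \<rho>" and ?hi = "eval M hi (B + 1) \<rho>"
  show ?case unfolding computes_def
  proof (intro allI impI, elim conjE)
    fix s :: config assume s: "\<forall>r\<in>A. regs s r = \<rho> r" "mem s = M"
    have fl: "fits w M lo B A \<rho>" and fh: "fits w M hi (B + 1) A \<rho>" using First.prems by auto
    have IH1: "computes w (compile lo B) B A \<rho> M (cost M lo B \<rho>) ?lo"
      using First.prems(2) by (intro First.IH(1)[OF fl]) auto
    have IH2: "computes w (compile hi (B + 1)) (B + 1) A \<rho> M (cost M hi (B + 1) \<rho>) ?hi"
      using First.prems(2) by (intro First.IH(2)[OF fh]) auto
    have IH3: "computes w (compile (f B) (B + 2)) (B + 2) (insert B A) (\<rho>(B := j)) M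
        (cost M (f B) (B + 2) (\<rho>(B := j))) (eval M (f B) (B + 2) (\<rho>(B := j)))"
      if "?lo \<le> j" "j < ?hi" for j
    proof (rule First.IH(3)[OF rangeI])
      show "fits w M (f B) (B + 2) (insert B A) (\<rho>(B := j))"
        using First.prems(1) that unfolding fits.simps by simp
    qed (use First.prems(2) in auto)
    obtain t1 s1 where 1: "exec w (compile lo B) s t1 s1" "t1 \<le> cost M lo B \<rho>"
      "regs s1 B = ?lo"
      "\<And>r. r < B \<Longrightarrow> regs s1 r = regs s r" "mem s1 = M" "pending s1 = pending s"
      using computesD[OF IH1, of s] s by blast
    have "regs s1 r = \<rho> r" if "r \<in> A" for r using that 1(4)[of r] s First.prems(2) by auto
    then obtain t2 s2 where 2: "exec w (compile hi (B + 1)) s1 t2 s2" "t2 \<le> cost M hi (B + 1) \<rho>"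
      "regs s2 (B + 1) = ?hi"
      "\<And>r. r < B + 1 \<Longrightarrow> regs s2 r = regs s1 r" "mem s2 = M" "pending s2 = pending s1"
      using computesD[OF IH2, of s1] 1(5) by blast
    have keep: "regs s2 r = regs s r" if "r < B" for r
      using that 1(4)[of r] 2(4)[of r] by simp
    have s2: "regs s2 B = ?lo" using 1(3) 2(4)[of B] by auto
    have s2A: "regs s2 r = \<rho> r" if "r \<in> A" for r using that keep[of r] s First.prems(2) by auto
    from first_loop[OF IH3 First.prems(2) assms(3) fits_words[OF fl] fits_words[OF fh]
        order_refl s2 2(3) 2(5) s2A]
    obtain t4 s4 where 4: "exec w (WhileLess B (B + 1)
         (Seq (compile (f B) (B + 2)) (Seq (Instr (Const (B + 3) 0))
           (IfLess (B + 3) (B + 2)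
             (Instr (Arith Plus (B + 1) B (B + 3)))
             (Seq (Instr (Const (B + 3) 1)) (Instr (Arith Plus B B (B + 3)))))))) s2 t4 s4"
     "t4 \<le> 1 + (\<Sum>j\<in>{?lo..<?hi}. cost M (f B) (B + 2) (\<rho>(B := j)) + 5)"
     "regs s4 B = eval M (First lo hi f) B \<rho>"
     "\<forall>r<B. regs s4 r = regs s2 r" "mem s4 = M" "pending s4 = pending s2"
      by auto
    show "\<exists>t s'. exec w (compile (First lo hi f) B) s t s' \<and> t \<le> cost M (First lo hi f) B \<rho> \<and>
          regs s' B = eval M (First lo hi f) B \<rho> \<and> (\<forall>r<B. regs s' r = regs s r) \<and>
          mem s' = M \<and> pending s' = pending s"
      using exec_Seq[OF 1(1) exec_Seq[OF 2(1) 4(1)]] 1(2,6) 2(2,6) 4(2-6) keep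
      by (intro exI[of _ "t1 + (t2 + t4)"] exI[of _ s4]) auto
  qed
qed

text \<open>Range, value and a cost bound in one judgement, so that one rule per constructor
  establishes all three. The cost is only bounded, which allows it to be rounded up to closed
  forms.\<close>

definition evaluates ::
    "nat \<Rightarrow> (int \<Rightarrow> int) \<Rightarrow> nat \<Rightarrow> reg set \<Rightarrow> (reg \<Rightarrow> int) \<Rightarrow> expr \<Rightarrow> int \<Rightarrow> nat \<Rightarrow> bool" where
  "evaluates w M B A \<rho> e v c \<longleftrightarrow> fits w M e B A \<rho> \<and> eval M e B \<rho> = v \<and> cost M e B \<rho> \<le> c"

lemma evaluates_Num: "v \<in> words w \<Longrightarrow> evaluates w M B A \<rho> (Num v) v 1"
  by (simp add: evaluates_def)

lemma evaluates_Bin: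
  "evaluates w M B A \<rho> a u c \<Longrightarrow> evaluates w M (B + 1) A \<rho> b v d \<Longrightarrow> arith f u v \<in> words w \<Longrightarrow>
   evaluates w M B A \<rho> (Bin f a b) (arith f u v) (c + d + 1)"
  by (simp add: evaluates_def)

lemma evaluates_Mem:
  "evaluates w M B A \<rho> a u c \<Longrightarrow> M u \<in> words w \<Longrightarrow> evaluates w M B A \<rho> (Mem a) (M u) (c + 1)"
  by (simp add: evaluates_def)

lemma evaluates_Cond:
  "evaluates w M B A \<rho> a va ca \<Longrightarrow> evaluates w M (B + 1) A \<rho> b vb cb \<Longrightarrow>
   evaluates w M B A \<rho> c vc cc \<Longrightarrow> evaluates w M B A \<rho> d vd cd \<Longrightarrow>
   evaluates w M B A \<rho> (Cond a b c d) (if va < vb then vc else vd) (ca + cb + cc + cd + 1)"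
  by (simp add: evaluates_def)

lemma evaluates_weaken:
  "evaluates w M B A \<rho> e v c \<Longrightarrow> v = v' \<Longrightarrow> c \<le> c' \<Longrightarrow> evaluates w M B A \<rho> e v' c'"
  by (simp add: evaluates_def)

lemma sum_le_range:
  fixes b :: "int \<Rightarrow> nat"
  assumes "\<And>j. lo \<le> j \<Longrightarrow> j < hi \<Longrightarrow> b j \<le> c" "hi - lo \<le> int K"
  shows "(\<Sum>j\<in>{lo..<hi}. b j) \<le> K * c"
proof -
  have "(\<Sum>j\<in>{lo..<hi}. b j) \<le> of_nat (card {lo..<hi}) * c"
    by (rule sum_bounded_above) (use assms(1) in auto)
  also have "\<dots> \<le> K * c" using assms(2) by (intro mult_right_mono) auto
  finally show ?thesis .
qed

text \<open>Nonnegative summands make every partial sum at most the total, so it suffices that the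
  total is a word.\<close>

lemma evaluates_Total:
  assumes lo: "evaluates w M (B + 1) A \<rho> lo u c1" and hi: "evaluates w M (B + 2) A \<rho> hi v c2"
    and body: "\<And>j. u \<le> j \<Longrightarrow> j < v \<Longrightarrow>
       evaluates w M (B + 3) (insert (B + 1) A) (\<rho>(B + 1 := j)) (f (B + 1)) (g j) c"
    and g: "\<And>j. u \<le> j \<Longrightarrow> j < v \<Longrightarrow> 0 \<le> g j" "(\<Sum>j\<in>{u..<v}. g j) \<in> words w"
    and K: "v - u \<le> int K"
  shows "evaluates w M B A \<rho> (Total lo hi f) (\<Sum>j\<in>{u..<v}. g j) (c1 + c2 + 2 + K * (c + 4))"
proof -
  have part: "(\<Sum>j\<in>{u..<h}. g j) \<in> words w" if "h \<le> v" for h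
  proof -
    have "(\<Sum>j\<in>{u..<h}. g j) \<le> (\<Sum>j\<in>{u..<v}. g j)"
      by (rule sum_mono2) (use that g(1) in auto)
    moreover have "0 \<le> (\<Sum>j\<in>{u..<h}. g j)" by (rule sum_nonneg) (use that g(1) in auto)
    ultimately show ?thesis using g(2) unfolding words_def by auto
  qed
  have ev: "(\<Sum>j\<in>{u..<h}. eval M (f (B + 1)) (B + 3) (\<rho>(B + 1 := j))) = (\<Sum>j\<in>{u..<h}. g j)"
    if "h \<le> v" for h
    by (rule sum.cong) (use body that in \<open>auto simp: evaluates_def\<close>)
  have "(\<Sum>j\<in>{u..<v}. cost M (f (B + 1)) (B + 3) (\<rho>(B + 1 := j)) + 4) \<le> K * (c + 4)"
    by (rule sum_le_range[OF _ K]) (use body in \<open>auto simp: evaluates_def\<close>)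
  moreover have "fits w M (Total lo hi f) B A \<rho>"
    using lo hi body part ev unfolding evaluates_def fits.simps by simp
  moreover have "eval M (Total lo hi f) B \<rho> = (\<Sum>j\<in>{u..<v}. g j)"
    using lo hi ev[of v] unfolding evaluates_def eval.simps by simp
  ultimately show ?thesis using lo hi unfolding evaluates_def cost.simps by simp
qed

lemma evaluates_First:
  assumes lo: "evaluates w M B A \<rho> lo u c1" and hi: "evaluates w M (B + 1) A \<rho> hi v c2"
    and body: "\<And>j. u \<le> j \<Longrightarrow> j < v \<Longrightarrow>
       evaluates w M (B + 2) (insert B A) (\<rho>(B := j)) (f B) (of_bool (P j)) c"
    and K: "v - u \<le> int K"
  shows "evaluates w M B A \<rho> (First lo hi f) (first_from u v P) (c1 + c2 + 1 + K * (c + 5))"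
proof -
  have "(\<Sum>j\<in>{u..<v}. cost M (f B) (B + 2) (\<rho>(B := j)) + 5) \<le> K * (c + 5)"
    by (rule sum_le_range[OF _ K]) (use body in \<open>auto simp: evaluates_def\<close>)
  moreover have "fits w M (First lo hi f) B A \<rho>"
    using lo hi body unfolding evaluates_def fits.simps by simp
  moreover have "first_from u v (\<lambda>j. 0 < eval M (f B) (B + 2) (\<rho>(B := j))) = first_from u v P"
    by (rule first_from_cong) (use body in \<open>auto simp: evaluates_def\<close>)
  then have "eval M (First lo hi f) B \<rho> = first_from u v P"
    using lo hi unfolding evaluates_def eval.simps by simp
  ultimately show ?thesis using lo hi unfolding evaluates_def cost.simps by simp
qed

lemma sum_of_bool_int: "(\<Sum>j\<in>{u..<v::int}. (of_bool (P j)::int)) = int (card {j\<in>{u..<v}. P j})"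
proof -
  have "{j \<in> {u..<v}. P j} = {u..<v} \<inter> Collect P" by auto
  then show ?thesis by (simp add: sum.If_cases of_bool_def)
qed

subsection \<open>Statements\<close>

text \<open>Registers below 40 are the program variables, and expressions use those from 40 on as
  temporaries. Nothing is recorded about the latter, so statements compose without tracking
  them.\<close>

definition runs ::
    "nat \<Rightarrow> com \<Rightarrow> (reg \<Rightarrow> int) \<Rightarrow> (int \<Rightarrow> int) \<Rightarrow> bits list \<Rightarrow> nat \<Rightarrow>
     (reg \<Rightarrow> int) \<Rightarrow> (int \<Rightarrow> int) \<Rightarrow> bits list \<Rightarrow> bool" where
  "runs w c \<rho> M zs b \<rho>' M' zs' \<longleftrightarrow>
     (\<forall>s. (\<forall>r<40. regs s r = \<rho> r) \<and> mem s = M \<and> pending s = zs \<longrightarrow>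
       (\<exists>t s'. exec w c s t s' \<and> t \<le> b \<and> (\<forall>r<40. regs s' r = \<rho>' r) \<and> mem s' = M' \<and>
          pending s' = zs'))"

definition assign :: "reg \<Rightarrow> expr \<Rightarrow> com" where
  "assign d e = Seq (compile e 40) (Seq (Instr (Const 41 0)) (Instr (Arith Plus d 40 41)))"

definition store :: "expr \<Rightarrow> expr \<Rightarrow> com" where
  "store a e = Seq (compile a 40) (Seq (compile e 41) (Instr (Store 40 41)))"

text \<open>The length of the sample lands in a temporary and is dropped: rows of the table have a
  fixed stride, and no test looks for the end of a trace.\<close>

definition draw :: "expr \<Rightarrow> com" where
  "draw a = Seq (compile a 40) (Instr (Draw 40 40))"

lemma runs_Seq:
  assumes "runs w c \<rho> M zs b \<rho>1 M1 zs1" "runs w c' \<rho>1 M1 zs1 b' \<rho>2 M2 zs2" "b + b' \<le> b''"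
  shows "runs w (Seq c c') \<rho> M zs b'' \<rho>2 M2 zs2"
  unfolding runs_def
proof (intro allI impI)
  fix s :: config assume "(\<forall>r<40. regs s r = \<rho> r) \<and> mem s = M \<and> pending s = zs"
  with assms(1) obtain t1 s1 where 1: "exec w c s t1 s1" "t1 \<le> b" "\<forall>r<40. regs s1 r = \<rho>1 r"
    "mem s1 = M1" "pending s1 = zs1" unfolding runs_def by blast
  with assms(2) obtain t2 s2 where 2: "exec w c' s1 t2 s2" "t2 \<le> b'" "\<forall>r<40. regs s2 r = \<rho>2 r"
    "mem s2 = M2" "pending s2 = zs2" unfolding runs_def by blast
  show "\<exists>t s'. exec w (Seq c c') s t s' \<and> t \<le> b'' \<and> (\<forall>r<40. regs s' r = \<rho>2 r) \<and> mem s' = M2 \<and>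
          pending s' = zs2"
    using exec_Seq[OF 1(1) 2(1)] 1 2 assms(3) by (intro exI[of _ "t1 + t2"] exI[of _ s2]) auto
qed

lemma runs_weaken:
  "runs w c \<rho> M zs b \<rho>' M' zs' \<Longrightarrow> b \<le> b' \<Longrightarrow> runs w c \<rho> M zs b' \<rho>' M' zs'"
  unfolding runs_def using order_trans[of _ b b'] by blast

lemma evaluates_exec:
  assumes "evaluates w M B {..<40} \<rho> e v c" "40 \<le> B" "0 < w"
    and "\<forall>r<40. regs s r = \<rho> r" "mem s = M"
  obtains t s' where "exec w (compile e B) s t s'" "t \<le> c" "regs s' B = v"
    "\<And>r. r < B \<Longrightarrow> regs s' r = regs s r" "mem s' = M" "pending s' = pending s"
proof -
  have "computes w (compile e B) B {..<40} \<rho> M (cost M e B \<rho>) (eval M e B \<rho>)"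
    by (rule compile_correct) (use assms in \<open>auto simp: evaluates_def\<close>)
  moreover have "regs s r = \<rho> r" if "r \<in> {..<40}" for r using that assms(4) by simp
  ultimately obtain t s' where 1: "exec w (compile e B) s t s'" "t \<le> cost M e B \<rho>"
    "regs s' B = eval M e B \<rho>" "\<And>r. r < B \<Longrightarrow> regs s' r = regs s r" "mem s' = M" "pending s' = pending s"
    using assms(5) by (elim computesD) auto
  show ?thesis by (rule that[of t s']) (use 1 assms(1) in \<open>auto simp: evaluates_def\<close>)
qed

lemma runs_assign:
  assumes "evaluates w M 40 {..<40} \<rho> e v c" "d < 40" "0 < w"
  shows "runs w (assign d e) \<rho> M zs (c + 2) (\<rho>(d := v)) M zs"
  unfolding runs_def
proof (intro allI impI)
  fix s :: config assume s: "(\<forall>r<40. regs s r = \<rho> r) \<and> mem s = M \<and> pending s = zs"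
  then obtain t s1 where 1: "exec w (compile e 40) s t s1" "t \<le> c" "regs s1 40 = v"
    "\<And>r. r < 40 \<Longrightarrow> regs s1 r = regs s r" "mem s1 = M" "pending s1 = pending s"
    using evaluates_exec[OF assms(1) order_refl assms(3), of s] by auto
  have "v \<in> words w" using assms(1) fits_words unfolding evaluates_def by blast
  then have 3: "exec w (Instr (Arith Plus d 40 41)) (s1\<lparr>regs := (regs s1)(41 := 0)\<rparr>) 1
     (s1\<lparr>regs := (regs s1)(41 := 0, d := v)\<rparr>)"
    using exec_Arith[of Plus "s1\<lparr>regs := (regs s1)(41 := 0)\<rparr>" 40 41 w d] 1(3) by simp
  note e = exec_Seq[OF 1(1) exec_Seq[OF exec_Const[OF zero_words] 3]]
  show "\<exists>t s'. exec w (assign d e) s t s' \<and> t \<le> c + 2 \<and>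
        (\<forall>r<40. regs s' r = (\<rho>(d := v)) r) \<and> mem s' = M \<and> pending s' = zs"
    unfolding assign_def using e 1 s assms(2)
    by (intro exI[of _ "t + (1 + 1)"] exI) auto
qed

lemma runs_store:
  assumes a: "evaluates w M 40 {..<40} \<rho> a u c" and e: "evaluates w M 41 {..<40} \<rho> e v c'" and "0 < w"
  shows "runs w (store a e) \<rho> M zs (c + c' + 1) \<rho> (M(u := v)) zs"
  unfolding runs_def
proof (intro allI impI)
  fix s :: config assume s: "(\<forall>r<40. regs s r = \<rho> r) \<and> mem s = M \<and> pending s = zs"
  then obtain t s1 where 1: "exec w (compile a 40) s t s1" "t \<le> c" "regs s1 40 = u"
    "\<And>r. r < 40 \<Longrightarrow> regs s1 r = regs s r" "mem s1 = M" "pending s1 = pending s"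
    using evaluates_exec[OF a order_refl assms(3), of s] by auto
  have "\<forall>r<40. regs s1 r = \<rho> r" using s 1(4) by auto
  with 1(5) obtain t2 s2 where 2: "exec w (compile e 41) s1 t2 s2" "t2 \<le> c'" "regs s2 41 = v"
    "\<And>r. r < 41 \<Longrightarrow> regs s2 r = regs s1 r" "mem s2 = M" "pending s2 = pending s1"
    using evaluates_exec[OF e _ assms(3), of s1] by auto
  have 3: "exec w (Instr (Store 40 41)) s2 1 (s2\<lparr>mem := M(u := v)\<rparr>)"
    by (rule exec_Instr) (use 1(3) 2(3,5) 2(4)[of 40] in simp)
  note e = exec_Seq[OF 1(1) exec_Seq[OF 2(1) 3]]
  show "\<exists>t s'. exec w (store a e) s t s' \<and> t \<le> c + c' + 1 \<and>
        (\<forall>r<40. regs s' r = \<rho> r) \<and> mem s' = M(u := v) \<and> pending s' = zs"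
    unfolding store_def using e 1 2 s
    by (intro exI[of _ "t + (t2 + 1)"] exI) auto
qed

lemma runs_draw:
  assumes a: "evaluates w M 40 {..<40} \<rho> a u c" and "0 < w"
  shows "runs w (draw a) \<rho> M (z # zs) (c + 1 + length z) \<rho> (write_bits u z M) zs"
  unfolding runs_def
proof (intro allI impI)
  fix s :: config assume s: "(\<forall>r<40. regs s r = \<rho> r) \<and> mem s = M \<and> pending s = z # zs"
  then obtain t s1 where 1: "exec w (compile a 40) s t s1" "t \<le> c" "regs s1 40 = u"
    "\<And>r. r < 40 \<Longrightarrow> regs s1 r = regs s r" "mem s1 = M" "pending s1 = pending s"
    using evaluates_exec[OF a order_refl assms(2), of s] by auto
  have 3: "exec w (Instr (Draw 40 40)) s1 (1 + length z)
      (set_reg w 40 (int (length z)) (s1\<lparr>mem := write_bits u z M, pending := zs\<rparr>))"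
    by (rule exec_Instr) (use 1 s in simp)
  show "\<exists>t s'. exec w (draw a) s t s' \<and> t \<le> c + 1 + length z \<and>
        (\<forall>r<40. regs s' r = \<rho> r) \<and> mem s' = write_bits u z M \<and> pending s' = zs"
    unfolding draw_def using exec_Seq[OF 1(1) 3] 1 s
    by (intro exI[of _ "t + (1 + length z)"] exI) (auto simp: set_reg_def)
qed

text \<open>The loop is described by the explicit sequence of its states instead of an invariant.
  Each of the \<open>K\<close> rounds pays for the body and a test, and the remaining 1 for the test
  that fails.\<close>

lemma runs_WhileLess:
  assumes body: "\<And>i. i < K \<Longrightarrow> runs w c (\<rho> i) (M i) (zs i) b (\<rho> (Suc i)) (M (Suc i)) (zs (Suc i))"
    and cond: "\<And>i. i < K \<Longrightarrow> \<rho> i x < \<rho> i y" "\<not> \<rho> K x < \<rho> K y" and xy: "x < 40" "y < 40"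
  shows "runs w (WhileLess x y c) (\<rho> 0) (M 0) (zs 0) (1 + K * (b + 1)) (\<rho> K) (M K) (zs K)"
proof -
  have "runs w (WhileLess x y c) (\<rho> i) (M i) (zs i) (1 + (K - i) * (b + 1)) (\<rho> K) (M K) (zs K)"
    if "i \<le> K" for i
    using that
  proof (induction "K - i" arbitrary: i)
    case 0
    then have "i = K" by simp
    show ?case unfolding runs_def
    proof (intro allI impI)
      fix s :: config assume "(\<forall>r<40. regs s r = \<rho> i r) \<and> mem s = M i \<and> pending s = zs i"
      then show "\<exists>t s'. exec w (WhileLess x y c) s t s' \<and> t \<le> 1 + (K - i) * (b + 1) \<and>
          (\<forall>r<40. regs s' r = \<rho> K r) \<and> mem s' = M K \<and> pending s' = zs K"
        using exec_WhileFalse[of s x y w c] cond(2) xy \<open>i = K\<close>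
        by (intro exI[of _ 1] exI[of _ s]) auto
    qed
  next
    case (Suc d)
    then have i: "i < K" by simp
    show ?case unfolding runs_def
    proof (intro allI impI)
      fix s :: config assume s: "(\<forall>r<40. regs s r = \<rho> i r) \<and> mem s = M i \<and> pending s = zs i"
      have "d = K - Suc i" using Suc.hyps(2) by linarith
      from Suc.hyps(1)[OF this] i have IH: "runs w (WhileLess x y c) (\<rho> (Suc i)) (M (Suc i)) (zs (Suc i))
          (1 + (K - Suc i) * (b + 1)) (\<rho> K) (M K) (zs K)" by simp
      from s obtain t1 s1 where 1: "exec w c s t1 s1" "t1 \<le> b" "\<forall>r<40. regs s1 r = \<rho> (Suc i) r"
        "mem s1 = M (Suc i)" "pending s1 = zs (Suc i)"
        using body[OF i] unfolding runs_def by blast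
      obtain t2 s2 where 2: "exec w (WhileLess x y c) s1 t2 s2" "t2 \<le> 1 + (K - Suc i) * (b + 1)"
        "\<forall>r<40. regs s2 r = \<rho> K r" "mem s2 = M K" "pending s2 = zs K"
        using IH 1(3-5) unfolding runs_def by blast
      have "(K - i) * (b + 1) = (b + 1) + (K - Suc i) * (b + 1)"
        using i by (metis Suc_diff_Suc mult_Suc)
      moreover have "regs s x < regs s y" using s cond(1)[OF i] xy by simp
      ultimately show "\<exists>t s'. exec w (WhileLess x y c) s t s' \<and> t \<le> 1 + (K - i) * (b + 1) \<and>
          (\<forall>r<40. regs s' r = \<rho> K r) \<and> mem s' = M K \<and> pending s' = zs K"
        using exec_WhileTrue[OF _ 1(1) 2(1)] 1(2) 2
        by (intro exI[of _ "1 + t1 + t2"] exI[of _ s2]) auto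
    qed
  qed
  from this[of 0] show ?thesis by simp
qed

subsection \<open>The search for the end of the desert\<close>

abbreviation add_expr (infixl "\<oplus>" 65) where "a \<oplus> b \<equiv> Bin Plus a b"
abbreviation sub_expr (infixl "\<ominus>" 65) where "a \<ominus> b \<equiv> Bin Minus a b"
abbreviation mul_expr (infixl "\<otimes>" 70) where "a \<otimes> b \<equiv> Bin Times a b"
abbreviation div_expr (infixl "\<oslash>" 70) where "a \<oslash> b \<equiv> Bin Quot a b"

lemma sum_of_bool_bounds:
  assumes "v - u \<le> int K"
  shows "(\<Sum>j\<in>{u..<v}. of_bool (P j)) \<le> int K" "0 \<le> (\<Sum>j\<in>{u..<v}. (of_bool (P j)::int))"
proof -
  have "(\<Sum>j\<in>{u..<v}. of_bool (P j)) \<le> (\<Sum>j\<in>{u..<v}. (1::int))" by (rule sum_mono) simp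
  then show "(\<Sum>j\<in>{u..<v}. of_bool (P j)) \<le> int K" using assms by (simp split: if_splits)
qed (simp add: sum_nonneg)

lemma sum_of_bool_less_1:
  "(\<Sum>j\<in>{u..<v::int}. (of_bool (P j)::int)) < 1 \<longleftrightarrow> (\<forall>j\<in>{u..<v}. \<not> P j)"
proof -
  have "0 \<le> (\<Sum>j\<in>{u..<v}. (of_bool (P j)::int))" by (simp add: sum_nonneg)
  then have "(\<Sum>j\<in>{u..<v}. (of_bool (P j)::int)) < 1 \<longleftrightarrow> (\<Sum>j\<in>{u..<v}. (of_bool (P j)::int)) = 0"
    by linarith
  also have "\<dots> \<longleftrightarrow> (\<forall>j\<in>{u..<v}. (of_bool (P j)::int) = 0)"
    by (rule sum_nonneg_eq_0_iff) auto
  finally show ?thesis by simp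
qed

text \<open>
  Registers: 0 holds \<open>n\<close>, 3 the number \<open>N\<close> of given traces, 6 the half-width \<open>m\<close>, 10 the tolerance
  \<open>q\<close> for the location of corresponding windows, 11 the number \<open>T\<close> of samples, 12 the address of
  the table of traces, whose row \<open>i\<close> starts at offset \<open>i * n\<close>, 13 the period \<open>k\<close>, 14 the accepted
  location \<open>l\<close> and 15 the trace \<open>j\<close> in which it was found.
\<close>

definition neq_expr :: "expr \<Rightarrow> expr \<Rightarrow> expr" where
  "neq_expr a b = Cond a b (Num 1) (Cond b a (Num 1) (Num 0))"

definition cell :: "reg \<Rightarrow> expr \<Rightarrow> expr" where
  "cell i e = Mem (Var 12 \<oplus> Var i \<otimes> Var 0 \<oplus> e)"

text \<open>Mismatches are counted, and a count below 1 is a match. The window has \<open>m\<close>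
  cells up to and including the given location and \<open>m\<close> cells after it, so that the
  break of the period lies at its centre.\<close>

definition match_expr :: "reg \<Rightarrow> reg \<Rightarrow> reg \<Rightarrow> reg \<Rightarrow> expr" where
  "match_expr i z j l = Cond
     (Total (Num 0) (Num 2 \<otimes> Var 6) (\<lambda>t. neq_expr
        (cell i (Var z \<oplus> Num 1 \<ominus> Var 6 \<oplus> Var t)) (cell j (Var l \<oplus> Num 1 \<ominus> Var 6 \<oplus> Var t))))
     (Num 1) (Num 1) (Num 0)"

text \<open>A failed search returns its upper bound; comparing with this bound turns the search into
  a test for existence.\<close>

definition near_expr :: "reg \<Rightarrow> reg \<Rightarrow> reg \<Rightarrow> expr" where
  "near_expr i j l = Cond
     (First (Var l \<ominus> Var 10) (Var l \<oplus> Var 10 \<oplus> Num 1) (\<lambda>z. match_expr i z j l))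
     (Var l \<oplus> Var 10 \<oplus> Num 1) (Num 1) (Num 0)"

definition break_expr :: "reg \<Rightarrow> reg \<Rightarrow> expr" where
  "break_expr j l = Cond
     (Total (Num 0) (Var 6 \<ominus> Var 13)
       (\<lambda>t. neq_expr (cell j (Var l \<ominus> Var t)) (cell j (Var l \<ominus> Var t \<ominus> Var 13))))
     (Num 1) (neq_expr (cell j (Var l \<oplus> Num 1)) (cell j (Var l \<oplus> Num 1 \<ominus> Var 13))) (Num 0)"

definition accept_expr :: "reg \<Rightarrow> reg \<Rightarrow> expr" where
  "accept_expr j l = Cond (break_expr j l) (Num 1) (Num 0)
     (Cond (Var 3) (Num 2 \<otimes> Total (Num 0) (Var 3) (\<lambda>i. near_expr i j l)) (Num 1) (Num 0))"

text \<open>An accepted location is within \<open>q\<close> of the image of the end in one good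
  trace, and the images in two typical traces differ by at most \<open>q\<close>. Hence the image
  lies within \<open>2 * q\<close> of the accepted location in every typical trace, inside the
  radius \<open>3 * q\<close>.\<close>

definition result_expr :: "reg \<Rightarrow> expr" where
  "result_expr i = First (Var 14 \<ominus> Num 3 \<otimes> Var 10) (Var 14 \<oplus> Num 3 \<otimes> Var 10 \<oplus> Num 1)
     (\<lambda>z. match_expr i z 15 14)"

definition table_row :: "(int \<Rightarrow> int) \<Rightarrow> nat \<Rightarrow> nat \<Rightarrow> int \<Rightarrow> int \<Rightarrow> int" where
  "table_row M base n i t = M (int base + i * int n + t)"

definition window_match :: "(int \<Rightarrow> int \<Rightarrow> int) \<Rightarrow> nat \<Rightarrow> int \<Rightarrow> int \<Rightarrow> int \<Rightarrow> int \<Rightarrow> bool" where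
  "window_match Y m i z j l \<longleftrightarrow> (\<forall>t\<in>{0..<2 * int m}. Y i (z + 1 - int m + t) = Y j (l + 1 - int m + t))"

text \<open>All cells compared here lie inside the window of \<open>window_match\<close>, so a match
  transfers the whole test to another trace.\<close>

definition break_window :: "(int \<Rightarrow> int \<Rightarrow> int) \<Rightarrow> nat \<Rightarrow> nat \<Rightarrow> int \<Rightarrow> int \<Rightarrow> bool" where
  "break_window Y m k j l \<longleftrightarrow>
     (\<forall>t\<in>{0..<int m - int k}. Y j (l - t) = Y j (l - t - int k)) \<and> Y j (l + 1) \<noteq> Y j (l + 1 - int k)"

text \<open>A strict majority suffices: together with two properties that each hold for nine tenths
  of the traces, the shares add up to more than 2, so some trace has all three.\<close>

definition accepted :: "(int \<Rightarrow> int \<Rightarrow> int) \<Rightarrow> nat \<Rightarrow> nat \<Rightarrow> nat \<Rightarrow> nat \<Rightarrow> int \<Rightarrow> int \<Rightarrow> bool" where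
  "accepted Y m k q N j l \<longleftrightarrow> break_window Y m k j l \<and>
     int N < 2 * int (card {i\<in>{0..<int N}. \<exists>z\<in>{l - int q..l + int q}. window_match Y m i z j l})"

lemma first_from_less: "first_from lo hi P < hi \<longleftrightarrow> (\<exists>z\<in>{lo..<hi}. P z)"
  using first_from_stop[of hi lo P] first_from_ge[of lo hi P] first_from_least[of lo _ hi P]
  by (metis atLeastLessThan_iff linorder_not_less order_less_le_trans order_le_less)

lemma first_from_le_iff: "(\<exists>z\<in>{lo..hi}. P z) \<longleftrightarrow> first_from lo (hi + 1) P < hi + 1"
  unfolding first_from_less by force

lemma evaluates_neq:
  assumes "\<And>B. evaluates w M B A \<rho> a u c" "\<And>B. evaluates w M B A \<rho> b v c" "0 < w"
  shows "evaluates w M B A \<rho> (neq_expr a b) (of_bool (u \<noteq> v)) (4 * c + 5)"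
  unfolding neq_expr_def
  by (rule evaluates_weaken, (rule evaluates_Cond assms(1,2) evaluates_Num zero_words one_words assms(3))+)
    (use assms in auto)

text \<open>All quantities are measured in \<open>P\<close>, and a word holds a large multiple of
  \<open>P * P\<close>. The bound for \<open>k\<close> is \<open>3 * P\<close> because a failed
  search for a period yields \<open>2 * m + 1\<close>; \<open>base\<close> is quadratic in
  \<open>P\<close> because the table lies behind the input.\<close>

locale word_ram =
  fixes w :: nat and n m k q N T base P :: nat
  assumes w: "0 < w" and P10: "10 \<le> P" and P2: "1000 * (int P * int P) \<le> 2 ^ w"
    and le_P: "n \<le> P" "m \<le> P" "k \<le> 3 * P" "q \<le> P" "N \<le> P" "T \<le> P"
    and base_le: "int base \<le> 8 * (int P * int P)"
begin

definition env :: "reg set \<Rightarrow> (reg \<Rightarrow> int) \<Rightarrow> bool" where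
  "env A \<rho> \<longleftrightarrow> {0, 3, 6, 10, 11, 12, 13} \<subseteq> A \<and> \<rho> 0 = int n \<and> \<rho> 3 = int N \<and> \<rho> 6 = int m \<and>
     \<rho> 10 = int q \<and> \<rho> 11 = int T \<and> \<rho> 12 = int base \<and> \<rho> 13 = int k"

definition loc :: "reg set \<Rightarrow> (reg \<Rightarrow> int) \<Rightarrow> reg \<Rightarrow> bool" where
  "loc A \<rho> r \<longleftrightarrow> r \<in> A \<and> \<bar>\<rho> r\<bar> \<le> 10 * int P"

definition idx :: "reg set \<Rightarrow> (reg \<Rightarrow> int) \<Rightarrow> reg \<Rightarrow> bool" where
  "idx A \<rho> r \<longleftrightarrow> r \<in> A \<and> 0 \<le> \<rho> r \<and> \<rho> r \<le> 2 * int P"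

lemma PP: "10 * int P \<le> int P * int P"
  using P10 by (intro mult_right_mono) auto

lemma P10': "10 \<le> int P"
  using P10 by simp

lemma wordsI:
  assumes "\<bar>v\<bar> \<le> 900 * (int P * int P)"
  shows "v \<in> words w"
proof -
  have "- (2 ^ w) \<le> v" "v < 2 ^ w" using assms P2 PP P10' by linarith+
  then show ?thesis by (simp add: words_def)
qed

lemma small_wordsI: "\<bar>v\<bar> \<le> 900 * int P \<Longrightarrow> v \<in> words w"
  by (rule wordsI) (use PP P10' in linarith)

lemma env_update: "env A \<rho> \<Longrightarrow> 40 \<le> B \<Longrightarrow> env (insert B A) (\<rho>(B := x))"
  by (auto simp: env_def)

lemma loc_update: "loc A \<rho> r \<Longrightarrow> r < B \<Longrightarrow> loc (insert B A) (\<rho>(B := x)) r"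
  by (auto simp: loc_def)

lemma idx_update: "idx A \<rho> r \<Longrightarrow> r < B \<Longrightarrow> idx (insert B A) (\<rho>(B := x)) r"
  by (auto simp: idx_def)

lemma env_simps:
  assumes "env A \<rho>"
  shows "0 \<in> A" "3 \<in> A" "6 \<in> A" "10 \<in> A" "11 \<in> A" "12 \<in> A" "13 \<in> A" "\<rho> 0 = int n" "\<rho> 3 = int N"
    "\<rho> 6 = int m" "\<rho> 10 = int q" "\<rho> 11 = int T" "\<rho> 12 = int base" "\<rho> 13 = int k"
  using assms unfolding env_def by blast+

lemma evaluates_pos:
  assumes "y \<in> A" "x \<in> A" "6 \<in> A" "\<rho> 6 = int m" "\<bar>\<rho> y\<bar> \<le> 10 * int P" "\<bar>\<rho> x\<bar> \<le> 10 * int P"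
  shows "evaluates w M B A \<rho> (Var y \<oplus> Num 1 \<ominus> Var 6 \<oplus> Var x) (\<rho> y + 1 - int m + \<rho> x) 10"
proof -
  have "\<rho> y \<in> words w" "1 \<in> words w" "\<rho> y + 1 \<in> words w" "int m \<in> words w" "\<rho> y + 1 - int m \<in> words w"
    "\<rho> x \<in> words w" "\<rho> y + 1 - int m + \<rho> x \<in> words w"
    by (rule small_wordsI, use assms le_P P10' in linarith)+
  then show ?thesis using assms(1-4) by (simp add: evaluates_def)
qed

lemma evaluates_cell:
  assumes "env A \<rho>" "idx A \<rho> i" "\<And>B. evaluates w M B A \<rho> e v c" "\<bar>v\<bar> \<le> 50 * int P"
    and M: "\<And>a. M a \<in> words w"
  shows "evaluates w M B A \<rho> (cell i e) (table_row M base n (\<rho> i) v) (c + 10)"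
proof -
  have i: "0 \<le> \<rho> i" "\<rho> i \<le> 2 * int P" using assms(2) by (auto simp: idx_def)
  have pos: "0 \<le> \<rho> i * int n" using i by simp
  have le: "\<rho> i * int n \<le> 2 * (int P * int P)"
    using mult_mono[of "\<rho> i" "2 * int P" "int n" "int P"] i le_P by simp
  have b: "0 \<le> int base" "int base \<le> 8 * (int P * int P)" using base_le by simp_all
  define y where "y = \<rho> i * int n"
  have 1: "int base + y \<in> words w" "int base + y + v \<in> words w" "y \<in> words w" "int base \<in> words w"
      "\<rho> i \<in> words w" "int n \<in> words w"
    by (rule wordsI, use pos[folded y_def] le[folded y_def] b assms(4) PP P10' i le_P(1) in linarith)+
  have "evaluates w M B A \<rho> (Var 12 \<oplus> Var i \<otimes> Var 0) (int base + y) 8" for B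
    using 1 assms(2) env_simps[OF assms(1)] by (simp add: evaluates_def idx_def y_def)
  then have "evaluates w M B A \<rho> (Mem (Var 12 \<oplus> Var i \<otimes> Var 0 \<oplus> e))
      (M (arith Plus (int base + y) v)) (8 + c + 1 + 1)"
    by (intro evaluates_Mem evaluates_Bin assms(3) M) (use 1(2) in simp_all)
  then show ?thesis unfolding cell_def by (rule evaluates_weaken) (auto simp: table_row_def y_def)
qed

lemma evaluates_match:
  assumes env: "env A \<rho>" and i: "idx A \<rho> i" "idx A \<rho> j" and l: "loc A \<rho> z" "loc A \<rho> l"
    and B: "40 \<le> B" "A \<subseteq> {..<B}" and M: "\<And>a. M a \<in> words w"
  shows "evaluates w M B A \<rho> (match_expr i z j l)
     (of_bool (window_match (table_row M base n) m (\<rho> i) (\<rho> z) (\<rho> j) (\<rho> l))) (200 * (m + 1))"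
proof -
  define g where "g t = (of_bool (table_row M base n (\<rho> i) (\<rho> z + 1 - int m + t) \<noteq>
     table_row M base n (\<rho> j) (\<rho> l + 1 - int m + t)) :: int)" for t
  have lt: "i < B" "j < B" "z < B" "l < B" using i l B unfolding idx_def loc_def by auto
  have body: "evaluates w M (B + 3) (insert (B + 1) A) (\<rho>(B + 1 := t))
      (neq_expr (cell i (Var z \<oplus> Num 1 \<ominus> Var 6 \<oplus> Var (B + 1)))
         (cell j (Var l \<oplus> Num 1 \<ominus> Var 6 \<oplus> Var (B + 1)))) (g t) 85"
    if t: "0 \<le> t" "t < 2 * int m" for t
  proof -
    let ?A = "insert (B + 1) A" and ?r = "\<rho>(B + 1 := t)"
    have e: "env ?A ?r" by (rule env_update[OF env]) (use B in simp)
    have ix: "idx ?A ?r i" "idx ?A ?r j" using i lt by (auto intro!: idx_update)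
    have lc: "loc ?A ?r z" "loc ?A ?r l" using l lt by (auto intro!: loc_update)
    have pos: "evaluates w M B' ?A ?r (Var y \<oplus> Num 1 \<ominus> Var 6 \<oplus> Var (B + 1)) (\<rho> y + 1 - int m + t) 10"
      if "loc ?A ?r y" "y < B" for y B'
    proof -
      have "?r y = \<rho> y" "?r (B + 1) = t" using that(2) by auto
      moreover have "\<bar>t\<bar> \<le> 10 * int P" using t le_P by linarith
      ultimately show ?thesis
        using evaluates_pos[of y ?A "B + 1" ?r M B'] that(1) env_simps[OF e] unfolding loc_def by simp
    qed
    have small: "\<bar>\<rho> y + 1 - int m + t\<bar> \<le> 50 * int P" if "loc A \<rho> y" for y
      using that t le_P P10 by (auto simp: loc_def)
    have "evaluates w M B' ?A ?r (cell i (Var z \<oplus> Num 1 \<ominus> Var 6 \<oplus> Var (B + 1)))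
        (table_row M base n (\<rho> i) (\<rho> z + 1 - int m + t)) 20" for B'
      using evaluates_cell[OF e ix(1) pos[OF lc(1) lt(3)] small[OF l(1)] M, of B'] lt by simp
    moreover have "evaluates w M B' ?A ?r (cell j (Var l \<oplus> Num 1 \<ominus> Var 6 \<oplus> Var (B + 1)))
        (table_row M base n (\<rho> j) (\<rho> l + 1 - int m + t)) 20" for B'
      using evaluates_cell[OF e ix(2) pos[OF lc(2) lt(4)] small[OF l(2)] M, of B'] lt by simp
    ultimately show ?thesis
      unfolding g_def by (rule evaluates_weaken[OF evaluates_neq[OF _ _ w]]) simp_all
  qed
  have le: "(\<Sum>t\<in>{0..<2 * int m}. g t) \<le> int (2 * m)" and ge: "0 \<le> (\<Sum>t\<in>{0..<2 * int m}. g t)"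
    unfolding g_def using sum_of_bool_bounds[of "2 * int m" 0 "2 * m"] by auto
  have hi: "evaluates w M (B + 2) A \<rho> (Num 2 \<otimes> Var 6) (2 * int m) 4"
    using env le_P P10 unfolding evaluates_def env_def by (auto intro!: small_wordsI)
  have "evaluates w M B A \<rho> (Total (Num 0) (Num 2 \<otimes> Var 6) (\<lambda>t. neq_expr
        (cell i (Var z \<oplus> Num 1 \<ominus> Var 6 \<oplus> Var t)) (cell j (Var l \<oplus> Num 1 \<ominus> Var 6 \<oplus> Var t))))
        (\<Sum>t\<in>{0..<2 * int m}. g t) (1 + 4 + 2 + 2 * m * (85 + 4))"
    by (rule evaluates_Total[OF evaluates_Num[OF zero_words] hi])
      (use body le ge le_P P10 in \<open>auto simp: g_def intro!: small_wordsI\<close>)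
  moreover have "(\<Sum>t\<in>{0..<2 * int m}. g t) < 1 \<longleftrightarrow>
      window_match (table_row M base n) m (\<rho> i) (\<rho> z) (\<rho> j) (\<rho> l)"
    unfolding g_def sum_of_bool_less_1 window_match_def by simp
  ultimately show ?thesis
    unfolding match_expr_def
    by (intro evaluates_weaken[OF evaluates_Cond[OF _ evaluates_Num evaluates_Num evaluates_Num]])
      (auto intro: one_words[OF w])
qed

lemma evaluates_near:
  assumes env: "env A \<rho>" and i: "idx A \<rho> i" "idx A \<rho> j" and l: "l \<in> A" "\<bar>\<rho> l\<bar> \<le> 4 * int P"
    and B: "40 \<le> B" "A \<subseteq> {..<B}" and M: "\<And>a. M a \<in> words w"
  shows "evaluates w M B A \<rho> (near_expr i j l)
     (of_bool (\<exists>z\<in>{\<rho> l - int q..\<rho> l + int q}. window_match (table_row M base n) m (\<rho> i) z (\<rho> j) (\<rho> l)))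
     (250 * (m + 1) * (2 * q + 1))"
proof -
  have lt: "i < B" "j < B" "l < B" using i l B unfolding idx_def by auto
  have body: "evaluates w M (B + 2) (insert B A) (\<rho>(B := z)) (match_expr i B j l)
      (of_bool (window_match (table_row M base n) m (\<rho> i) z (\<rho> j) (\<rho> l))) (200 * (m + 1))"
    if z: "\<rho> l - int q \<le> z" "z < \<rho> l + int q + 1" for z
  proof -
    have "loc (insert B A) (\<rho>(B := z)) B" using z l le_P P10 unfolding loc_def by auto
    moreover have "loc (insert B A) (\<rho>(B := z)) l" using l lt P10 unfolding loc_def by auto
    ultimately have "evaluates w M (B + 2) (insert B A) (\<rho>(B := z)) (match_expr i B j l)
        (of_bool (window_match (table_row M base n) m ((\<rho>(B := z)) i) ((\<rho>(B := z)) B) ((\<rho>(B := z)) j) ((\<rho>(B := z)) l)))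
        (200 * (m + 1))"
      using B lt i by (intro evaluates_match env_update[OF env] idx_update M) auto
    then show ?thesis using lt by simp
  qed
  have "\<rho> l \<in> words w" "\<rho> l + int q \<in> words w" "int q \<in> words w" "\<rho> l - int q \<in> words w"
    "\<rho> l + int q + 1 \<in> words w" "1 \<in> words w"
    by (rule small_wordsI, use l le_P P10' in linarith)+
  then have lo: "evaluates w M B A \<rho> (Var l \<ominus> Var 10) (\<rho> l - int q) 5"
    and hi: "evaluates w M B' A \<rho> (Var l \<oplus> Var 10 \<oplus> Num 1) (\<rho> l + int q + 1) 7" for B'
    using env_simps[OF env] l(1) by (simp_all add: evaluates_def)
  have "evaluates w M B A \<rho> (First (Var l \<ominus> Var 10) (Var l \<oplus> Var 10 \<oplus> Num 1) (\<lambda>z. match_expr i z j l))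
      (first_from (\<rho> l - int q) (\<rho> l + int q + 1) (\<lambda>z. window_match (table_row M base n) m (\<rho> i) z (\<rho> j) (\<rho> l)))
      (5 + 7 + 1 + (2 * q + 1) * (200 * (m + 1) + 5))"
    by (rule evaluates_First[OF lo hi]) (use body in auto)
  from evaluates_Cond[OF this hi evaluates_Num evaluates_Num, OF one_words[OF w] zero_words]
  have "evaluates w M B A \<rho> (near_expr i j l)
     (of_bool (\<exists>z\<in>{\<rho> l - int q..\<rho> l + int q}. window_match (table_row M base n) m (\<rho> i) z (\<rho> j) (\<rho> l)))
     (5 + 7 + 1 + (2 * q + 1) * (200 * (m + 1) + 5) + 7 + 1 + 1 + 1)"
    unfolding near_expr_def first_from_le_iff by (rule evaluates_weaken) simp_all
  then show ?thesis by (rule evaluates_weaken) (auto simp: algebra_simps)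
qed

lemma evaluates_break:
  assumes env: "env A \<rho>" and i: "idx A \<rho> j" and l: "l \<in> A" "\<bar>\<rho> l\<bar> \<le> 4 * int P"
    and B: "40 \<le> B" "A \<subseteq> {..<B}" and M: "\<And>a. M a \<in> words w"
  shows "evaluates w M B A \<rho> (break_expr j l)
     (of_bool (break_window (table_row M base n) m k (\<rho> j) (\<rho> l))) (200 * (m + 1))"
proof -
  define g where "g t = (of_bool (table_row M base n (\<rho> j) (\<rho> l - t) \<noteq>
     table_row M base n (\<rho> j) (\<rho> l - t - int k)) :: int)" for t
  have lt: "j < B" "l < B" using i l B unfolding idx_def by auto
  have body: "evaluates w M (B + 3) (insert (B + 1) A) (\<rho>(B + 1 := t))
      (neq_expr (cell j (Var l \<ominus> Var (B + 1))) (cell j (Var l \<ominus> Var (B + 1) \<ominus> Var 13))) (g t) 77"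
    if t: "0 \<le> t" "t < int m - int k" for t
  proof -
    let ?A = "insert (B + 1) A" and ?r = "\<rho>(B + 1 := t)"
    have e: "env ?A ?r" by (rule env_update[OF env]) (use B in simp)
    have ix: "idx ?A ?r j" using i lt by (auto intro!: idx_update)
    have "\<rho> l \<in> words w" "t \<in> words w" "\<rho> l - t \<in> words w" "int k \<in> words w" "\<rho> l - t - int k \<in> words w"
      by (rule small_wordsI, use l t le_P P10' in linarith)+
    moreover have "?r l = \<rho> l" "?r (B + 1) = t" using lt by auto
    ultimately have 1: "evaluates w M B' ?A ?r (Var l \<ominus> Var (B + 1)) (\<rho> l - t) 8"
      and 2: "evaluates w M B' ?A ?r (Var l \<ominus> Var (B + 1) \<ominus> Var 13) (\<rho> l - t - int k) 8" for B'
      using env_simps[OF e] l(1) by (simp_all add: evaluates_def)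
    have "evaluates w M B' ?A ?r (cell j (Var l \<ominus> Var (B + 1))) (table_row M base n (\<rho> j) (\<rho> l - t)) 18" for B'
      using evaluates_cell[OF e ix 1 _ M, of B'] lt l t le_P P10 by simp
    moreover have "evaluates w M B' ?A ?r (cell j (Var l \<ominus> Var (B + 1) \<ominus> Var 13))
        (table_row M base n (\<rho> j) (\<rho> l - t - int k)) 18" for B'
      using evaluates_cell[OF e ix 2 _ M, of B'] lt l t le_P P10 by simp
    ultimately show ?thesis
      unfolding g_def by (rule evaluates_weaken[OF evaluates_neq[OF _ _ w]]) simp_all
  qed
  have le: "(\<Sum>t\<in>{0..<int m - int k}. g t) \<le> int m" and ge: "0 \<le> (\<Sum>t\<in>{0..<int m - int k}. g t)"
    unfolding g_def using sum_of_bool_bounds[of "int m - int k" 0 m] by auto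
  have hi: "evaluates w M (B + 2) A \<rho> (Var 6 \<ominus> Var 13) (int m - int k) 5"
    using env le_P P10 unfolding evaluates_def env_def by (auto intro!: small_wordsI)
  have "evaluates w M B A \<rho> (Total (Num 0) (Var 6 \<ominus> Var 13)
       (\<lambda>t. neq_expr (cell j (Var l \<ominus> Var t)) (cell j (Var l \<ominus> Var t \<ominus> Var 13))))
        (\<Sum>t\<in>{0..<int m - int k}. g t) (1 + 5 + 2 + m * (77 + 4))"
    by (rule evaluates_Total[OF evaluates_Num[OF zero_words] hi])
      (use body le ge le_P P10 in \<open>auto simp: g_def intro!: small_wordsI\<close>)
  moreover have "(\<Sum>t\<in>{0..<int m - int k}. g t) < 1 \<longleftrightarrow>
      (\<forall>t\<in>{0..<int m - int k}. table_row M base n (\<rho> j) (\<rho> l - t) = table_row M base n (\<rho> j) (\<rho> l - t - int k))"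
    unfolding g_def sum_of_bool_less_1 by simp
  moreover have "evaluates w M B A \<rho>
      (neq_expr (cell j (Var l \<oplus> Num 1)) (cell j (Var l \<oplus> Num 1 \<ominus> Var 13)))
      (of_bool (table_row M base n (\<rho> j) (\<rho> l + 1) \<noteq> table_row M base n (\<rho> j) (\<rho> l + 1 - int k))) 77"
  proof -
    have "\<rho> l \<in> words w" "\<rho> l + 1 \<in> words w" "int k \<in> words w" "\<rho> l + 1 - int k \<in> words w" "1 \<in> words w"
      by (rule small_wordsI, use l le_P P10' in linarith)+
    then have 1: "evaluates w M B' A \<rho> (Var l \<oplus> Num 1) (\<rho> l + 1) 8"
      and 2: "evaluates w M B' A \<rho> (Var l \<oplus> Num 1 \<ominus> Var 13) (\<rho> l + 1 - int k) 8" for B'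
      using env_simps[OF env] l(1) by (simp_all add: evaluates_def)
    have "evaluates w M B' A \<rho> (cell j (Var l \<oplus> Num 1)) (table_row M base n (\<rho> j) (\<rho> l + 1)) 18" for B'
      using evaluates_cell[OF env i 1 _ M, of B'] l le_P P10 by simp
    moreover have "evaluates w M B' A \<rho> (cell j (Var l \<oplus> Num 1 \<ominus> Var 13))
        (table_row M base n (\<rho> j) (\<rho> l + 1 - int k)) 18" for B'
      using evaluates_cell[OF env i 2 _ M, of B'] l le_P P10 by simp
    ultimately show ?thesis
      by (rule evaluates_weaken[OF evaluates_neq[OF _ _ w]]) simp_all
  qed
  ultimately show ?thesis
    unfolding break_expr_def break_window_def
    by (intro evaluates_weaken[OF evaluates_Cond[OF _ evaluates_Num _ evaluates_Num]])
      (auto intro: one_words[OF w])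
qed

lemma evaluates_accept:
  assumes env: "env A \<rho>" and i: "idx A \<rho> j" and l: "l \<in> A" "\<bar>\<rho> l\<bar> \<le> 4 * int P"
    and B: "40 \<le> B" "A \<subseteq> {..<B}" and M: "\<And>a. M a \<in> words w"
  shows "evaluates w M B A \<rho> (accept_expr j l)
     (of_bool (accepted (table_row M base n) m k q N (\<rho> j) (\<rho> l))) (600 * (m + 1) * (2 * q + 1) * (N + 1))"
proof -
  let ?Q = "\<lambda>i. \<exists>z\<in>{\<rho> l - int q..\<rho> l + int q}. window_match (table_row M base n) m i z (\<rho> j) (\<rho> l)"
  have lt: "j < B" "l < B" using i l B unfolding idx_def by auto
  have body: "evaluates w M (B + 2 + 3) (insert (B + 2 + 1) A) (\<rho>(B + 2 + 1 := t)) (near_expr (B + 2 + 1) j l)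
      (of_bool (?Q t)) (250 * (m + 1) * (2 * q + 1))" if t: "0 \<le> t" "t < int N" for t
  proof -
    let ?A = "insert (B + 2 + 1) A" and ?r = "\<rho>(B + 2 + 1 := t)"
    have "idx ?A ?r (B + 2 + 1)" using t le_P P10 unfolding idx_def by auto
    then have "evaluates w M (B + 2 + 3) ?A ?r (near_expr (B + 2 + 1) j l)
      (of_bool (\<exists>z\<in>{?r l - int q..?r l + int q}.
          window_match (table_row M base n) m (?r (B + 2 + 1)) z (?r j) (?r l))) (250 * (m + 1) * (2 * q + 1))"
      using B lt i l by (intro evaluates_near env_update[OF env] M) (auto intro: idx_update)
    then show ?thesis using lt by simp
  qed
  have cle: "card {t\<in>{0..<int N}. ?Q t} \<le> N"
    using card_mono[of "{0..<int N}" "{t\<in>{0..<int N}. ?Q t}"] by fastforce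
  have three: "evaluates w M B' A \<rho> (Var 3) (int N) 2" for B'
    using env le_P P10 unfolding evaluates_def env_def by (auto intro!: small_wordsI)
  have "evaluates w M (B + 2) A \<rho> (Total (Num 0) (Var 3) (\<lambda>i. near_expr i j l))
     (\<Sum>t\<in>{0..<int N}. of_bool (?Q t)) (1 + 2 + 2 + N * (250 * (m + 1) * (2 * q + 1) + 4))"
    by (rule evaluates_Total[OF evaluates_Num[OF zero_words] three])
      (use body cle le_P P10 in \<open>auto simp: sum_of_bool_int intro!: small_wordsI\<close>)
  then have tot: "evaluates w M (B + 2) A \<rho> (Total (Num 0) (Var 3) (\<lambda>i. near_expr i j l))
     (int (card {t\<in>{0..<int N}. ?Q t})) (1 + 2 + 2 + N * (250 * (m + 1) * (2 * q + 1) + 4))"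
    unfolding sum_of_bool_int .
  have two: "2 \<in> words w" by (rule small_wordsI) (use P10 in simp)
  have prod: "evaluates w M (B + 1) A \<rho> (Num 2 \<otimes> Total (Num 0) (Var 3) (\<lambda>i. near_expr i j l))
     (2 * int (card {t\<in>{0..<int N}. ?Q t})) (1 + (1 + 2 + 2 + N * (250 * (m + 1) * (2 * q + 1) + 4)) + 1)"
    by (rule evaluates_weaken, rule evaluates_Bin, rule evaluates_Num[OF two])
      (use tot cle le_P P10 in \<open>auto intro!: small_wordsI\<close>)
  have "evaluates w M B A \<rho> (accept_expr j l)
     (of_bool (accepted (table_row M base n) m k q N (\<rho> j) (\<rho> l)))
     (200 * (m + 1) + 1 + 1 +
       (2 + (1 + (1 + 2 + 2 + N * (250 * (m + 1) * (2 * q + 1) + 4)) + 1) + 1 + 1 + 1) + 1)"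
    unfolding accept_expr_def
    by (rule evaluates_weaken[OF evaluates_Cond[OF evaluates_break[OF assms] evaluates_Num evaluates_Num
          evaluates_Cond[OF three prod evaluates_Num evaluates_Num]]])
      (auto simp: accepted_def one_words[OF w])
  then show ?thesis by (rule evaluates_weaken) (auto simp: algebra_simps)
qed

end

section \<open>Expressions for the accepted location and the sums over all traces\<close>

definition search_expr :: expr where
  "search_expr = First (Var 18) (Var 19)
     (\<lambda>l. Cond (First (Num 0) (Var 3) (\<lambda>j. accept_expr j l)) (Var 3) (Num 1) (Num 0))"

text \<open>A nested search returns only the outer value, so a trace in which the location is
  accepted is looked up once more after the location has been stored.\<close>

definition witness_expr :: expr where
  "witness_expr = First (Num 0) (Var 3) (\<lambda>j. accept_expr j 14)"

definition found_expr :: expr where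
  "found_expr = Total (Num 0) (Var 3 \<oplus> Var 11) (\<lambda>i. Cond (result_expr i)
     (Var 14 \<oplus> Num 3 \<otimes> Var 10 \<oplus> Num 1) (Num 1) (Num 0))"

text \<open>A failed search contributes 0. The search is written twice because expressions have no
  local bindings; this only doubles the cost.\<close>

definition sum_expr :: expr where
  "sum_expr = Total (Num 0) (Var 3 \<oplus> Var 11) (\<lambda>i. Cond (result_expr i)
     (Var 14 \<oplus> Num 3 \<otimes> Var 10 \<oplus> Num 1) (result_expr i) (Num 0))"

definition result :: "(int \<Rightarrow> int \<Rightarrow> int) \<Rightarrow> nat \<Rightarrow> nat \<Rightarrow> int \<Rightarrow> int \<Rightarrow> int \<Rightarrow> int" where
  "result Y m q j l i =
     first_from (l - 3 * int q) (l + 3 * int q + 1) (\<lambda>z. window_match Y m i z j l)"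

lemma result_bounds: "l - 3 * int q \<le> result Y m q j l i" "result Y m q j l i \<le> l + 3 * int q + 1"
  unfolding result_def by (auto intro: first_from_ge first_from_le)

context word_ram
begin

lemma evaluates_search:
  assumes env: "env A \<rho>" and s: "18 \<in> A" "19 \<in> A" "0 \<le> \<rho> 18" "\<rho> 18 \<le> 4 * int P" "\<rho> 19 \<le> int n + 1" "0 \<le> \<rho> 19"
    and B: "40 \<le> B" "A \<subseteq> {..<B}" and M: "\<And>a. M a \<in> words w"
  shows "evaluates w M B A \<rho> search_expr
     (first_from (\<rho> 18) (\<rho> 19) (\<lambda>l. \<exists>j\<in>{0..<int N}. accepted (table_row M base n) m k q N j l))
     (700 * (n + 2) * (m + 1) * (2 * q + 1) * (N + 1) * (N + 1))"
proof -
  let ?acc = "accepted (table_row M base n) m k q N"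
  let ?c = "600 * (m + 1) * (2 * q + 1) * (N + 1)"
  have inner: "evaluates w M (B + 2) (insert B A) (\<rho>(B := l)) (Cond (First (Num 0) (Var 3)
      (\<lambda>j. accept_expr j B)) (Var 3) (Num 1) (Num 0))
      (of_bool (\<exists>j\<in>{0..<int N}. ?acc j l)) (1 + 2 + 1 + N * (?c + 5) + 2 + 1 + 1 + 1)"
    if l: "\<rho> 18 \<le> l" "l < \<rho> 19" for l
  proof -
    let ?A = "insert B A" and ?r = "\<rho>(B := l)"
    have e: "env ?A ?r" by (rule env_update[OF env]) (use B in simp)
    have "int N \<in> words w" by (rule small_wordsI) (use le_P P10' in linarith)
    then have three: "evaluates w M B' ?A ?r (Var 3) (int N) 2" for B'
      using env_simps[OF e] by (simp add: evaluates_def)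
    have body: "evaluates w M (B + 2 + 2) (insert (B + 2) ?A) (?r(B + 2 := j)) (accept_expr (B + 2) B)
        (of_bool (?acc j l)) ?c" if j: "0 \<le> j" "j < int N" for j
    proof -
      have "idx (insert (B + 2) ?A) (?r(B + 2 := j)) (B + 2)" using j le_P unfolding idx_def by simp
      then have "evaluates w M (B + 2 + 2) (insert (B + 2) ?A) (?r(B + 2 := j)) (accept_expr (B + 2) B)
        (of_bool (?acc ((?r(B + 2 := j)) (B + 2)) ((?r(B + 2 := j)) B))) ?c"
        by (intro evaluates_accept env_update[OF e] M) (use B l s(3,5) le_P P10 in auto)
      then show ?thesis by simp
    qed
    have "evaluates w M (B + 2) ?A ?r (First (Num 0) (Var 3) (\<lambda>j. accept_expr j B))
      (first_from 0 (int N) (\<lambda>j. ?acc j l)) (1 + 2 + 1 + N * (?c + 5))"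
      by (rule evaluates_First[OF evaluates_Num[OF zero_words] three]) (use body in auto)
    then have "evaluates w M (B + 2) ?A ?r (Cond (First (Num 0) (Var 3)
      (\<lambda>j. accept_expr j B)) (Var 3) (Num 1) (Num 0))
      (if first_from 0 (int N) (\<lambda>j. ?acc j l) < int N then 1 else 0)
      ((1 + 2 + 1 + N * (?c + 5)) + 2 + 1 + 1 + 1)"
      by (intro evaluates_Cond three evaluates_Num zero_words one_words w)
    then show ?thesis by (rule evaluates_weaken) (auto simp: first_from_less)
  qed
  have "\<rho> 18 \<in> words w" "\<rho> 19 \<in> words w"
    by (rule small_wordsI, use s le_P P10' in linarith)+
  then have "evaluates w M B A \<rho> (Var 18) (\<rho> 18) 2" "evaluates w M (B + 1) A \<rho> (Var 19) (\<rho> 19) 2"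
    using s(1,2) by (simp_all add: evaluates_def)
  then have "evaluates w M B A \<rho> search_expr
     (first_from (\<rho> 18) (\<rho> 19) (\<lambda>l. \<exists>j\<in>{0..<int N}. ?acc j l))
     (2 + 2 + 1 + (n + 1) * ((1 + 2 + 1 + N * (?c + 5) + 2 + 1 + 1 + 1) + 5))"
    unfolding search_expr_def by (rule evaluates_First) (use inner s in auto)
  moreover have "2 + 2 + 1 + (n + 1) * ((1 + 2 + 1 + N * (?c + 5) + 2 + 1 + 1 + 1) + 5)
      \<le> 700 * (n + 2) * (m + 1) * (2 * q + 1) * (N + 1) * (N + 1)"
  proof -
    define X where "X = (m + 1) * (2 * q + 1) * (N + 1)"
    have X: "1 \<le> X" "N + 1 \<le> X" unfolding X_def by auto
    have "N * (600 * X + 5) + 14 \<le> (N + 1) * (700 * X)"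
      using mult_le_mono2[OF X(1), of "5 * N"] X by (simp add: algebra_simps)
    then have "(n + 1) * (N * (600 * X + 5) + 14) + 5 \<le> (n + 2) * ((N + 1) * (700 * X))"
      using mult_le_mono2[of "N * (600 * X + 5) + 14" "(N + 1) * (700 * X)" "n + 1"] X
      by (simp add: algebra_simps)
    then show ?thesis unfolding X_def by (simp add: algebra_simps)
  qed
  ultimately show ?thesis by (auto intro: evaluates_weaken)
qed

lemma evaluates_witness:
  assumes env: "env A \<rho>" and s: "14 \<in> A" "0 \<le> \<rho> 14" "\<rho> 14 \<le> 4 * int P"
    and B: "40 \<le> B" "A \<subseteq> {..<B}" and M: "\<And>a. M a \<in> words w"
  shows "evaluates w M B A \<rho> witness_expr
     (first_from 0 (int N) (\<lambda>j. accepted (table_row M base n) m k q N j (\<rho> 14)))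
     (700 * (m + 1) * (2 * q + 1) * (N + 1) * (N + 1))"
proof -
  let ?c = "600 * (m + 1) * (2 * q + 1) * (N + 1)"
  have "int N \<in> words w" by (rule small_wordsI) (use le_P P10' in linarith)
  then have three: "evaluates w M B' A \<rho> (Var 3) (int N) 2" for B'
    using env_simps[OF env] by (simp add: evaluates_def)
  have body: "evaluates w M (B + 2) (insert B A) (\<rho>(B := j)) (accept_expr B 14)
      (of_bool (accepted (table_row M base n) m k q N j (\<rho> 14))) ?c" if j: "0 \<le> j" "j < int N" for j
  proof -
    have "idx (insert B A) (\<rho>(B := j)) B" using j le_P unfolding idx_def by simp
    then have "evaluates w M (B + 2) (insert B A) (\<rho>(B := j)) (accept_expr B 14)
      (of_bool (accepted (table_row M base n) m k q N ((\<rho>(B := j)) B) ((\<rho>(B := j)) 14))) ?c"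
      by (intro evaluates_accept env_update[OF env] M) (use B s le_P P10 in auto)
    then show ?thesis using B by simp
  qed
  have "evaluates w M B A \<rho> witness_expr
      (first_from 0 (int N) (\<lambda>j. accepted (table_row M base n) m k q N j (\<rho> 14))) (1 + 2 + 1 + N * (?c + 5))"
    unfolding witness_expr_def
    by (rule evaluates_First[OF evaluates_Num[OF zero_words] three]) (use body in auto)
  moreover have "1 + 2 + 1 + N * (?c + 5) \<le> 700 * (m + 1) * (2 * q + 1) * (N + 1) * (N + 1)"
  proof -
    define X where "X = (m + 1) * (2 * q + 1) * (N + 1)"
    have X: "1 \<le> X" "N + 1 \<le> X" unfolding X_def by auto
    have "N * (600 * X + 5) + 14 \<le> (N + 1) * (700 * X)"
      using mult_le_mono2[OF X(1), of "5 * N"] X by (simp add: algebra_simps)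
    then show ?thesis unfolding X_def by (simp add: algebra_simps)
  qed
  ultimately show ?thesis by (auto intro: evaluates_weaken)
qed

definition res_env :: "reg set \<Rightarrow> (reg \<Rightarrow> int) \<Rightarrow> int \<Rightarrow> int \<Rightarrow> bool" where
  "res_env A \<rho> j l \<longleftrightarrow> env A \<rho> \<and> 14 \<in> A \<and> 15 \<in> A \<and> \<rho> 14 = l \<and> \<rho> 15 = j \<and>
     3 * int q \<le> l \<and> l \<le> 4 * int P \<and> 0 \<le> j \<and> j \<le> int N"

lemma res_env_update: "res_env A \<rho> j l \<Longrightarrow> 40 \<le> B \<Longrightarrow> res_env (insert B A) (\<rho>(B := x)) j l"
  unfolding res_env_def using env_update by auto

lemma evaluates_limits:
  assumes "res_env A \<rho> j l"
  shows "evaluates w M B A \<rho> (Var 14 \<ominus> Num 3 \<otimes> Var 10) (l - 3 * int q) 7"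
    "evaluates w M B A \<rho> (Var 14 \<oplus> Num 3 \<otimes> Var 10 \<oplus> Num 1) (l + 3 * int q + 1) 9"
proof -
  have l: "0 \<le> l" "l \<le> 4 * int P" using assms unfolding res_env_def by auto
  have "l \<in> words w" "3 * int q \<in> words w" "l + 3 * int q \<in> words w" "l + 3 * int q + 1 \<in> words w"
    "l - 3 * int q \<in> words w" "3 \<in> words w" "1 \<in> words w" "int q \<in> words w"
    by (rule small_wordsI, use l le_P P10' in linarith)+
  moreover have "\<rho> 10 = int q" "10 \<in> A" using assms unfolding res_env_def by (auto dest: env_simps)
  ultimately show "evaluates w M B A \<rho> (Var 14 \<ominus> Num 3 \<otimes> Var 10) (l - 3 * int q) 7"
    "evaluates w M B A \<rho> (Var 14 \<oplus> Num 3 \<otimes> Var 10 \<oplus> Num 1) (l + 3 * int q + 1) 9"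
    using assms by (simp_all add: evaluates_def res_env_def)
qed

lemma evaluates_result:
  assumes r: "res_env A \<rho> j l" and i: "idx A \<rho> i"
    and B: "40 \<le> B" "A \<subseteq> {..<B}" and M: "\<And>a. M a \<in> words w"
  shows "evaluates w M B A \<rho> (result_expr i) (result (table_row M base n) m q j l (\<rho> i))
     (250 * (m + 1) * (6 * q + 1))"
proof -
  have l: "0 \<le> l" "l \<le> 4 * int P" using r unfolding res_env_def by auto
  have lt: "i < B" using i B unfolding idx_def by auto
  have body: "evaluates w M (B + 2) (insert B A) (\<rho>(B := z)) (match_expr i B 15 14)
      (of_bool (window_match (table_row M base n) m (\<rho> i) z j l)) (200 * (m + 1))"
    if z: "l - 3 * int q \<le> z" "z < l + 3 * int q + 1" for z
  proof -
    let ?A = "insert B A" and ?r = "\<rho>(B := z)"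
    have r': "res_env ?A ?r j l" by (rule res_env_update[OF r B(1)])
    then have "idx ?A ?r 15" "loc ?A ?r 14" "env ?A ?r"
      unfolding res_env_def idx_def loc_def using le_P P10 by auto
    moreover have "loc ?A ?r B" using z l le_P P10 unfolding loc_def by auto
    moreover have "idx ?A ?r i" by (rule idx_update[OF i lt])
    ultimately have "evaluates w M (B + 2) ?A ?r (match_expr i B 15 14)
      (of_bool (window_match (table_row M base n) m (?r i) (?r B) (?r 15) (?r 14))) (200 * (m + 1))"
      by (intro evaluates_match M) (use B in auto)
    moreover have "?r 15 = j" "?r 14 = l" using r' unfolding res_env_def by auto
    ultimately show ?thesis using lt by simp
  qed
  have "evaluates w M B A \<rho> (result_expr i) (result (table_row M base n) m q j l (\<rho> i))
     (7 + 9 + 1 + (6 * q + 1) * (200 * (m + 1) + 5))"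
    unfolding result_expr_def result_def
    by (rule evaluates_First[OF evaluates_limits[OF r]]) (use body in auto)
  then show ?thesis by (rule evaluates_weaken) (auto simp: algebra_simps)
qed

lemma evaluates_found:
  assumes r: "res_env A \<rho> j l" and B: "40 \<le> B" "A \<subseteq> {..<B}" and M: "\<And>a. M a \<in> words w"
  shows "evaluates w M B A \<rho> found_expr
     (int (card {i\<in>{0..<int (N + T)}. result (table_row M base n) m q j l i < l + 3 * int q + 1}))
     (300 * (m + 1) * (6 * q + 1) * (N + T + 1))" (is ?found)
    and "evaluates w M B A \<rho> sum_expr
     (\<Sum>i\<in>{0..<int (N + T)}. if result (table_row M base n) m q j l i < l + 3 * int q + 1
        then result (table_row M base n) m q j l i else 0)
     (600 * (m + 1) * (6 * q + 1) * (N + T + 1))" (is ?sum)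
proof -
  let ?R = "result (table_row M base n) m q j l" and ?c = "250 * (m + 1) * (6 * q + 1)"
  let ?h = "l + 3 * int q + 1"
  have l: "3 * int q \<le> l" "l \<le> 4 * int P" using r unfolding res_env_def by auto
  have res: "evaluates w M B' (insert (B + 1) A) (\<rho>(B + 1 := i)) (result_expr (B + 1)) (?R i) ?c"
    "evaluates w M B' (insert (B + 1) A) (\<rho>(B + 1 := i)) (Var 14 \<oplus> Num 3 \<otimes> Var 10 \<oplus> Num 1) ?h 9"
    if i: "0 \<le> i" "i < int (N + T)" and B': "B + 3 \<le> B'" for i B'
  proof -
    let ?A = "insert (B + 1) A" and ?r = "\<rho>(B + 1 := i)"
    have r': "res_env ?A ?r j l" by (rule res_env_update[OF r]) (use B in simp)
    have "idx ?A ?r (B + 1)" using i le_P unfolding idx_def by auto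
    from evaluates_result[OF r' this _ _ M, of B'] B B'
    show "evaluates w M B' ?A ?r (result_expr (B + 1)) (?R i) ?c" by fastforce
    show "evaluates w M B' ?A ?r (Var 14 \<oplus> Num 3 \<otimes> Var 10 \<oplus> Num 1) ?h 9"
      by (rule evaluates_limits[OF r'])
  qed
  have "int N \<in> words w" "int T \<in> words w" "int N + int T \<in> words w"
    by (rule small_wordsI, use le_P P10' in linarith)+
  then have hi: "evaluates w M B' A \<rho> (Var 3 \<oplus> Var 11) (int (N + T)) 5" for B'
    using env_simps[of A \<rho>] r unfolding res_env_def by (simp add: evaluates_def)
  have one: "1 \<in> words w" by (rule one_words[OF w])
  have R: "0 \<le> ?R i" "?R i \<le> 8 * int P" for i
    using result_bounds[where l=l and q=q and Y="table_row M base n" and m=m and j=j and i=i] l le_P P10 by linarith+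
  show ?found
  proof -
    have body: "evaluates w M (B + 3) (insert (B + 1) A) (\<rho>(B + 1 := i)) (Cond (result_expr (B + 1))
      (Var 14 \<oplus> Num 3 \<otimes> Var 10 \<oplus> Num 1) (Num 1) (Num 0)) (of_bool (?R i < ?h)) (?c + 9 + 1 + 1 + 1)"
      if i: "0 \<le> i" "i < int (N + T)" for i
      by (rule evaluates_weaken[OF evaluates_Cond[OF res(1)[OF i] res(2)[OF i] evaluates_Num evaluates_Num]])
        (use one in auto)
    have "(\<Sum>i\<in>{0..<int (N + T)}. of_bool (?R i < ?h)) \<in> words w"
      using sum_of_bool_bounds[of "int (N + T)" 0 "N + T" "\<lambda>i. ?R i < ?h"] le_P P10
      by (intro small_wordsI) linarith
    then have "evaluates w M B A \<rho> found_expr (\<Sum>i\<in>{0..<int (N + T)}. of_bool (?R i < ?h))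
       (1 + 5 + 2 + (N + T) * ((?c + 9 + 1 + 1 + 1) + 4))"
      unfolding found_expr_def
      by (intro evaluates_Total[OF evaluates_Num[OF zero_words] hi]) (use body in auto)
    then show ?thesis unfolding sum_of_bool_int
      by (rule evaluates_weaken) (auto simp: algebra_simps)
  qed
  show ?sum
  proof -
    have body: "evaluates w M (B + 3) (insert (B + 1) A) (\<rho>(B + 1 := i)) (Cond (result_expr (B + 1))
      (Var 14 \<oplus> Num 3 \<otimes> Var 10 \<oplus> Num 1) (result_expr (B + 1)) (Num 0))
      (if ?R i < ?h then ?R i else 0) (?c + 9 + ?c + 1 + 1)"
      if i: "0 \<le> i" "i < int (N + T)" for i
      by (rule evaluates_weaken[OF evaluates_Cond[OF res(1)[OF i] res(2)[OF i] res(1)[OF i] evaluates_Num]])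
        (use one in auto)
    have "(\<Sum>i\<in>{0..<int (N + T)}. if ?R i < ?h then ?R i else 0) \<le> of_nat (card {0..<int (N + T)}) * (8 * int P)"
      by (rule sum_bounded_above) (use R in auto)
    also have "\<dots> \<le> (2 * int P) * (8 * int P)"
      using le_P by (intro mult_right_mono) auto
    finally have "(\<Sum>i\<in>{0..<int (N + T)}. if ?R i < ?h then ?R i else 0) \<le> 16 * (int P * int P)" by simp
    moreover have "0 \<le> (\<Sum>i\<in>{0..<int (N + T)}. if ?R i < ?h then ?R i else 0)"
      by (rule sum_nonneg) (use R in auto)
    ultimately have "(\<Sum>i\<in>{0..<int (N + T)}. if ?R i < ?h then ?R i else 0) \<in> words w"
      by (intro wordsI) linarith
    then have "evaluates w M B A \<rho> sum_expr (\<Sum>i\<in>{0..<int (N + T)}. if ?R i < ?h then ?R i else 0)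
       (1 + 5 + 2 + (N + T) * ((?c + 9 + ?c + 1 + 1) + 4))"
      unfolding sum_expr_def
      by (intro evaluates_Total[OF evaluates_Num[OF zero_words] hi]) (use body R in auto)
    then show ?thesis
      by (rule evaluates_weaken) (auto simp: algebra_simps)
  qed
qed

end

section \<open>The table of traces\<close>

primrec block :: "com list \<Rightarrow> com" where
  "block [] = Skip"
| "block (c # cs) = Seq c (block cs)"

lemma runs_Nil: "runs w (block []) \<rho> M zs 0 \<rho> M zs"
  unfolding runs_def block.simps using exec_Skip by (metis order_refl)

lemma runs_Cons:
  assumes "runs w c \<rho> M zs b \<rho>1 M1 zs1" "runs w (block cs) \<rho>1 M1 zs1 b' \<rho>2 M2 zs2"
  shows "runs w (block (c # cs)) \<rho> M zs (b + b') \<rho>2 M2 zs2"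
  using runs_Seq[OF assms order_refl] by simp

definition copy_body :: com where
  "copy_body = block
     [store (Var 12 \<oplus> Var 20 \<otimes> Var 0 \<oplus> Var 22) (Mem (Var 21 \<oplus> Num 1 \<oplus> Var 22)),
      assign 22 (Var 22 \<oplus> Num 1)]"

text \<open>The input stores the given traces one behind the other, each preceded by its length.
  Rows of fixed stride make every cell of every trace accessible by one multiplication.\<close>

definition copy_loop :: com where
  "copy_loop = WhileLess 20 3 (block
     [assign 23 (Mem (Var 21)), assign 22 (Num 0), WhileLess 22 23 copy_body,
      assign 21 (Var 21 \<oplus> Var 23 \<oplus> Num 1), assign 20 (Var 20 \<oplus> Num 1)])"

definition draw_loop :: com where
  "draw_loop = WhileLess 20 24 (block
     [draw (Var 12 \<oplus> Var 20 \<otimes> Var 0), assign 20 (Var 20 \<oplus> Num 1)])"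

primrec put_rows :: "nat \<Rightarrow> nat \<Rightarrow> bits list \<Rightarrow> nat \<Rightarrow> (int \<Rightarrow> int) \<Rightarrow> int \<Rightarrow> int" where
  "put_rows base n Z 0 M = M"
| "put_rows base n Z (Suc i) M = write_bits (int base + int i * int n) (Z ! i) (put_rows base n Z i M)"

lemma put_rows_below: "a < int base \<Longrightarrow> put_rows base n Z i M a = M a"
proof (induction i)
  case (Suc i)
  have "0 \<le> int i * int n" by simp
  with Suc.prems have "\<not> int base + int i * int n \<le> a" by linarith
  with Suc show ?case by (simp add: write_bits_def)
qed simp

text \<open>Rows are written in increasing order and hold at most \<open>n\<close> cells, so a later
  row starts behind all earlier ones.\<close>

lemma put_rows_row:
  assumes "j < i" "t < length (Z ! j)" "\<And>j. j < i \<Longrightarrow> length (Z ! j) \<le> n"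
  shows "put_rows base n Z i M (int base + int j * int n + int t) = of_bool (Z ! j ! t)"
  using assms
proof (induction i)
  case (Suc i)
  show ?case
  proof (cases "j = i")
    case True
    then show ?thesis using Suc.prems by (simp add: write_bits_def)
  next
    case False
    then have "j < i" using Suc.prems by simp
    have "int (Suc j) * int n \<le> int i * int n" using \<open>j < i\<close> by (intro mult_right_mono) auto
    then have "int j * int n + int n \<le> int i * int n" by (simp add: algebra_simps)
    moreover have "t < n" using Suc.prems(2) Suc.prems(3)[of j] Suc.prems(1) by simp
    ultimately have "int base + int j * int n + int t < int base + int i * int n" by linarith
    then have "\<not> int base + int i * int n \<le> int base + int j * int n + int t" by linarith
    then show ?thesis using Suc \<open>j < i\<close> by (simp add: write_bits_def)
  qed
qed simp

lemma write_bits_words: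
  assumes "\<And>a. M a \<in> words w" "0 < w"
  shows "write_bits b z M a \<in> words w"
  using assms one_words[OF assms(2)] by (simp add: write_bits_def of_bool_def)

lemma put_rows_words: "(\<And>a. M a \<in> words w) \<Longrightarrow> 0 < w \<Longrightarrow> put_rows base n Z i M a \<in> words w"
  by (induction i arbitrary: a) (auto intro: write_bits_words)

lemma write_bits_take_Suc:
  assumes "t < length z"
  shows "(write_bits a (take t z) M)(a + int t := of_bool (z ! t)) = write_bits a (take (Suc t) z) M"
proof
  fix x
  show "((write_bits a (take t z) M)(a + int t := of_bool (z ! t))) x = write_bits a (take (Suc t) z) M x"
    using assms by (cases "x = a + int t") (auto simp: write_bits_def)
qed

context word_ram
begin

lemma address_words:
  assumes "0 \<le> i" "i \<le> 2 * int P"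
  shows "int base + i * int n \<in> words w" "i * int n \<in> words w" "int base \<in> words w"
    "0 \<le> t \<Longrightarrow> t \<le> 5 * int P \<Longrightarrow> int base + i * int n + t \<in> words w"
proof -
  have pos: "0 \<le> i * int n" using assms by simp
  have le: "i * int n \<le> 2 * (int P * int P)"
    using mult_mono[of i "2 * int P" "int n" "int P"] assms le_P by simp
  show "int base + i * int n \<in> words w" "i * int n \<in> words w" "int base \<in> words w"
    by (rule wordsI, use pos le base_le in linarith)+
  show "0 \<le> t \<Longrightarrow> t \<le> 5 * int P \<Longrightarrow> int base + i * int n + t \<in> words w"
    by (rule wordsI) (use pos le base_le PP in linarith)
qed

text \<open>The cells read lie below \<open>base\<close> and the cells written do not, hence the
  copy never destroys what it still has to read.\<close>

lemma runs_copy_row: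
  assumes \<rho>: "\<rho> 0 = int n" "\<rho> 12 = int base" "\<rho> 20 = int i" "\<rho> 21 = p" "\<rho> 23 = int (length z)"
    and i: "i \<le> P" "length z \<le> n" "0 \<le> p" "p + int (length z) < int base"
    and z: "\<And>t. t < length z \<Longrightarrow> M (p + 1 + int t) = of_bool (z ! t)"
    and M: "\<And>a. M a \<in> words w"
  shows "runs w (WhileLess 22 23 copy_body) (\<rho>(22 := 0)) M zs (1 + n * 40)
     (\<rho>(22 := int (length z))) (write_bits (int base + int i * int n) z M) zs"
proof -
  define a where "a = int base + int i * int n"
  let ?\<rho> = "\<lambda>t. \<rho>(22 := int t)" and ?M = "\<lambda>t. write_bits a (take t z) M"
  have "runs w (WhileLess 22 23 copy_body) (?\<rho> 0) (?M 0) zs (1 + length z * (39 + 1))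
      (?\<rho> (length z)) (?M (length z)) zs"
  proof (rule runs_WhileLess[where \<rho> = ?\<rho> and M = ?M and zs = "\<lambda>_. zs"])
    fix t assume t: "t < length z"
    have W: "int base + int i * int n \<in> words w" "int i * int n \<in> words w" "int base \<in> words w"
      "int base + int i * int n + int t \<in> words w"
      using address_words(1-3)[where i = "int i"] address_words(4)[where i = "int i" and t = "int t"] i t le_P by auto
    have W2: "int i \<in> words w" "int t \<in> words w" "int n \<in> words w" "1 \<in> words w" "int t + 1 \<in> words w"
      by (rule small_wordsI, use i t le_P P10' in linarith)+
    have W3: "p \<in> words w" "p + 1 \<in> words w" "p + 1 + int t \<in> words w"
      by (rule wordsI, use i t le_P PP base_le in linarith)+
    have 1: "evaluates w (?M t) 40 {..<40} (?\<rho> t) (Var 12 \<oplus> Var 20 \<otimes> Var 0 \<oplus> Var 22)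
        (a + int t) 11"
      using W W2 \<rho> by (simp add: evaluates_def a_def)
    have "0 \<le> int i * int n" by simp
    then have "p + 1 + int t < a" using i t unfolding a_def by linarith
    then have "?M t (p + 1 + int t) = M (p + 1 + int t)"
      by (simp add: write_bits_def)
    then have rd: "?M t (p + 1 + int t) = of_bool (z ! t)" using z[OF t] by simp
    have "?M t (p + 1 + int t) \<in> words w" by (rule write_bits_words[OF M w])
    then have 2: "evaluates w (?M t) 41 {..<40} (?\<rho> t) (Mem (Var 21 \<oplus> Num 1 \<oplus> Var 22))
        (of_bool (z ! t)) 10"
      using W2 W3 \<rho> rd by (simp add: evaluates_def)
    have 3: "evaluates w (?M (Suc t)) 40 {..<40} (?\<rho> t) (Var 22 \<oplus> Num 1) (int t + 1) 4"
      using W2 by (simp add: evaluates_def)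
    have s: "runs w (store (Var 12 \<oplus> Var 20 \<otimes> Var 0 \<oplus> Var 22) (Mem (Var 21 \<oplus> Num 1 \<oplus> Var 22)))
       (?\<rho> t) (?M t) zs (11 + 10 + 1) (?\<rho> t) (?M (Suc t)) zs"
      using runs_store[OF 1 2 w] write_bits_take_Suc[OF t] by simp
    have eq: "(?\<rho> t)(22 := int t + 1) = ?\<rho> (Suc t)" by (rule ext) simp
    from runs_Cons[OF s runs_Cons[OF runs_assign[OF 3 _ w] runs_Nil], of 22, unfolded eq]
    have "runs w copy_body (?\<rho> t) (?M t) zs (11 + 10 + 1 + (4 + 2 + 0)) (?\<rho> (Suc t)) (?M (Suc t)) zs"
      unfolding copy_body_def by simp
    then show "runs w copy_body (?\<rho> t) (?M t) zs 39 (?\<rho> (Suc t)) (?M (Suc t)) zs"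
      by (rule runs_weaken) simp
  qed (use \<rho> in auto)
  moreover have "?M 0 = M" by (auto simp: write_bits_def)
  ultimately show ?thesis
    using runs_weaken i(2) unfolding a_def[symmetric] by auto
qed

lemma runs_copy:
  assumes \<rho>: "\<rho> 0 = int n" "\<rho> 3 = int N" "\<rho> 12 = int base"
    and Z: "\<And>i. i < N \<Longrightarrow> length (Z ! i) \<le> n"
    and p: "\<And>i. i < N \<Longrightarrow> p (Suc i) = p i + int (length (Z ! i)) + 1" "0 \<le> p 0" "p N \<le> int base"
    and z: "\<And>i. i < N \<Longrightarrow> M (p i) = int (length (Z ! i))"
      "\<And>i t. i < N \<Longrightarrow> t < length (Z ! i) \<Longrightarrow> M (p i + 1 + int t) = of_bool (Z ! i ! t)"
    and M: "\<And>a. M a \<in> words w"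
  shows "\<exists>x. runs w copy_loop (\<rho>(20 := 0, 21 := p 0, 22 := 0, 23 := 0)) M zs (1 + N * (n * 40 + 40))
     (\<rho>(20 := int N, 21 := p N, 22 := x, 23 := x)) (put_rows base n Z N M) zs"
proof -
  \<comment> \<open>Between rounds, registers 22 and 23 still hold the length of the preceding row;
    0 is their value before the first round.\<close>
  define x where "x i = (case i of 0 \<Rightarrow> 0 | Suc j \<Rightarrow> int (length (Z ! j)))" for i
  let ?\<rho> = "\<lambda>i. \<rho>(20 := int i, 21 := p i, 22 := x i, 23 := x i)"
  let ?M = "\<lambda>i. put_rows base n Z i M"
  have mono: "p 0 \<le> p i \<and> p i \<le> p N" if "i \<le> N" for i
  proof
    show "p 0 \<le> p i" using that by (induction i) (use p in auto)
    show "p i \<le> p N" using that by (induction rule: inc_induct) (use p in auto)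
  qed
  have "runs w copy_loop (?\<rho> 0) (?M 0) zs (1 + N * (n * 40 + 39 + 1)) (?\<rho> N) (?M N) zs"
    unfolding copy_loop_def
  proof (rule runs_WhileLess[where \<rho> = ?\<rho> and M = ?M and zs = "\<lambda>_. zs"])
    fix i assume i: "i < N"
    let ?z = "Z ! i"
    have p0: "0 \<le> p i" "p (Suc i) \<le> int base" using mono[of i] mono[of "Suc i"] i p(2,3) by auto
    then have p1: "p i + int (length ?z) < int base" using p(1)[OF i] by simp
    have ii: "i \<le> P" using i le_P by simp
    have W: "p i \<in> words w" "p i + int (length ?z) \<in> words w" "p i + int (length ?z) + 1 \<in> words w"
      by (rule wordsI, use p0 p1 base_le in linarith)+
    have W2: "int i \<in> words w" "1 \<in> words w" "int i + 1 \<in> words w" "int (length ?z) \<in> words w"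
      by (rule small_wordsI, use i Z[OF i] le_P P10' in linarith)+
    have Mi: "?M i a \<in> words w" for a by (rule put_rows_words[OF M w])
    have rd: "?M i (p i) = int (length ?z)"
      using put_rows_below[of "p i" base n Z i M] z(1)[OF i] p1 by simp
    have rdt: "?M i (p i + 1 + int t) = of_bool (?z ! t)" if "t < length ?z" for t
      using put_rows_below[of "p i + 1 + int t" base n Z i M] z(2)[OF i that] p1 that by simp
    let ?r1 = "(?\<rho> i)(23 := int (length ?z))"
    have 1: "evaluates w (?M i) 40 {..<40} (?\<rho> i) (Mem (Var 21)) (int (length ?z)) 3"
      using W W2 rd by (simp add: evaluates_def)
    have 2: "evaluates w (?M i) 40 {..<40} ?r1 (Num 0) 0 1" by (simp add: evaluates_def)
    have 3: "runs w (WhileLess 22 23 copy_body) (?r1(22 := 0)) (?M i) zs (1 + n * 40)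
       (?r1(22 := int (length ?z))) (?M (Suc i)) zs"
      unfolding put_rows.simps
      by (rule runs_copy_row[where p = "p i"]) (use \<rho> ii Z[OF i] p0 p1 rdt Mi in auto)
    let ?r3 = "?r1(22 := int (length ?z))"
    have 4: "evaluates w (?M (Suc i)) 40 {..<40} ?r3 (Var 21 \<oplus> Var 23 \<oplus> Num 1) (p (Suc i)) 7"
      using W W2 p(1)[OF i] by (simp add: evaluates_def)
    have 5: "evaluates w (?M (Suc i)) 40 {..<40} (?r3(21 := p (Suc i))) (Var 20 \<oplus> Num 1) (int i + 1) 4"
      using W2 by (simp add: evaluates_def)
    have eq: "?r3(21 := p (Suc i), 20 := int i + 1) = ?\<rho> (Suc i)"
      by (rule ext) (simp add: x_def)
    note c = runs_Cons[OF runs_assign[OF 1 _ w] runs_Cons[OF runs_assign[OF 2 _ w] runs_Cons[OF 3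
          runs_Cons[OF runs_assign[OF 4 _ w] runs_Cons[OF runs_assign[OF 5 _ w] runs_Nil]]]], of 20]
    from c[unfolded eq] show "runs w (block
     [assign 23 (Mem (Var 21)), assign 22 (Num 0), WhileLess 22 23 copy_body,
      assign 21 (Var 21 \<oplus> Var 23 \<oplus> Num 1), assign 20 (Var 20 \<oplus> Num 1)])
        (?\<rho> i) (?M i) zs (n * 40 + 39) (?\<rho> (Suc i)) (?M (Suc i)) zs"
      by - (rule runs_weaken, auto)
  qed (use \<rho> in auto)
  moreover have "?\<rho> 0 = \<rho>(20 := 0, 21 := p 0, 22 := 0, 23 := 0)" by (simp add: x_def)
  ultimately show ?thesis by (intro exI[of _ "x N"]) (simp add: algebra_simps)
qed

lemma runs_draw_loop:
  assumes \<rho>: "\<rho> 0 = int n" "\<rho> 12 = int base" "\<rho> 24 = int N + int T"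
    and Z: "length ys = N" "length zs = T" "\<And>z. z \<in> set zs \<Longrightarrow> length z \<le> n"
  shows "runs w draw_loop (\<rho>(20 := int N)) (put_rows base n (ys @ zs) N M) zs (1 + T * (n + 30))
     (\<rho>(20 := int N + int T)) (put_rows base n (ys @ zs) (N + T) M) []"
proof -
  let ?\<rho> = "\<lambda>i. \<rho>(20 := int (N + i))" and ?M = "\<lambda>i. put_rows base n (ys @ zs) (N + i) M"
  have "runs w draw_loop (?\<rho> 0) (?M 0) (drop 0 zs) (1 + T * (n + 29 + 1)) (?\<rho> T) (?M T) (drop T zs)"
    unfolding draw_loop_def
  proof (rule runs_WhileLess[where \<rho> = ?\<rho> and M = ?M and zs = "\<lambda>i. drop i zs"])
    fix i assume i: "i < T"
    have W: "int base + int (N + i) * int n \<in> words w" "int (N + i) * int n \<in> words w" "int base \<in> words w"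
      using address_words[of "int (N + i)"] i le_P by auto
    have W2: "int (N + i) \<in> words w" "1 \<in> words w" "int (N + i) + 1 \<in> words w" "int n \<in> words w"
      by (rule small_wordsI, use i le_P P10' in linarith)+
    have 1: "evaluates w (?M i) 40 {..<40} (?\<rho> i) (Var 12 \<oplus> Var 20 \<otimes> Var 0)
        (int base + int (N + i) * int n) 8"
      using W W2 \<rho> by (simp add: evaluates_def del: of_nat_add)
    have dr: "drop i zs = zs ! i # drop (Suc i) zs" using i Z by (simp add: Cons_nth_drop_Suc)
    have M: "?M (Suc i) = write_bits (int base + int (N + i) * int n) (zs ! i) (?M i)"
      using Z by (simp add: nth_append del: of_nat_add)
    have 2: "evaluates w (?M (Suc i)) 40 {..<40} (?\<rho> i) (Var 20 \<oplus> Num 1) (int (N + i) + 1) 4"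
      using W2 by (simp add: evaluates_def del: of_nat_add)
    have eq: "(?\<rho> i)(20 := int (N + i) + 1) = ?\<rho> (Suc i)" by (rule ext) simp
    have "runs w (draw (Var 12 \<oplus> Var 20 \<otimes> Var 0)) (?\<rho> i) (?M i) (drop i zs) (8 + 1 + length (zs ! i))
        (?\<rho> i) (?M (Suc i)) (drop (Suc i) zs)"
      unfolding dr M by (rule runs_draw[OF 1 w])
    from runs_Cons[OF this runs_Cons[OF runs_assign[OF 2 _ w] runs_Nil], of 20, unfolded eq]
    have "runs w (block [draw (Var 12 \<oplus> Var 20 \<otimes> Var 0), assign 20 (Var 20 \<oplus> Num 1)])
      (?\<rho> i) (?M i) (drop i zs) (8 + 1 + length (zs ! i) + (4 + 2 + 0)) (?\<rho> (Suc i)) (?M (Suc i)) (drop (Suc i) zs)"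
      by simp
    moreover have "length (zs ! i) \<le> n" using Z i by simp
    ultimately show "runs w (block [draw (Var 12 \<oplus> Var 20 \<otimes> Var 0), assign 20 (Var 20 \<oplus> Num 1)])
      (?\<rho> i) (?M i) (drop i zs) (n + 29) (?\<rho> (Suc i)) (?M (Suc i)) (drop (Suc i) zs)"
      by (elim runs_weaken) simp
  qed (use \<rho> in auto)
  moreover have "n + 29 + 1 = n + 30" by simp
  ultimately show ?thesis using Z by (simp del: One_nat_def plus_1_eq_Suc)
qed

end

subsection \<open>The parameters\<close>

text \<open>The least \<open>j\<close> with n < (j + 1)^3 is the cube root rounded down. A linear
  search is cheap enough here.\<close>

definition cbrt_expr :: expr where
  "cbrt_expr = First (Num 0) (Var 0) (\<lambda>j. Cond (Var 0)
     ((Var j \<oplus> Num 1) \<otimes> (Var j \<oplus> Num 1) \<otimes> (Var j \<oplus> Num 1)) (Num 1) (Num 0))"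

text \<open>The test amounts to v \<le> j^2, so this is the square root rounded up.\<close>

definition sqrt_expr :: expr where
  "sqrt_expr = First (Num 0) (Var 0) (\<lambda>j. Cond (Var 9) (Var j \<otimes> Var j \<oplus> Num 1) (Num 1) (Num 0))"

text \<open>Four cells of header and the length of \<open>u\<close> precede its bits, which
  therefore start at address 5. The least period of the last \<open>2 * m + 1\<close> bits of
  \<open>u\<close> is all that is needed of the pattern of the desert.\<close>

definition period_expr :: expr where
  "period_expr = First (Num 1) (Num 2 \<otimes> Var 6 \<oplus> Num 1)
     (\<lambda>k. Cond (Total (Num 0) (Num 2 \<otimes> Var 6 \<oplus> Num 1 \<ominus> Var k)
       (\<lambda>t. neq_expr (Mem (Num 5 \<oplus> Var 2 \<ominus> Var 6 \<oplus> Var t))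
          (Mem (Num 5 \<oplus> Var 2 \<ominus> Var 6 \<oplus> Var t \<oplus> Var k)))) (Num 1) (Num 1) (Num 0))"

definition doubling :: com where
  "doubling = block [assign 4 (Var 4 \<oplus> Var 4), assign 5 (Var 5 \<oplus> Num 1)]"

text \<open>A word has ten times as many bits as \<open>P\<close>, and the deletion rate arrives
  with denominator P^10. Cut down to denominator P^3 it is still precise enough, as the error
  accumulated over \<open>n\<close> positions is of order 1/P^2, while the products in the final
  quotient stay below P^9. The table begins at 8 P^2, behind the input.\<close>

locale find_end_scalars = word_ram w n m k q N T base P for w n m k q N T base P +
  fixes L r v s :: nat and dw d3 :: int and M :: "int \<Rightarrow> int"
  assumes word: "2 ^ w = int P ^ 10" and P: "P = 2 ^ L" and L: "\<And>i. i < L \<Longrightarrow> 2 ^ i < n" and L_le: "L \<le> n"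
    and dw: "0 \<le> dw" "dw < 2 ^ w" and d3: "d3 = dw div int P ^ 7"
    and v: "int v = (int n * int L * int L * d3) div int P ^ 3" "v \<le> P"
    and s: "int s = first_from 0 (int n) (\<lambda>j. int v < j * j + 1)" and q: "q = 2 * (5 * s + 10)"
    and T: "T = v * L * L" and base: "base = 8 * P * P"
    and m: "int m = first_from 0 (int n) (\<lambda>j. int n < (j + 1) * (j + 1) * (j + 1))"
    and r: "r \<le> n" and qP: "3 * q + 5 \<le> P"
    and k: "int k = first_from 1 (2 * int m + 1)
       (\<lambda>k. \<forall>t\<in>{0..<2 * int m + 1 - k}. M (5 + int r - int m + t) = M (5 + int r - int m + t + k))"
    and M: "\<And>a. M a \<in> words w" "M 0 = int n" "M 1 = dw" "M 2 = int r" "M 3 = int N"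
begin

lemma bigI: "\<bar>x\<bar> \<le> int P ^ 9 \<Longrightarrow> x \<in> words w"
proof -
  assume "\<bar>x\<bar> \<le> int P ^ 9"
  moreover have "int P ^ 9 < int P ^ 10" using P10 by (intro power_strict_increasing) auto
  ultimately have "- (2 ^ w) \<le> x" "x < 2 ^ w" unfolding word by linarith+
  then show ?thesis by (simp add: words_def)
qed

lemma pow_bound: "a \<le> 9 \<Longrightarrow> 0 \<le> x \<Longrightarrow> x \<le> int P ^ a \<Longrightarrow> x \<in> words w"
proof (rule bigI)
  assume "a \<le> 9" "0 \<le> x" "x \<le> int P ^ a"
  moreover have "int P ^ a \<le> int P ^ 9" using P10 \<open>a \<le> 9\<close> by (intro power_increasing) auto
  ultimately show "\<bar>x\<bar> \<le> int P ^ 9" by linarith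
qed

text \<open>Ranges are tracked as powers of \<open>P\<close>, so a product is checked by adding
  exponents.\<close>

lemma mult_pow: "0 \<le> x \<Longrightarrow> x \<le> int P ^ a \<Longrightarrow> 0 \<le> y \<Longrightarrow> y \<le> int P ^ b \<Longrightarrow> x * y \<le> int P ^ (a + b)"
  unfolding power_add by (intro mult_mono) auto

lemma d3_bounds: "0 \<le> d3" "d3 \<le> int P ^ 3"
proof -
  show "0 \<le> d3" using dw P10 unfolding d3 by (intro pos_imp_zdiv_nonneg_iff[THEN iffD2]) auto
  have "int P ^ 10 = int P ^ 3 * int P ^ 7" by (simp flip: power_add)
  then have "dw < int P ^ 3 * int P ^ 7" using dw word by simp
  moreover have "0 < int P ^ 7" using P10 by simp
  moreover have "dw div int P ^ 7 * int P ^ 7 \<le> dw"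
  proof -
    have "0 \<le> dw mod int P ^ 7" using P10 by (intro pos_mod_sign) simp
    then show ?thesis using div_mult_mod_eq[of dw "int P ^ 7"] by linarith
  qed
  ultimately have "d3 * int P ^ 7 < int P ^ 3 * int P ^ 7" unfolding d3 by linarith
  then have "d3 < int P ^ 3" by (rule mult_right_less_imp_less) simp
  then show "d3 \<le> int P ^ 3" by simp
qed

text \<open>Location \<open>r\<close> is mapped to about \<open>(1 - \<delta>) * r\<close>. The
  margin ensures that the source of an accepted location lies behind \<open>r\<close>, where the
  period is known, and that the interval of radius \<open>3 * q\<close> around it is
  nonnegative.\<close>

definition start :: int where
  "start = (int r * (int P ^ 3 - d3)) div int P ^ 3 + 3 * int q + 5"

text \<open>A trace location never exceeds its source, so the image of the end is at most
  \<open>3 * n div 4\<close>; the 1 accounts for the exclusive upper bound of the search.\<close>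

definition limit :: int where
  "limit = 3 * int n div 4 + 1"

lemma start_bounds: "3 * int q + 5 \<le> start" "start \<le> 4 * int P"
proof -
  have pos: "0 < int P ^ 3" using P10 by simp
  have "0 \<le> int r * (int P ^ 3 - d3)" using d3_bounds by simp
  then show "3 * int q + 5 \<le> start" using pos by (simp add: start_def pos_imp_zdiv_nonneg_iff)
  have "int r * (int P ^ 3 - d3) \<le> int r * int P ^ 3" using d3_bounds by (intro mult_left_mono) auto
  then have "(int r * (int P ^ 3 - d3)) div int P ^ 3 \<le> (int r * int P ^ 3) div int P ^ 3"
    using pos by (intro zdiv_mono1) auto
  then have "(int r * (int P ^ 3 - d3)) div int P ^ 3 \<le> int r" using pos by simp
  then show "start \<le> 4 * int P" using r le_P qP unfolding start_def by linarith
qed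

lemma limit_bounds: "0 \<le> limit" "limit \<le> int n + 1"
  unfolding limit_def by linarith+

definition regs_in :: "reg \<Rightarrow> int" where
  "regs_in = (\<lambda>_. 0)(0 := int n, 1 := dw, 2 := int r, 3 := int N)"

definition scalars :: "reg \<Rightarrow> int" where
  "scalars = regs_in(4 := int P, 5 := int L, 6 := int m, 7 := int P ^ 3, 8 := d3, 9 := int v,
     10 := int q, 11 := int T, 12 := int base, 13 := int k, 18 := start, 19 := limit)"

lemma evaluates_cbrt:
  assumes "\<rho> 0 = int n"
  shows "evaluates w M 40 {..<40} \<rho> cbrt_expr (int m) (n * 30 + 10)"
proof -
  have one: "1 \<in> words w" by (rule one_words[OF w])
  have nw: "int n \<in> words w" by (rule small_wordsI) (use le_P P10' in linarith)
  have body: "evaluates w M (40 + 2) (insert 40 {..<40}) (\<rho>(40 := j)) (Cond (Var 0)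
     ((Var 40 \<oplus> Num 1) \<otimes> (Var 40 \<oplus> Num 1) \<otimes> (Var 40 \<oplus> Num 1)) (Num 1) (Num 0))
     (of_bool (int n < (j + 1) * (j + 1) * (j + 1))) 25" if j: "0 \<le> j" "j < int n" for j
  proof -
    have j1: "0 \<le> j + 1" "j + 1 \<le> int P ^ 1" using j le_P by auto
    have j2: "(j + 1) * (j + 1) \<le> int P ^ 2" "0 \<le> (j + 1) * (j + 1)"
      using mult_pow[OF j1 j1] j1 by (auto simp: numeral_2_eq_2)
    have j3: "(j + 1) * (j + 1) * (j + 1) \<le> int P ^ 3" "0 \<le> (j + 1) * (j + 1) * (j + 1)"
      using mult_pow[OF j2(2,1) j1] j1 j2 by auto
    have "j \<in> words w" by (rule small_wordsI) (use j le_P P10' in linarith)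
    moreover have "j + 1 \<in> words w" "(j + 1) * (j + 1) \<in> words w" "(j + 1) * (j + 1) * (j + 1) \<in> words w"
      using pow_bound[of 1 "j + 1"] pow_bound[of 2 "(j + 1) * (j + 1)"]
        pow_bound[of 3 "(j + 1) * (j + 1) * (j + 1)"] j1 j2 j3 by auto
    ultimately show ?thesis using assms nw one by (simp add: evaluates_def)
  qed
  have "evaluates w M 40 {..<40} \<rho> cbrt_expr
      (first_from 0 (int n) (\<lambda>j. int n < (j + 1) * (j + 1) * (j + 1))) (1 + 2 + 1 + n * (25 + 5))"
    unfolding cbrt_expr_def
    by (rule evaluates_First[OF evaluates_Num[OF zero_words]])
      (use body nw assms in \<open>auto simp: evaluates_def\<close>)
  then show ?thesis unfolding m by (rule evaluates_weaken) simp_all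
qed

lemma evaluates_sqrt:
  assumes "\<rho> 0 = int n" "\<rho> 9 = int v" "42 \<le> B"
  shows "evaluates w M B {..<40} \<rho> sqrt_expr (int s) (n * 30 + 10)"
proof -
  have one: "1 \<in> words w" by (rule one_words[OF w])
  have nw: "int n \<in> words w" "int v \<in> words w" by (rule small_wordsI, use le_P v P10' in linarith)+
  have body: "evaluates w M (B + 2) (insert B {..<40}) (\<rho>(B := j)) (Cond (Var 9)
     (Var B \<otimes> Var B \<oplus> Num 1) (Num 1) (Num 0))
     (of_bool (int v < j * j + 1)) 20" if j: "0 \<le> j" "j < int n" for j
  proof -
    have j2: "j * j \<le> int P * int P" "0 \<le> j * j" using j le_P by (auto intro: mult_mono)
    have "j \<in> words w" by (rule small_wordsI) (use j le_P P10' in linarith)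
    moreover have "j * j \<in> words w" "j * j + 1 \<in> words w" by (rule wordsI, use j2 PP P10' in linarith)+
    ultimately show ?thesis using assms nw one by (simp add: evaluates_def)
  qed
  have "evaluates w M B {..<40} \<rho> sqrt_expr
      (first_from 0 (int n) (\<lambda>j. int v < j * j + 1)) (1 + 2 + 1 + n * (20 + 5))"
    unfolding sqrt_expr_def
    by (rule evaluates_First[OF evaluates_Num[OF zero_words]])
      (use body nw assms in \<open>auto simp: evaluates_def\<close>)
  then show ?thesis unfolding s by (rule evaluates_weaken) simp_all
qed

lemma evaluates_period:
  assumes "\<rho> 6 = int m" "\<rho> 2 = int r"
  shows "evaluates w M 40 {..<40} \<rho> period_expr (int k) (400 * (m + 1) * (m + 1))"
proof -
  have one: "1 \<in> words w" by (rule one_words[OF w])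
  have W: "int m \<in> words w" "2 \<in> words w" "2 * int m \<in> words w" "2 * int m + 1 \<in> words w" "5 \<in> words w"
      "int r \<in> words w" "5 + int r \<in> words w" "5 + int r - int m \<in> words w"
    by (rule small_wordsI, use le_P r P10' in linarith)+
  let ?Q = "\<lambda>k t. M (5 + int r - int m + t) \<noteq> M (5 + int r - int m + t + k)"
  have body: "evaluates w M (40 + 2) (insert 40 {..<40}) (\<rho>(40 := j))
     (Cond (Total (Num 0) (Num 2 \<otimes> Var 6 \<oplus> Num 1 \<ominus> Var 40)
       (\<lambda>t. neq_expr (Mem (Num 5 \<oplus> Var 2 \<ominus> Var 6 \<oplus> Var t))
          (Mem (Num 5 \<oplus> Var 2 \<ominus> Var 6 \<oplus> Var t \<oplus> Var 40)))) (Num 1) (Num 1) (Num 0))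
     (of_bool (\<forall>t\<in>{0..<2 * int m + 1 - j}. \<not> ?Q j t)) (170 * m + 20)"
    if j: "1 \<le> j" "j < 2 * int m + 1" for j
  proof -
    let ?A = "insert 40 {..<40}" and ?r = "\<rho>(40 := j)"
    have Wj: "j \<in> words w" "2 * int m + 1 - j \<in> words w"
      by (rule small_wordsI, use j le_P P10' in linarith)+
    have hi: "evaluates w M (42 + 2) ?A ?r (Num 2 \<otimes> Var 6 \<oplus> Num 1 \<ominus> Var 40) (2 * int m + 1 - j) 9"
      using W Wj assms one by (simp add: evaluates_def)
    have in1: "evaluates w M (42 + 3) (insert 43 ?A) (?r(43 := t)) (neq_expr
        (Mem (Num 5 \<oplus> Var 2 \<ominus> Var 6 \<oplus> Var 43)) (Mem (Num 5 \<oplus> Var 2 \<ominus> Var 6 \<oplus> Var 43 \<oplus> Var 40)))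
        (of_bool (?Q j t)) 65" if t: "0 \<le> t" "t < 2 * int m + 1 - j" for t
    proof -
      have Wt: "t \<in> words w" "5 + int r - int m + t \<in> words w" "5 + int r - int m + t + j \<in> words w"
        by (rule small_wordsI, use j t r le_P P10' in linarith)+
      have "evaluates w M B (insert 43 ?A) (?r(43 := t)) (Mem (Num 5 \<oplus> Var 2 \<ominus> Var 6 \<oplus> Var 43))
          (M (5 + int r - int m + t)) 15" for B
        using W Wt assms M(1) by (simp add: evaluates_def)
      moreover have "evaluates w M B (insert 43 ?A) (?r(43 := t))
          (Mem (Num 5 \<oplus> Var 2 \<ominus> Var 6 \<oplus> Var 43 \<oplus> Var 40)) (M (5 + int r - int m + t + j)) 15" for B
        using W Wt Wj assms M(1) by (simp add: evaluates_def)
      ultimately have "evaluates w M (42 + 3) (insert 43 ?A) (?r(43 := t)) (neq_expr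
        (Mem (Num 5 \<oplus> Var 2 \<ominus> Var 6 \<oplus> Var 43)) (Mem (Num 5 \<oplus> Var 2 \<ominus> Var 6 \<oplus> Var 43 \<oplus> Var 40)))
        (of_bool (?Q j t)) (4 * 15 + 5)" by (intro evaluates_neq w)
      then show ?thesis by simp
    qed
    have "(\<Sum>t\<in>{0..<2 * int m + 1 - j}. of_bool (?Q j t)) \<in> words w"
      using sum_of_bool_bounds[of "2 * int m + 1 - j" 0 "2 * m" "?Q j"] j le_P P10'
      by (intro small_wordsI) linarith
    then have "evaluates w M 42 ?A ?r (Total (Num 0) (Num 2 \<otimes> Var 6 \<oplus> Num 1 \<ominus> Var 40)
       (\<lambda>t. neq_expr (Mem (Num 5 \<oplus> Var 2 \<ominus> Var 6 \<oplus> Var t))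
          (Mem (Num 5 \<oplus> Var 2 \<ominus> Var 6 \<oplus> Var t \<oplus> Var 40))))
       (\<Sum>t\<in>{0..<2 * int m + 1 - j}. of_bool (?Q j t)) (1 + 9 + 2 + (2 * m) * (65 + 4))"
      by (intro evaluates_Total[OF evaluates_Num[OF zero_words] hi]) (use in1 j in auto)
    from evaluates_Cond[OF this evaluates_Num evaluates_Num evaluates_Num, OF one one zero_words]
    have "evaluates w M 42 ?A ?r (Cond (Total (Num 0) (Num 2 \<otimes> Var 6 \<oplus> Num 1 \<ominus> Var 40)
       (\<lambda>t. neq_expr (Mem (Num 5 \<oplus> Var 2 \<ominus> Var 6 \<oplus> Var t))
          (Mem (Num 5 \<oplus> Var 2 \<ominus> Var 6 \<oplus> Var t \<oplus> Var 40)))) (Num 1) (Num 1) (Num 0))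
       (of_bool (\<forall>t\<in>{0..<2 * int m + 1 - j}. \<not> ?Q j t)) (170 * m + 20)"
      unfolding sum_of_bool_less_1 by (rule evaluates_weaken) auto
    then show ?thesis by simp
  qed
  have "evaluates w M 40 {..<40} \<rho> period_expr (first_from 1 (2 * int m + 1)
      (\<lambda>j. \<forall>t\<in>{0..<2 * int m + 1 - j}. \<not> ?Q j t)) (1 + 6 + 1 + (2 * m) * (170 * m + 20 + 5))"
    unfolding period_expr_def
    by (rule evaluates_First[OF evaluates_Num[OF one]])
      (use body W one assms in \<open>auto simp: evaluates_def\<close>)
  then show ?thesis unfolding k by (rule evaluates_weaken) (auto simp: algebra_simps)
qed

lemma runs_doubling:
  "runs w (WhileLess 4 0 doubling) (regs_in(4 := 1, 5 := 0)) M zs (1 + L * 20)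
     (regs_in(4 := int P, 5 := int L)) M zs"
proof -
  let ?\<rho> = "\<lambda>i. regs_in(4 := 2 ^ i, 5 := int i)"
  have "runs w (WhileLess 4 0 doubling) (?\<rho> 0) M zs (1 + L * (19 + 1)) (?\<rho> L) M zs"
  proof (rule runs_WhileLess[where \<rho> = ?\<rho> and M = "\<lambda>_. M" and zs = "\<lambda>_. zs"])
    fix i assume i: "i < L"
    have le: "(2::int) ^ i \<le> int n" using L[OF i] by (simp flip: of_nat_power add: less_imp_le)
    have W: "2 ^ i \<in> words w" "2 ^ i + 2 ^ i \<in> words w" "int i \<in> words w" "int i + 1 \<in> words w" "1 \<in> words w"
      by (rule small_wordsI, use le zero_le_power[of "2::int" i] i L_le le_P P10' in linarith)+
    have 1: "evaluates w M 40 {..<40} (?\<rho> i) (Var 4 \<oplus> Var 4) (2 ^ i + 2 ^ i) 5"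
      using W by (simp add: evaluates_def)
    have 2: "evaluates w M 40 {..<40} ((?\<rho> i)(4 := 2 ^ i + 2 ^ i)) (Var 5 \<oplus> Num 1) (int i + 1) 4"
      using W by (simp add: evaluates_def)
    have eq: "(?\<rho> i)(4 := 2 ^ i + 2 ^ i, 5 := int i + 1) = ?\<rho> (Suc i)"
      by (rule ext) simp
    from runs_Cons[OF runs_assign[OF 1 _ w] runs_Cons[OF runs_assign[OF 2 _ w] runs_Nil], of 5, unfolded eq]
    show "runs w doubling (?\<rho> i) M zs 19 (?\<rho> (Suc i)) M zs"
      unfolding doubling_def by - (rule runs_weaken, auto)
    show "?\<rho> i 4 < ?\<rho> i 0" using L[OF i] by (simp add: regs_in_def flip: of_nat_power)
  next
    show "\<not> ?\<rho> L 4 < ?\<rho> L 0" using le_P P by (simp add: regs_in_def flip: of_nat_power)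
  qed auto
  then show ?thesis using P by simp
qed

end

section \<open>Setting up the parameters and the final quotient\<close>

definition prepare :: "com list" where
  "prepare =
     [assign 0 (Mem (Num 0)), assign 1 (Mem (Num 1)), assign 2 (Mem (Num 2)), assign 3 (Mem (Num 3)),
      assign 4 (Num 1), assign 5 (Num 0), WhileLess 4 0 doubling, assign 6 cbrt_expr,
      assign 7 (Var 4 \<otimes> Var 4 \<otimes> Var 4), assign 8 (Var 1 \<oslash> (Var 7 \<otimes> Var 7 \<otimes> Var 4)),
      assign 9 ((Var 0 \<otimes> Var 5 \<otimes> Var 5 \<otimes> Var 8) \<oslash> Var 7),
      assign 10 (Num 2 \<otimes> (Num 5 \<otimes> sqrt_expr \<oplus> Num 10)), assign 11 (Var 9 \<otimes> Var 5 \<otimes> Var 5),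
      assign 12 (Num 8 \<otimes> Var 4 \<otimes> Var 4), assign 13 period_expr,
      assign 18 ((Var 2 \<otimes> (Var 7 \<ominus> Var 8)) \<oslash> Var 7 \<oplus> Num 3 \<otimes> Var 10 \<oplus> Num 5),
      assign 19 (Num 3 \<otimes> Var 0 \<oslash> Num 4 \<oplus> Num 1),
      assign 20 (Num 0), assign 21 (Mem (Num 4) \<oplus> Num 5), assign 22 (Num 0), assign 23 (Num 0)]"

definition estimate_expr :: expr where
  "estimate_expr = (Num 2 \<otimes> (Var 7 \<otimes> (Var 17 \<ominus> (Num 2 \<otimes> Var 6 \<ominus> Num 1) \<otimes> Var 16)) \<oplus> Var 16 \<otimes> (Var 7 \<ominus> Var 8))
     \<oslash> (Num 2 \<otimes> (Var 16 \<otimes> (Var 7 \<ominus> Var 8))) \<oplus> (Num 2 \<otimes> Var 6 \<ominus> Num 1)"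

definition write_loop :: com where
  "write_loop = WhileLess 20 3
     (block [store (Var 20 \<oplus> Num 1) (result_expr 20), assign 20 (Var 20 \<oplus> Num 1)])"

text \<open>With \<open>Z\<close> locations of sum \<open>S\<close> and rate d/D, this is (S/Z - (2m
  - 1)) / (1 - d/D) rounded to the nearest integer, plus 2m - 1. It inverts the map from the end to
  the mean location: the \<open>2 * m\<close> bits up to the end are read intact, and the bits
  before them shrink by the factor 1 - d/D. The rounding is done by adding half of the
  denominator.\<close>

definition estimate :: "int \<Rightarrow> int \<Rightarrow> int \<Rightarrow> int \<Rightarrow> int \<Rightarrow> int" where
  "estimate D d m Z S =
     (2 * (D * (S - (2 * m - 1) * Z)) + Z * (D - d)) div (2 * (Z * (D - d))) + (2 * m - 1)"

text \<open>This includes division by 0, which yields 0: no location need be found on an input for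
  which nothing is promised, and the quotient must still fit into a word.\<close>

lemma abs_div_le:
  fixes x y :: int
  assumes "0 \<le> y"
  shows "\<bar>x div y\<bar> \<le> \<bar>x\<bar>"
proof (cases "y = 0")
  case False
  then have y: "1 \<le> y" "0 < y" using assms by auto
  show ?thesis
  proof (cases "0 \<le> x")
    case True
    have "x div y \<le> x div 1" by (rule zdiv_mono2) (use True y in auto)
    moreover have "0 \<le> x div y" using True y by (simp add: pos_imp_zdiv_nonneg_iff)
    ultimately show ?thesis by simp
  next
    case x: False
    have "x div 1 \<le> x div y" by (rule zdiv_mono2_neg) (use x y in auto)
    moreover have "x div y < 0" using x y by (simp add: pos_imp_zdiv_neg_iff)
    ultimately show ?thesis by simp
  qed
qed simp

context find_end_scalars
begin

lemma bounds:
  shows "int n \<le> int P ^ 1" "int L \<le> int P ^ 1" "int v \<le> int P ^ 1" "int r \<le> int P ^ 1" "int P \<le> int P ^ 1"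
  using le_P L_le v r by auto

lemma runs_prepare:
  assumes M4: "M 4 = p" "0 \<le> p" "p \<le> 2 * int P"
  shows "runs w (block prepare) (\<lambda>_. 0) M zs (500 * (n + 1) + 400 * (m + 1) * (m + 1))
     (scalars(20 := 0, 21 := p + 5, 22 := 0, 23 := 0)) M zs"
proof -
  have one: "1 \<in> words w" by (rule one_words[OF w])
  let ?P3 = "int P ^ 3"
  have P3: "int P * int P * int P = ?P3" by (simp add: power3_eq_cube)
  have pos: "0 < ?P3" using P10 by simp
  have qs: "int q = 10 * int s + 20" using q by simp
  have W: "int n \<in> words w" "int L \<in> words w" "int m \<in> words w" "int v \<in> words w" "int q \<in> words w"
     "int T \<in> words w" "int r \<in> words w" "int N \<in> words w" "int P \<in> words w" "3 * int q \<in> words w"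
     "2 \<in> words w" "3 \<in> words w" "4 \<in> words w" "5 \<in> words w" "8 \<in> words w" "10 \<in> words w" "3 * int n \<in> words w"
     "3 * int n div 4 \<in> words w" "3 * int n div 4 + 1 \<in> words w" "p + 5 \<in> words w" "p \<in> words w" "int s \<in> words w"
     "5 * int s \<in> words w" "5 * int s + 10 \<in> words w" "start \<in> words w" "start - 5 \<in> words w"
     "8 * int P \<in> words w"
    by (rule small_wordsI, use le_P L_le v(2) r M4 qP qs start_bounds P10' in linarith)+
  have dww: "dw \<in> words w" using dw by (simp add: words_def)
  have P2w: "int P * int P \<in> words w" using pow_bound[of 2 "int P * int P"] by (simp add: power2_eq_square)
  have P3w: "?P3 \<in> words w" by (rule pow_bound[of 3]) auto
  have P6: "?P3 * ?P3 = int P ^ 6" "?P3 * ?P3 * int P = int P ^ 7"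
    by (simp_all flip: power_add power_Suc2)
  have P67: "int P ^ 6 \<in> words w" "int P ^ 7 \<in> words w" by (rule pow_bound[of 6] pow_bound[of 7]; simp)+
  have d3w: "d3 \<in> words w" "?P3 - d3 \<in> words w"
    using d3_bounds pow_bound[of 3 d3] pow_bound[of 3 "?P3 - d3"] by auto
  have nL: "int n * int L \<le> int P ^ 2" "0 \<le> int n * int L"
    using mult_pow[of "int n" 1 "int L" 1] bounds by (auto simp: numeral_2_eq_2)
  have nLL: "int n * int L * int L \<le> int P ^ 3" "0 \<le> int n * int L * int L"
    using mult_pow[of "int n * int L" 2 "int L" 1] nL bounds by auto
  have nLLd: "int n * int L * int L * d3 \<le> int P ^ 6" "0 \<le> int n * int L * int L * d3"
    using mult_pow[of "int n * int L * int L" 3 d3 3] nLL d3_bounds by auto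
  have vL: "int v * int L \<le> int P ^ 2" "0 \<le> int v * int L"
    using mult_pow[of "int v" 1 "int L" 1] bounds by (auto simp: numeral_2_eq_2)
  have rD: "int r * (?P3 - d3) \<le> int P ^ 4" "0 \<le> int r * (?P3 - d3)"
    using mult_pow[of "int r" 1 "?P3 - d3" 3] bounds d3_bounds by auto
  have W2: "int n * int L \<in> words w" "int n * int L * int L \<in> words w" "int n * int L * int L * d3 \<in> words w"
    "int v * int L \<in> words w" "int r * (?P3 - d3) \<in> words w"
    using nL nLL nLLd vL rD pow_bound[of 2] pow_bound[of 3] pow_bound[of 6] pow_bound[of 4] by auto
  have st: "start - 5 = (int r * (?P3 - d3)) div ?P3 + 3 * int q" by (simp add: start_def)
  have rq: "(int r * (?P3 - d3)) div ?P3 \<in> words w"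
    by (rule small_wordsI) (use start_bounds start_def le_P P10' in linarith)
  have qeq: "int q = 2 * (5 * int s + 10)" and Teq: "int T = int v * int L * int L"
    and beq: "int base = 8 * int P * int P" using q T base by simp_all
  have Tw: "int v * int L * int L \<in> words w" using W Teq by simp
  have bw: "8 * int P * int P \<in> words w" using pow_bound[of 3 "int base"] beq base_le P10
    by (intro wordsI) simp
  define r4 where "r4 = regs_in(4 := int P, 5 := int L)"
  define r6 where "r6 = r4(6 := int m)"
  define r7 where "r7 = r6(7 := ?P3)"
  define r8 where "r8 = r7(8 := d3)"
  define r9 where "r9 = r8(9 := int v)"
  define r10 where "r10 = r9(10 := int q)"
  define r11 where "r11 = r10(11 := int T)"
  define r12 where "r12 = r11(12 := int base)"
  define r13 where "r13 = r12(13 := int k)"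
  define r18 where "r18 = r13(18 := start)"
  note rs = r18_def r13_def r12_def r11_def r10_def r9_def r8_def r7_def r6_def r4_def regs_in_def
  have i0: "evaluates w M 40 {..<40} (\<lambda>_. 0) (Mem (Num 0)) (int n) 2"
    using W M by (simp add: evaluates_def)
  have i1: "evaluates w M 40 {..<40} ((\<lambda>_. 0)(0 := int n)) (Mem (Num 1)) dw 2"
    using one dww M by (simp add: evaluates_def)
  have i2: "evaluates w M 40 {..<40} ((\<lambda>_. 0)(0 := int n, 1 := dw)) (Mem (Num 2)) (int r) 2"
    using W M by (simp add: evaluates_def)
  have i3: "evaluates w M 40 {..<40} ((\<lambda>_. 0)(0 := int n, 1 := dw, 2 := int r)) (Mem (Num 3)) (int N) 2"
    using W M by (simp add: evaluates_def)
  have i4: "evaluates w M 40 {..<40} regs_in (Num 1) 1 1" using one by (simp add: evaluates_def)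
  have i5: "evaluates w M 40 {..<40} (regs_in(4 := 1)) (Num 0) 0 1" by (simp add: evaluates_def)
  have dbl: "runs w (WhileLess 4 0 doubling) (regs_in(4 := 1, 5 := 0)) M zs (1 + L * 20) r4 M zs"
    unfolding r4_def by (rule runs_doubling)
  have e6: "evaluates w M 40 {..<40} r4 cbrt_expr (int m) (n * 30 + 10)"
    by (rule evaluates_cbrt) (simp add: rs)
  have e7: "evaluates w M 40 {..<40} r6 (Var 4 \<otimes> Var 4 \<otimes> Var 4) ?P3 8"
    using W P2w P3w P3 by (simp add: evaluates_def rs)
  have e8: "evaluates w M 40 {..<40} r7 (Var 1 \<oslash> (Var 7 \<otimes> Var 7 \<otimes> Var 4)) d3 11"
    using W P3w P67 P6 dww d3w by (simp add: evaluates_def rs d3)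
  have e9: "evaluates w M 40 {..<40} r8 ((Var 0 \<otimes> Var 5 \<otimes> Var 5 \<otimes> Var 8) \<oslash> Var 7) (int v) 14"
    using W W2 P3w d3w v(1) by (simp add: evaluates_def rs)
  have "evaluates w M (Suc (Suc (Suc 40))) {..<40} r9 sqrt_expr (int s) (n * 30 + 10)"
    "evaluates w M (Suc (Suc 40)) {..<40} r9 sqrt_expr (int s) (n * 30 + 10)"
    by (rule evaluates_sqrt; simp add: rs)+
  then have e10: "evaluates w M 40 {..<40} r9 (Num 2 \<otimes> (Num 5 \<otimes> sqrt_expr \<oplus> Num 10)) (int q) (n * 30 + 20)"
    using W qeq by (simp add: evaluates_def)
  have e11: "evaluates w M 40 {..<40} r10 (Var 9 \<otimes> Var 5 \<otimes> Var 5) (int T) 8"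
    using W W2 Teq Tw by (simp add: evaluates_def rs)
  have e12: "evaluates w M 40 {..<40} r11 (Num 8 \<otimes> Var 4 \<otimes> Var 4) (int base) 8"
    using W bw beq by (simp add: evaluates_def rs)
  have e13: "evaluates w M 40 {..<40} r12 period_expr (int k) (400 * (m + 1) * (m + 1))"
    by (rule evaluates_period) (simp_all add: rs)
  have e18: "evaluates w M 40 {..<40} r13
      ((Var 2 \<otimes> (Var 7 \<ominus> Var 8)) \<oslash> Var 7 \<oplus> Num 3 \<otimes> Var 10 \<oplus> Num 5) start 20"
    using W W2 P3w d3w st rq by (simp add: evaluates_def rs start_def)
  have e19: "evaluates w M 40 {..<40} r18 (Num 3 \<otimes> Var 0 \<oslash> Num 4 \<oplus> Num 1) limit 9"
    using W one by (simp add: evaluates_def rs limit_def)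
  let ?s = "r18(19 := limit)"
  have e20: "evaluates w M 40 {..<40} ?s (Num 0) 0 1" by (simp add: evaluates_def)
  have e21: "evaluates w M 40 {..<40} (?s(20 := 0)) (Mem (Num 4) \<oplus> Num 5) (p + 5) 4"
    using W M4 by (simp add: evaluates_def)
  have e22: "evaluates w M 40 {..<40} (?s(20 := 0, 21 := p + 5)) (Num 0) 0 1" by (simp add: evaluates_def)
  have e23: "evaluates w M 40 {..<40} (?s(20 := 0, 21 := p + 5, 22 := 0)) (Num 0) 0 1"
    by (simp add: evaluates_def)
  have fin: "?s = scalars" by (simp add: rs scalars_def)
  note A = runs_assign[OF _ _ w]
  have c23: "runs w (block [assign 20 (Num 0), assign 21 (Mem (Num 4) \<oplus> Num 5), assign 22 (Num 0), assign 23 (Num 0)])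
      ?s M zs 15 (scalars(20 := 0, 21 := p + 5, 22 := 0, 23 := 0)) M zs"
    unfolding fin[symmetric]
    by (rule runs_weaken, rule runs_Cons[OF A[OF e20] runs_Cons[OF A[OF e21] runs_Cons[OF A[OF e22]
      runs_Cons[OF A[OF e23] runs_Nil]]]]) simp_all
  have r0: "regs_in = (\<lambda>_. 0)(0 := int n, 1 := dw, 2 := int r, 3 := int N)" by (simp add: regs_in_def)
  show ?thesis
    unfolding prepare_def
    by (rule runs_weaken, rule runs_Cons[OF A[OF i0]], simp, rule runs_Cons[OF A[OF i1]], simp,
        rule runs_Cons[OF A[OF i2]], simp, rule runs_Cons[OF A[OF i3]], simp, subst r0[symmetric],
        rule runs_Cons[OF A[OF i4]], simp, rule runs_Cons[OF A[OF i5]], simp, rule runs_Cons[OF dbl],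
        rule runs_Cons[OF A[OF e6]], simp, fold r6_def, rule runs_Cons[OF A[OF e7]], simp, fold r7_def,
        rule runs_Cons[OF A[OF e8]], simp, fold r8_def, rule runs_Cons[OF A[OF e9]], simp, fold r9_def,
        rule runs_Cons[OF A[OF e10]], simp, fold r10_def, rule runs_Cons[OF A[OF e11]], simp, fold r11_def,
        rule runs_Cons[OF A[OF e12]], simp, fold r12_def, rule runs_Cons[OF A[OF e13]], simp, fold r13_def,
        rule runs_Cons[OF A[OF e18]], simp, fold r18_def, rule runs_Cons[OF A[OF e19]], simp, rule c23)
      (use L_le in \<open>simp add: algebra_simps\<close>)
qed

end

section \<open>The whole program and its running time\<close>

definition find_end :: com where
  "find_end = block
     [block prepare, copy_loop, assign 24 (Var 3 \<oplus> Var 11), draw_loop, assign 14 search_expr,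
      assign 15 witness_expr, assign 16 found_expr, assign 17 sum_expr,
      store (Num 0) estimate_expr, assign 20 (Num 0), write_loop]"

text \<open>The dominant terms are the search with n * m * q * N^2 and the drawing with n * T. As
  \<open>q\<close> is about n^(1/3 - \<epsilon>/2) up to logarithms when deletions are frequent and
  bounded otherwise, both are below n^(5/3).\<close>

definition time_bound :: "nat \<Rightarrow> nat \<Rightarrow> nat \<Rightarrow> nat \<Rightarrow> nat \<Rightarrow> nat" where
  "time_bound n m q N T = 500 * (n + 1) + 400 * (m + 1) * (m + 1) + (1 + N * (n * 40 + 40)) +
     (1 + T * (n + 30)) + 1400 * (n + 2) * (m + 1) * (2 * q + 1) * (N + 1) * (N + 1) +
     1200 * (m + 1) * (6 * q + 1) * (N + T + 1) + 200"

definition found_count :: "(int \<Rightarrow> int \<Rightarrow> int) \<Rightarrow> nat \<Rightarrow> nat \<Rightarrow> int \<Rightarrow> int \<Rightarrow> nat \<Rightarrow> int" where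
  "found_count Y m q j l K = int (card {i\<in>{0..<int K}. result Y m q j l i < l + 3 * int q + 1})"

definition found_sum :: "(int \<Rightarrow> int \<Rightarrow> int) \<Rightarrow> nat \<Rightarrow> nat \<Rightarrow> int \<Rightarrow> int \<Rightarrow> nat \<Rightarrow> int" where
  "found_sum Y m q j l K = (\<Sum>i\<in>{0..<int K}.
     if result Y m q j l i < l + 3 * int q + 1 then result Y m q j l i else 0)"

context find_end_scalars
begin

lemma result_range:
  assumes "3 * int q + 5 \<le> l" "l \<le> 4 * int P"
  shows "0 \<le> result Y m q j l i" "result Y m q j l i \<le> 6 * int P"
  using result_bounds[where Y = Y and m = m and q = q and j = j and l = l and i = i] assms qP by linarith+

lemma found_count_bounds: "0 \<le> found_count Y m q j l K" "found_count Y m q j l K \<le> int K"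
proof -
  have "card {i\<in>{0..<int K}. result Y m q j l i < l + 3 * int q + 1} \<le> card {0..<int K}"
    by (rule card_mono) auto
  then show "found_count Y m q j l K \<le> int K" by (simp add: found_count_def)
qed (simp add: found_count_def)

lemma found_sum_bounds:
  assumes "3 * int q + 5 \<le> l" "l \<le> 4 * int P" "K \<le> 2 * P"
  shows "0 \<le> found_sum Y m q j l K" "found_sum Y m q j l K \<le> 12 * (int P * int P)"
proof -
  show "0 \<le> found_sum Y m q j l K" unfolding found_sum_def
    by (rule sum_nonneg) (use result_range[OF assms(1,2)] in auto)
  have "found_sum Y m q j l K \<le> of_nat (card {0..<int K}) * (6 * int P)" unfolding found_sum_def
    by (rule sum_bounded_above) (use result_range[OF assms(1,2)] in auto)
  also have "\<dots> \<le> (2 * int P) * (6 * int P)" using assms(3) by (intro mult_right_mono) auto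
  finally show "found_sum Y m q j l K \<le> 12 * (int P * int P)" by simp
qed

lemma evaluates_estimate:
  assumes \<rho>: "\<rho> 6 = int m" "\<rho> 7 = int P ^ 3" "\<rho> 8 = d3" "\<rho> 16 = Z" "\<rho> 17 = S"
    and Z: "0 \<le> Z" "Z \<le> 2 * int P" and S: "0 \<le> S" "S \<le> 12 * (int P * int P)"
  shows "evaluates w M' B {..<40} \<rho> estimate_expr (estimate (int P ^ 3) d3 (int m) Z S) 60"
proof -
  let ?D = "int P ^ 3" and ?u = "2 * int m - 1"
  have Pp: "10 \<le> int P" using P10 by simp
  have up: "\<bar>?u * Z\<bar> \<le> 6 * (int P * int P)"
  proof -
    have "\<bar>?u\<bar> * \<bar>Z\<bar> \<le> (3 * int P) * (2 * int P)" using Z le_P Pp by (intro mult_mono) auto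
    then show ?thesis by (simp add: abs_mult)
  qed
  then have in1: "\<bar>S - ?u * Z\<bar> \<le> 18 * (int P * int P)" using S by linarith
  have P4: "100 * (int P * int P) \<le> int P ^ 4"
    using mult_mono[of 100 "int P * int P" "int P * int P" "int P * int P"] mult_mono[of 10 "int P" 10 "int P"] Pp
    by (simp add: power4_eq_xxxx mult.assoc)
  have DS: "\<bar>?D * (S - ?u * Z)\<bar> \<le> int P ^ 7"
  proof -
    have "\<bar>?D * (S - ?u * Z)\<bar> \<le> ?D * int P ^ 4"
      unfolding abs_mult using in1 P4 by (intro mult_mono) auto
    then show ?thesis by (simp flip: power_add)
  qed
  have Dd: "0 \<le> ?D - d3" "?D - d3 \<le> ?D" using d3_bounds by auto
  have "2 * int P \<le> int P ^ 2" using Pp by (simp add: power2_eq_square)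
  then have ZD: "0 \<le> Z * (?D - d3)" "Z * (?D - d3) \<le> int P ^ 5"
    using mult_pow[of Z 2 "?D - d3" 3] Z Dd by auto
  have p57: "int P ^ 5 \<le> int P ^ 7" by (rule power_increasing) (use Pp in auto)
  have p8: "10 * int P ^ 7 \<le> int P ^ 8" using mult_right_mono[of 10 "int P" "int P ^ 7"] Pp
    by (simp flip: power_Suc)
  have p9: "10 * int P ^ 8 \<le> int P ^ 9" using mult_right_mono[of 10 "int P" "int P ^ 8"] Pp
    by (simp flip: power_Suc)
  have pos: "0 \<le> int P ^ 7" "0 \<le> int P ^ 8" by simp_all
  have P7: "int P \<le> int P ^ 7" using power_increasing[of 1 7 "int P"] Pp by simp
  have quo: "\<bar>(2 * (?D * (S - ?u * Z)) + Z * (?D - d3)) div (2 * (Z * (?D - d3)))\<bar> \<le> 3 * int P ^ 7"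
    by (rule order_trans[OF abs_div_le]) (use ZD DS p57 in linarith)+
  have W: "S \<in> words w" "Z \<in> words w" "?u * Z \<in> words w" "S - ?u * Z \<in> words w" "?u \<in> words w"
    "int m \<in> words w" "2 * int m \<in> words w" "2 \<in> words w" "1 \<in> words w"
    by (rule wordsI, use S Z up in1 le_P Pp PP in linarith)+
  have W2: "?D \<in> words w" "d3 \<in> words w" "?D - d3 \<in> words w"
    using d3_bounds pow_bound[of 3 d3] pow_bound[of 3 "?D - d3"] pow_bound[of 3 "?D"] by auto
  have W3: "?D * (S - ?u * Z) \<in> words w" "2 * (?D * (S - ?u * Z)) \<in> words w" "Z * (?D - d3) \<in> words w"
    "2 * (Z * (?D - d3)) \<in> words w" "2 * (?D * (S - ?u * Z)) + Z * (?D - d3) \<in> words w"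
    "(2 * (?D * (S - ?u * Z)) + Z * (?D - d3)) div (2 * (Z * (?D - d3))) \<in> words w"
    by (rule bigI, use DS ZD quo p57 p8 p9 pos P7 le_P in linarith)+
  have est: "estimate ?D d3 (int m) Z S \<in> words w"
  proof (rule bigI)
    have "\<bar>?u\<bar> \<le> 3 * int P ^ 7" using le_P(2) P7 Pp by linarith
    moreover have "\<bar>estimate ?D d3 (int m) Z S\<bar> \<le> 3 * int P ^ 7 + \<bar>?u\<bar>"
      unfolding estimate_def by (rule order_trans[OF abs_triangle_ineq add_right_mono[OF quo]])
    ultimately show "\<bar>estimate ?D d3 (int m) Z S\<bar> \<le> int P ^ 9" using p8 p9 pos by linarith
  qed
  show ?thesis using \<rho> W W2 W3 est by (simp add: evaluates_def estimate_expr_def estimate_def)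
qed

text \<open>The outputs are written while later ones are still to be computed, so each result is
  evaluated in the memory left by the preceding writes.\<close>

definition write_mem :: "int \<Rightarrow> int \<Rightarrow> (int \<Rightarrow> int) \<Rightarrow> nat \<Rightarrow> int \<Rightarrow> int" where
  "write_mem j l M0 i = rec_nat M0 (\<lambda>i M'. M'(int i + 1 := result (table_row M' base n) m q j l (int i))) i"

lemma write_mem_simps:
  "write_mem j l M0 0 = M0"
  "write_mem j l M0 (Suc i) = (write_mem j l M0 i)(int i + 1 := result (table_row (write_mem j l M0 i) base n) m q j l (int i))"
  by (simp_all add: write_mem_def)

lemma write_mem_above: "i \<le> N \<Longrightarrow> int N < a \<Longrightarrow> write_mem j l M0 i a = M0 a"
  by (induction i) (auto simp: write_mem_simps)

lemma write_mem_0: "write_mem j l M0 i 0 = M0 0"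
  by (induction i) (auto simp: write_mem_simps)

lemma write_mem_out:
  "i < K \<Longrightarrow> write_mem j l M0 K (int i + 1) = result (table_row (write_mem j l M0 i) base n) m q j l (int i)"
  by (induction K) (auto simp: write_mem_simps less_Suc_eq)

lemma runs_write_loop:
  assumes \<rho>: "res_env {..<40} \<rho> j l" "3 * int q + 5 \<le> l" and M0: "\<And>a. M0 a \<in> words w"
  shows "runs w write_loop (\<rho>(20 := 0)) M0 zs (1 + N * (250 * (m + 1) * (6 * q + 1) + 20))
     (\<rho>(20 := int N)) (write_mem j l M0 N) zs"
proof -
  let ?\<rho> = "\<lambda>i. \<rho>(20 := int i)" and ?M = "write_mem j l M0"
  have l: "l \<le> 4 * int P" using \<rho> by (simp add: res_env_def)
  have "runs w write_loop (?\<rho> 0) (?M 0) zs (1 + N * (250 * (m + 1) * (6 * q + 1) + 19 + 1)) (?\<rho> N) (?M N) zs"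
    unfolding write_loop_def
  proof (rule runs_WhileLess[where \<rho> = ?\<rho> and M = ?M and zs = "\<lambda>_. zs"])
    fix i assume i: "i < N"
    have Mi: "?M i a \<in> words w" for a
    proof (induction i arbitrary: a)
      case (Suc i)
      have "result (table_row (?M i) base n) m q j l (int i) \<in> words w"
        by (rule small_wordsI) (use result_range[OF \<rho>(2) l, where Y = "table_row (?M i) base n" and j = j and i = "int i"] in linarith)
      then show ?case using Suc by (simp add: write_mem_simps)
    qed (simp add: write_mem_simps M0)
    have W: "int i \<in> words w" "1 \<in> words w" "int i + 1 \<in> words w"
      by (rule small_wordsI, use i le_P P10' in linarith)+
    have re: "res_env {..<40} (?\<rho> i) j l" using \<rho>(1) by (simp add: res_env_def env_def)
    have ix: "idx {..<40} (?\<rho> i) 20" using i le_P by (simp add: idx_def)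
    have 1: "evaluates w (?M i) 40 {..<40} (?\<rho> i) (Var 20 \<oplus> Num 1) (int i + 1) 4"
      using W by (simp add: evaluates_def)
    have "evaluates w (?M i) 41 {..<40} (?\<rho> i) (result_expr 20)
       (result (table_row (?M i) base n) m q j l ((?\<rho> i) 20)) (250 * (m + 1) * (6 * q + 1))"
      by (rule evaluates_result[OF re ix _ _ Mi]) auto
    then have 2: "evaluates w (?M i) 41 {..<40} (?\<rho> i) (result_expr 20)
       (result (table_row (?M i) base n) m q j l (int i)) (250 * (m + 1) * (6 * q + 1))" by simp
    have 3: "evaluates w (?M (Suc i)) 40 {..<40} (?\<rho> i) (Var 20 \<oplus> Num 1) (int i + 1) 4"
      using W by (simp add: evaluates_def)
    have eq: "(?\<rho> i)(20 := int i + 1) = ?\<rho> (Suc i)" by (rule ext) simp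
    have s: "runs w (store (Var 20 \<oplus> Num 1) (result_expr 20)) (?\<rho> i) (?M i) zs
       (4 + 250 * (m + 1) * (6 * q + 1) + 1) (?\<rho> i) (?M (Suc i)) zs"
      using runs_store[OF 1 2 w] by (simp add: write_mem_simps)
    show "runs w (block [store (Var 20 \<oplus> Num 1) (result_expr 20), assign 20 (Var 20 \<oplus> Num 1)])
        (?\<rho> i) (?M i) zs (250 * (m + 1) * (6 * q + 1) + 19) (?\<rho> (Suc i)) (?M (Suc i)) zs"
      by (rule runs_weaken, rule runs_Cons[OF s runs_Cons[OF runs_assign[OF 3 _ w] runs_Nil], of 20, unfolded eq])
        simp_all
  qed (use \<rho> in \<open>auto simp: res_env_def env_def\<close>)
  then show ?thesis by (simp add: write_mem_simps add.assoc)
qed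

text \<open>\<open>Y' i\<close> is the table as it stands when output \<open>i\<close> is computed.
  The output cells lie below \<open>base\<close>, so it agrees with \<open>Y\<close> at nonnegative
  rows and positions; a negative position may point below \<open>base\<close>, and nothing is
  claimed there.\<close>

lemma runs_find_end:
  assumes M4: "M 4 = int (length u)" "length u \<le> 2 * P"
    and ys: "length ys = N" "\<And>y. y \<in> set ys \<Longrightarrow> length y \<le> n"
    and zs: "length zs = T" "\<And>z. z \<in> set zs \<Longrightarrow> length z \<le> n"
    and p: "\<And>i. i < N \<Longrightarrow> p (Suc i) = p i + int (length (ys ! i)) + 1" "p 0 = int (length u) + 5" "p N \<le> int base"
    and inp: "\<And>i. i < N \<Longrightarrow> M (p i) = int (length (ys ! i))"
      "\<And>i t. i < N \<Longrightarrow> t < length (ys ! i) \<Longrightarrow> M (p i + 1 + int t) = of_bool (ys ! i ! t)"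
    and Y: "Y = table_row (put_rows base n (ys @ zs) (N + T) M) base n"
    and l: "l = first_from start limit (\<lambda>l. \<exists>j\<in>{0..<int N}. accepted Y m k q N j l)"
    and j: "j = first_from 0 (int N) (\<lambda>j. accepted Y m k q N j l)"
  shows "\<exists>\<rho>' M' Y'. runs w find_end (\<lambda>_. 0) M zs (time_bound n m q N T) \<rho>' M' [] \<and>
     M' 0 = estimate (int P ^ 3) d3 (int m) (found_count Y m q j l (N + T)) (found_sum Y m q j l (N + T)) \<and>
     (\<forall>i<N. M' (int i + 1) = result (Y' i) m q j l (int i) \<and> (\<forall>a\<ge>0. \<forall>t\<ge>0. Y' i a t = Y a t))"
proof -
  let ?M2 = "put_rows base n (ys @ zs) (N + T) M"
  let ?Z = "found_count Y m q j l (N + T)" and ?S = "found_sum Y m q j l (N + T)"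
  have M2: "?M2 a \<in> words w" for a by (rule put_rows_words[OF M(1) w])
  have prep: "runs w (block prepare) (\<lambda>_. 0) M zs (500 * (n + 1) + 400 * (m + 1) * (m + 1))
     (scalars(20 := 0, 21 := p 0, 22 := 0, 23 := 0)) M zs"
    unfolding p(2) by (rule runs_prepare) (use M4 in auto)
  have "\<exists>x. runs w copy_loop (scalars(20 := 0, 21 := p 0, 22 := 0, 23 := 0)) M zs
     (1 + N * (n * 40 + 40)) (scalars(20 := int N, 21 := p N, 22 := x, 23 := x)) (put_rows base n (ys @ zs) N M) zs"
    by (rule runs_copy) (use p inp ys M(1) in \<open>auto simp: scalars_def regs_in_def nth_append\<close>)
  then obtain x where copy: "runs w copy_loop (scalars(20 := 0, 21 := p 0, 22 := 0, 23 := 0)) M zs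
     (1 + N * (n * 40 + 40)) (scalars(20 := int N, 21 := p N, 22 := x, 23 := x)) (put_rows base n (ys @ zs) N M) zs"
    by blast
  define r1 where "r1 = scalars(20 := int N, 21 := p N, 22 := x, 23 := x)"
  define r2 where "r2 = scalars(20 := int N, 21 := p N, 22 := x, 23 := x, 24 := int N + int T)"
  have N20: "r2(20 := int N) = r2" by (rule ext) (simp add: r2_def)
  have W: "int N \<in> words w" "int T \<in> words w" "int N + int T \<in> words w"
    by (rule small_wordsI, use le_P P10' in linarith)+
  let ?M1 = "put_rows base n (ys @ zs) N M"
  have e24: "evaluates w ?M1 40 {..<40} r1 (Var 3 \<oplus> Var 11) (int N + int T) 5"
    using W by (simp add: evaluates_def r1_def scalars_def regs_in_def)
  have r12: "r1(24 := int N + int T) = r2" by (simp add: r1_def r2_def)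
  have draws: "runs w draw_loop r2 ?M1 zs (1 + T * (n + 30)) (r2(20 := int N + int T)) ?M2 []"
    using runs_draw_loop[of r2 ys zs M] ys zs unfolding N20
    by (simp add: r2_def scalars_def regs_in_def)
  define r3 where "r3 = r2(20 := int N + int T)"
  define r4 where "r4 = r3(14 := l)"
  define r5 where "r5 = r4(15 := j)"
  define r6 where "r6 = r5(16 := ?Z)"
  define r7 where "r7 = r6(17 := ?S)"
  note rs = r7_def r6_def r5_def r4_def r3_def r2_def scalars_def regs_in_def
  have env3: "env {..<40} r3" "env {..<40} r4" by (simp_all add: env_def rs)
  have lge: "3 * int q + 5 \<le> l" unfolding l using start_bounds first_from_ge order_trans by blast
  have lle: "l \<le> 4 * int P"
  proof (cases "start \<le> limit")
    case True
    then have "l \<le> limit" unfolding l by (rule first_from_le)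
    then show ?thesis using limit_bounds le_P P10 by linarith
  next
    case False
    then show ?thesis unfolding l using start_bounds by (simp add: first_from_empty)
  qed
  have jb: "0 \<le> j" "j \<le> int N" unfolding j by (auto intro: first_from_ge first_from_le)
  have renv: "res_env {..<40} r5 j l" "res_env {..<40} r6 j l" "res_env {..<40} r7 j l"
    using lge lle jb by (simp_all add: res_env_def env_def rs)
  have e14: "evaluates w ?M2 40 {..<40} r3 search_expr l (700 * (n + 2) * (m + 1) * (2 * q + 1) * (N + 1) * (N + 1))"
    using evaluates_search[OF env3(1) _ _ _ _ _ _ _ _ M2, of 40] start_bounds limit_bounds
    unfolding l Y by (simp add: rs)
  have e15: "evaluates w ?M2 40 {..<40} r4 witness_expr j (700 * (m + 1) * (2 * q + 1) * (N + 1) * (N + 1))"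
    using evaluates_witness[OF env3(2) _ _ _ _ _ M2, of 40] lge lle
    unfolding j Y by (simp add: rs)
  have e16: "evaluates w ?M2 40 {..<40} r5 found_expr ?Z (300 * (m + 1) * (6 * q + 1) * (N + T + 1))"
    unfolding found_count_def Y by (rule evaluates_found(1)[OF renv(1) _ _ M2]) auto
  have e17: "evaluates w ?M2 40 {..<40} r6 sum_expr ?S (600 * (m + 1) * (6 * q + 1) * (N + T + 1))"
    unfolding found_sum_def Y by (rule evaluates_found(2)[OF renv(2) _ _ M2]) auto
  have Zb: "0 \<le> ?Z" "?Z \<le> 2 * int P"
    using found_count_bounds[of Y j l "N + T"] le_P by auto
  have Sb: "0 \<le> ?S" "?S \<le> 12 * (int P * int P)"
    using found_sum_bounds[OF lge lle, of "N + T"] le_P by auto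
  let ?b = "estimate (int P ^ 3) d3 (int m) ?Z ?S"
  have eb: "evaluates w ?M2 41 {..<40} r7 estimate_expr ?b 60"
    by (rule evaluates_estimate[OF _ _ _ _ _ Zb Sb]) (simp_all add: rs)
  have e0: "evaluates w ?M2 40 {..<40} r7 (Num 0) 0 1" by (simp add: evaluates_def)
  let ?M3 = "?M2(0 := ?b)"
  have "?b \<in> words w" using eb fits_words[of w ?M2 estimate_expr 41 "{..<40}" r7] by (simp add: evaluates_def)
  then have M3: "?M3 a \<in> words w" for a using M2 by simp
  have e20: "evaluates w ?M3 40 {..<40} r7 (Num 0) 0 1" by (simp add: evaluates_def)
  have wr: "runs w write_loop (r7(20 := 0)) ?M3 [] (1 + N * (250 * (m + 1) * (6 * q + 1) + 20))
     (r7(20 := int N)) (write_mem j l ?M3 N) []"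
    by (rule runs_write_loop[OF renv(3) lge M3])
  note A = runs_assign[OF _ _ w]
  have cost: "N * (250 * (m + 1) * (6 * q + 1) + 20) \<le> 270 * (m + 1) * (6 * q + 1) * (N + T + 1)"
  proof -
    have "250 * (m + 1) * (6 * q + 1) + 20 \<le> 270 * ((m + 1) * (6 * q + 1))" by (simp add: algebra_simps)
    then have "N * (250 * (m + 1) * (6 * q + 1) + 20) \<le> (N + T + 1) * (270 * ((m + 1) * (6 * q + 1)))"
      by (intro mult_le_mono) auto
    then show ?thesis by (simp only: mult.assoc mult.left_commute mult.commute)
  qed
  have cost2: "700 * (m + 1) * (2 * q + 1) * (N + 1) * (N + 1) \<le> 700 * (n + 2) * (m + 1) * (2 * q + 1) * (N + 1) * (N + 1)"
    by (intro mult_le_mono) auto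
  have total: "500 * (n + 1) + 400 * (m + 1) * (m + 1) + (1 + N * (n * 40 + 40) + (5 + 2 + (1 + T * (n + 30) +
     (700 * (n + 2) * (m + 1) * (2 * q + 1) * (N + 1) * (N + 1) + 2 + (700 * (m + 1) * (2 * q + 1) * (N + 1) * (N + 1) + 2 +
     (300 * (m + 1) * (6 * q + 1) * (N + T + 1) + 2 + (600 * (m + 1) * (6 * q + 1) * (N + T + 1) + 2 +
     (1 + 60 + 1 + (1 + 2 + (1 + N * (250 * (m + 1) * (6 * q + 1) + 20) + 0)))))))))) \<le> time_bound n m q N T"
  proof -
    define X where "X = (n + 2) * (m + 1) * (2 * q + 1) * (N + 1) * (N + 1)"
    define X' where "X' = (m + 1) * (6 * q + 1) * (N + T + 1)"
    have "700 * (n + 2) * (m + 1) * (2 * q + 1) * (N + 1) * (N + 1) = 700 * X"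
      "1400 * (n + 2) * (m + 1) * (2 * q + 1) * (N + 1) * (N + 1) = 1400 * X"
      "270 * (m + 1) * (6 * q + 1) * (N + T + 1) = 270 * X'"
      "300 * (m + 1) * (6 * q + 1) * (N + T + 1) = 300 * X'"
      "600 * (m + 1) * (6 * q + 1) * (N + T + 1) = 600 * X'"
      "1200 * (m + 1) * (6 * q + 1) * (N + T + 1) = 1200 * X'"
      unfolding X_def X'_def by (simp_all only: mult.assoc)
    with cost cost2 show ?thesis unfolding time_bound_def by linarith
  qed
  have run: "runs w find_end (\<lambda>_. 0) M zs (time_bound n m q N T) (r7(20 := int N)) (write_mem j l ?M3 N) []"
    unfolding find_end_def
    by (rule runs_weaken, rule runs_Cons[OF prep], rule runs_Cons[OF copy[folded r1_def]],
        rule runs_Cons[OF A[OF e24, of 24, unfolded r12]], simp, rule runs_Cons[OF draws[folded r3_def]],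
        rule runs_Cons[OF A[OF e14, of 14, folded r4_def]], simp, rule runs_Cons[OF A[OF e15, of 15, folded r5_def]], simp,
        rule runs_Cons[OF A[OF e16, of 16, folded r6_def]], simp, rule runs_Cons[OF A[OF e17, of 17, folded r7_def]], simp,
        rule runs_Cons[OF runs_store[OF e0 eb w]], rule runs_Cons[OF A[OF e20]], simp,
        rule runs_Cons[OF wr runs_Nil])
      (rule total)
  have NB: "int N < int base"
  proof -
    have "int N \<le> int P" using le_P by simp
    moreover have "int base = 8 * (int P * int P)" using base by simp
    ultimately show ?thesis using PP P10' by linarith
  qed
  let ?Y' = "\<lambda>i. table_row (write_mem j l ?M3 i) base n"
  have "?Y' i a t = Y a t" if "i < N" "0 \<le> a" "0 \<le> t" for i a t
  proof -
    have "0 \<le> a * int n" using that by simp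
    then have ge: "int N < int base + a * int n + t" using NB that by linarith
    then show ?thesis unfolding Y table_row_def using write_mem_above[OF less_imp_le[OF that(1)] ge] by simp
  qed
  then show ?thesis using run
    by (intro exI[of _ "r7(20 := int N)"] exI[of _ "write_mem j l ?M3 N"] exI[of _ ?Y'])
      (auto simp: write_mem_0 write_mem_out)
qed

end

section \<open>The parameters as functions of the length, and the layout of the input\<close>

definition bit_len :: "nat \<Rightarrow> nat" where
  "bit_len n = nat \<lceil>log 2 (real n)\<rceil>"

definition rate :: "nat \<Rightarrow> real \<Rightarrow> int" where
  "rate n \<delta> = \<lfloor>\<delta> * 2 ^ (10 * bit_len n)\<rfloor> div int (2 ^ bit_len n) ^ 7"

text \<open>
  \<open>spread n \<delta>\<close> approximates \<open>n \<delta> log\<^sup>2 n\<close>, so that its square root exceeds the typical deviation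
  of the number of deletions by a logarithmic factor. It vanishes eventually if \<open>n \<delta>\<close> is a
  negative power of \<open>n\<close>.
\<close>

definition spread :: "nat \<Rightarrow> real \<Rightarrow> nat" where
  "spread n \<delta> =
     nat ((int n * int (bit_len n) * int (bit_len n) * rate n \<delta>) div int (2 ^ bit_len n) ^ 3)"

definition spread_root :: "nat \<Rightarrow> real \<Rightarrow> nat" where
  "spread_root n \<delta> = nat (first_from 0 (int n) (\<lambda>j. int (spread n \<delta>) < j * j + 1))"

text \<open>The factor 5 yields a tolerance of \<open>4 * (bit_len n * sqrt (n * \<delta>))\<close>
  despite the rounding in \<open>spread\<close> and \<open>rate\<close>. The summand 10 covers the
  case of few deletions, where the expected drift of at most 10 must still be tolerated.\<close>

definition tolerance :: "nat \<Rightarrow> real \<Rightarrow> nat" where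
  "tolerance n \<delta> = 5 * spread_root n \<delta> + 10"

text \<open>Concentration of the average takes about q^2 ln n samples, and q^2 is of the order of
  \<open>spread\<close>. One of the two extra logarithms supplies ln n, the other one absorbs the
  constant.\<close>

definition sample_count :: "nat \<Rightarrow> real \<Rightarrow> nat" where
  "sample_count n \<delta> = spread n \<delta> * bit_len n * bit_len n"

definition input_pos :: "bits \<Rightarrow> bits list \<Rightarrow> nat \<Rightarrow> nat" where
  "input_pos u ys i = 4 + length (concat (map encode_bits (u # take i ys)))"

lemma length_encode: "length (encode_bits z) = Suc (length z)"
  by (simp add: encode_bits_def)

lemma input_pos_0: "input_pos u ys 0 = length u + 5"
  by (simp add: input_pos_def length_encode)

lemma input_pos_Suc: "i < length ys \<Longrightarrow> input_pos u ys (Suc i) = input_pos u ys i + length (ys ! i) + 1"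
  by (simp add: input_pos_def length_encode take_Suc_conv_app_nth)

lemma length_input: "length (find_end_input w n \<delta> r u ys) = input_pos u ys (length ys)"
  by (simp add: find_end_input_def input_pos_def)

lemma input_pos_le:
  assumes "\<And>y. y \<in> set ys \<Longrightarrow> length y \<le> n" "i \<le> length ys"
  shows "input_pos u ys i \<le> length u + 5 + i * (n + 1)"
  using assms(2)
proof (induction i)
  case (Suc i)
  then have "length (ys ! i) \<le> n" using assms(1) by simp
  then show ?case using Suc by (simp add: input_pos_Suc)
qed (simp add: input_pos_0)

lemma input_nth:
  assumes i: "i < length ys" and t: "t \<le> length (ys ! i)"
  shows "input_pos u ys i + t < length (find_end_input w n \<delta> r u ys)"
    and "find_end_input w n \<delta> r u ys ! (input_pos u ys i + t) = encode_bits (ys ! i) ! t"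
proof -
  have split: "find_end_input w n \<delta> r u ys =
     ([int n, \<lfloor>\<delta> * 2 ^ w\<rfloor>, int r, int (length ys)] @ concat (map encode_bits (u # take i ys))) @
     encode_bits (ys ! i) @ concat (map encode_bits (drop (Suc i) ys))"
    unfolding find_end_input_def
    by (subst id_take_nth_drop[OF i]) simp
  have len: "length ([int n, \<lfloor>\<delta> * 2 ^ w\<rfloor>, int r, int (length ys)] @ concat (map encode_bits (u # take i ys)))
     = input_pos u ys i" by (simp add: input_pos_def)
  show "find_end_input w n \<delta> r u ys ! (input_pos u ys i + t) = encode_bits (ys ! i) ! t"
    unfolding split len[symmetric] nth_append_length_plus using t by (simp add: nth_append length_encode)
  have "length (find_end_input w n \<delta> r u ys) \<ge> input_pos u ys i + Suc (length (ys ! i))"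
    unfolding split length_append len[unfolded length_append, symmetric] by (simp add: length_encode)
  then show "input_pos u ys i + t < length (find_end_input w n \<delta> r u ys)" using t by simp
qed

definition parameters_ok :: "nat \<Rightarrow> real \<Rightarrow> nat \<Rightarrow> bool" where
  "parameters_ok n \<delta> N \<longleftrightarrow> (10::nat) \<le> 2 ^ bit_len n \<and> bit_len n \<le> n \<and> 0 \<le> \<delta> \<and> \<delta> < 1 \<and>
     spread n \<delta> \<le> 2 ^ bit_len n \<and> sample_count n \<delta> \<le> 2 ^ bit_len n \<and> N \<le> 2 ^ bit_len n \<and>
     6 * tolerance n \<delta> + 5 \<le> 2 ^ bit_len n \<and> 2 * half_width n \<le> n \<and> 2 \<le> n"

lemma bit_len_bounds:
  assumes "2 \<le> n"
  shows "n \<le> 2 ^ bit_len n" "i < bit_len n \<Longrightarrow> 2 ^ i < n"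
proof -
  have n: "0 < real n" "0 \<le> log 2 (real n)" using assms by simp_all
  then have c: "real (bit_len n) = \<lceil>log 2 (real n)\<rceil>"
    unfolding bit_len_def by (subst of_nat_nat) (auto simp: ceiling_mono[of 0, simplified])
  have "log 2 (real n) \<le> real (bit_len n)" unfolding c by simp
  then have "real n \<le> 2 powr real (bit_len n)" using n by (simp add: log_le_iff)
  then have "real n \<le> real (2 ^ bit_len n)" by (simp add: powr_realpow)
  then show "n \<le> 2 ^ bit_len n" unfolding of_nat_le_iff .
  show "2 ^ i < n" if "i < bit_len n"
  proof -
    have "int i < \<lceil>log 2 (real n)\<rceil>" using that unfolding bit_len_def by linarith
    then have "real i < log 2 (real n)" by (simp add: less_ceiling_iff)
    then have "2 powr real i < real n" using n by (simp add: less_log_iff)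
    then have "real (2 ^ i) < real n" by (simp add: powr_realpow)
    then show "2 ^ i < n" unfolding of_nat_less_iff .
  qed
qed

lemma half_width_cube: "half_width n * half_width n * half_width n \<le> n"
  "n < (half_width n + 1) * (half_width n + 1) * (half_width n + 1)"
proof -
  let ?x = "root 3 (real n)"
  have x: "?x ^ 3 = real n" "0 \<le> ?x" by simp_all
  have m: "real (half_width n) = \<lfloor>?x\<rfloor>" unfolding half_width_def using x by simp
  have "real (half_width n) ^ 3 \<le> ?x ^ 3" unfolding m by (rule power_mono) (use x in auto)
  then have "real (half_width n ^ 3) \<le> real n" using x by simp
  then show "half_width n * half_width n * half_width n \<le> n"
    unfolding of_nat_le_iff by (simp add: power3_eq_cube)
  have "?x < real (half_width n) + 1" unfolding m by linarith
  then have "?x ^ 3 < (real (half_width n) + 1) ^ 3" by (rule power_strict_mono) (use x in auto)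
  then have "real n < real ((half_width n + 1) ^ 3)" using x by (simp add: add.commute)
  then show "n < (half_width n + 1) * (half_width n + 1) * (half_width n + 1)"
    unfolding of_nat_less_iff by (simp add: power3_eq_cube)
qed

lemma half_width_first:
  assumes "2 \<le> n"
  shows "int (half_width n) = first_from 0 (int n) (\<lambda>j. int n < (j + 1) * (j + 1) * (j + 1))"
proof (rule first_from_eqI[symmetric])
  show "int n \<le> int (half_width n) \<or> int n < (int (half_width n) + 1) * (int (half_width n) + 1) * (int (half_width n) + 1)"
  proof -
    have "int n < int ((half_width n + 1) * (half_width n + 1) * (half_width n + 1))"
      unfolding of_nat_less_iff by (rule half_width_cube(2))
    then show ?thesis unfolding of_nat_mult of_nat_add of_nat_1 by blast
  qed
  fix j assume j: "0 \<le> j" "j < int (half_width n)"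
  have "(j + 1) * (j + 1) * (j + 1) \<le> int (half_width n) * int (half_width n) * int (half_width n)"
    using j by (intro mult_mono) auto
  also have "\<dots> \<le> int n" unfolding of_nat_mult[symmetric] of_nat_le_iff by (rule half_width_cube(1))
  finally have c: "(j + 1) * (j + 1) * (j + 1) \<le> int n" .
  have "1 * 1 \<le> (j + 1) * (j + 1)" using j by (intro mult_mono) auto
  then have "(j + 1) * 1 \<le> (j + 1) * ((j + 1) * (j + 1))" using j by (intro mult_left_mono) auto
  then show "j < int n \<and> \<not> int n < (j + 1) * (j + 1) * (j + 1)" using c by (simp add: mult.assoc)
qed simp

lemma int_first_from: "int (nat (first_from 0 hi P)) = first_from 0 hi P"
  using first_from_ge[of 0 hi P] by simp

lemma rate_nonneg: "0 \<le> \<delta> \<Longrightarrow> 0 \<le> rate n \<delta>"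
  unfolding rate_def by (intro pos_imp_zdiv_nonneg_iff[THEN iffD2]) auto

text \<open>The interface between the machine and the mathematics. The period is determined only for
  \<open>m \<le> r\<close>, where the inspected bits belong to \<open>u\<close>; for other locations
  the program still halts in time, which is required of all inputs.\<close>

lemma exec_find_end:
  assumes ok: "parameters_ok n \<delta> N"
    and r: "r \<le> n" and u: "length u = r + half_width n + 1" and ys: "length ys = N" "\<And>y. y \<in> set ys \<Longrightarrow> length y \<le> n"
    and zs: "length zs = sample_count n \<delta>" "\<And>z. z \<in> set zs \<Longrightarrow> length z \<le> n"
    and m: "m = half_width n" and q: "q = 2 * tolerance n \<delta>" and D: "D = int (2 ^ bit_len n) ^ 3"
    and w: "w = word_size 10 n"
  shows "\<exists>t s k Y l j Y'. exec w find_end (initial w (find_end_input w n \<delta> r u ys) zs) t s \<and>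
     t \<le> time_bound n m q N (sample_count n \<delta>) \<and>
     (m \<le> r \<longrightarrow> int k = first_from 1 (2 * int m + 1)
        (\<lambda>k. \<forall>t\<in>{0..<2 * int m + 1 - k}. u ! nat (int r - int m + t) = u ! nat (int r - int m + t + k))) \<and>
     (\<forall>i<length (ys @ zs). \<forall>t<length ((ys @ zs) ! i). Y (int i) (int t) = of_bool ((ys @ zs) ! i ! t)) \<and>
     l = first_from ((int r * (D - rate n \<delta>)) div D + 3 * int q + 5) (3 * int n div 4 + 1)
       (\<lambda>l. \<exists>j\<in>{0..<int N}. accepted Y m k q N j l) \<and>
     j = first_from 0 (int N) (\<lambda>j. accepted Y m k q N j l) \<and>
     out_b s = estimate D (rate n \<delta>) (int m) (found_count Y m q j l (length (ys @ zs)))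
        (found_sum Y m q j l (length (ys @ zs))) \<and>
     (\<forall>i<N. out_l s i = result (Y' i) m q j l (int i) \<and> (\<forall>a\<ge>0. \<forall>t\<ge>0. Y' i a t = Y a t))"
proof -
  define L where "L = bit_len n"
  define P where "P = (2::nat) ^ L"
  define T where "T = sample_count n \<delta>"
  define inp where "inp = find_end_input w n \<delta> r u ys"
  define M where "M = mem (initial w inp zs)"
  define base where "base = 8 * P * P"
  define k where "k = nat (first_from 1 (2 * int m + 1)
       (\<lambda>k. \<forall>t\<in>{0..<2 * int m + 1 - k}. M (5 + int r - int m + t) = M (5 + int r - int m + t + k)))"
  note mh = m
  note okP = ok[unfolded parameters_ok_def, folded L_def, folded P_def, folded T_def]
  have P10: "10 \<le> P" and n2: "2 \<le> n" and \<delta>: "0 \<le> \<delta>" "\<delta> < 1" using okP by auto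
  have nP: "n \<le> P" using bit_len_bounds(1)[OF n2] by (simp add: P_def L_def)
  have wL: "w = 10 * L" using w by (simp add: word_size_def L_def bit_len_def)
  have word: "2 ^ w = int P ^ 10" by (simp add: wL P_def power_mult mult.commute[of 10] flip: power_mult)
  have w0: "0 < w"
  proof (rule ccontr)
    assume "\<not> 0 < w"
    then have "L = 0" by (simp add: wL)
    then show False using P10 by (simp add: P_def)
  qed
  have mP: "2 * m \<le> P" using okP nP m by auto
  have kint: "int k = first_from 1 (2 * int m + 1)
       (\<lambda>k. \<forall>t\<in>{0..<2 * int m + 1 - k}. M (5 + int r - int m + t) = M (5 + int r - int m + t + k))"
    unfolding k_def using first_from_ge[of 1] by (smt (verit) int_nat_eq)
  have k3: "k \<le> 3 * P"
  proof -
    have "int k \<le> 2 * int m + 1" unfolding kint by (rule first_from_le) simp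
    then show ?thesis using mP P10 by linarith
  qed
  have P2: "1000 * (int P * int P) \<le> 2 ^ w"
  proof -
    have "int 10 ^ 3 \<le> int P ^ 3" by (rule power_mono) (use P10 in auto)
    then have "1000 * (int P * int P) \<le> int P ^ 3 * (int P * int P)" by (intro mult_right_mono) auto
    also have "\<dots> = int P ^ 5" by (simp add: eval_nat_numeral)
    also have "\<dots> \<le> int P ^ 10" by (rule power_increasing) (use P10 in auto)
    finally show ?thesis unfolding word .
  qed
  have inpw: "x \<in> words w" if "0 \<le> x" "x \<le> 9 * int P" for x
  proof -
    have "9 * int P < 1000 * (int P * int P)" using P10 mult_mono[of 10 "int P" 1 "int P"] by auto
    then show ?thesis using that P2 unfolding words_def by auto
  qed
  have Mw: "M a \<in> words w" for a
    unfolding M_def initial_def words_def by (auto simp: signed_take_bit_int_greater_eq_minus_exp signed_take_bit_int_less_exp)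
  have Mnth: "M (int a) = signed_take_bit w (inp ! a)" if "a < length inp" for a
    using that unfolding M_def initial_def by simp
  have dw: "0 \<le> \<lfloor>\<delta> * 2 ^ w\<rfloor>" "\<lfloor>\<delta> * 2 ^ w\<rfloor> < 2 ^ w"
  proof -
    show "0 \<le> \<lfloor>\<delta> * 2 ^ w\<rfloor>" using \<delta> by simp
    have "\<delta> * 2 ^ w < 2 ^ w" using \<delta> by simp
    then show "\<lfloor>\<delta> * 2 ^ w\<rfloor> < 2 ^ w" by (simp add: floor_less_iff)
  qed
  have NP: "N \<le> P" "T \<le> P" "spread n \<delta> \<le> P" "3 * q + 5 \<le> P" using okP q by auto
  have len5: "5 \<le> length inp"
    unfolding inp_def length_input input_pos_def by (simp add: length_encode)
  then have inp0: "inp \<noteq> []" by auto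
  have i4: "inp ! 0 = int n" "inp ! 1 = \<lfloor>\<delta> * 2 ^ w\<rfloor>" "inp ! 2 = int r" "inp ! 3 = int N" "inp ! 4 = int (length u)"
    unfolding inp_def find_end_input_def using ys by (simp_all add: encode_bits_def nth_append eval_nat_numeral)
  have uP: "length u \<le> 2 * P" using u r nP mP m P10 okP by linarith
  have M0: "M 0 = int n" "M 1 = \<lfloor>\<delta> * 2 ^ w\<rfloor>" "M 2 = int r" "M 3 = int N" "M 4 = int (length u)"
  proof -
    have "signed_take_bit w (int n) = int n" "signed_take_bit w (int r) = int r"
      "signed_take_bit w (int N) = int N" "signed_take_bit w (int (length u)) = int (length u)"
      by (rule signed_take_bit_words, rule inpw, simp, use nP r NP uP in linarith)+
    moreover have "signed_take_bit w \<lfloor>\<delta> * 2 ^ w\<rfloor> = \<lfloor>\<delta> * 2 ^ w\<rfloor>"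
    proof (rule signed_take_bit_words)
      have "- (2 ^ w) \<le> \<lfloor>\<delta> * 2 ^ w\<rfloor>" using dw(1) zero_le_power[of "2::int" w] by linarith
      then show "\<lfloor>\<delta> * 2 ^ w\<rfloor> \<in> words w" using dw(2) by (simp add: words_def)
    qed
    ultimately show "M 0 = int n" "M 1 = \<lfloor>\<delta> * 2 ^ w\<rfloor>" "M 2 = int r" "M 3 = int N" "M 4 = int (length u)"
      using Mnth[of 0] Mnth[of 1] Mnth[of 2] Mnth[of 3] Mnth[of 4] len5 i4 inp0 by auto
  qed
  have vint: "int (spread n \<delta>) = (int n * int L * int L * rate n \<delta>) div int P ^ 3"
  proof -
    have "0 \<le> (int n * int L * int L * rate n \<delta>) div int P ^ 3"
      using rate_nonneg[OF \<delta>(1), of n] P10 by (intro pos_imp_zdiv_nonneg_iff[THEN iffD2]) auto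
    then show ?thesis
      unfolding spread_def L_def[symmetric] P_def[symmetric] by (rule nat_0_le)
  qed
  have scal: "find_end_scalars w n m k q N T base P L r (spread n \<delta>) (spread_root n \<delta>) \<lfloor>\<delta> * 2 ^ w\<rfloor> (rate n \<delta>) M"
  proof (unfold_locales)
    show "rate n \<delta> = \<lfloor>\<delta> * 2 ^ w\<rfloor> div int P ^ 7"
      unfolding rate_def by (simp add: wL L_def P_def)
    show "int (spread_root n \<delta>) = first_from 0 (int n) (\<lambda>j. int (spread n \<delta>) < j * j + 1)"
      unfolding spread_root_def by (rule int_first_from)
    show "int m = first_from 0 (int n) (\<lambda>j. int n < (j + 1) * (j + 1) * (j + 1))"
      unfolding m by (rule half_width_first[OF n2])
    show "i < L \<Longrightarrow> 2 ^ i < n" for i using bit_len_bounds(2)[OF n2] by (simp add: L_def)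
    show "int base \<le> 8 * (int P * int P)" by (simp add: base_def)
    show "T = spread n \<delta> * L * L" by (simp add: T_def sample_count_def L_def)
    show "q = 2 * (5 * spread_root n \<delta> + 10)" by (simp add: q tolerance_def)
    show "M a \<in> words w" for a by (rule Mw)
    show "m \<le> P" "q \<le> P" "L \<le> n" using mP NP okP by auto
  qed (fact w0 P10 P2 nP k3 NP word dw vint kint M0 r P_def base_def)+
  interpret find_end_scalars w n m k q N T base P L r "spread n \<delta>" "spread_root n \<delta>" "\<lfloor>\<delta> * 2 ^ w\<rfloor>" "rate n \<delta>" M
    by (rule scal)
  let ?p = "\<lambda>i. int (input_pos u ys i)"
  \<comment> \<open>The given traces occupy at most \<open>N * (n + 1)\<close> cells, at most 2 P^2;
    the rest of the input is linear in \<open>P\<close>. Hence the table at 8 P^2 does not overlap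
    the input.\<close>
  have pN: "?p N \<le> int base"
  proof -
    have "N * (n + 1) \<le> P * (P + P)" using NP nP P10 by (intro mult_le_mono) auto
    moreover have "input_pos u ys N \<le> length u + 5 + N * (n + 1)" using input_pos_le[of ys n N u] ys by simp
    moreover have "10 * P \<le> P * P" using P10 by simp
    ultimately have "input_pos u ys N \<le> 8 * (P * P)" using uP P10 unfolding distrib_left by linarith
    then show ?thesis by (simp add: base_def mult.assoc flip: of_nat_mult)
  qed
  have len: "M (?p i) = int (length (ys ! i))" if i: "i < N" for i
  proof -
    have "M (?p i) = signed_take_bit w (int (length (ys ! i)))"
      using Mnth[of "input_pos u ys i"] input_nth[where i = i and ys = ys and t = 0 and u = u and w = w and n = n and \<delta> = \<delta> and r = r] i ys
      by (simp add: inp_def encode_bits_def)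
    moreover have "length (ys ! i) \<le> n" using ys i by simp
    ultimately show ?thesis using signed_take_bit_words[OF inpw[of "int (length (ys ! i))"]] nP by simp
  qed
  have bits: "M (?p i + 1 + int t) = of_bool (ys ! i ! t)" if i: "i < N" "t < length (ys ! i)" for i t
  proof -
    have "M (int (input_pos u ys i + Suc t)) = signed_take_bit w (of_bool (ys ! i ! t))"
      using Mnth[of "input_pos u ys i + Suc t"] input_nth[where i = i and ys = ys and t = "Suc t" and u = u and w = w and n = n and \<delta> = \<delta> and r = r] i ys
      by (simp add: inp_def encode_bits_def)
    moreover have "(of_bool (ys ! i ! t) :: int) \<in> words w" by (rule inpw) (use P10 in auto)
    ultimately show ?thesis using signed_take_bit_words by (simp add: algebra_simps)
  qed
  define Y where "Y = table_row (put_rows base n (ys @ zs) (N + T) M) base n"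
  define l where "l = first_from start limit (\<lambda>l. \<exists>j\<in>{0..<int N}. accepted Y m k q N j l)"
  define j where "j = first_from 0 (int N) (\<lambda>j. accepted Y m k q N j l)"
  have "\<exists>\<rho>' M' Y'. runs w find_end (\<lambda>_. 0) M zs (time_bound n m q N T) \<rho>' M' [] \<and>
     M' 0 = estimate (int P ^ 3) (rate n \<delta>) (int m) (found_count Y m q j l (N + T)) (found_sum Y m q j l (N + T)) \<and>
     (\<forall>i<N. M' (int i + 1) = result (Y' i) m q j l (int i) \<and> (\<forall>a\<ge>0. \<forall>t\<ge>0. Y' i a t = Y a t))"
    by (rule runs_find_end[where u = u and p = ?p, OF M0(5) uP ys _ _ _ _ pN len bits Y_def l_def j_def])
      (use ys zs in \<open>auto simp: T_def input_pos_0 input_pos_Suc\<close>)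
  then obtain \<rho>' M' Y' where run: "runs w find_end (\<lambda>_. 0) M zs (time_bound n m q N T) \<rho>' M' []"
    and out: "M' 0 = estimate (int P ^ 3) (rate n \<delta>) (int m) (found_count Y m q j l (N + T)) (found_sum Y m q j l (N + T))"
    "\<forall>i<N. M' (int i + 1) = result (Y' i) m q j l (int i) \<and> (\<forall>a\<ge>0. \<forall>t\<ge>0. Y' i a t = Y a t)"
    by blast
  have "(\<forall>r<40. regs (initial w inp zs) r = 0) \<and> mem (initial w inp zs) = M \<and> pending (initial w inp zs) = zs"
    unfolding M_def by (simp add: initial_def)
  with run obtain t s where e: "exec w find_end (initial w inp zs) t s" "t \<le> time_bound n m q N T" "mem s = M'"
    unfolding runs_def by blast
  have NT: "N + T = length (ys @ zs)" using ys zs by (simp add: T_def)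
  have rows: "Y (int i) (int t) = of_bool ((ys @ zs) ! i ! t)" if "i < length (ys @ zs)" "t < length ((ys @ zs) ! i)" for i t
  proof -
    have "length ((ys @ zs) ! j) \<le> n" if "j < N + T" for j
    proof -
      have "(ys @ zs) ! j \<in> set (ys @ zs)" by (rule nth_mem) (use that NT in simp)
      then show ?thesis using ys(2) zs(2) unfolding set_append by blast
    qed
    then show ?thesis
      unfolding Y_def table_row_def by (intro put_rows_row) (use that NT in simp_all)
  qed
  have kk: "int k = first_from 1 (2 * int m + 1)
        (\<lambda>k. \<forall>t\<in>{0..<2 * int m + 1 - k}. u ! nat (int r - int m + t) = u ! nat (int r - int m + t + k))"
    if mr: "m \<le> r"
  proof -
    have Mu: "M (5 + int r - int m + t) = of_bool (u ! nat (int r - int m + t))" if t: "0 \<le> t" "t < 2 * int m + 1" for t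
    proof -
      define a where "a = nat (int r - int m + t)"
      have a: "int a = int r - int m + t" using t mr by (simp add: a_def)
      then have al: "a < length u" using t u mh by linarith
      have "length inp \<ge> length u + 5"
        unfolding inp_def length_input input_pos_def by (simp add: length_encode)
      then have "M (int (5 + a)) = signed_take_bit w (inp ! (5 + a))" using al by (intro Mnth) simp
      also have "inp ! (5 + a) = of_bool (u ! a)"
        unfolding inp_def find_end_input_def using al by (simp add: encode_bits_def nth_append eval_nat_numeral)
      also have "signed_take_bit w (of_bool (u ! a)) = (of_bool (u ! a) :: int)"
        by (rule signed_take_bit_words, rule inpw) (use P10 in auto)
      finally show ?thesis unfolding a_def[symmetric] using a by (simp add: algebra_simps)
    qed
    show ?thesis unfolding kint
    proof (rule first_from_cong, rule ball_cong)
      fix k t assume k: "1 \<le> k" and t: "t \<in> {0..<2 * int m + 1 - k}"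
      have "M (5 + int r - int m + t + k) = of_bool (u ! nat (int r - int m + t + k))"
        using Mu[of "t + k"] k t by (simp add: add.assoc)
      with Mu[of t] k t show "(M (5 + int r - int m + t) = M (5 + int r - int m + t + k)) =
         (u ! nat (int r - int m + t) = u ! nat (int r - int m + t + k))" by simp
    qed simp
  qed
  have DP: "D = int P ^ 3" using D by (simp add: P_def L_def)
  have l': "l = first_from ((int r * (D - rate n \<delta>)) div D + 3 * int q + 5) (3 * int n div 4 + 1)
       (\<lambda>l. \<exists>j\<in>{0..<int N}. accepted Y m k q N j l)"
    unfolding DP l_def start_def limit_def ..
  have "out_b s = estimate D (rate n \<delta>) (int m) (found_count Y m q j l (length (ys @ zs)))
        (found_sum Y m q j l (length (ys @ zs)))"
    unfolding DP NT[symmetric] out_b_def using e(3) out(1) by simp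
  moreover have "\<forall>i<N. out_l s i = result (Y' i) m q j l (int i) \<and> (\<forall>a\<ge>0. \<forall>t\<ge>0. Y' i a t = Y a t)"
    unfolding out_l_def using e(3) out(2) by simp
  ultimately show ?thesis
    using e(1)[unfolded inp_def] e(2)[unfolded T_def] rows kk l' j_def by blast
qed

subsection \<open>Positions in a trace\<close>

text \<open>If bit \<open>t\<close> survives, this is its position in the trace. Being a count, it
  splits additively at any place of the source.\<close>

definition survivor_count :: "bool list \<Rightarrow> nat \<Rightarrow> nat" where
  "survivor_count b t = card {i. i < t \<and> b ! i}"

lemma survivor_count_0 [simp]: "survivor_count b 0 = 0"
  by (simp add: survivor_count_def)

lemma survivor_count_Suc: "survivor_count b (Suc t) = survivor_count b t + of_bool (b ! t)"
proof -
  have "{i. i < Suc t \<and> b ! i} = {i. i < t \<and> b ! i} \<union> (if b ! t then {t} else {})"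
    by (auto simp: less_Suc_eq)
  then show ?thesis unfolding survivor_count_def by (simp add: card_insert_if)
qed

lemma survivor_count_add:
  "survivor_count b (s + t) + card {i\<in>{s..<s + t}. \<not> b ! i} = survivor_count b s + t"
proof (induction t)
  case (Suc t)
  have "{i\<in>{s..<s + Suc t}. \<not> b ! i} = {i\<in>{s..<s + t}. \<not> b ! i} \<union> (if b ! (s + t) then {} else {s + t})"
    by (auto simp: less_Suc_eq)
  then have "card {i\<in>{s..<s + Suc t}. \<not> b ! i} = card {i\<in>{s..<s + t}. \<not> b ! i} + of_bool (\<not> b ! (s + t))"
    by (simp add: card_insert_if)
  then show ?case using Suc by (simp add: survivor_count_Suc)
qed simp

lemma survivor_count_mono: "s \<le> t \<Longrightarrow> survivor_count b s \<le> survivor_count b t"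
  unfolding survivor_count_def by (intro card_mono) auto

lemma survivor_count_le: "s \<le> t \<Longrightarrow> survivor_count b t \<le> survivor_count b s + (t - s)"
  using survivor_count_add[of b s "t - s"] by simp

lemma survivor_count_less: "b ! s \<Longrightarrow> s < t \<Longrightarrow> survivor_count b s < survivor_count b t"
  using survivor_count_mono[of "Suc s" t b] by (simp add: survivor_count_Suc)

lemma survivor_count_clean:
  assumes "\<And>i. s \<le> i \<Longrightarrow> i < t \<Longrightarrow> b ! i" "s \<le> t"
  shows "survivor_count b t = survivor_count b s + (t - s)"
proof -
  have "{i\<in>{s..<s + (t - s)}. \<not> b ! i} = {}" using assms by auto
  then show ?thesis using survivor_count_add[of b s "t - s"] assms(2) by (metis add.right_neutral card.empty le_add_diff_inverse)
qed

text \<open>The count starts at 0 and rises by one exactly at surviving bits, so it passes through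
  every smaller value at such a bit.\<close>

lemma survivor_count_source: "z < survivor_count b t \<Longrightarrow> \<exists>s<t. b ! s \<and> survivor_count b s = z"
proof (induction t)
  case (Suc t)
  show ?case
  proof (cases "z < survivor_count b t")
    case True
    then show ?thesis using Suc.IH less_SucI by blast
  next
    case False
    then have "b ! t \<and> survivor_count b t = z" using Suc.prems by (cases "b ! t") (simp_all add: survivor_count_Suc)
    then show ?thesis by blast
  qed
qed simp

lemma length_filter_survivor_count: "length (filter (\<lambda>i. b ! i) [0..<t]) = survivor_count b t"
  by (induction t) (auto simp: survivor_count_Suc)

lemma survivors_split:
  assumes "t \<le> length b"
  shows "survivors b = filter (\<lambda>i. b ! i) [0..<t] @ filter (\<lambda>i. b ! i) [t..<length b]"
  unfolding survivors_def using upt_add_eq_append[of 0 t "length b - t"] assms by (simp flip: filter_append)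

lemma survivors_nth:
  assumes "i < length b" "b ! i"
  shows "survivor_count b i < length (survivors b)" "survivors b ! survivor_count b i = i"
proof -
  have "survivors b = filter (\<lambda>i. b ! i) [0..<i] @ i # filter (\<lambda>i. b ! i) [Suc i..<length b]"
    using survivors_split[of i b] assms by (simp add: upt_conv_Cons)
  then show "survivor_count b i < length (survivors b)" "survivors b ! survivor_count b i = i"
    unfolding length_filter_survivor_count[symmetric] by simp_all
qed

text \<open>The survivors are listed in increasing order, so those up to \<open>e\<close> form an
  initial segment. The default -1 comes out of the same formula.\<close>

lemma last_loc_eq:
  assumes "e < length b"
  shows "last_loc e b = int (survivor_count b (Suc e)) - 1"
proof -
  define u where "u = filter (\<lambda>i. b ! i) [0..<Suc e]"
  define v where "v = filter (\<lambda>i. b ! i) [Suc e..<length b]"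
  have split: "survivors b = u @ v" unfolding u_def v_def by (rule survivors_split) (use assms in simp)
  have u: "i < length u \<Longrightarrow> u ! i \<le> e" for i using nth_mem[of i u] unfolding u_def by auto
  have v: "i < length v \<Longrightarrow> \<not> v ! i \<le> e" for i using nth_mem[of i v] unfolding v_def by auto
  have "{l. l < length (survivors b) \<and> survivors b ! l \<le> e} = {..<length u}"
  proof (intro equalityI subsetI)
    fix l assume l: "l \<in> {l. l < length (survivors b) \<and> survivors b ! l \<le> e}"
    show "l \<in> {..<length u}"
    proof (rule ccontr)
      assume "l \<notin> {..<length u}"
      then have "l - length u < length v" "v ! (l - length u) \<le> e" using l unfolding split by (auto simp: nth_append)
      then show False using v by blast
    qed
  qed (use u in \<open>auto simp: split nth_append\<close>)
  then have last: "last_loc e b = (if length u = 0 then -1 else int (Max {..<length u}))"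
    unfolding last_loc_def Let_def by (simp add: lessThan_empty_iff)
  have "length u = survivor_count b (Suc e)" unfolding u_def by (rule length_filter_survivor_count)
  moreover have "Max {..<length u} = length u - 1" if "length u \<noteq> 0"
    by (rule Max_eqI) (use that in auto)
  ultimately show ?thesis using last by (simp add: of_nat_diff)
qed

text \<open>Only the cells of surviving bits are constrained. Behind the trace a row may contain
  anything.\<close>

definition reads :: "(int \<Rightarrow> int) \<Rightarrow> bits \<Rightarrow> bool list \<Rightarrow> bool" where
  "reads y x b \<longleftrightarrow> (\<forall>i<length x. b ! i \<longrightarrow> y (int (survivor_count b i)) = of_bool (x ! i))"

lemma reads_trace:
  assumes "length b = length x" "\<And>t. t < length (trace_of x b) \<Longrightarrow> y (int t) = of_bool (trace_of x b ! t)"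
  shows "reads y x b"
  unfolding reads_def
proof (intro allI impI)
  fix i assume "i < length x" "b ! i"
  with survivors_nth[of i b] assms(1) assms(2)[of "survivor_count b i"]
  show "y (int (survivor_count b i)) = of_bool (x ! i)" by (simp add: trace_of_def)
qed

lemma survivor_count_drop:
  "survivor_count b (a + t) = survivor_count b a + survivor_count (drop a b) t" if "a \<le> length b"
  using that by (induction t) (simp_all add: survivor_count_Suc)

text \<open>Relative to the image of \<open>a\<close>, what is read depends only on the deletions
  from \<open>a\<close> on. This locality later gives independence from the number of deletions
  before \<open>a\<close>.\<close>

lemma reads_drop:
  assumes "reads y x b" "length b = length x" "a \<le> length x"
    and p: "p < survivor_count (drop a b) t" "t \<le> length x - a"
  shows "y (int (survivor_count b a) + int p) = of_bool (trace_of (drop a x) (drop a b) ! p)"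
proof -
  obtain s where s: "s < t" "drop a b ! s" "survivor_count (drop a b) s = p"
    using survivor_count_source[OF p(1)] by blast
  have "trace_of (drop a x) (drop a b) ! p = x ! (a + s)"
    using survivors_nth[of s "drop a b"] s p(2) assms(2,3) by (simp add: trace_of_def)
  moreover have "y (int (survivor_count b (a + s))) = of_bool (x ! (a + s))"
    using assms(1-3) s p(2) unfolding reads_def by simp
  ultimately show ?thesis using survivor_count_drop[of a b s] assms(2,3) s(3) by simp
qed

text \<open>Pigeonhole: \<open>A \<inter> B\<close> has at least
  \<open>card A + card B - card U\<close> elements, too many to be disjoint from \<open>D\<close>
  within \<open>U\<close>.\<close>

lemma card3_inter:
  assumes "finite U" "A \<subseteq> U" "B \<subseteq> U" "D \<subseteq> U" "2 * card U < card A + card B + card D"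
  shows "A \<inter> B \<inter> D \<noteq> {}"
proof
  assume e: "A \<inter> B \<inter> D = {}"
  have f: "finite A" "finite B" "finite D" using assms finite_subset by blast+
  have "card A + card B = card (A \<union> B) + card (A \<inter> B)" using f(1,2) by (rule card_Un_Int)
  moreover have "card (A \<union> B) \<le> card U" using assms by (intro card_mono) auto
  moreover have "card (A \<inter> B) + card D = card ((A \<inter> B) \<union> D)" using f e by (simp add: card_Un_disjoint)
  moreover have "card ((A \<inter> B) \<union> D) \<le> card U" using assms by (intro card_mono) auto
  ultimately show False using assms(5) by linarith
qed

subsection \<open>The search finds the end of the desert\<close>

text \<open>\<open>small\<close> says that the window is long compared with the period, with
  \<open>J\<close> and with all displacements, which are multiples of \<open>q\<close>. The period
  is stated with sums in place of \<open>r - m\<close> to avoid truncated subtraction.\<close>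

locale desert_traces =
  fixes x :: bits and n m k e r g q J :: nat and \<delta> :: real
  assumes len: "length x = n" and k: "1 \<le> k" and r: "m \<le> r" "r + m \<le> e"
    and periodic: "\<And>i. r + k \<le> i + m \<Longrightarrow> i \<le> e \<Longrightarrow> x ! i = x ! (i - k)"
    and break: "x ! (e + 1) \<noteq> x ! (e + 1 - k)"
    and size: "e + 3 * m + 10 \<le> n" and q: "q = 2 * g" and g: "10 \<le> g" "J \<le> g"
    and small: "30 * q + k + J + 40 \<le> m" and \<delta>: "0 \<le> \<delta>" "\<delta> \<le> 1/2" "\<delta> * m \<le> 1"
begin

definition X :: "int \<Rightarrow> int" where
  "X i = of_bool (x ! nat i)"

text \<open>The bound holds for all prefixes at once because it is applied at sources that depend on
  the trace.\<close>

definition typical :: "bool list \<Rightarrow> bool" where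
  "typical b \<longleftrightarrow> (\<forall>t\<le>n. \<bar>real (survivor_count b t) - (1 - \<delta>) * t\<bar> \<le> g)"

text \<open>The radius \<open>3 * m\<close> leaves room for a window whose centre is itself
  displaced from \<open>c\<close> by up to \<open>m\<close>.\<close>

definition clean :: "nat \<Rightarrow> bool list \<Rightarrow> bool" where
  "clean c b \<longleftrightarrow> (\<forall>i<n. c \<le> i + 3 * m \<and> i \<le> c + 3 * m \<longrightarrow> b ! i)"

definition good :: "nat \<Rightarrow> bool list \<Rightarrow> bool" where
  "good c b \<longleftrightarrow> typical b \<and> clean c b"

definition pos :: "bool list \<Rightarrow> int" where
  "pos b = int (survivor_count b (e + 1)) - 1"

lemma X_periodic: "int r - int m + int k \<le> i \<Longrightarrow> i \<le> int e \<Longrightarrow> X i = X (i - int k)"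
  using periodic[of "nat i"] r unfolding X_def by (simp add: nat_diff_distrib' le_nat_iff nat_le_iff)

lemma X_break: "X (int e + 1) \<noteq> X (int e + 1 - int k)"
proof -
  have "nat (int e + 1) = e + 1" "nat (int e + 1 - int k) = e + 1 - k" using small r by auto
  then show ?thesis using break unfolding X_def by simp
qed

lemma readsD: "reads y x b \<Longrightarrow> s < n \<Longrightarrow> b ! s \<Longrightarrow> y (int (survivor_count b s)) = X (int s)"
  unfolding reads_def X_def len by simp

lemma clean_count:
  assumes "clean c b" "s \<le> t" "c \<le> s + 3 * m" "t \<le> c + 3 * m + 1" "t \<le> n"
  shows "survivor_count b t = survivor_count b s + (t - s)"
  using assms unfolding clean_def by (intro survivor_count_clean) auto

lemma clean_reads:
  assumes "clean c b" "reads y x b" and s: "c \<le> s + 3 * m" "s \<le> c + 3 * m" "s < n"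
    and t: "int c - 3 * int m \<le> int s + t" "int s + t \<le> int c + 3 * int m" "0 \<le> int s + t" "int s + t < int n"
  shows "y (int (survivor_count b s) + t) = X (int s + t)"
proof -
  define i where "i = nat (int s + t)"
  have i: "int i = int s + t" using t by (simp add: i_def)
  have ib: "b ! i" using assms(1) t i unfolding clean_def by simp
  have "int (survivor_count b i) = int (survivor_count b s) + t"
  proof (cases "s \<le> i")
    case True
    then show ?thesis using clean_count[OF assms(1), of s i] s t i by simp
  next
    case False
    then show ?thesis using clean_count[OF assms(1), of i s] s t i by simp
  qed
  then show ?thesis using readsD[OF assms(2) _ ib] i t by simp
qed

lemma clean_pos:
  assumes "clean e b"
  shows "pos b = int (survivor_count b e)"
proof -
  have "b ! e" using assms size unfolding clean_def by auto
  then show ?thesis unfolding pos_def by (simp add: survivor_count_Suc)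
qed

lemma typicalD: "typical b \<Longrightarrow> t \<le> n \<Longrightarrow> \<bar>real (survivor_count b t) - (1 - \<delta>) * t\<bar> \<le> g"
  unfolding typical_def by blast

lemma typical_pos: "typical b \<Longrightarrow> \<bar>of_int (pos b) + 1 - (1 - \<delta>) * (e + 1)\<bar> \<le> g"
  using typicalD[of b "e + 1"] size unfolding pos_def by simp

text \<open>The origin of \<open>q = 2 * g\<close>: each of the two images deviates by at most
  \<open>g\<close> from the same value.\<close>

lemma pos_close: "typical b \<Longrightarrow> typical b' \<Longrightarrow> \<bar>pos b - pos b'\<bar> \<le> int q"
  using typical_pos[of b] typical_pos[of b'] unfolding q by (simp add: abs_le_iff)

lemma scale_bound: "\<bar>(1 - \<delta>) * (a::real)\<bar> \<le> B \<Longrightarrow> \<bar>a\<bar> \<le> 2 * B"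
proof -
  assume "\<bar>(1 - \<delta>) * a\<bar> \<le> B"
  moreover have "(1 / 2) * \<bar>a\<bar> \<le> (1 - \<delta>) * \<bar>a\<bar>" using \<delta> by (intro mult_right_mono) auto
  ultimately show ?thesis using \<delta> by (simp add: abs_mult)
qed

lemma good_window:
  assumes "clean e b" "reads y x b" "- 2 * int m \<le> t" "t \<le> 2 * int m"
  shows "y (pos b + t) = X (int e + t)"
  unfolding clean_pos[OF assms(1)] using r size assms by (intro clean_reads) auto

lemma windowD:
  assumes "window_match Y m i z j l" "- int m < t" "t \<le> int m"
  shows "Y i (z + t) = Y j (l + t)"
  using assms(1)[unfolded window_match_def, rule_format, of "t + int m - 1"] assms(2,3)
  by (simp add: algebra_simps)

lemma windowI:
  assumes "\<And>t. - int m < t \<Longrightarrow> t \<le> int m \<Longrightarrow> Y i (z + t) = Y j (l + t)"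
  shows "window_match Y m i z j l"
  unfolding window_match_def
proof
  fix t assume "t \<in> {0..<2 * int m}"
  then show "Y i (z + 1 - int m + t) = Y j (l + 1 - int m + t)"
    using assms[of "t + 1 - int m"] by (simp add: algebra_simps)
qed

lemma window_mono: "window_match Y m i z j l \<longleftrightarrow> (\<forall>t. - int m < t \<and> t \<le> int m \<longrightarrow> Y i (z + t) = Y j (l + t))"
  using windowD windowI by blast

text \<open>An accepted window occurs in a trace that is undamaged around its source and around the
  end. There it is a substring of \<open>x\<close>, and the only place in reach where
  \<open>x\<close> has the period and then leaves it is the end. Stopping at the first accepted
  location supplies the upper bound \<open>l \<le> pos b'\<close>.\<close>

lemma accepted_sound:
  assumes N: "0 < N" and rows: "\<And>i. i < N \<Longrightarrow> reads (Y (int i)) x (bs i)"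
    and many: "\<And>c. c < n \<Longrightarrow> 9 * N \<le> 10 * card {i. i < N \<and> good c (bs i)}"
    and acc: "accepted Y m k q N j l"
    and low: "(1 - \<delta>) * r + 3 * q + 4 \<le> of_int l"
    and high: "typical b'" "l \<le> pos b'"
  obtains i where "i < N" "good e (bs i)" "\<bar>l - pos (bs i)\<bar> \<le> int q"
    "\<And>t. - int m < t \<Longrightarrow> t \<le> int m \<Longrightarrow> Y j (l + t) = X (int e + t)"
proof -
  \<comment> \<open>The source expected for \<open>l\<close>. The location is chosen depending on
    the traces, so \<open>many\<close> must hold for all \<open>c\<close> simultaneously; it is
    applied to this one.\<close>
  define c where "c = nat \<lfloor>of_int l / (1 - \<delta>)\<rfloor>"
  have d0: "0 < 1 - \<delta>" using \<delta> by simp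
  have r0: "0 \<le> (1 - \<delta>) * r" using d0 by simp
  have l0: "0 \<le> real_of_int l" using low r0 by linarith
  have c: "real c \<le> of_int l / (1 - \<delta>)" "of_int l / (1 - \<delta>) < real c + 1"
  proof -
    have "0 \<le> of_int l / (1 - \<delta>)" using l0 d0 by simp
    then have "real c = of_int \<lfloor>of_int l / (1 - \<delta>)\<rfloor>" unfolding c_def by simp
    then show "real c \<le> of_int l / (1 - \<delta>)" "of_int l / (1 - \<delta>) < real c + 1" by linarith+
  qed
  have cl: "(1 - \<delta>) * c \<le> l" "l < (1 - \<delta>) * c + 1"
  proof -
    show "(1 - \<delta>) * c \<le> l" using c(1) d0 by (simp add: pos_le_divide_eq mult.commute)
    have "real_of_int l < (real c + 1) * (1 - \<delta>)" using c(2) d0 by (simp add: pos_divide_less_eq)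
    then show "l < (1 - \<delta>) * c + 1" using \<delta>(1) unfolding distrib_right by (simp add: mult.commute)
  qed
  have hi: "real_of_int l \<le> (1 - \<delta>) * (e + 1) + g - 1"
    using typical_pos[OF high(1)] high(2) by (simp add: abs_le_iff)
  have "(1 - \<delta>) * (real c - e - 1) \<le> g" using cl(1) hi by (simp add: algebra_simps)
  then have ce: "c \<le> e + 1 + 2 * g"
    using mult_right_mono[of "1/2" "1 - \<delta>" "real c - e - 1"] \<delta> by (cases "real c - e - 1 \<ge> 0") auto
  have cn: "c < n" using ce size small q by linarith
  have en: "e < n" using size by simp
  let ?A = "{i. i < N \<and> (\<exists>z\<in>{l - int q..l + int q}. window_match Y m (int i) z j l)}"
  have "bij_betw int ?A {i\<in>{0..<int N}. \<exists>z\<in>{l - int q..l + int q}. window_match Y m i z j l}"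
    by (rule bij_betwI[where g = nat]) auto
  then have "card ?A = card {i\<in>{0..<int N}. \<exists>z\<in>{l - int q..l + int q}. window_match Y m i z j l}"
    by (rule bij_betw_same_card)
  then have A: "N < 2 * card ?A" using acc unfolding accepted_def by simp
  \<comment> \<open>More than half of the given traces contain the window near \<open>l\<close>, and
    nine tenths each are good at \<open>c\<close> and at \<open>e\<close>.\<close>
  have "?A \<inter> {i. i < N \<and> good c (bs i)} \<inter> {i. i < N \<and> good e (bs i)} \<noteq> {}"
  proof (rule card3_inter[of "{..<N}"])
    show "2 * card {..<N} < card ?A + card {i. i < N \<and> good c (bs i)} + card {i. i < N \<and> good e (bs i)}"
      using A many[OF cn] many[OF en] by simp
  qed auto
  then obtain i z where i: "i < N" "good c (bs i)" "good e (bs i)"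
    and z: "l - int q \<le> z" "z \<le> l + int q" and w: "window_match Y m (int i) z j l" by auto
  define b where "b = bs i"
  have tb: "typical b" and cc: "clean c b" and cle: "clean e b" using i unfolding good_def b_def by auto
  have R: "reads (Y (int i)) x b" using rows[OF i(1)] by (simp add: b_def)
  have z0: "0 \<le> z" using z(1) low r0 by linarith
  have posb: "pos b = int (survivor_count b e)" by (rule clean_pos[OF cle])
  have zp: "z \<le> pos b + 2 * int q" using z(2) high(2) pos_close[OF high(1) tb] by linarith
  \<comment> \<open>Around the end this trace is intact, so a location at most \<open>2 * q\<close>
    behind the image of \<open>e\<close> has a source at most \<open>2 * q\<close> behind
    \<open>e\<close>.\<close>
  have c1: "survivor_count b (e + 2 * q + 1) = survivor_count b e + (2 * q + 1)"
    using clean_count[OF cle, of e "e + 2 * q + 1"] small size by simp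
  have "nat z < survivor_count b (e + 2 * q + 1)" using zp z0 c1 posb by linarith
  then obtain s where s: "s < e + 2 * q + 1" "b ! s" "int (survivor_count b s) = z"
  proof -
    obtain s where "s < e + 2 * q + 1" "b ! s" "survivor_count b s = nat z"
      using survivor_count_source[OF \<open>nat z < _\<close>] by blast
    then show ?thesis using that z0 by simp
  qed
  have sn: "s \<le> n" using s(1) small size by linarith
  have s1: "\<bar>of_int z - (1 - \<delta>) * s\<bar> \<le> g" using typicalD[OF tb sn] s(3) by (metis of_int_of_nat_eq)
  have "(1 - \<delta>) * r < (1 - \<delta>) * s" using s1 z(1) low q by linarith
  then have rs: "r < s" using d0 by simp
  have "\<bar>(1 - \<delta>) * (real s - real c)\<bar> \<le> g + q + 1"
    using s1 cl z unfolding right_diff_distrib abs_le_iff by linarith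
  from scale_bound[OF this] have sc: "\<bar>real s - real c\<bar> \<le> 2 * (real g + q + 1)" by simp
  have "2 * g + 2 * q + 2 \<le> m" using small q by linarith
  then have "real (2 * g + 2 * q + 2) \<le> real m" by (rule of_nat_mono)
  then have "\<bar>real s - real c\<bar> \<le> real m" using sc by simp
  then have sc': "s \<le> c + m" "c \<le> s + m" by linarith+
  have win: "Y (int i) (z + t) = X (int s + t)" if "- int m < t" "t \<le> int m" for t
    unfolding s(3)[symmetric]
    by (rule clean_reads[OF cc R]) (use that sc' rs r s(1) small size in linarith)+
  have win': "Y j (l + t) = X (int s + t)" if "- int m < t" "t \<le> int m" for t
    using win[OF that] windowD[OF w that] by simp
  have brk: "X (int s + 1) \<noteq> X (int s + 1 - int k)"
  proof -
    have "Y j (l + 1) \<noteq> Y j (l + 1 - int k)" using acc unfolding accepted_def break_window_def by blast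
    then show ?thesis using win'[of 1] win'[of "1 - int k"] small by (simp add: algebra_simps)
  qed
  \<comment> \<open>Behind \<open>r\<close> the period holds up to \<open>e\<close>, so a break
    after \<open>s\<close> forces \<open>e \<le> s\<close>. If \<open>s\<close> were larger, the
    true break after \<open>e\<close> would be among the comparisons before the centre, where the
    window has been found periodic.\<close>
  have "e \<le> s" using X_periodic[of "int s + 1"] brk rs small by linarith
  moreover have "\<not> e < s"
  proof
    assume es: "e < s"
    define t where "t = int s - int e - 1"
    have t: "0 \<le> t" "t < int m - int k" using es s(1) small by (simp_all add: t_def)
    have "Y j (l - t) = Y j (l - t - int k)"
      using acc t unfolding accepted_def break_window_def by auto
    then have "X (int s - t) = X (int s - t - int k)"
      using win'[of "- t"] win'[of "- t - int k"] t k by (simp add: algebra_simps)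
    then show False using X_break by (simp add: t_def)
  qed
  ultimately have se: "s = e" by simp
  show ?thesis
  proof (rule that)
    show "i < N" "good e (bs i)" using i by auto
    show "\<bar>l - pos (bs i)\<bar> \<le> int q" using z posb s(3) se unfolding b_def by simp
  qed (use win' se in simp)
qed

text \<open>All good traces show the same part of \<open>x\<close> around their images of
  \<open>e\<close>. Hence their windows match each other at locations that differ by at most
  \<open>q\<close>.\<close>

lemma accepted_complete:
  assumes rows: "\<And>i. i < N \<Longrightarrow> reads (Y (int i)) x (bs i)"
    and many: "N < 2 * card {i. i < N \<and> good e (bs i)}"
    and j: "j < N" "good e (bs j)"
  shows "accepted Y m k q N (int j) (pos (bs j))"
proof -
  have w: "Y (int i) (pos (bs i) + t) = X (int e + t)" if "i < N" "good e (bs i)" "- 2 * int m \<le> t" "t \<le> 2 * int m" for i t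
    using good_window[OF _ rows] that unfolding good_def by blast
  have "break_window Y m k (int j) (pos (bs j))"
    unfolding break_window_def
  proof (intro conjI ballI)
    fix t assume t: "t \<in> {0..<int m - int k}"
    have "Y (int j) (pos (bs j) + (- t)) = Y (int j) (pos (bs j) + (- t - int k))"
      unfolding w[OF j, of "- t", simplified] using t w[OF j, of "- t"] w[OF j, of "- t - int k"] X_periodic[of "int e - t"] r by (simp add: algebra_simps)
    then show "Y (int j) (pos (bs j) - t) = Y (int j) (pos (bs j) - t - int k)" by (simp add: algebra_simps)
  next
    show "Y (int j) (pos (bs j) + 1) \<noteq> Y (int j) (pos (bs j) + 1 - int k)"
      using w[OF j, of 1] w[OF j, of "1 - int k"] X_break small by (simp add: algebra_simps)
  qed
  moreover have "card {i. i < N \<and> good e (bs i)} \<le>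
    card {i\<in>{0..<int N}. \<exists>z\<in>{pos (bs j) - int q..pos (bs j) + int q}. window_match Y m i z (int j) (pos (bs j))}"
  proof (rule card_inj_on_le[of int])
    show "int ` {i. i < N \<and> good e (bs i)} \<subseteq>
      {i\<in>{0..<int N}. \<exists>z\<in>{pos (bs j) - int q..pos (bs j) + int q}. window_match Y m i z (int j) (pos (bs j))}"
    proof clarify
      fix i assume i: "i < N" "good e (bs i)"
      have "window_match Y m (int i) (pos (bs i)) (int j) (pos (bs j))"
        by (rule windowI) (simp add: w[OF i] w[OF j])
      moreover have "\<bar>pos (bs i) - pos (bs j)\<bar> \<le> int q" using pos_close i j unfolding good_def by blast
      ultimately show "int i \<in> {0..<int N} \<and>
         (\<exists>z\<in>{pos (bs j) - int q..pos (bs j) + int q}. window_match Y m (int i) z (int j) (pos (bs j)))"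
        using i(1) by (auto intro!: bexI[of _ "pos (bs i)"])
    qed
  qed (auto intro!: finite_subset[of _ "{0..<int N}"])
  ultimately show ?thesis using many unfolding accepted_def by linarith
qed

text \<open>The image of the end in any good trace lies in the searched range and is accepted there.
  The search therefore stops no later, as \<open>accepted_sound\<close> requires.\<close>

lemma search_correct:
  assumes N: "0 < N" and rows: "\<And>i. i < N \<Longrightarrow> reads (Y (int i)) x (bs i)"
    and many: "\<And>c. c < n \<Longrightarrow> 9 * N \<le> 10 * card {i. i < N \<and> good c (bs i)}"
    and start: "(1 - \<delta>) * r + 3 * q + 4 \<le> of_int start" "of_int start \<le> (1 - \<delta>) * r + 3 * q + 6"
    and limit: "int e < limit"
    and l: "l = first_from start limit (\<lambda>l. \<exists>j\<in>{0..<int N}. accepted Y m k q N j l)"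
    and j: "j = first_from 0 (int N) (\<lambda>j. accepted Y m k q N j l)"
  obtains i where "i < N" "good e (bs i)" "\<bar>l - pos (bs i)\<bar> \<le> int q" "start \<le> l" "0 \<le> j"
    "\<And>t. - int m < t \<Longrightarrow> t \<le> int m \<Longrightarrow> Y j (l + t) = X (int e + t)"
proof -
  have en: "e < n" using size by simp
  have "card {i. i < N \<and> good e (bs i)} \<noteq> 0" using many[OF en] N by linarith
  then obtain j0 where j0: "j0 < N" "good e (bs j0)" by (metis (mono_tags, lifting) Collect_empty_eq card.empty)
  have acc0: "accepted Y m k q N (int j0) (pos (bs j0))"
    by (rule accepted_complete[where bs = bs]) (use many[OF en] N rows j0 in auto)
  have typ0: "typical (bs j0)" using j0 unfolding good_def by simp
  have "survivor_count (bs j0) (e + 1) \<le> e + 1" using survivor_count_le[of 0 "e + 1" "bs j0"] by simp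
  then have p1: "pos (bs j0) < limit" using limit unfolding pos_def by linarith
  \<comment> \<open>At least \<open>m\<close> bits separate \<open>r\<close> from \<open>e\<close>.
    At least half of this distance remains in the trace on average, which outweighs the margin in
    \<open>start\<close> and the deviation \<open>g\<close>.\<close>
  have "(1 - \<delta>) * (r + m + 1) \<le> (1 - \<delta>) * (e + 1)" using r \<delta> by (intro mult_left_mono) auto
  also have "(1 - \<delta>) * (r + m + 1) = (1 - \<delta>) * r + (1 - \<delta>) * (real m + 1)" by (simp add: algebra_simps)
  finally have up: "(1 - \<delta>) * r + (1 - \<delta>) * (real m + 1) \<le> (1 - \<delta>) * (e + 1)" by simp
  have half: "(1/2) * (real m + 1) \<le> (1 - \<delta>) * (real m + 1)" using \<delta> by (intro mult_right_mono) auto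
  define Q where "Q = (1 - \<delta>) * real (e + 1)"
  have "(1 - \<delta>) * r + (real m + 1) / 2 \<le> Q" using half up unfolding Q_def by linarith
  then have "(1 - \<delta>) * r + real m / 2 \<le> real_of_int (pos (bs j0)) + 1 + real g"
    using typical_pos[OF typ0] unfolding Q_def[symmetric] by (simp add: abs_le_iff add_divide_distrib)
  then have "real_of_int start \<le> of_int (pos (bs j0))" using start(2) small q by linarith
  then have p0: "start \<le> pos (bs j0)" by simp
  have le: "l \<le> pos (bs j0)"
  proof (rule ccontr)
    assume "\<not> l \<le> pos (bs j0)"
    then have "\<not> (\<exists>j\<in>{0..<int N}. accepted Y m k q N j (pos (bs j0)))"
      using first_from_least[OF p0, of limit "\<lambda>l. \<exists>j\<in>{0..<int N}. accepted Y m k q N j l"] l by simp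
    then show False using acc0 j0 by auto
  qed
  then have "l < limit" using p1 by simp
  then have ex: "\<exists>j\<in>{0..<int N}. accepted Y m k q N j l"
    using first_from_stop[of limit start "\<lambda>l. \<exists>j\<in>{0..<int N}. accepted Y m k q N j l"] l by simp
  then have "j < int N" unfolding j by (simp add: first_from_less)
  then have acc: "accepted Y m k q N j l"
    using first_from_stop[of "int N" 0 "\<lambda>j. accepted Y m k q N j l"] j by simp
  have sl: "start \<le> l" unfolding l by (rule first_from_ge)
  have "(1 - \<delta>) * r + 3 * q + 4 \<le> of_int l" using start(1) sl by linarith
  from accepted_sound[OF N rows many acc this typ0 le] obtain i where
    "i < N" "good e (bs i)" "\<bar>l - pos (bs i)\<bar> \<le> int q"
    "\<And>t. - int m < t \<Longrightarrow> t \<le> int m \<Longrightarrow> Y j (l + t) = X (int e + t)" by blast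
  moreover have "0 \<le> j" unfolding j by (rule first_from_ge)
  ultimately show ?thesis using that sl by blast
qed

end

subsection \<open>False matches\<close>

context desert_traces
begin

text \<open>The source is cut here, \<open>2 * m\<close> bits before the place of the break. Damage
  to the window comes from behind the cut, while the fluctuation that is averaged comes from before
  it.\<close>

definition a :: nat where
  "a = e + 1 - 2 * m"

text \<open>The possible displacements of a false match to the left. A searched location is within
  \<open>3 * q\<close> of the accepted one, which is within \<open>2 * q\<close> of the image of the
  end; this gives \<open>5 * q\<close>. Each of at most \<open>J\<close> deletions accounts for at
  most \<open>k\<close> breaks of the period, whence \<open>k * J\<close>.\<close>

definition offsets :: "nat set" where
  "offsets = {D. 1 \<le> D \<and> D \<le> 5 * q \<and> X (int e + 1 + int D) \<noteq> X (int e + 1 + int D - int k) \<and>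
     card {t. t < D \<and> X (int e + 1 + int t) \<noteq> X (int e + 1 + int t - int k)} \<le> k * J}"

text \<open>
  A match of the window at a wrong place forces a deletion at one of boundedly many positions: if the
  match is \<open>D\<close> places too far left, then the true end of the desert, where the trace breaks the
  period, shows that \<open>x\<close> also breaks the period \<open>D\<close> places after \<open>e\<close>. The breaks of the trace
  before that all come from the at most \<open>J\<close> deletions, so only the first few breaks qualify.
\<close>

definition fragile :: "nat set" where
  "fragile = {e + 1 - k..e + 1} \<union> (\<Union>D\<in>offsets. {e + 1 - D - k - J..e + 1 - D})"

text \<open>Weaker than \<open>good e\<close>: deletions near the end are tolerated if they are few
  and hit no fragile position. Irregular traces are so rare that their total error, up to about
  \<open>6 * q\<close> each, is negligible.\<close>

definition regular :: "bool list \<Rightarrow> bool" where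
  "regular b \<longleftrightarrow> typical b \<and> (\<forall>i\<in>fragile. b ! i) \<and> card {i\<in>{a..<a + 4 * m}. \<not> b ! i} \<le> J"

lemma a: "a + 2 * m = e + 1" "r + 1 \<le> a + m" "1 \<le> a"
  using r unfolding a_def by auto

text \<open>Each element is itself a break, so the number of preceding breaks strictly increases
  along the set, and it is at most \<open>k * J\<close>. The point is that the growing length
  \<open>5 * q\<close> of the range does not enter.\<close>

lemma card_offsets: "card offsets \<le> k * J + 1"
proof -
  define h where "h D = card {t. t < D \<and> X (int e + 1 + int t) \<noteq> X (int e + 1 + int t - int k)}" for D
  have less: "h D < h D'" if "D \<in> offsets" "D < D'" for D D'
    unfolding h_def by (rule psubset_card_mono) (use that in \<open>auto simp: offsets_def\<close>)
  have "inj_on h offsets"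
    by (rule inj_onI) (metis less less_irrefl linorder_neqE_nat)
  then have "card offsets \<le> card {0..k * J}"
    by (rule card_inj_on_le) (auto simp: offsets_def h_def)
  then show ?thesis by simp
qed

lemma finite_offsets: "finite offsets"
  by (rule finite_subset[of _ "{..5 * q}"]) (auto simp: offsets_def)

lemma card_fragile: "card fragile \<le> (k + 2) + (k * J + 1) * (k + J + 1)"
proof -
  have "card (\<Union>D\<in>offsets. {e + 1 - D - k - J..e + 1 - D}) \<le> (\<Sum>D\<in>offsets. card {e + 1 - D - k - J..e + 1 - D})"
    by (rule card_UN_le[OF finite_offsets])
  also have "\<dots> \<le> (\<Sum>D\<in>offsets. k + J + 1)" by (rule sum_mono) auto
  also have "\<dots> \<le> (k * J + 1) * (k + J + 1)"
    unfolding sum_constant of_nat_id using card_offsets by (rule mult_right_mono) simp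
  finally have "card (\<Union>D\<in>offsets. {e + 1 - D - k - J..e + 1 - D}) \<le> (k * J + 1) * (k + J + 1)" .
  moreover have "card {e + 1 - k..e + 1} \<le> k + 2" by auto
  ultimately show ?thesis unfolding fragile_def
    using card_Un_le[of "{e + 1 - k..e + 1}" "\<Union>D\<in>offsets. {e + 1 - D - k - J..e + 1 - D}"] by linarith
qed

lemma fragile_range: "i \<in> fragile \<Longrightarrow> a \<le> i \<and> i \<le> e + 1"
  unfolding fragile_def offsets_def using a(1) small by auto

lemma regular_dels:
  assumes "regular b" "a \<le> s" "s \<le> t" "t \<le> a + 4 * m"
  shows "survivor_count b s + (t - s) \<le> survivor_count b t + J"
proof -
  have "card {i\<in>{s..<s + (t - s)}. \<not> b ! i} \<le> card {i\<in>{a..<a + 4 * m}. \<not> b ! i}"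
    by (rule card_mono) (use assms in auto)
  then show ?thesis
    using survivor_count_add[of b s "t - s"] assms unfolding regular_def by simp
qed

lemma regular_near:
  assumes "regular b" "e + 1 - k \<le> i" "i \<le> e + 1"
  shows "b ! i"
  using assms unfolding regular_def fragile_def by auto

lemma regular_pos: "regular b \<Longrightarrow> pos b = int (survivor_count b e)"
  using regular_near[of b e] k unfolding pos_def by (simp add: survivor_count_Suc)

text \<open>With at most \<open>J\<close> deletions nearby, \<open>D\<close> steps back in the trace
  correspond to between \<open>D\<close> and \<open>D + J\<close> steps back in
  \<open>x\<close>.\<close>

lemma source_before:
  assumes b: "regular b" and D: "D + J + 1 \<le> 2 * m"
  shows "\<exists>s. b ! s \<and> survivor_count b s + D = survivor_count b e \<and> e \<le> s + D + J \<and> s + D \<le> e"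
proof (cases "D = 0")
  case True
  then show ?thesis using regular_near[OF b, of e] k by (intro exI[of _ e]) auto
next
  case False
  have "survivor_count b (e - D - J) + (D + J) \<le> survivor_count b e + J"
    using regular_dels[OF b, of "e - D - J" e] D a by (simp add: a_def)
  then have 1: "survivor_count b (e - D - J) + D \<le> survivor_count b e" by linarith
  then obtain s where s: "s < e" "b ! s" "survivor_count b s = survivor_count b e - D"
    using survivor_count_source[of "survivor_count b e - D" b e] False by auto
  have eq: "survivor_count b s + D = survivor_count b e" using s(3) 1 by linarith
  have "e \<le> s + D + J"
  proof (rule ccontr)
    assume "\<not> e \<le> s + D + J"
    then have "survivor_count b s < survivor_count b (e - D - J)" by (intro survivor_count_less[OF s(2)]) simp
    then show False using 1 eq by linarith
  qed
  moreover have "s + D \<le> e" using survivor_count_le[of s e b] s(1) eq by linarith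
  ultimately show ?thesis using s eq by blast
qed

text \<open>Without a deletion in between, two bits at trace distance \<open>k\<close> have sources
  at distance \<open>k\<close>, and the period of \<open>x\<close> makes them equal.\<close>

lemma deletion_between:
  assumes R: "reads y x b" and s: "b ! s" "b ! s'" "s' < s" "s \<le> e" "r \<le> s' + m"
    and c: "survivor_count b s = survivor_count b s' + k" and ne: "y (int (survivor_count b s)) \<noteq> y (int (survivor_count b s'))"
  shows "\<exists>d. s' < d \<and> d < s \<and> \<not> b ! d"
proof (rule ccontr)
  assume no: "\<not> ?thesis"
  have "survivor_count b s = survivor_count b s' + (s - s')"
  proof (rule survivor_count_clean)
    fix i assume "s' \<le> i" "i < s"
    then show "b ! i" using no s(2) by (cases "i = s'") auto
  qed (use s in simp)
  then have "s = s' + k" using c s(3) by linarith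
  then have "X (int s) = X (int s')" using X_periodic[of "int s"] s(4,5) by simp
  moreover have "y (int (survivor_count b s)) = X (int s)" "y (int (survivor_count b s')) = X (int s')"
    by (rule readsD[OF R]; use s size in simp)+
  ultimately show False using ne by simp
qed

text \<open>The deletion is located twice: in \<open>x\<close>, to show that it hits a fragile
  position, and in the trace, to count how many breaks it can cause.\<close>

lemma break_deletion:
  assumes b: "regular b" and R: "reads y x b" and D: "D \<le> 5 * q"
    and ne: "y (pos b - int D) \<noteq> y (pos b - int D - int k)"
  obtains d where "\<not> b ! d" "e \<le> d + D + k + J" "d + D \<le> e"
    "pos b - int D - int k < int (survivor_count b d)" "int (survivor_count b d) \<le> pos b - int D"
proof -
  obtain s where s: "b ! s" "survivor_count b s + D = survivor_count b e" "e \<le> s + D + J" "s + D \<le> e"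
    using source_before[OF b, of D] D small by auto
  obtain s' where s': "b ! s'" "survivor_count b s' + (D + k) = survivor_count b e" "e \<le> s' + (D + k) + J" "s' + (D + k) \<le> e"
    using source_before[OF b, of "D + k"] D small by auto
  have p: "pos b - int D = int (survivor_count b s)" "pos b - int D - int k = int (survivor_count b s')"
    using regular_pos[OF b] s(2) s'(2) by simp_all
  have lt: "s' < s" using survivor_count_mono[of s s' b] s(2) s'(2) k by linarith
  obtain d where d: "s' < d" "d < s" "\<not> b ! d"
  proof -
    have "r \<le> s' + m" using s'(3) D small r by linarith
    moreover have "s \<le> e" using s(4) by linarith
    moreover have "survivor_count b s = survivor_count b s' + k" using s(2) s'(2) by linarith
    moreover have "y (int (survivor_count b s)) \<noteq> y (int (survivor_count b s'))"
      using ne unfolding p[symmetric] by simp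
    ultimately have "\<exists>d>s'. d < s \<and> \<not> b ! d" by (intro deletion_between[OF R s(1) s'(1) lt])
    then show ?thesis using that by blast
  qed
  have "survivor_count b s' < survivor_count b d" by (rule survivor_count_less[OF s'(1) d(1)])
  moreover have "survivor_count b d \<le> survivor_count b s" using survivor_count_mono[of d s b] d(2) by simp
  ultimately show ?thesis
    by (intro that[OF d(3)]) (use p d s s' in linarith)+
qed

lemma card_image_fibres:
  assumes "finite Q" "P \<subseteq> {p. \<exists>d\<in>Q. f d \<le> p \<and> p < f d + int k}"
  shows "card P \<le> k * card Q"
proof -
  have "P \<subseteq> (\<Union>d\<in>Q. {f d..<f d + int k})" using assms(2) by auto
  then have "card P \<le> card (\<Union>d\<in>Q. {f d..<f d + int k})" by (rule card_mono[rotated]) (use assms(1) in auto)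
  also have "\<dots> \<le> (\<Sum>d\<in>Q. card {f d..<f d + int k})" by (rule card_UN_le[OF assms(1)])
  also have "\<dots> = k * card Q" by simp
  finally show ?thesis .
qed

text \<open>Compare where the trace breaks the period with where the window, copied from
  \<open>x\<close>, does. A shift to the right contradicts the period before \<open>e\<close>; a
  shift to the left forces a deletion at a fragile position.\<close>

lemma regular_match:
  assumes b: "regular b" and R: "reads y x b" and z: "\<bar>z - pos b\<bar> \<le> 5 * int q"
    and w: "\<And>t. - int m < t \<Longrightarrow> t \<le> int m \<Longrightarrow> y (z + t) = X (int e + t)"
  shows "z = pos b"
proof -
  have posb: "pos b = int (survivor_count b e)" by (rule regular_pos[OF b])
  have c0: "survivor_count b e = survivor_count b (e + 1 - k) + (k - 1)"
    using survivor_count_clean[of "e + 1 - k" e b] regular_near[OF b] k small r by simp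
  have e1: "y (pos b + 1) = X (int e + 1)"
    using readsD[OF R, of "e + 1"] regular_near[OF b, of "e + 1"] size unfolding pos_def
    using posb[unfolded pos_def] by (simp add: survivor_count_Suc algebra_simps)
  have ek: "y (pos b + 1 - int k) = X (int e + 1 - int k)"
  proof -
    have "int (e + 1 - k) = int e + 1 - int k" using small r k by simp
    moreover have "int (survivor_count b (e + 1 - k)) = pos b + 1 - int k" using c0 posb k by simp
    moreover have "y (int (survivor_count b (e + 1 - k))) = X (int (e + 1 - k))"
      by (rule readsD[OF R]) (use regular_near[OF b, of "e + 1 - k"] size in auto)
    ultimately show ?thesis by simp
  qed
  have ybreak: "y (pos b + 1) \<noteq> y (pos b + 1 - int k)" unfolding e1 ek by (rule X_break)
  \<comment> \<open>A match to the right would place the break of the trace after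
    \<open>pos b\<close> into the part of the window up to its centre, where \<open>x\<close> has
    period \<open>k\<close>.\<close>
  have "\<not> pos b < z"
  proof
    assume "pos b < z"
    define d where "d = z - pos b"
    have d: "1 \<le> d" "d \<le> 5 * int q" using \<open>pos b < z\<close> z by (simp_all add: d_def)
    have "y (pos b + 1) = X (int e + (1 - d))" "y (pos b + 1 - int k) = X (int e + (1 - d - int k))"
      using w[of "1 - d"] w[of "1 - d - int k"] d small by (simp_all add: d_def algebra_simps)
    moreover have "X (int e + (1 - d)) = X (int e + (1 - d) - int k)"
      by (rule X_periodic) (use d small r in linarith)+
    ultimately show False using ybreak by (simp add: algebra_simps)
  qed
  moreover have "\<not> z < pos b"
  proof
    assume "z < pos b"
    define D where "D = nat (pos b - z)"
    have D: "1 \<le> D" "D \<le> 5 * q" "z = pos b - int D" using \<open>z < pos b\<close> z by (auto simp: D_def)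
    have wD: "X (int e + t) = y (pos b - int D + t)" if "- int m < t" "t \<le> int m" for t
      using w[OF that] D(3) by simp
    have "X (int e + (1 + int D)) \<noteq> X (int e + (1 + int D - int k))"
      using ybreak D small by (subst (1 2) wD) (auto simp: algebra_simps)
    then have xb: "X (int e + 1 + int D) \<noteq> X (int e + 1 + int D - int k)" by (simp add: algebra_simps)
    \<comment> \<open>The breaks of \<open>x\<close> after \<open>e\<close> that the match copies
      into the trace before its own image of the break. There the source is still periodic, so each
      copied break is due to a deletion.\<close>
    define B where "B = {t. t < D \<and> X (int e + 1 + int t) \<noteq> X (int e + 1 + int t - int k)}"
    have B: "\<exists>d. \<not> b ! d \<and> e + 1 + t \<le> d + D + k + J \<and> d \<le> e \<and> d + D \<le> e + 1 + t \<and>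
        pos b - int D + 1 + int t - int k < int (survivor_count b d) \<and> int (survivor_count b d) \<le> pos b - int D + 1 + int t"
      if "t \<in> B" for t
    proof -
      have t: "t < D" "X (int e + (1 + int t)) \<noteq> X (int e + (1 + int t - int k))"
        using that unfolding B_def by (simp_all add: algebra_simps)
      have le: "D - 1 - t \<le> 5 * q" using D by linarith
      have ne: "y (pos b - int (D - 1 - t)) \<noteq> y (pos b - int (D - 1 - t) - int k)"
        using t(2) wD[of "1 + int t"] wD[of "1 + int t - int k"] t(1) D(2) small by (simp add: of_nat_diff algebra_simps)
      then obtain d where "\<not> b ! d" "e \<le> d + (D - 1 - t) + k + J" "d + (D - 1 - t) \<le> e"
        "pos b - int (D - 1 - t) - int k < int (survivor_count b d)" "int (survivor_count b d) \<le> pos b - int (D - 1 - t)"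
        using break_deletion[OF b R le ne] by blast
      then show ?thesis using t(1) by (intro exI[of _ d]) auto
    qed
    let ?Q = "{d\<in>{a..<a + 4 * m}. \<not> b ! d}"
    have "card ((\<lambda>t. pos b - int D + 1 + int t) ` B) \<le> k * card ?Q"
    proof (rule card_image_fibres[where f = "\<lambda>d. int (survivor_count b d)"])
      show "(\<lambda>t. pos b - int D + 1 + int t) ` B
          \<subseteq> {p. \<exists>d\<in>?Q. int (survivor_count b d) \<le> p \<and> p < int (survivor_count b d) + int k}"
      proof clarify
        fix t assume "t \<in> B"
        from B[OF this] obtain d where d: "\<not> b ! d" "e + 1 + t \<le> d + D + k + J" "d \<le> e"
          "pos b - int D + 1 + int t - int k < int (survivor_count b d)" "int (survivor_count b d) \<le> pos b - int D + 1 + int t"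
          by blast
        have "d \<in> ?Q" using d D(2) small a(1) by auto
        then show "\<exists>d\<in>?Q. int (survivor_count b d) \<le> pos b - int D + 1 + int t \<and>
            pos b - int D + 1 + int t < int (survivor_count b d) + int k"
          using d by (intro bexI[of _ d]) auto
      qed
    qed simp
    also have "\<dots> \<le> k * J" using b unfolding regular_def by simp
    finally have "card B \<le> k * J" by (subst (asm) card_image) (auto simp: inj_on_def)
    then have off: "D \<in> offsets" using D xb unfolding offsets_def B_def by simp
    \<comment> \<open>The break of \<open>x\<close> directly after \<open>e\<close> is one of those
      copied. The place of the deletion behind it is known up to \<open>k + J\<close> positions from
      \<open>D\<close> alone, which is how the intervals in \<open>fragile\<close> arise.\<close>
    have "0 \<in> B" using D(1) X_break unfolding B_def by simp
    from B[OF this] obtain d where "\<not> b ! d" "e + 1 \<le> d + D + k + J" "d + D \<le> e + 1" by auto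
    moreover from this have "d \<in> {e + 1 - D - k - J..e + 1 - D}" by auto
    then have "d \<in> fragile" using off unfolding fragile_def by blast
    ultimately show False using b unfolding regular_def by blast
  qed
  ultimately show ?thesis by simp
qed

definition shows_end :: "(int \<Rightarrow> int) \<Rightarrow> bool list \<Rightarrow> bool" where
  "shows_end y b \<longleftrightarrow> (\<forall>t. - int m < t \<and> t \<le> int m \<longrightarrow> y (pos b + t) = X (int e + t))"

text \<open>For a regular trace the search can only return the true image. A damaged window makes
  the trace drop out of the average instead of distorting it.\<close>

lemma result_regular:
  assumes b: "regular b" and R: "reads (Y i) x b" and l: "\<bar>l - pos b\<bar> \<le> 2 * int q"
    and w: "\<And>t. - int m < t \<Longrightarrow> t \<le> int m \<Longrightarrow> Y j (l + t) = X (int e + t)"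
  shows "result Y m q j l i = (if shows_end (Y i) b then pos b else l + 3 * int q + 1)"
proof -
  have match: "window_match Y m i z j l \<longleftrightarrow> (\<forall>t. - int m < t \<and> t \<le> int m \<longrightarrow> Y i (z + t) = X (int e + t))" for z
    unfolding window_mono using w by simp
  have only: "z = pos b \<and> shows_end (Y i) b" if "l - 3 * int q \<le> z" "z \<le> l + 3 * int q" "window_match Y m i z j l" for z
  proof -
    have "z = pos b" by (rule regular_match[OF b R]) (use that l match in auto)
    then show ?thesis using that(3) unfolding match shows_end_def by simp
  qed
  show ?thesis unfolding result_def
  proof (rule first_from_eqI)
    show "l - 3 * int q \<le> (if shows_end (Y i) b then pos b else l + 3 * int q + 1)" using l by auto
    show "l + 3 * int q + 1 \<le> (if shows_end (Y i) b then pos b else l + 3 * int q + 1) \<or>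
        window_match Y m i (if shows_end (Y i) b then pos b else l + 3 * int q + 1) j l"
      unfolding match by (auto simp: shows_end_def)
    fix z assume z: "l - 3 * int q \<le> z" "z < (if shows_end (Y i) b then pos b else l + 3 * int q + 1)"
    then have "z \<le> l + 3 * int q" using l by (auto split: if_splits)
    then show "z < l + 3 * int q + 1 \<and> \<not> window_match Y m i z j l"
      using only[of z] z by auto
  qed
qed

lemma good_regular: "good e b \<Longrightarrow> regular b"
proof -
  assume g: "good e b"
  have c: "b ! i" if "i < n" "e \<le> i + 3 * m" "i \<le> e + 3 * m" for i
    using g that unfolding good_def clean_def by auto
  have "{i\<in>{a..<a + 4 * m}. \<not> b ! i} = {}" using c a size by auto
  moreover have "b ! i" if "i \<in> fragile" for i using fragile_range[OF that] c[of i] a size small by auto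
  ultimately show ?thesis using g unfolding regular_def good_def by (metis card.empty le0)
qed

lemma good_shows: "good e b \<Longrightarrow> reads y x b \<Longrightarrow> shows_end y b"
  unfolding shows_end_def good_def using good_window by auto

text \<open>The condition \<open>shows_end\<close> in terms of the deletions from \<open>a\<close>
  on alone, so that it becomes independent of the prefix.\<close>

definition marked :: "bool list \<Rightarrow> bool" where
  "marked f \<longleftrightarrow> (\<forall>t. - int m < t \<and> t \<le> int m \<longrightarrow>
     of_bool (trace_of (drop a x) f ! nat (int (survivor_count f (2 * m)) - 1 + t)) = X (int e + t))"

lemma shows_marked:
  assumes b: "regular b" and R: "reads y x b" and n: "length b = n"
  shows "shows_end y b \<longleftrightarrow> marked (drop a b)"
proof -
  have an: "a \<le> length b" using a size n by simp
  have s2: "survivor_count b (e + 1) = survivor_count b a + survivor_count (drop a b) (2 * m)"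
    using survivor_count_drop[OF an, of "2 * m"] a by simp
  have s4: "survivor_count b (a + 4 * m) = survivor_count b a + survivor_count (drop a b) (4 * m)"
    using survivor_count_drop[OF an, of "4 * m"] by simp
  have d2: "2 * m \<le> survivor_count (drop a b) (2 * m) + J"
    using regular_dels[OF b, of a "e + 1"] a s2 by simp
  have d4: "survivor_count (drop a b) (2 * m) + 2 * m \<le> survivor_count (drop a b) (4 * m) + J"
    using regular_dels[OF b, of "e + 1" "a + 4 * m"] a s2 s4 by simp
  have "y (pos b + t) = of_bool (trace_of (drop a x) (drop a b) ! nat (int (survivor_count (drop a b) (2 * m)) - 1 + t))"
    if t: "- int m < t" "t \<le> int m" for t
  proof -
    define p where "p = nat (int (survivor_count (drop a b) (2 * m)) - 1 + t)"
    have p: "int p = int (survivor_count (drop a b) (2 * m)) - 1 + t" using t d2 small unfolding p_def by linarith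
    have "p < survivor_count (drop a b) (4 * m)" using p t d4 small by linarith
    then have "y (int (survivor_count b a) + int p) = of_bool (trace_of (drop a x) (drop a b) ! p)"
      using reads_drop[OF R, of a p "4 * m"] n len a size by auto
    moreover have "pos b + t = int (survivor_count b a) + int p" unfolding pos_def s2 p by simp
    ultimately show ?thesis by (simp add: p_def)
  qed
  then show ?thesis unfolding shows_end_def marked_def by auto
qed

end

subsection \<open>The estimate of the end\<close>

context desert_traces
begin

text \<open>The expected image of \<open>e\<close> given that none of the \<open>2 * m\<close> bits
  from \<open>a\<close> to \<open>e\<close> is deleted.\<close>

definition \<mu> :: real where
  "\<mu> = (1 - \<delta>) * a + 2 * real m - 1"

definition local_event :: "bool list \<Rightarrow> bool" where
  "local_event f \<longleftrightarrow> marked f \<and> (\<forall>i\<in>fragile. f ! (i - a)) \<and> card {i. i < 4 * m \<and> \<not> f ! i} \<le> J"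

text \<open>
  The deviation of \<open>pos\<close> from its expectation without deletions near the end. It is the sum of a
  term that depends on the first \<open>a\<close> bits only and one that depends on the others, and so is the
  condition under which it counts. This keeps its mean small.
\<close>

definition score :: "bool list \<Rightarrow> real" where
  "score b = (if \<bar>real (survivor_count b a) - (1 - \<delta>) * a\<bar> \<le> g \<and> local_event (drop a b)
     then (real (survivor_count b a) - (1 - \<delta>) * a) + (real (survivor_count (drop a b) (2 * m)) - 2 * m) else 0)"

lemma card_drop:
  assumes "length b = n"
  shows "card {i. i < 4 * m \<and> \<not> drop a b ! i} = card {i\<in>{a..<a + 4 * m}. \<not> b ! i}"
proof (rule bij_betw_same_card)
  show "bij_betw (\<lambda>i. a + i) {i. i < 4 * m \<and> \<not> drop a b ! i} {i\<in>{a..<a + 4 * m}. \<not> b ! i}"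
    by (rule bij_betwI[where g = "\<lambda>i. i - a"]) (use assms a size in auto)
qed

lemma regular_local:
  assumes "regular b" "length b = n"
  shows "local_event (drop a b) \<longleftrightarrow> marked (drop a b)"
proof -
  have "drop a b ! (i - a)" if "i \<in> fragile" for i
    using that fragile_range[OF that] assms a size unfolding regular_def by simp
  then show ?thesis using assms card_drop[OF assms(2)] unfolding local_event_def regular_def by simp
qed

lemma pos_split:
  assumes "length b = n"
  shows "of_int (pos b) - \<mu> =
    (real (survivor_count b a) - (1 - \<delta>) * a) + (real (survivor_count (drop a b) (2 * m)) - 2 * m)"
proof -
  have "survivor_count b (e + 1) = survivor_count b a + survivor_count (drop a b) (2 * m)"
    using survivor_count_drop[of a b "2 * m"] a size assms by simp
  then show ?thesis unfolding pos_def \<mu>_def by simp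
qed

lemma score_regular:
  assumes "regular b" "length b = n" "reads y x b"
  shows "score b = (if shows_end y b then of_int (pos b) - \<mu> else 0)"
  using typicalD[of b a] a size assms(1) pos_split[OF assms(2)]
  unfolding score_def regular_local[OF assms(1,2)] shows_marked[OF assms(1,3,2)] by (auto simp: regular_def)

lemma local_offset:
  assumes "local_event f"
  shows "\<bar>real (survivor_count f (2 * m)) - 2 * m\<bar> \<le> J"
proof -
  have "card {i\<in>{0..<0 + 2 * m}. \<not> f ! i} \<le> card {i. i < 4 * m \<and> \<not> f ! i}"
    by (rule card_mono) auto
  then have "card {i\<in>{0..<0 + 2 * m}. \<not> f ! i} \<le> J" using assms unfolding local_event_def by linarith
  then have "2 * m \<le> survivor_count f (2 * m) + J" "survivor_count f (2 * m) \<le> 2 * m"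
    using survivor_count_add[of f 0 "2 * m"] by simp_all
  then show ?thesis by linarith
qed

lemma score_bound: "\<bar>score b\<bar> \<le> real g + real J"
  unfolding score_def using local_offset[of "drop a b"] by (auto simp: abs_le_iff)

lemma sum_int_shift: "(\<Sum>i\<in>{0..<int M}. f i) = (\<Sum>i<M. f (int i))"
  by (rule sum.reindex_bij_witness[of _ int nat]) auto

text \<open>The summand \<open>W\<close> turns the rounding down of \<open>div\<close> into rounding
  to the nearest integer.\<close>

lemma round_div:
  fixes A c W :: int
  assumes "0 < W" "\<bar>2 * (A - c * W)\<bar> < W"
  shows "(2 * A + W) div (2 * W) = c"
proof (rule int_div_pos_eq[where r = "2 * (A - c * W) + W"])
  show "2 * A + W = 2 * W * c + (2 * (A - c * W) + W)" by algebra
qed (use assms in auto)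

text \<open>On regular traces the deviation of the found location from \<open>\<mu>\<close> is
  exactly the score, so the sum of scores controls the average; irregular traces are covered by the
  trivial bound.\<close>

lemma estimate_correct:
  assumes M: "0 < M" and rows: "\<And>i. i < M \<Longrightarrow> reads (Y (int i)) x (bs i)" "\<And>i. i < M \<Longrightarrow> length (bs i) = n"
    and b0: "good e b0" "\<bar>l - pos b0\<bar> \<le> int q"
    and w: "\<And>t. - int m < t \<Longrightarrow> t \<le> int m \<Longrightarrow> Y j (l + t) = X (int e + t)"
    and goods: "9 * M \<le> 10 * card {i. i < M \<and> good e (bs i)}"
    and scores: "\<bar>\<Sum>i<M. score (bs i)\<bar> \<le> M / 20"
    and irregular: "6 * q * card {i. i < M \<and> \<not> regular (bs i)} \<le> M / 20"
    and D: "0 < D" "0 \<le> d" "\<bar>of_int d / of_int D - \<delta>\<bar> * n \<le> 1 / 20" "of_int d / of_int D \<le> (1/2 :: real)"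
  shows "estimate D d (int m) (found_count Y m q j l M) (found_sum Y m q j l M) = int e"
    and "i < M \<Longrightarrow> good e (bs i) \<Longrightarrow> result Y m q j l (int i) = pos (bs i)"
proof -
  define F where "F i \<longleftrightarrow> result Y m q j l (int i) < l + 3 * int q + 1" for i
  define h where "h i = (if F i then of_int (result Y m q j l (int i)) - \<mu> else 0)" for i
  have near: "\<bar>l - pos b\<bar> \<le> 2 * int q" if "typical b" for b
    using pos_close[of b0 b] that b0 unfolding good_def by auto
  have res: "result Y m q j l (int i) = (if shows_end (Y (int i)) (bs i) then pos (bs i) else l + 3 * int q + 1)"
    if "i < M" "regular (bs i)" for i
    by (rule result_regular[where b = "bs i"]) (use that rows w near in \<open>auto simp: regular_def\<close>)
  show good_res: "result Y m q j l (int i) = pos (bs i)" if "i < M" "good e (bs i)" for i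
    using res[OF that(1)] good_regular[OF that(2)] good_shows[OF that(2) rows(1)[OF that(1)]] by simp
  have gF: "F i" if "i < M" "good e (bs i)" for i
    using good_res[OF that] near[of "bs i"] that(2) unfolding F_def good_def by linarith
  have l\<mu>: "\<bar>of_int l - \<mu>\<bar> \<le> real q + g"
  proof -
    have t: "typical b0" and c: "clean e b0" using b0(1) unfolding good_def by auto
    have "survivor_count b0 (e + 1) = survivor_count b0 a + (e + 1 - a)"
      by (rule clean_count[OF c]) (use a size in auto)
    then have "pos b0 = int (survivor_count b0 a) + 2 * int m - 1" unfolding pos_def using a(1) by linarith
    then have "\<bar>of_int (pos b0) - \<mu>\<bar> \<le> g" using typicalD[OF t, of a] a size unfolding \<mu>_def by simp
    moreover have "\<bar>real_of_int l - of_int (pos b0)\<bar> \<le> real q" using b0(2) by linarith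
    ultimately show ?thesis by linarith
  qed
  \<comment> \<open>A found location is within \<open>3 * q\<close> of \<open>l\<close>, which is
    within \<open>q + g\<close> of \<open>\<mu>\<close>, and the score is at most
    \<open>g + J \<le> q\<close> in absolute value. As \<open>q = 2 * g\<close>, this adds up to
    less than \<open>6 * q\<close>.\<close>
  have diff: "\<bar>h i - score (bs i)\<bar> \<le> (if regular (bs i) then 0 else 6 * real q)" if i: "i < M" for i
  proof (cases "regular (bs i)")
    case True
    have "F i \<longleftrightarrow> shows_end (Y (int i)) (bs i)"
      using res[OF i True] near[of "bs i"] True unfolding F_def regular_def by auto
    then show ?thesis using score_regular[OF True rows(2,1)[OF i]] res[OF i True] True unfolding h_def by simp
  next
    case False
    have "\<bar>h i\<bar> \<le> 4 * real q + g"
    proof (cases "F i")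
      case True
      have "l - 3 * int q \<le> result Y m q j l (int i)" by (rule result_bounds)
      then have "\<bar>real_of_int (result Y m q j l (int i)) - of_int l\<bar> \<le> 3 * real q" using True unfolding F_def by linarith
      then show ?thesis using l\<mu> True unfolding h_def by simp
    qed (simp add: h_def)
    moreover have "real g + real J \<le> real q" using g q by simp
    ultimately show ?thesis using score_bound[of "bs i"] False by simp
  qed
  define Z where "Z = found_count Y m q j l M"
  define S where "S = found_sum Y m q j l M"
  have Z: "Z = (\<Sum>i<M. of_bool (F i))"
    unfolding Z_def found_count_def F_def sum_of_bool_int[symmetric] by (rule sum_int_shift)
  have S: "S = (\<Sum>i<M. if F i then result Y m q j l (int i) else 0)"
    unfolding S_def found_sum_def F_def by (rule sum_int_shift)
  have "(\<Sum>i<M. h i) = (\<Sum>i<M. real_of_int (if F i then result Y m q j l (int i) else 0) - \<mu> * of_int (of_bool (F i)))"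
    unfolding h_def by (rule sum.cong) auto
  then have SZ: "(\<Sum>i<M. h i) = of_int S - \<mu> * of_int Z"
    unfolding S Z by (simp add: sum_subtractf sum_distrib_left)
  have "\<bar>(\<Sum>i<M. h i) - (\<Sum>i<M. score (bs i))\<bar> \<le> (\<Sum>i<M. if regular (bs i) then 0 else 6 * real q)"
    unfolding sum_subtractf[symmetric] by (rule order_trans[OF sum_abs]) (use diff in \<open>auto intro: sum_mono\<close>)
  also have "\<dots> = (\<Sum>i\<in>{i. i < M \<and> \<not> regular (bs i)}. 6 * real q)"
    by (rule sum.mono_neutral_cong_right) auto
  also have "\<dots> = 6 * q * card {i. i < M \<and> \<not> regular (bs i)}" by simp
  also have "\<dots> \<le> M / 20" by (rule irregular)
  finally have dev: "\<bar>of_int S - \<mu> * of_int Z\<bar> \<le> M / 10" using scores unfolding SZ by linarith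
  have "card {i. i < M \<and> good e (bs i)} \<le> card {i. i < M \<and> F i}"
    by (rule card_mono) (use gF in auto)
  also have "int (card {i. i < M \<and> F i}) = Z"
  proof -
    have "int (card {i. i < M \<and> F i}) = (\<Sum>i\<in>{i. i < M \<and> F i}. 1)" by simp
    also have "\<dots> = Z" unfolding Z by (rule sum.mono_neutral_cong_left) auto
    finally show ?thesis .
  qed
  finally have "9 * int M \<le> 10 * Z" using goods by linarith
  then have ZM: "9 * real M \<le> 10 * of_int Z" by linarith
  have Z0: "0 < real_of_int Z" using ZM M by linarith
  define \<eta> where "\<eta> = of_int d / of_int D - \<delta>"
  define W where "W = Z * (D - d)"
  define A where "A = D * (S - (2 * int m - 1) * Z)"
  have D0: "0 < real_of_int D" using D(1) by simp
  have dD: "real_of_int d = of_int D * (\<delta> + \<eta>)" using D0 by (simp add: \<eta>_def)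
  have eq: "real_of_int (A - int a * W) = of_int D * ((of_int S - \<mu> * of_int Z) + real a * \<eta> * of_int Z)"
    unfolding A_def W_def \<mu>_def by (simp add: dD algebra_simps)
  have "\<bar>\<eta>\<bar> * real a \<le> \<bar>\<eta>\<bar> * real n" using a size by (intro mult_left_mono) auto
  then have "\<bar>real a * \<eta>\<bar> \<le> \<bar>\<eta>\<bar> * n" by (simp add: abs_mult mult.commute)
  then have "\<bar>real a * \<eta>\<bar> \<le> 1 / 20" using D(3) unfolding \<eta>_def by linarith
  then have "\<bar>real a * \<eta>\<bar> * of_int Z \<le> 1 / 20 * of_int Z" using Z0 by (intro mult_right_mono) auto
  then have "\<bar>real a * \<eta> * of_int Z\<bar> \<le> of_int Z / 20" using Z0 by (simp add: abs_mult)
  \<comment> \<open>As \<open>Z\<close> is at least nine tenths of \<open>M\<close>, the error M/10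
    is at most Z/9, and the inexact rate adds at most Z/20. Since the divisor is at least D * Z / 2,
    anything below Z/4 leaves less than half a unit.\<close>
  then have "\<bar>(of_int S - \<mu> * of_int Z) + real a * \<eta> * of_int Z\<bar> < of_int Z / 4" using dev ZM Z0 by linarith
  then have "of_int D * \<bar>(of_int S - \<mu> * of_int Z) + real a * \<eta> * of_int Z\<bar> < of_int D * (of_int Z / 4)"
    using D0 by (rule mult_strict_left_mono)
  then have lt: "\<bar>real_of_int (A - int a * W)\<bar> < of_int D * of_int Z / 4"
    unfolding eq using D0 by (simp add: abs_mult)
  have "real_of_int d \<le> of_int D / 2" using D(4) D0 by (simp add: pos_divide_le_eq)
  then have "of_int Z * (of_int D / 2) \<le> of_int Z * (of_int D - real_of_int d)" using Z0 by (intro mult_left_mono) auto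
  then have WZ: "of_int D * of_int Z / 2 \<le> real_of_int W" unfolding W_def by (simp add: mult.commute)
  define E where "E = \<bar>real_of_int (A - int a * W)\<bar>"
  define V where "V = of_int D * real_of_int Z"
  have "2 * E < real_of_int W" using lt WZ unfolding E_def[symmetric] V_def[symmetric] by linarith
  then have "real_of_int \<bar>2 * (A - int a * W)\<bar> < real_of_int W"
    unfolding E_def by (simp only: abs_mult of_int_abs of_int_mult)
  then have "\<bar>2 * (A - int a * W)\<bar> < W" unfolding of_int_less_iff .
  moreover have "0 < W" using calculation by linarith
  ultimately have "(2 * A + W) div (2 * W) = int a" by (intro round_div)
  then show "estimate D d (int m) (found_count Y m q j l M) (found_sum Y m q j l M) = int e"
    unfolding estimate_def Z_def[symmetric] S_def[symmetric] A_def[symmetric] W_def[symmetric]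
    using a(1) by simp
qed

end

subsection \<open>Periods of deserts\<close>

text \<open>Deserts enter only through their period: a pattern of length \<open>k\<close> is
  recovered as the first \<open>k\<close> symbols.\<close>

definition periodic_on :: "'a list \<Rightarrow> nat \<Rightarrow> nat \<Rightarrow> nat \<Rightarrow> bool" where
  "periodic_on x k u v \<longleftrightarrow> (\<forall>i. u + k \<le> i \<and> i \<le> v \<longrightarrow> x ! i = x ! (i - k))"

lemma nth_concat_replicate:
  "i < j * length s \<Longrightarrow> concat (replicate j s) ! i = s ! (i mod length s)"
proof (induction j arbitrary: i)
  case (Suc j)
  show ?case
  proof (cases "i < length s")
    case False
    then show ?thesis using Suc.IH[of "i - length s"] Suc.prems by (simp add: nth_append le_mod_geq)
  qed (simp add: nth_append)
qed simp

lemma length_concat_replicate: "length (concat (replicate j s)) = j * length s"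
  by (induction j) auto

lemma desert_of_periodic:
  assumes "desert_of m s z"
  shows "0 < length s" and "periodic_on z (length s) 0 (length z - 1)"
proof -
  obtain j where p: "prefix z (concat (replicate j s))" and l: "2 * m + 1 \<le> length z"
    using assms unfolding desert_of_def by blast
  have lz: "length z \<le> j * length s" using prefix_length_le[OF p] by (simp add: length_concat_replicate)
  have z: "z ! i = s ! (i mod length s)" if "i < length z" for i
    using nth_concat_replicate[of i j s] p that lz unfolding prefix_def by (auto simp: nth_append)
  show "0 < length s" using l lz by (cases "length s") auto
  show "periodic_on z (length s) 0 (length z - 1)"
    unfolding periodic_on_def
  proof (intro allI impI)
    fix i assume "0 + length s \<le> i \<and> i \<le> length z - 1"
    moreover from this l have "i < length z" by linarith
    ultimately show "z ! i = z ! (i - length s)" using z[of i] z[of "i - length s"] by (simp add: le_mod_geq)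
  qed
qed

lemma periodic_desert_of:
  assumes "0 < k" "k \<le> length z" "2 * m + 1 \<le> length z" "periodic_on z k 0 (length z - 1)"
  shows "desert_of m (take k z) z"
proof -
  have z: "i < length z \<Longrightarrow> z ! i = z ! (i mod k)" for i
  proof (induction i rule: less_induct)
    case (less i)
    show ?case
    proof (cases "i < k")
      case False
      then have "z ! i = z ! (i - k)" using assms(4) less.prems unfolding periodic_on_def by auto
      also have "\<dots> = z ! ((i - k) mod k)" using less.IH[of "i - k"] less.prems False assms(1) by simp
      finally show ?thesis using False by (simp add: le_mod_geq)
    qed simp
  qed
  have l: "length z \<le> length z * k" using assms(1) by simp
  have "take (length z) (concat (replicate (length z) (take k z))) = z"
  proof (rule nth_equalityI)
    fix i assume "i < length (take (length z) (concat (replicate (length z) (take k z))))"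
    then have i: "i < length z" by simp
    then have "concat (replicate (length z) (take k z)) ! i = take k z ! (i mod k)"
      using nth_concat_replicate[of i "length z" "take k z"] assms(2) l by (simp add: min_absorb2)
    then show "take (length z) (concat (replicate (length z) (take k z))) ! i = z ! i"
      using i z[OF i] assms(1) by simp
  qed (use l assms(2) in \<open>simp add: length_concat_replicate min_absorb2\<close>)
  then have "prefix z (concat (replicate (length z) (take k z)))" by (metis take_is_prefix)
  then show ?thesis using assms(3) unfolding desert_of_def by blast
qed

lemma substring_window:
  assumes "m \<le> r" "r + m < length x"
  shows "length (substring x (r - m) (r + m)) = 2 * m + 1"
    and "i \<le> 2 * m \<Longrightarrow> substring x (r - m) (r + m) ! i = x ! (r - m + i)"
  using assms by (auto simp: substring_def)

lemma periodic_window: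
  assumes "m \<le> r" "r + m < length x"
  shows "periodic_on (substring x (r - m) (r + m)) k 0 (length (substring x (r - m) (r + m)) - 1)
    \<longleftrightarrow> periodic_on x k (r - m) (r + m)"
proof -
  have "(\<forall>i. k \<le> i \<and> i \<le> 2 * m \<longrightarrow> x ! (r - m + i) = x ! (r - m + (i - k))) \<longleftrightarrow>
    (\<forall>i. r - m + k \<le> i \<and> i \<le> r + m \<longrightarrow> x ! i = x ! (i - k))" (is "?L \<longleftrightarrow> ?R")
  proof
    assume L: ?L
    show ?R
    proof (intro allI impI)
      fix i assume i: "r - m + k \<le> i \<and> i \<le> r + m"
      then have "k \<le> i - (r - m) \<and> i - (r - m) \<le> 2 * m" "r - m + (i - (r - m)) = i"
        "r - m + (i - (r - m) - k) = i - k" using assms(1) by auto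
      then show "x ! i = x ! (i - k)" using L[rule_format, of "i - (r - m)"] by simp
    qed
  next
    assume R: ?R
    show ?L
    proof (intro allI impI)
      fix i assume i: "k \<le> i \<and> i \<le> 2 * m"
      then have "r - m + k \<le> r - m + i \<and> r - m + i \<le> r + m" "r - m + i - k = r - m + (i - k)" using assms(1) by auto
      then show "x ! (r - m + i) = x ! (r - m + (i - k))" using R[rule_format, of "r - m + i"] by metis
    qed
  qed
  moreover have "(\<forall>i. 0 + k \<le> i \<and> i \<le> 2 * m + 1 - 1 \<longrightarrow>
      substring x (r - m) (r + m) ! i = substring x (r - m) (r + m) ! (i - k)) \<longleftrightarrow> ?L"
  proof (intro iff_allI imp_cong)
    fix i assume i: "k \<le> i \<and> i \<le> 2 * m"
    then have "i - k \<le> 2 * m" by linarith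
    then show "(substring x (r - m) (r + m) ! i = substring x (r - m) (r + m) ! (i - k)) =
        (x ! (r - m + i) = x ! (r - m + (i - k)))"
      using substring_window(2)[OF assms] i by metis
  qed simp
  ultimately show ?thesis unfolding periodic_on_def substring_window(1)[OF assms] by blast
qed

text \<open>The length of the shortest pattern is the least period of the window. The bound on
  \<open>C\<close> makes every candidate pattern fit into the window, as needed to read a pattern
  off a period.\<close>

lemma deep_pattern:
  assumes d: "deep C m x r" and C: "C \<le> 2 * m"
  defines "k \<equiv> length (pattern C m x r)"
  shows "1 \<le> k" "k \<le> C" "periodic_on x k (r - m) (r + m)"
    and "1 \<le> k' \<Longrightarrow> k' < k \<Longrightarrow> \<not> periodic_on x k' (r - m) (r + m)"
proof -
  define z where "z = substring x (r - m) (r + m)"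
  have rm: "m \<le> r" "r + m < length x" and ex: "\<exists>s. length s \<le> C \<and> desert_of m s z"
    using d unfolding deep_def desert_def z_def by auto
  note pz = periodic_window[OF rm, folded z_def] and lz = substring_window(1)[OF rm, folded z_def]
  obtain s where "length s \<le> C \<and> desert_of m s z" using ex by blast
  from arg_min_nat_lemma[of "\<lambda>s. length s \<le> C \<and> desert_of m s z", OF this, of length]
  have p: "length (pattern C m x r) \<le> C" "desert_of m (pattern C m x r) z"
    and least: "\<And>s. length s \<le> C \<Longrightarrow> desert_of m s z \<Longrightarrow> k \<le> length s"
    unfolding pattern_def k_def z_def by auto
  show "1 \<le> k" "k \<le> C" "periodic_on x k (r - m) (r + m)"
    using desert_of_periodic[OF p(2)] p(1) pz unfolding k_def by (simp_all add: Suc_le_eq)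
  assume k': "1 \<le> k'" "k' < k"
  show "\<not> periodic_on x k' (r - m) (r + m)"
  proof
    assume "periodic_on x k' (r - m) (r + m)"
    then have "desert_of m (take k' z) z" using k' \<open>k \<le> C\<close> C lz pz by (intro periodic_desert_of) auto
    then have "k \<le> k'" using least[of "take k' z"] k' \<open>k \<le> C\<close> C lz by simp
    then show False using k' by simp
  qed
qed

text \<open>The window has the period up to \<open>r + m\<close>, and the absence of earlier breaks
  extends it step by step to \<open>e\<close>.\<close>

lemma desert_end_periodic:
  assumes d: "deep C m x r" and C: "C \<le> 2 * m" and e: "desert_end C m x r e"
  defines "k \<equiv> length (pattern C m x r)"
  shows "r + m \<le> e" "e + 1 < length x" "x ! (e + 1) \<noteq> x ! (e + 1 - k)"
    and "periodic_on x k (r - m) e"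
proof -
  have E: "r + m \<le> e" "breaks_at x k e" "\<And>e'. r + m \<le> e' \<Longrightarrow> e' < e \<Longrightarrow> \<not> breaks_at x k e'"
    using e unfolding desert_end_def k_def Let_def by auto
  show "r + m \<le> e" "e + 1 < length x" "x ! (e + 1) \<noteq> x ! (e + 1 - k)"
    using E(1,2) unfolding breaks_at_def by auto
  note P = deep_pattern(3)[OF d C, folded k_def]
  show "periodic_on x k (r - m) e"
    unfolding periodic_on_def
  proof (intro allI impI)
    fix i assume i: "r - m + k \<le> i \<and> i \<le> e"
    show "x ! i = x ! (i - k)"
    proof (cases "i \<le> r + m")
      case True
      then show ?thesis using P i unfolding periodic_on_def by blast
    next
      case False
      then have "\<not> breaks_at x k (i - 1)" using i by (intro E(3)) auto
      then show ?thesis using False i E(2) unfolding breaks_at_def by auto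
    qed
  qed
qed

text \<open>The period that the program computes from the prefix of \<open>x\<close>.\<close>

lemma period_of_prefix:
  assumes d: "deep C m x r" and C: "C \<le> 2 * m" and u: "u = substring x 0 (r + m)"
  shows "first_from 1 (2 * int m + 1)
       (\<lambda>k. \<forall>t\<in>{0..<2 * int m + 1 - k}. u ! nat (int r - int m + t) = u ! nat (int r - int m + t + k))
     = int (length (pattern C m x r))"
proof -
  define k where "k = length (pattern C m x r)"
  have rm: "m \<le> r" "r + m < length x" using d unfolding deep_def by auto
  have un: "u ! i = x ! i" if "i \<le> r + m" for i using that unfolding u substring_def by simp
  have iff: "(\<forall>t\<in>{0..<2 * int m + 1 - int k}. u ! nat (int r - int m + t) = u ! nat (int r - int m + t + int k))
      \<longleftrightarrow> periodic_on x k (r - m) (r + m)" (is "?L \<longleftrightarrow> ?R") if "1 \<le> k" for k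
  proof
    assume L: ?L
    show ?R
      unfolding periodic_on_def
    proof (intro allI impI)
      fix i assume i: "r - m + k \<le> i \<and> i \<le> r + m"
      define t where "t = int i - int k - (int r - int m)"
      have "u ! nat (int r - int m + t) = u ! nat (int r - int m + t + int k)"
      proof (rule L[rule_format])
        show "t \<in> {0..<2 * int m + 1 - int k}" using i rm(1) unfolding t_def by auto
      qed
      moreover have "nat (int r - int m + t) = i - k" "nat (int r - int m + t + int k) = i"
        using i unfolding t_def by linarith+
      ultimately show "x ! i = x ! (i - k)" using un[of i] un[of "i - k"] i le_trans[OF diff_le_self, of i "r + m" k] by simp
    qed
  next
    assume R: ?R
    show ?L
    proof
      fix t assume t: "t \<in> {0..<2 * int m + 1 - int k}"
      define i where "i = nat (int r - int m + t + int k)"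
      have i: "nat (int r - int m + t) = i - k" "r - m + k \<le> i" "i \<le> r + m"
        using t rm(1) unfolding i_def by auto
      have "x ! i = x ! (i - k)" using R i(2,3) unfolding periodic_on_def by blast
      then show "u ! nat (int r - int m + t) = u ! nat (int r - int m + t + int k)"
        using un[of i] un[of "i - k"] i by (simp add: i_def)
    qed
  qed
  note P = deep_pattern[OF d C, folded k_def]
  show ?thesis unfolding k_def[symmetric]
  proof (rule first_from_eqI)
    show "1 \<le> int k" using P(1) by simp
    show "2 * int m + 1 \<le> int k \<or> (\<forall>t\<in>{0..<2 * int m + 1 - int k}. u ! nat (int r - int m + t) = u ! nat (int r - int m + t + int k))"
      using iff[OF P(1)] P(3) by blast
    fix j assume j: "1 \<le> j" "j < int k"
    define k' where "k' = nat j"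
    have jk: "j = int k'" using j by (simp add: k'_def)
    show "j < 2 * int m + 1 \<and> \<not> (\<forall>t\<in>{0..<2 * int m + 1 - j}. u ! nat (int r - int m + t) = u ! nat (int r - int m + t + j))"
      unfolding jk using iff[of k'] P(2) P(4)[of k'] C j jk by auto
  qed
qed

text \<open>Two roundings, of the input and of the quotient by P^7, lose less than two units of
  1/P^3. Multiplied by \<open>n \<le> P\<close> this is at most 2/P^2.\<close>

lemma rate_approx:
  assumes P: "(10::nat) \<le> 2 ^ bit_len n" "n \<le> 2 ^ bit_len n" and \<delta>: "0 \<le> \<delta>"
  defines "D \<equiv> int (2 ^ bit_len n) ^ 3"
  shows "of_int (rate n \<delta>) / of_int D \<le> \<delta>" "\<bar>of_int (rate n \<delta>) / of_int D - \<delta>\<bar> * n \<le> 1 / 20"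
proof -
  define P :: real where "P = 2 ^ bit_len n"
  have P10: "10 \<le> P" and nP: "real n \<le> P" using P unfolding P_def by (simp_all add: numeral_power_le_of_nat_cancel_iff)
    (metis of_nat_le_iff of_nat_numeral of_nat_power)+
  define f where "f = \<lfloor>\<delta> * 2 ^ (10 * bit_len n)\<rfloor>"
  define d where "d = rate n \<delta>"
  have pw: "(2::real) ^ (10 * bit_len n) = P ^ 10" unfolding P_def by (simp add: power_mult mult.commute[of 10])
  have D: "real_of_int D = P ^ 3" unfolding D_def P_def by simp
  have d: "d = f div int (2 ^ bit_len n) ^ 7" unfolding d_def rate_def f_def ..
  have Q: "real_of_int (int (2 ^ bit_len n) ^ 7) = P ^ 7" unfolding P_def by simp
  have "f = d * int (2 ^ bit_len n) ^ 7 + f mod int (2 ^ bit_len n) ^ 7" unfolding d by (rule div_mult_mod_eq[symmetric])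
  moreover have "0 \<le> f mod int (2 ^ bit_len n) ^ 7" "f mod int (2 ^ bit_len n) ^ 7 < int (2 ^ bit_len n) ^ 7" by simp_all
  ultimately have "d * int (2 ^ bit_len n) ^ 7 \<le> f" "f < (d + 1) * int (2 ^ bit_len n) ^ 7"
    unfolding distrib_right by linarith+
  then have "real_of_int (d * int (2 ^ bit_len n) ^ 7) \<le> real_of_int f"
    "real_of_int f < real_of_int ((d + 1) * int (2 ^ bit_len n) ^ 7)" by (simp_all only: of_int_le_iff of_int_less_iff)
  then have 1: "real_of_int d * P ^ 7 \<le> of_int f" and 2: "of_int f < (real_of_int d + 1) * P ^ 7"
    unfolding Q[symmetric] by simp_all
  have f: "real_of_int f \<le> \<delta> * P ^ 10" "\<delta> * P ^ 10 < real_of_int f + 1" unfolding f_def pw by linarith+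
  have P0: "0 < P" using P10 by simp
  have p7: "P ^ 10 = P ^ 3 * P ^ 7" by (simp flip: power_add)
  have "real_of_int d * P ^ 7 \<le> (\<delta> * P ^ 3) * P ^ 7" using order_trans[OF 1 f(1)] unfolding p7 mult.assoc .
  then have up: "real_of_int d \<le> \<delta> * P ^ 3" using P0 by simp
  have "1 \<le> P ^ 7" using P10 by simp
  then have "(\<delta> * P ^ 3) * P ^ 7 < (real_of_int d + 2) * P ^ 7"
    using 2 f(2) unfolding p7 mult.assoc[symmetric] distrib_right by linarith
  then have lo: "\<delta> * P ^ 3 < real_of_int d + 2" using P0 by simp
  show u: "of_int (rate n \<delta>) / of_int D \<le> \<delta>"
    unfolding D d_def[symmetric] using up P0 by (simp add: pos_divide_le_eq)
  have "\<delta> < (real_of_int d + 2) / P ^ 3" using lo P0 by (simp add: pos_less_divide_eq)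
  then have "\<delta> - of_int d / P ^ 3 \<le> 2 / P ^ 3" by (simp add: add_divide_distrib)
  then have "\<bar>of_int d / P ^ 3 - \<delta>\<bar> \<le> 2 / P ^ 3" using u unfolding D d_def[symmetric] by simp
  then have "\<bar>of_int d / P ^ 3 - \<delta>\<bar> * n \<le> 2 / P ^ 3 * P" using nP P0 by (intro mult_mono) auto
  also have "\<dots> = 2 / P ^ 2" using P0 by (simp add: power2_eq_square power3_eq_cube)
  also have "\<dots> \<le> 2 / 10 ^ 2" using P10 by (intro divide_left_mono power_mono) auto
  finally show "\<bar>of_int (rate n \<delta>) / of_int D - \<delta>\<bar> * n \<le> 1 / 20" unfolding D d_def[symmetric] by simp
qed

section \<open>Correctness of the outputs for given deletion patterns\<close>

context desert_traces
begin

text \<open>Every inspected cell has a nonnegative position because the windows start at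
  \<open>l - 3 * q - m + 1\<close> or later. The outputs already written below the table are thus
  invisible to the search.\<close>

lemma result_cong:
  assumes "\<And>a t. 0 \<le> a \<Longrightarrow> 0 \<le> t \<Longrightarrow> Y' a t = Y a t" "0 \<le> i" "0 \<le> j" "3 * int q + int m \<le> l"
  shows "result Y' m q j l i = result Y m q j l i"
  unfolding result_def window_match_def using assms by (intro first_from_cong ball_cong) auto

text \<open>The deterministic half of the argument. The last four assumptions are all that the
  randomness of the traces has to supply.\<close>

lemma find_end_correct:
  fixes bs cs :: "bool list list"
  defines "M \<equiv> length (bs @ cs)" and "b i \<equiv> (bs @ cs) ! i"
  assumes ok: "parameters_ok n \<delta> N" and mg: "m = half_width n" "g = tolerance n \<delta>" and w: "w = word_size 10 n"
    and C: "deep C m x r" "desert_end C m x r e" "k = length (pattern C m x r)" "C \<le> 2 * m" and e: "4 * e \<le> 3 * n"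
    and N: "0 < N" "length bs = N" "length cs = sample_count n \<delta>" "\<And>b. b \<in> set (bs @ cs) \<Longrightarrow> length b = n"
    and many: "\<And>c. c < n \<Longrightarrow> 9 * N \<le> 10 * card {i. i < N \<and> good c (b i)}"
    and goods: "9 * M \<le> 10 * card {i. i < M \<and> good e (b i)}"
    and scores: "\<bar>\<Sum>i<M. score (b i)\<bar> \<le> M / 20"
    and irregular: "6 * q * card {i. i < M \<and> \<not> regular (b i)} \<le> M / 20"
  shows "\<exists>t s. exec w find_end (initial w (find_end_input w n \<delta> r (substring x 0 (r + m)) (map (trace_of x) bs)) (map (trace_of x) cs)) t s \<and>
    out_b s = int e \<and> real (card {i\<in>{..<N}. out_l s i = last_loc e (bs ! i)}) \<ge> 0.9 * real N"
proof -
  define u where "u = substring x 0 (r + m)"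
  define ys where "ys = map (trace_of x) bs"
  define zs where "zs = map (trace_of x) cs"
  define D where "D = int (2 ^ bit_len n) ^ 3"
  have rn: "r \<le> n" "r + m < length x" using r size len by auto
  have tl: "length (trace_of x b) \<le> n" if "length b = n" for b
    using that length_filter_le[of "\<lambda>i. b ! i" "[0..<n]"] by (simp add: trace_of_def survivors_def)
  have ul: "length u = r + half_width n + 1" using rn mg by (simp add: u_def substring_def)
  obtain t s k' Y l j Y' where ex: "exec w find_end (initial w (find_end_input w n \<delta> r u ys) zs) t s"
    and k': "m \<le> r \<longrightarrow> int k' = first_from 1 (2 * int m + 1)
        (\<lambda>k. \<forall>t\<in>{0..<2 * int m + 1 - k}. u ! nat (int r - int m + t) = u ! nat (int r - int m + t + k))"
    and Y: "\<forall>i<length (ys @ zs). \<forall>t<length ((ys @ zs) ! i). Y (int i) (int t) = of_bool ((ys @ zs) ! i ! t)"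
    and l: "l = first_from ((int r * (D - rate n \<delta>)) div D + 3 * int q + 5) (3 * int n div 4 + 1)
       (\<lambda>l. \<exists>j\<in>{0..<int N}. accepted Y m k' q N j l)"
    and j: "j = first_from 0 (int N) (\<lambda>j. accepted Y m k' q N j l)"
    and out: "out_b s = estimate D (rate n \<delta>) (int m) (found_count Y m q j l (length (ys @ zs)))
        (found_sum Y m q j l (length (ys @ zs)))"
      "\<forall>i<N. out_l s i = result (Y' i) m q j l (int i) \<and> (\<forall>a\<ge>0. \<forall>t\<ge>0. Y' i a t = Y a t)"
  proof -
    have "length ys = N" "length zs = sample_count n \<delta>" "q = 2 * tolerance n \<delta>"
      using N q mg by (simp_all add: ys_def zs_def)
    moreover have "\<And>y. y \<in> set ys \<Longrightarrow> length y \<le> n" "\<And>z. z \<in> set zs \<Longrightarrow> length z \<le> n"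
      using N(4) tl by (auto simp: ys_def zs_def)
    ultimately show ?thesis
      using exec_find_end[OF ok rn(1) ul _ _ _ _ mg(1) _ D_def w, of ys zs q] that by blast
  qed
  have kk: "k' = k" using k' r(1) period_of_prefix[OF C(1,4) u_def] C(3) by simp
  note ok' = ok[unfolded parameters_ok_def]
  have P: "10 \<le> (2::nat) ^ bit_len n" "n \<le> 2 ^ bit_len n" using ok' bit_len_bounds(1) by auto
  note rate = rate_approx[OF P \<delta>(1), folded D_def]
  have D0: "0 < D" unfolding D_def by simp
  have lenM: "length (ys @ zs) = M" unfolding M_def ys_def zs_def by simp
  have bl: "length (b i) = n" if "i < M" for i
    using N(4) nth_mem[of i "bs @ cs"] that unfolding b_def M_def by simp
  have rows: "reads (Y (int i)) x (b i)" if i: "i < M" for i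
  proof (rule reads_trace)
    have "(ys @ zs) ! i = trace_of x (b i)"
      using i unfolding ys_def zs_def b_def M_def map_append[symmetric] by (rule nth_map)
    then show "Y (int i) (int t) = of_bool (trace_of x (b i) ! t)" if "t < length (trace_of x (b i))" for t
      using Y i that unfolding lenM by simp
  qed (use bl[OF i] len in simp)
  have NM: "N \<le> M" using N unfolding M_def by simp
  define start where "start = (int r * (D - rate n \<delta>)) div D + 3 * int q + 5"
  \<comment> \<open>Rounding down and the approximate rate each move the starting point by at most
    1, in opposite directions; this explains 4 and 6 around the summand 5 of
    \<open>start\<close>.\<close>
  have start: "(1 - \<delta>) * r + 3 * q + 4 \<le> of_int start" "of_int start \<le> (1 - \<delta>) * r + 3 * q + 6"
  proof -
    define v where "v = (int r * (D - rate n \<delta>)) div D"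
    define \<eta> where "\<eta> = \<delta> - of_int (rate n \<delta>) / of_int D"
    have "real_of_int v = of_int \<lfloor>of_int (int r * (D - rate n \<delta>)) / (of_int D :: real)\<rfloor>"
      unfolding v_def by (simp only: floor_divide_of_int_eq)
    moreover have "of_int (int r * (D - rate n \<delta>)) / (of_int D :: real) = (1 - \<delta>) * r + r * \<eta>"
      using D0 by (simp add: \<eta>_def field_simps)
    ultimately have v: "real_of_int v \<le> (1 - \<delta>) * r + r * \<eta>" "(1 - \<delta>) * r + r * \<eta> < real_of_int v + 1" by linarith+
    have \<eta>: "0 \<le> \<eta>" using rate(1) by (simp add: \<eta>_def)
    then have "\<eta> * r \<le> \<eta> * n" using rn(1) by (intro mult_left_mono) auto
    moreover have "\<eta> * n \<le> 1 / 20" using rate(2) \<eta> unfolding \<eta>_def by simp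
    ultimately have "0 \<le> r * \<eta>" "r * \<eta> \<le> 1" using \<eta> by (simp_all add: mult.commute)
    moreover have "real_of_int start = real_of_int v + real (3 * q) + 5" unfolding start_def v_def[symmetric] by simp
    ultimately show "(1 - \<delta>) * r + 3 * q + 4 \<le> of_int start" "of_int start \<le> (1 - \<delta>) * r + 3 * q + 6"
      using v by linarith+
  qed
  have lim: "int e < 3 * int n div 4 + 1" using e by linarith
  obtain i0 where i0: "i0 < N" "good e (b i0)" "\<bar>l - pos (b i0)\<bar> \<le> int q" "start \<le> l" "0 \<le> j"
    and win: "\<And>t. - int m < t \<Longrightarrow> t \<le> int m \<Longrightarrow> Y j (l + t) = X (int e + t)"
  proof -
    have rN: "reads (Y (int i)) x (b i)" if "i < N" for i using rows[of i] that NM by simp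
    show ?thesis
      by (rule search_correct[OF N(1) _ _ start lim l[unfolded kk, folded start_def] j[unfolded kk]])
        (fact rN many that)+
  qed
  have M0: "0 < M" using N(1) NM by simp
  have half: "of_int (rate n \<delta>) / of_int D \<le> (1/2 :: real)" using rate(1) \<delta>(2) by linarith
  note est = estimate_correct[where Y = Y and j = j and l = l and bs = b, OF M0 rows bl i0(2,3) win goods scores irregular D0 rate_nonneg[OF \<delta>(1)] rate(2) half]
  have "3 * int q + int m \<le> l"
  proof -
    have "(1 - \<delta>) * m \<le> (1 - \<delta>) * r" using r \<delta> by (intro mult_left_mono) auto
    moreover have "(1 - \<delta>) * m = real m - \<delta> * m" by (simp add: algebra_simps)
    ultimately have "real m - 1 + 3 * q + 4 \<le> of_int start" using start(1) \<delta>(3) by linarith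
    then show ?thesis using i0(4) by linarith
  qed
  then have "out_l s i = result Y m q j l (int i)" if "i < N" for i
    using out(2) that i0(5) result_cong[of "Y' i" Y "int i" j l] by simp
  moreover have "result Y m q j l (int i) = last_loc e (bs ! i)" if "i < N" "good e (b i)" for i
  proof -
    have "e < length (b i)" using bl[of i] that NM size by simp
    then have "last_loc e (b i) = pos (b i)" unfolding pos_def by (simp add: last_loc_eq)
    then show ?thesis using est(2)[of i] that NM N(2) by (simp add: b_def nth_append)
  qed
  ultimately have "card {i. i < N \<and> good e (b i)} \<le> card {i\<in>{..<N}. out_l s i = last_loc e (bs ! i)}"
    by (intro card_mono) auto
  moreover have "9 * N \<le> 10 * card {i. i < N \<and> good e (b i)}" using many[of e] size by simp
  ultimately have "9 * N \<le> 10 * card {i\<in>{..<N}. out_l s i = last_loc e (bs ! i)}" by linarith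
  then have "real (card {i\<in>{..<N}. out_l s i = last_loc e (bs ! i)}) \<ge> 0.9 * real N" by linarith
  moreover have "out_b s = int e" unfolding out(1) lenM by (rule est(1))
  ultimately show ?thesis using ex unfolding u_def ys_def zs_def by blast
qed

end

subsection \<open>Sums over independent samples\<close>

abbreviation expect :: "'a pmf \<Rightarrow> ('a \<Rightarrow> real) \<Rightarrow> real" where
  "expect p f \<equiv> measure_pmf.expectation p f"

lemma finite_replicate_pmf: "finite (set_pmf p) \<Longrightarrow> finite (set_pmf (replicate_pmf n p))"
  using finite_lists_length_eq[of "set_pmf p" n] by (simp add: set_replicate_pmf lists_eq_set Collect_conj_eq[symmetric])

lemma replicate_pmf_append:
  "replicate_pmf (a + c) p = map_pmf (\<lambda>(u, v). u @ v) (pair_pmf (replicate_pmf a p) (replicate_pmf c p))"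
  by (simp add: replicate_pmf_distrib pair_pmf_def map_bind_pmf)

lemma expect_pair:
  assumes "finite (set_pmf p)" "finite (set_pmf q)"
  shows "expect (pair_pmf p q) (\<lambda>(x, y). f x * h y) = expect p f * expect q h"
proof -
  have "expect (pair_pmf p q) (\<lambda>(x, y). f x * h y) = (\<Sum>z\<in>set_pmf p \<times> set_pmf q. (case z of (x, y) \<Rightarrow> f x * h y) * pmf (pair_pmf p q) z)"
    by (rule integral_measure_pmf_real) (use assms in auto)
  also have "\<dots> = (\<Sum>x\<in>set_pmf p. \<Sum>y\<in>set_pmf q. (f x * pmf p x) * (h y * pmf q y))"
    unfolding sum.cartesian_product by (intro sum.cong) (auto simp: pmf_pair)
  also have "\<dots> = (\<Sum>x\<in>set_pmf p. f x * pmf p x) * (\<Sum>y\<in>set_pmf q. h y * pmf q y)"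
    by (simp add: sum_product)
  also have "\<dots> = expect p f * expect q h"
    using integral_measure_pmf_real[OF assms(1), where M = p and f = f] integral_measure_pmf_real[OF assms(2), where M = q and f = h] by simp
  finally show ?thesis .
qed

lemma expect_mono:
  assumes "finite (set_pmf p)" "\<And>x. x \<in> set_pmf p \<Longrightarrow> f x \<le> h x"
  shows "expect p f \<le> expect p h"
  by (rule integral_mono_AE) (use assms in \<open>auto intro: integrable_measure_pmf_finite AE_pmfI\<close>)

lemma expect_cong: "(\<And>x. x \<in> set_pmf p \<Longrightarrow> f x = h x) \<Longrightarrow> expect p f = expect p h"
  by (rule integral_cong_AE) (auto intro: AE_pmfI)

lemma expect_prod:
  fixes f :: "nat \<Rightarrow> 'a \<Rightarrow> real"
  assumes "finite (set_pmf p)"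
  shows "expect (replicate_pmf n p) (\<lambda>xs. \<Prod>i<n. f i (xs ! i)) = (\<Prod>i<n. expect p (f i))"
proof (induction n arbitrary: f)
  case (Suc n)
  have "replicate_pmf (Suc n) p = map_pmf (\<lambda>(x, xs). x # xs) (pair_pmf p (replicate_pmf n p))"
    by (simp add: pair_pmf_def map_bind_pmf)
  then have "expect (replicate_pmf (Suc n) p) (\<lambda>xs. \<Prod>i<Suc n. f i (xs ! i))
     = expect (pair_pmf p (replicate_pmf n p)) (\<lambda>(x, xs). f 0 x * (\<Prod>i<n. f (Suc i) (xs ! i)))"
    by (simp add: case_prod_unfold prod.lessThan_Suc_shift del: prod.lessThan_Suc)
  also have "\<dots> = expect p (f 0) * (\<Prod>i<n. expect p (f (Suc i)))"
    unfolding expect_pair[OF assms finite_replicate_pmf[OF assms]] Suc.IH[of "\<lambda>i. f (Suc i)"] ..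
  finally show ?case by (simp add: prod.lessThan_Suc_shift del: prod.lessThan_Suc)
qed simp

lemma prob_le_expect:
  assumes "finite (set_pmf p)" "\<And>x. x \<in> set_pmf p \<Longrightarrow> 0 \<le> h x" "\<And>x. x \<in> set_pmf p \<Longrightarrow> x \<in> A \<Longrightarrow> 1 \<le> h x"
  shows "measure_pmf.prob p A \<le> expect p h"
proof -
  have "measure_pmf.prob p A = expect p (indicator A)" by simp
  also have "\<dots> \<le> expect p h"
    by (rule expect_mono[OF assms(1)]) (use assms in \<open>auto simp: indicator_def\<close>)
  finally show ?thesis .
qed

text \<open>For negative \<open>z\<close>, (1 - z)(1 + z + z^2) = 1 - z^3 is at least 1, and 1 - z
  is at most exp(-z).\<close>

lemma exp_le_quadratic:
  assumes "\<bar>z\<bar> \<le> (1::real)"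
  shows "exp z \<le> 1 + z + z\<^sup>2"
proof (cases "0 \<le> z")
  case True
  then show ?thesis using exp_bound[of z] assms by simp
next
  case False
  have "1 \<le> (1 - z) * (1 + z + z\<^sup>2)"
  proof -
    have "(1 - z) * (1 + z + z\<^sup>2) = 1 + (- z) ^ 3" by (simp add: algebra_simps power2_eq_square power3_eq_cube)
    then show ?thesis using False by simp
  qed
  also have "\<dots> \<le> exp (- z) * (1 + z + z\<^sup>2)"
  proof (rule mult_right_mono)
    have "0 \<le> 1 + z" using assms by simp
    then show "0 \<le> 1 + z + z\<^sup>2" by simp
  qed (use exp_ge_add_one_self[of "- z"] in simp)
  finally have "exp z * 1 \<le> exp z * (exp (- z) * (1 + z + z\<^sup>2))" by (intro mult_left_mono) auto
  then show ?thesis by (simp add: exp_minus mult.assoc[symmetric])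
qed

text \<open>A Chernoff bound for bounded variables of which only an upper bound
  \<open>\<eta>\<close> of the mean is known. The index set \<open>I\<close> may be a part of the
  sample, as the given traces are.\<close>

lemma tail_bound:
  assumes p: "finite (set_pmf p)" and I: "I \<subseteq> {..<n}"
    and f: "\<And>x. x \<in> set_pmf p \<Longrightarrow> \<bar>f x\<bar> \<le> c" "expect p f \<le> \<eta>" and t: "0 < c" "0 \<le> t" "t \<le> 2 * c"
  shows "measure_pmf.prob (replicate_pmf n p) {xs. real (card I) * (\<eta> + t) \<le> (\<Sum>i\<in>I. f (xs ! i))}
    \<le> exp (- real (card I) * t\<^sup>2 / (4 * c\<^sup>2))"
proof -
  \<comment> \<open>This choice minimises s^2 c^2 - s t. The condition \<open>t \<le> 2 * c\<close>
    keeps the exponent in the range where the quadratic bound on \<open>exp\<close> applies.\<close>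
  define s where "s = t / (2 * c\<^sup>2)"
  have s: "0 \<le> s" "s * c \<le> 1" using t unfolding s_def by (simp_all add: power2_eq_square)
  have fin: "finite I" using I finite_subset by blast
  have "expect p (\<lambda>x. exp (s * f x)) \<le> expect p (\<lambda>x. (1 + s\<^sup>2 * c\<^sup>2) + s * f x)"
  proof (rule expect_mono[OF p])
    fix x assume x: "x \<in> set_pmf p"
    have "\<bar>s * f x\<bar> \<le> s * c" using f(1)[OF x] s by (simp add: abs_mult mult_left_mono)
    moreover have "(s * f x)\<^sup>2 \<le> (s * c)\<^sup>2" using calculation by (rule power2_le_iff_abs_le[THEN iffD2, rotated]) (use s t in auto)
    ultimately show "exp (s * f x) \<le> (1 + s\<^sup>2 * c\<^sup>2) + s * f x"
      using exp_le_quadratic[of "s * f x"] s(2) by (simp add: power_mult_distrib)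
  qed
  also have "\<dots> = 1 + s\<^sup>2 * c\<^sup>2 + s * expect p f"
    by (simp add: integrable_measure_pmf_finite[OF p])
  also have "\<dots> \<le> 1 + (s\<^sup>2 * c\<^sup>2 + s * \<eta>)" using f(2) s by (simp add: mult_left_mono)
  also have "\<dots> \<le> exp (s\<^sup>2 * c\<^sup>2 + s * \<eta>)" by (rule exp_ge_add_one_self)
  finally have mgf: "expect p (\<lambda>x. exp (s * f x)) \<le> exp (s\<^sup>2 * c\<^sup>2 + s * \<eta>)" .
  let ?v = "real (card I) * (\<eta> + t)"
  have "measure_pmf.prob (replicate_pmf n p) {xs. ?v \<le> (\<Sum>i\<in>I. f (xs ! i))}
     \<le> expect (replicate_pmf n p) (\<lambda>xs. exp (- s * ?v) * exp (s * (\<Sum>i\<in>I. f (xs ! i))))"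
  proof (rule prob_le_expect[OF finite_replicate_pmf[OF p]])
    fix xs assume "xs \<in> {xs. ?v \<le> (\<Sum>i\<in>I. f (xs ! i))}"
    then have "s * ?v \<le> s * (\<Sum>i\<in>I. f (xs ! i))" using s by (intro mult_left_mono) auto
    then show "1 \<le> exp (- s * ?v) * exp (s * (\<Sum>i\<in>I. f (xs ! i)))" by (simp flip: exp_add)
  qed simp
  also have "\<dots> = exp (- s * ?v) * expect (replicate_pmf n p) (\<lambda>xs. exp (s * (\<Sum>i\<in>I. f (xs ! i))))" by simp
  also have "(\<lambda>xs. exp (s * (\<Sum>i\<in>I. f (xs ! i)))) = (\<lambda>xs. \<Prod>i<n. (if i \<in> I then \<lambda>x. exp (s * f x) else (\<lambda>_. 1)) (xs ! i))"
  proof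
    fix xs
    have "exp (s * (\<Sum>i\<in>I. f (xs ! i))) = (\<Prod>i\<in>I. exp (s * f (xs ! i)))"
      by (simp add: sum_distrib_left exp_sum[OF fin])
    also have "\<dots> = (\<Prod>i<n. (if i \<in> I then \<lambda>x. exp (s * f x) else (\<lambda>_. 1)) (xs ! i))"
      by (rule prod.mono_neutral_cong_left) (use I in auto)
    finally show "exp (s * (\<Sum>i\<in>I. f (xs ! i))) = (\<Prod>i<n. (if i \<in> I then \<lambda>x. exp (s * f x) else (\<lambda>_. 1)) (xs ! i))" .
  qed
  also have "expect (replicate_pmf n p) (\<lambda>xs. \<Prod>i<n. (if i \<in> I then \<lambda>x. exp (s * f x) else (\<lambda>_. 1)) (xs ! i))
     = (\<Prod>i<n. expect p (if i \<in> I then \<lambda>x. exp (s * f x) else (\<lambda>_. 1)))" by (rule expect_prod[OF p])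
  also have "\<dots> = (\<Prod>i\<in>I. expect p (\<lambda>x. exp (s * f x)))"
    by (rule prod.mono_neutral_cong_right) (use I in auto)
  also have "\<dots> \<le> (\<Prod>i\<in>I. exp (s\<^sup>2 * c\<^sup>2 + s * \<eta>))"
    by (rule prod_mono) (use mgf in auto)
  also have "\<dots> = exp (real (card I) * (s\<^sup>2 * c\<^sup>2 + s * \<eta>))" by (simp add: exp_of_nat_mult)
  finally have "measure_pmf.prob (replicate_pmf n p) {xs. ?v \<le> (\<Sum>i\<in>I. f (xs ! i))}
     \<le> exp (- s * ?v) * exp (real (card I) * (s\<^sup>2 * c\<^sup>2 + s * \<eta>))" by simp
  also have "\<dots> = exp (real (card I) * (s\<^sup>2 * c\<^sup>2 - s * t))"
    unfolding exp_add[symmetric] by (simp add: algebra_simps)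
  also have "s\<^sup>2 * c\<^sup>2 - s * t = - (t\<^sup>2 / (4 * c\<^sup>2))"
    using t by (simp add: s_def power2_eq_square field_simps)
  finally show ?thesis by simp
qed

subsection \<open>The deletion channel\<close>

lemma finite_survival_pmf: "finite (set_pmf (survival_pmf \<delta> n))"
  unfolding survival_pmf_def by (rule finite_replicate_pmf) simp

lemma survival_length: "b \<in> set_pmf (survival_pmf \<delta> n) \<Longrightarrow> length b = n"
  by (simp add: survival_pmf_def set_replicate_pmf)

definition deletions :: "nat set \<Rightarrow> bool list \<Rightarrow> nat" where
  "deletions I b = card {i\<in>I. \<not> b ! i}"

text \<open>Independence turns the expectation into a product of factors 1 + \<delta> (exp s - 1),
  each of which is at most the exponential of its second summand.\<close>

lemma deletions_mgf:
  fixes \<delta> :: real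
  assumes I: "I \<subseteq> {..<n}" and \<delta>: "0 \<le> \<delta>" "\<delta> \<le> 1"
  shows "expect (survival_pmf \<delta> n) (\<lambda>b. exp (s * real (deletions I b))) \<le> exp (\<delta> * card I * (exp s - 1))"
proof -
  have fin: "finite I" using I finite_subset by blast
  have "expect (survival_pmf \<delta> n) (\<lambda>b. exp (s * real (deletions I b)))
     = expect (survival_pmf \<delta> n) (\<lambda>b. \<Prod>i<n. (if i \<in> I then (\<lambda>x. if x then 1 else exp s) else (\<lambda>_. 1)) (b ! i))"
  proof (rule expect_cong)
    fix b
    have "exp (s * real (deletions I b)) = (\<Prod>i\<in>{i\<in>I. \<not> b ! i}. exp s)"
      by (simp add: deletions_def exp_of_nat_mult mult.commute flip: exp_of_nat2_mult)
    also have "\<dots> = (\<Prod>i<n. (if i \<in> I then (\<lambda>x. if x then 1 else exp s) else (\<lambda>_. 1)) (b ! i))"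
      by (rule prod.mono_neutral_cong_left) (use I in auto)
    finally show "exp (s * real (deletions I b)) = (\<Prod>i<n. (if i \<in> I then (\<lambda>x. if x then 1 else exp s) else (\<lambda>_. 1)) (b ! i))" .
  qed
  also have "\<dots> = (\<Prod>i<n. expect (bernoulli_pmf (1 - \<delta>)) (if i \<in> I then (\<lambda>x. if x then 1 else exp s) else (\<lambda>_. 1)))"
    unfolding survival_pmf_def by (rule expect_prod) simp
  also have "\<dots> = (\<Prod>i\<in>I. expect (bernoulli_pmf (1 - \<delta>)) (\<lambda>x. if x then 1 else exp s))"
    by (rule prod.mono_neutral_cong_right) (use I in auto)
  also have "\<dots> = (1 + \<delta> * (exp s - 1)) ^ card I" using \<delta> by (simp add: algebra_simps)
  also have "\<dots> \<le> exp (\<delta> * (exp s - 1)) ^ card I"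
  proof (rule power_mono[OF exp_ge_add_one_self])
    have "\<delta> * (exp s - 1) \<ge> \<delta> * (- 1)" using \<delta> by (intro mult_left_mono) auto
    then show "0 \<le> 1 + \<delta> * (exp s - 1)" using \<delta> by simp
  qed
  also have "\<dots> = exp (\<delta> * card I * (exp s - 1))" by (simp add: exp_of_nat_mult[symmetric] mult_ac)
  finally show ?thesis .
qed

lemma expect_deletion:
  fixes \<delta> :: real
  assumes "i < n" "0 \<le> \<delta>" "\<delta> \<le> 1"
  shows "expect (survival_pmf \<delta> n) (\<lambda>b. of_bool (\<not> b ! i)) = \<delta>"
proof -
  have "expect (survival_pmf \<delta> n) (\<lambda>b. of_bool (\<not> b ! i))
     = expect (survival_pmf \<delta> n) (\<lambda>b. \<Prod>j<n. (if j = i then (\<lambda>x. of_bool (\<not> x)) else (\<lambda>_. 1)) (b ! j))"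
  proof (rule expect_cong)
    fix b :: "bool list"
    have "(\<Prod>j\<in>{i}. of_bool (\<not> b ! j)) = (\<Prod>j<n. (if j = i then (\<lambda>x. of_bool (\<not> x)) else (\<lambda>_. 1 :: real)) (b ! j))"
      by (rule prod.mono_neutral_cong_left) (use assms in auto)
    then show "of_bool (\<not> b ! i) = (\<Prod>j<n. (if j = i then (\<lambda>x. of_bool (\<not> x)) else (\<lambda>_. 1 :: real)) (b ! j))" by simp
  qed
  also have "\<dots> = (\<Prod>j<n. expect (bernoulli_pmf (1 - \<delta>)) (if j = i then (\<lambda>x. of_bool (\<not> x)) else (\<lambda>_. 1)))"
    unfolding survival_pmf_def by (rule expect_prod) simp
  also have "\<dots> = (\<Prod>j\<in>{i}. expect (bernoulli_pmf (1 - \<delta>)) (\<lambda>x. of_bool (\<not> x)))"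
    by (rule prod.mono_neutral_cong_right) (use assms in auto)
  also have "\<dots> = \<delta>" using assms by simp
  finally show ?thesis .
qed

lemma expect_deletions:
  fixes \<delta> :: real
  assumes "I \<subseteq> {..<n}" "0 \<le> \<delta>" "\<delta> \<le> 1"
  shows "expect (survival_pmf \<delta> n) (\<lambda>b. real (deletions I b)) = card I * \<delta>"
proof -
  have fin: "finite I" using assms finite_subset by blast
  have "real (deletions I b) = (\<Sum>i\<in>I. of_bool (\<not> b ! i))" for b
    unfolding deletions_def using fin by (simp add: Int_def)
  then have "expect (survival_pmf \<delta> n) (\<lambda>b. real (deletions I b)) = (\<Sum>i\<in>I. expect (survival_pmf \<delta> n) (\<lambda>b. of_bool (\<not> b ! i)))"
    by (simp add: Bochner_Integration.integral_sum integrable_measure_pmf_finite[OF finite_survival_pmf])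
  also have "\<dots> = (\<Sum>i\<in>I. \<delta>)" by (rule sum.cong) (use assms in \<open>auto intro!: expect_deletion\<close>)
  finally show ?thesis by simp
qed

lemma prob_deletion:
  fixes \<delta> :: real
  assumes "I \<subseteq> {..<n}" "0 \<le> \<delta>" "\<delta> \<le> 1"
  shows "measure_pmf.prob (survival_pmf \<delta> n) {b. \<exists>i\<in>I. \<not> b ! i} \<le> card I * \<delta>"
proof -
  have fin: "finite I" using assms finite_subset by blast
  have "measure_pmf.prob (survival_pmf \<delta> n) {b. \<exists>i\<in>I. \<not> b ! i} \<le> expect (survival_pmf \<delta> n) (\<lambda>b. real (deletions I b))"
  proof (rule prob_le_expect[OF finite_survival_pmf])
    fix b assume "b \<in> {b. \<exists>i\<in>I. \<not> b ! i}"
    then have "deletions I b \<noteq> 0" unfolding deletions_def using fin by auto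
    then show "1 \<le> real (deletions I b)" by simp
  qed simp
  then show ?thesis using expect_deletions[OF assms] by simp
qed

text \<open>A Chernoff bound with an exponent adapted to the small mean; a power of the mean
  results, so that a constant \<open>J\<close> already beats the factor \<open>q\<close>.\<close>

lemma prob_many_deletions:
  fixes \<delta> :: real
  assumes I: "I \<subseteq> {..<n}" and \<delta>: "0 < \<delta>" "\<delta> \<le> 1" and small: "\<delta> * card I \<le> 1" "I \<noteq> {}"
  shows "measure_pmf.prob (survival_pmf \<delta> n) {b. J < deletions I b} \<le> 3 * (\<delta> * card I) ^ (J + 1)"
proof -
  define v where "v = \<delta> * card I"
  have "finite I" using I finite_subset by blast
  then have v: "0 < v" "v \<le> 1" using \<delta> small by (auto simp: v_def card_gt_0_iff)
  \<comment> \<open>Then \<open>exp s = 1 / v\<close>, so \<open>J + 1\<close> deletions have weight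
    v^(-(J+1)) while the generating function stays below exp 1.\<close>
  define s where "s = - ln v"
  have s: "0 \<le> s" "exp s = 1 / v" using v by (simp_all add: s_def exp_minus field_simps)
  have "measure_pmf.prob (survival_pmf \<delta> n) {b. J < deletions I b}
     \<le> expect (survival_pmf \<delta> n) (\<lambda>b. v ^ (J + 1) * exp (s * real (deletions I b)))"
  proof (rule prob_le_expect[OF finite_survival_pmf])
    fix b assume "b \<in> {b. J < deletions I b}"
    then have "real (J + 1) \<le> real (deletions I b)" by (intro of_nat_mono) simp
    then have h1: "exp (s * real (J + 1)) \<le> exp (s * real (deletions I b))" using s by (simp add: mult_left_mono)
    have h2: "exp (s * real (J + 1)) = (1 / v) ^ (J + 1)" unfolding s(2)[symmetric] exp_of_nat2_mult ..
    have "v ^ (J + 1) * (1 / v) ^ (J + 1) \<le> v ^ (J + 1) * exp (s * real (deletions I b))"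
      by (rule mult_left_mono[OF h1[unfolded h2]]) (use v in simp)
    then show "1 \<le> v ^ (J + 1) * exp (s * real (deletions I b))" using v unfolding power_mult_distrib[symmetric] by simp
  qed (use v in simp)
  also have "\<dots> = v ^ (J + 1) * expect (survival_pmf \<delta> n) (\<lambda>b. exp (s * real (deletions I b)))" by simp
  also have "\<dots> \<le> v ^ (J + 1) * exp (\<delta> * card I * (exp s - 1))"
    using deletions_mgf[OF I, of \<delta> s] \<delta> v by (intro mult_left_mono) auto
  also have "\<delta> * card I * (exp s - 1) = 1 - v" using v by (simp add: s(2) v_def[symmetric] algebra_simps)
  also have "v ^ (J + 1) * exp (1 - v) \<le> v ^ (J + 1) * 3"
  proof (rule mult_left_mono)
    have "exp (1 - v) \<le> exp 1" using v by simp
    then show "exp (1 - v) \<le> 3" using exp_le by linarith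
  qed (use v in simp)
  finally show ?thesis by (simp add: v_def mult.commute)
qed

lemma survivor_deletions: "real (survivor_count b t) - (1 - \<delta>) * t = \<delta> * t - real (deletions {..<t} b)"
proof -
  have "deletions {..<t} b = card {i\<in>{0..<0 + t}. \<not> b ! i}"
    unfolding deletions_def by (rule arg_cong[where f = card]) auto
  then have "survivor_count b t + deletions {..<t} b = t" using survivor_count_add[of b 0 t] by simp
  then have "real (survivor_count b t) + real (deletions {..<t} b) = real t" by (metis of_nat_add)
  then show ?thesis by (simp add: algebra_simps)
qed

text \<open>The generating function is used with exponents \<open>s\<close> and \<open>- s\<close>,
  one for each direction. The free parameter is later chosen as
  \<open>1 / sqrt (n * \<delta>)\<close>, which makes the first term of the exponent 1.\<close>

lemma prob_deviation:
  fixes \<delta> :: real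
  assumes t: "t \<le> n" and \<delta>: "0 \<le> \<delta>" "\<delta> \<le> 1" and s: "0 < s" "s \<le> 1"
  shows "measure_pmf.prob (survival_pmf \<delta> n) {b. g < \<bar>real (survivor_count b t) - (1 - \<delta>) * t\<bar>}
    \<le> 2 * exp (n * \<delta> * s\<^sup>2 - s * g)"
proof -
  let ?d = "\<lambda>b. real (deletions {..<t} b)"
  have mgf: "expect (survival_pmf \<delta> n) (\<lambda>b. exp (z * ?d b)) \<le> exp (z * (\<delta> * t)) * exp (n * \<delta> * s\<^sup>2)"
    if z: "\<bar>z\<bar> = s" for z
  proof -
    have "expect (survival_pmf \<delta> n) (\<lambda>b. exp (z * ?d b)) \<le> exp (\<delta> * t * (exp z - 1))"
      using deletions_mgf[of "{..<t}" n \<delta> z] t \<delta> by simp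
    also have "\<delta> * t * (exp z - 1) \<le> \<delta> * t * (z + s\<^sup>2)"
    proof (rule mult_left_mono)
      have "z\<^sup>2 = s\<^sup>2" using z by (metis power2_abs)
      then show "exp z - 1 \<le> z + s\<^sup>2" using exp_le_quadratic[of z] z s(2) by simp
    qed (use \<delta> in simp)
    also have "\<delta> * t * s\<^sup>2 \<le> \<delta> * n * s\<^sup>2" using t \<delta> by (intro mult_right_mono mult_left_mono) auto
    then have "\<delta> * t * (z + s\<^sup>2) \<le> z * (\<delta> * t) + n * \<delta> * s\<^sup>2" by (simp add: algebra_simps)
    finally show ?thesis unfolding exp_add[symmetric] by simp
  qed
  have "measure_pmf.prob (survival_pmf \<delta> n) {b. g < \<bar>real (survivor_count b t) - (1 - \<delta>) * t\<bar>}
    \<le> expect (survival_pmf \<delta> n) (\<lambda>b. exp (- s * g - s * (\<delta> * t)) * exp (s * ?d b) + exp (- s * g + s * (\<delta> * t)) * exp (- s * ?d b))"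
  proof (rule prob_le_expect[OF finite_survival_pmf])
    fix b assume "b \<in> {b. g < \<bar>real (survivor_count b t) - (1 - \<delta>) * t\<bar>}"
    then have "g < \<bar>?d b - \<delta> * t\<bar>" unfolding survivor_deletions by simp
    then consider "s * g \<le> s * (?d b - \<delta> * t)" | "s * g \<le> s * (\<delta> * t - ?d b)"
      using s by fastforce
    then show "1 \<le> exp (- s * g - s * (\<delta> * t)) * exp (s * ?d b) + exp (- s * g + s * (\<delta> * t)) * exp (- s * ?d b)"
    proof cases
      case 1
      then have "1 \<le> exp (- s * g - s * (\<delta> * t)) * exp (s * ?d b)" by (simp add: algebra_simps flip: exp_add)
      moreover have "0 \<le> exp (- s * g + s * (\<delta> * t)) * exp (- s * ?d b)" by simp
      ultimately show ?thesis by linarith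
    next
      case 2
      then have "1 \<le> exp (- s * g + s * (\<delta> * t)) * exp (- s * ?d b)" by (simp add: algebra_simps flip: exp_add)
      moreover have "0 \<le> exp (- s * g - s * (\<delta> * t)) * exp (s * ?d b)" by simp
      ultimately show ?thesis by linarith
    qed
  qed simp
  also have "\<dots> = exp (- s * g - s * (\<delta> * t)) * expect (survival_pmf \<delta> n) (\<lambda>b. exp (s * ?d b))
      + exp (- s * g + s * (\<delta> * t)) * expect (survival_pmf \<delta> n) (\<lambda>b. exp (- s * ?d b))"
    by (simp add: integrable_measure_pmf_finite[OF finite_survival_pmf])
  also have "\<dots> \<le> exp (- s * g - s * (\<delta> * t)) * (exp (s * (\<delta> * t)) * exp (n * \<delta> * s\<^sup>2))
      + exp (- s * g + s * (\<delta> * t)) * (exp (- s * (\<delta> * t)) * exp (n * \<delta> * s\<^sup>2))"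
    using mgf[of s] mgf[of "- s"] s by (intro add_mono mult_left_mono) auto
  also have "\<dots> = 2 * exp (n * \<delta> * s\<^sup>2 - s * g)" by (simp add: algebra_simps flip: exp_add)
  finally show ?thesis .
qed

lemma survivor_count_append: "t \<le> length u \<Longrightarrow> survivor_count (u @ v) t = survivor_count u t"
  unfolding survivor_count_def by (rule arg_cong[where f = card]) (auto simp: nth_append)

lemma abs_expect_le:
  assumes "finite (set_pmf p)" "\<And>x. x \<in> set_pmf p \<Longrightarrow> \<bar>f x\<bar> \<le> h x"
  shows "\<bar>expect p f\<bar> \<le> expect p h"
proof -
  have "expect p f \<le> expect p h" by (rule expect_mono[OF assms(1)]) (use assms(2) in force)
  moreover have "expect p (\<lambda>x. - f x) \<le> expect p h" by (rule expect_mono[OF assms(1)]) (use assms(2) in force)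
  ultimately show ?thesis by simp
qed

lemma expect_of_bool: "expect p (\<lambda>x. of_bool (P x)) = measure_pmf.prob p {x. P x}"
proof -
  have "(\<lambda>x. of_bool (P x)) = (indicator {x. P x} :: _ \<Rightarrow> real)" by (auto simp: indicator_def)
  then show ?thesis by simp
qed

text \<open>
  \<open>\<beta>\<close> bounds the bias that the truncation at \<open>g\<close> causes, and \<open>\<pi>\<close> the probability that a trace is
  atypical. If there are few deletions, both are bounded by their expected number.
\<close>

definition deviation_bounds :: "nat \<Rightarrow> nat \<Rightarrow> real \<Rightarrow> real \<Rightarrow> real \<Rightarrow> bool" where
  "deviation_bounds n g \<delta> \<pi> \<beta> \<longleftrightarrow>
     (\<exists>s. 0 < s \<and> s \<le> 1 \<and> real (n + 1) * (2 * exp (n * \<delta> * s\<^sup>2 - s * g)) \<le> \<pi> \<and>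
        real n * (2 * exp (n * \<delta> * s\<^sup>2 - s * g)) \<le> \<beta>) \<or>
     n * \<delta> \<le> 10 \<and> n * \<delta> \<le> \<pi> \<and> 2 * n * \<delta> \<le> \<beta>"

context desert_traces
begin

lemma \<delta>1: "0 \<le> \<delta>" "\<delta> \<le> 1" using \<delta> by auto

lemma prob_untypical:
  assumes "deviation_bounds n g \<delta> \<pi> \<beta>"
  shows "measure_pmf.prob (survival_pmf \<delta> n) {b. \<not> typical b} \<le> \<pi>"
  using assms unfolding deviation_bounds_def
proof (elim disjE exE conjE)
  fix s :: real
  assume s: "0 < s" "s \<le> 1" and \<pi>: "real (n + 1) * (2 * exp (n * \<delta> * s\<^sup>2 - s * g)) \<le> \<pi>"
  have "measure_pmf.prob (survival_pmf \<delta> n) {b. \<not> typical b}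
     = measure_pmf.prob (survival_pmf \<delta> n) (\<Union>t\<in>{..n}. {b. g < \<bar>real (survivor_count b t) - (1 - \<delta>) * t\<bar>})"
    unfolding typical_def by (rule arg_cong[where f = "measure_pmf.prob _"]) (auto simp: not_le)
  also have "\<dots> \<le> (\<Sum>t\<in>{..n}. measure_pmf.prob (survival_pmf \<delta> n) {b. g < \<bar>real (survivor_count b t) - (1 - \<delta>) * t\<bar>})"
    by (rule measure_UNION_le) auto
  also have "\<dots> \<le> (\<Sum>t\<in>{..n}. 2 * exp (n * \<delta> * s\<^sup>2 - s * g))"
    by (rule sum_mono) (use prob_deviation[OF _ \<delta>1 s] in auto)
  also have "\<dots> \<le> \<pi>" using \<pi> by simp
  finally show ?thesis .
next
  \<comment> \<open>A trace without any deletion drifts by at most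
    \<open>n * \<delta> \<le> 10 \<le> g\<close> from its expectation and is therefore
    typical.\<close>
  assume s: "n * \<delta> \<le> 10" "n * \<delta> \<le> \<pi>"
  have "measure_pmf.prob (survival_pmf \<delta> n) {b. \<not> typical b} \<le> measure_pmf.prob (survival_pmf \<delta> n) {b. \<exists>i\<in>{..<n}. \<not> b ! i}"
  proof (rule measure_pmf.finite_measure_mono)
    show "{b. \<not> typical b} \<subseteq> {b. \<exists>i\<in>{..<n}. \<not> b ! i}"
    proof clarify
      fix b assume nt: "\<not> typical b"
      show "\<exists>i\<in>{..<n}. \<not> b ! i"
      proof (rule ccontr)
        assume no: "\<not> ?thesis"
        have "typical b"
          unfolding typical_def survivor_deletions
        proof (intro allI impI)
          fix t assume t: "t \<le> n"
          then have "deletions {..<t} b = 0" unfolding deletions_def using no by auto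
          moreover have "\<delta> * t \<le> \<delta> * n" using t \<delta> by (intro mult_left_mono) auto
          ultimately show "\<bar>\<delta> * t - real (deletions {..<t} b)\<bar> \<le> g" using s(1) \<delta> g by (simp add: mult.commute)
        qed
        then show False using nt by simp
      qed
    qed
  qed simp
  also have "\<dots> \<le> n * \<delta>" using prob_deletion[of "{..<n}" n \<delta>] \<delta>1 by simp
  finally show ?thesis using s(2) by linarith
qed

lemma prob_not_good:
  assumes "deviation_bounds n g \<delta> \<pi> \<beta>"
  shows "measure_pmf.prob (survival_pmf \<delta> n) {b. \<not> good c b} \<le> \<pi> + (6 * m + 1) * \<delta>"
proof -
  let ?I = "{i. i < n \<and> c \<le> i + 3 * m \<and> i \<le> c + 3 * m}"
  have "?I \<subseteq> {c - 3 * m..c + 3 * m}" by auto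
  then have "card ?I \<le> card {c - 3 * m..c + 3 * m}" by (rule card_mono[rotated]) simp
  then have cI: "card ?I \<le> 6 * m + 1" by simp
  have "measure_pmf.prob (survival_pmf \<delta> n) {b. \<not> good c b} \<le>
    measure_pmf.prob (survival_pmf \<delta> n) ({b. \<not> typical b} \<union> {b. \<exists>i\<in>?I. \<not> b ! i})"
    by (rule measure_pmf.finite_measure_mono) (auto simp: good_def clean_def)
  also have "\<dots> \<le> measure_pmf.prob (survival_pmf \<delta> n) {b. \<not> typical b} + measure_pmf.prob (survival_pmf \<delta> n) {b. \<exists>i\<in>?I. \<not> b ! i}"
    by (rule measure_Un_le) auto
  also have "\<dots> \<le> \<pi> + card ?I * \<delta>"
    by (intro add_mono prob_untypical[OF assms] prob_deletion \<delta>1) auto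
  also have "card ?I * \<delta> \<le> (6 * m + 1) * \<delta>" using cI \<delta> by (intro mult_right_mono) auto
  finally show ?thesis by simp
qed

lemma prob_irregular:
  assumes "deviation_bounds n g \<delta> \<pi> \<beta>" "0 < \<delta>" "4 * m * \<delta> \<le> 1"
  shows "measure_pmf.prob (survival_pmf \<delta> n) {b. \<not> regular b}
    \<le> \<pi> + ((k + 2) + (k * J + 1) * (k + J + 1)) * \<delta> + 3 * (4 * m * \<delta>) ^ (J + 1)"
proof -
  let ?R = "{a..<a + 4 * m}"
  have fr: "fragile \<subseteq> {..<n}" using fragile_range size by fastforce
  have R: "?R \<subseteq> {..<n}" "?R \<noteq> {}" using a size small by auto
  have "measure_pmf.prob (survival_pmf \<delta> n) {b. \<not> regular b} \<le>
    measure_pmf.prob (survival_pmf \<delta> n) ({b. \<not> typical b} \<union> {b. \<exists>i\<in>fragile. \<not> b ! i} \<union> {b. J < deletions ?R b})"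
    by (rule measure_pmf.finite_measure_mono) (auto simp: regular_def deletions_def)
  also have "\<dots> \<le> measure_pmf.prob (survival_pmf \<delta> n) ({b. \<not> typical b} \<union> {b. \<exists>i\<in>fragile. \<not> b ! i})
     + measure_pmf.prob (survival_pmf \<delta> n) {b. J < deletions ?R b}"
    by (rule measure_Un_le) auto
  also have "measure_pmf.prob (survival_pmf \<delta> n) ({b. \<not> typical b} \<union> {b. \<exists>i\<in>fragile. \<not> b ! i})
     \<le> measure_pmf.prob (survival_pmf \<delta> n) {b. \<not> typical b} + measure_pmf.prob (survival_pmf \<delta> n) {b. \<exists>i\<in>fragile. \<not> b ! i}"
    by (rule measure_Un_le) auto
  also have "\<dots> \<le> \<pi> + card fragile * \<delta>"
    by (intro add_mono prob_untypical[OF assms(1)] prob_deletion \<delta>1 fr)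
  also have "card fragile * \<delta> \<le> real ((k + 2) + (k * J + 1) * (k + J + 1)) * \<delta>"
    using card_fragile \<delta> by (intro mult_right_mono of_nat_mono) auto
  also have "measure_pmf.prob (survival_pmf \<delta> n) {b. J < deletions ?R b} \<le> 3 * (\<delta> * card ?R) ^ (J + 1)"
    by (rule prob_many_deletions[OF R(1) assms(2) \<delta>1(2) _ R(2)]) (use assms(3) in \<open>simp add: mult_ac\<close>)
  also have "\<delta> * card ?R = 4 * m * \<delta>" by simp
  finally show ?thesis by simp
qed

text \<open>Without truncation the mean is 0, so the bias is the mean over the discarded tail, at
  most \<open>n\<close> times its probability. With few deletions the mean absolute deviation is
  small by itself.\<close>

lemma expect_truncated:
  assumes "deviation_bounds n g \<delta> \<pi> \<beta>" "a \<le> n"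
  defines "d \<equiv> \<lambda>b. real (survivor_count b a) - (1 - \<delta>) * a"
  shows "\<bar>expect (survival_pmf \<delta> a) (\<lambda>b. d b * of_bool (\<bar>d b\<bar> \<le> g))\<bar> \<le> \<beta>"
  using assms(1) unfolding deviation_bounds_def
proof (elim disjE exE conjE)
  fix s :: real
  assume s: "0 < s" "s \<le> 1" and \<beta>: "n * (2 * exp (n * \<delta> * s\<^sup>2 - s * g)) \<le> \<beta>"
  have int: "integrable (measure_pmf (survival_pmf \<delta> a)) (f :: _ \<Rightarrow> real)" for f
    by (rule integrable_measure_pmf_finite[OF finite_survival_pmf])
  have mean: "expect (survival_pmf \<delta> a) d = 0"
    unfolding d_def survivor_deletions using expect_deletions[of "{..<a}" a \<delta>] \<delta>1 by (simp add: int)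
  have "expect (survival_pmf \<delta> a) (\<lambda>b. d b * of_bool (\<bar>d b\<bar> \<le> g)) = expect (survival_pmf \<delta> a) (\<lambda>b. d b - d b * of_bool (g < \<bar>d b\<bar>))"
    by (rule expect_cong) (auto simp: not_less)
  also have "\<dots> = - expect (survival_pmf \<delta> a) (\<lambda>b. d b * of_bool (g < \<bar>d b\<bar>))" using mean by (simp add: int)
  finally have "\<bar>expect (survival_pmf \<delta> a) (\<lambda>b. d b * of_bool (\<bar>d b\<bar> \<le> g))\<bar> = \<bar>expect (survival_pmf \<delta> a) (\<lambda>b. d b * of_bool (g < \<bar>d b\<bar>))\<bar>"
    by simp
  also have "\<dots> \<le> expect (survival_pmf \<delta> a) (\<lambda>b. n * of_bool (g < \<bar>d b\<bar>))"
  proof (rule abs_expect_le[OF finite_survival_pmf])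
    fix b
    have "deletions {..<a} b \<le> card {..<a}" unfolding deletions_def by (rule card_mono) auto
    moreover have "\<delta> * a \<le> 1 * real a" using \<delta> by (intro mult_right_mono) auto
    moreover have "0 \<le> \<delta> * a" using \<delta> by simp
    ultimately have "\<bar>d b\<bar> \<le> n" using assms(2) unfolding d_def survivor_deletions by (simp add: abs_le_iff)
    then show "\<bar>d b * of_bool (g < \<bar>d b\<bar>)\<bar> \<le> n * of_bool (g < \<bar>d b\<bar>)" by simp
  qed
  also have "\<dots> = n * measure_pmf.prob (survival_pmf \<delta> a) {b. g < \<bar>d b\<bar>}"
    by (simp add: expect_of_bool)
  also have "\<dots> \<le> n * (2 * exp (a * \<delta> * s\<^sup>2 - s * g))"
    unfolding d_def by (intro mult_left_mono prob_deviation[OF _ \<delta>1 s]) auto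
  also have "\<dots> \<le> n * (2 * exp (n * \<delta> * s\<^sup>2 - s * g))"
    using assms(2) \<delta> by (intro mult_left_mono) (auto intro!: mult_right_mono)
  finally show ?thesis using \<beta> by linarith
next
  assume \<beta>: "2 * n * \<delta> \<le> \<beta>"
  have int: "integrable (measure_pmf (survival_pmf \<delta> a)) (f :: _ \<Rightarrow> real)" for f
    by (rule integrable_measure_pmf_finite[OF finite_survival_pmf])
  have "\<bar>expect (survival_pmf \<delta> a) (\<lambda>b. d b * of_bool (\<bar>d b\<bar> \<le> g))\<bar> \<le> expect (survival_pmf \<delta> a) (\<lambda>b. \<delta> * a + real (deletions {..<a} b))"
  proof (rule abs_expect_le[OF finite_survival_pmf])
    fix b
    have "0 \<le> \<delta> * a" using \<delta> by simp
    then have "\<bar>d b\<bar> \<le> \<delta> * a + real (deletions {..<a} b)" unfolding d_def survivor_deletions by simp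
    moreover have "\<bar>d b * of_bool (\<bar>d b\<bar> \<le> g)\<bar> \<le> \<bar>d b\<bar>" by simp
    ultimately show "\<bar>d b * of_bool (\<bar>d b\<bar> \<le> g)\<bar> \<le> \<delta> * a + real (deletions {..<a} b)" by linarith
  qed
  also have "\<dots> = 2 * (a * \<delta>)" using expect_deletions[of "{..<a}" a \<delta>] \<delta>1 by (simp add: int)
  also have "\<dots> \<le> 2 * (n * \<delta>)" using assms(2) \<delta> by (intro mult_left_mono mult_right_mono) auto
  finally show ?thesis using \<beta> by simp
qed

text \<open>Cutting the deletion pattern at \<open>a\<close> gives two independent parts, and the
  score becomes \<open>f u * ev v + h u * off v\<close>. The factor \<open>f\<close> has mean nearly
  0 whatever the probability of the local event is, and \<open>off\<close> is bounded by the
  deletions among \<open>2 * m\<close> bits. Conditioning on an intact window thus causes no further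
  bias.\<close>

lemma expect_score:
  assumes "deviation_bounds n g \<delta> \<pi> \<beta>"
  shows "\<bar>expect (survival_pmf \<delta> n) score\<bar> \<le> \<beta> + 2 * m * \<delta>"
proof -
  define d where "d b = real (survivor_count b a) - (1 - \<delta>) * a" for b
  define f where "f u = d u * of_bool (\<bar>d u\<bar> \<le> g)" for u
  define h where "h u = (of_bool (\<bar>d u\<bar> \<le> g) :: real)" for u
  define ev where "ev v = (of_bool (local_event v) :: real)" for v
  define off where "off v = (real (survivor_count v (2 * m)) - 2 * m) * of_bool (local_event v)" for v
  let ?P = "survival_pmf \<delta> a" and ?Q = "survival_pmf \<delta> (n - a)"
  have an: "a \<le> n" "2 * m \<le> n - a" using a size by auto
  have int: "integrable (measure_pmf (pair_pmf ?P ?Q)) (f :: _ \<Rightarrow> real)" for f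
    by (rule integrable_measure_pmf_finite) (simp add: finite_survival_pmf)
  have split: "survival_pmf \<delta> n = map_pmf (\<lambda>(u, v). u @ v) (pair_pmf ?P ?Q)"
    using replicate_pmf_append[of a "n - a" "bernoulli_pmf (1 - \<delta>)"] an(1) unfolding survival_pmf_def by simp
  have "expect (survival_pmf \<delta> n) score = expect (pair_pmf ?P ?Q) (\<lambda>z. score (case z of (u, v) \<Rightarrow> u @ v))"
    unfolding split by simp
  also have "\<dots> = expect (pair_pmf ?P ?Q) (\<lambda>z. (case z of (u, v) \<Rightarrow> f u * ev v) + (case z of (u, v) \<Rightarrow> h u * off v))"
  proof (rule expect_cong)
    fix z assume "z \<in> set_pmf (pair_pmf ?P ?Q)"
    then obtain u v where z: "z = (u, v)" "length u = a" by (auto simp: survival_length)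
    have "survivor_count (u @ v) a = survivor_count u a" by (rule survivor_count_append) (simp add: z)
    then show "score (case z of (u, v) \<Rightarrow> u @ v) = (case z of (u, v) \<Rightarrow> f u * ev v) + (case z of (u, v) \<Rightarrow> h u * off v)"
      using z unfolding score_def f_def ev_def h_def off_def d_def by auto
  qed
  also have "\<dots> = expect ?P f * expect ?Q ev + expect ?P h * expect ?Q off"
    by (simp add: int expect_pair finite_survival_pmf)
  finally have E: "expect (survival_pmf \<delta> n) score = expect ?P f * expect ?Q ev + expect ?P h * expect ?Q off" .
  have "\<bar>expect ?P f\<bar> \<le> \<beta>" unfolding f_def d_def by (rule expect_truncated[OF assms an(1)])
  moreover have "\<bar>expect ?Q ev\<bar> \<le> 1" unfolding ev_def expect_of_bool by simp
  ultimately have "\<bar>expect ?P f * expect ?Q ev\<bar> \<le> \<beta> * 1" unfolding abs_mult by (intro mult_mono) auto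
  moreover have "\<bar>expect ?Q off\<bar> \<le> expect ?Q (\<lambda>v. real (deletions {..<2 * m} v))"
  proof (rule abs_expect_le[OF finite_survival_pmf])
    fix v
    have "real (survivor_count v (2 * m)) - 2 * m = - real (deletions {..<2 * m} v)"
      using survivor_deletions[of v "2 * m" 0] by simp
    then show "\<bar>off v\<bar> \<le> real (deletions {..<2 * m} v)" unfolding off_def by simp
  qed
  then have "\<bar>expect ?Q off\<bar> \<le> 2 * m * \<delta>"
    using expect_deletions[of "{..<2 * m}" "n - a" \<delta>] \<delta>1 an(2) by simp
  moreover have "\<bar>expect ?P h\<bar> \<le> 1" unfolding h_def expect_of_bool by simp
  ultimately have "\<bar>expect ?P f * expect ?Q ev\<bar> \<le> \<beta> * 1" "\<bar>expect ?P h\<bar> * \<bar>expect ?Q off\<bar> \<le> 1 * (2 * m * \<delta>)"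
    using mult_mono[of "\<bar>expect ?P h\<bar>" 1 "\<bar>expect ?Q off\<bar>" "2 * m * \<delta>"] by auto
  moreover have "\<bar>expect ?P h * expect ?Q off\<bar> = \<bar>expect ?P h\<bar> * \<bar>expect ?Q off\<bar>" by (rule abs_mult)
  ultimately show ?thesis unfolding E by linarith
qed

end

lemma replicate_pmf_map: "replicate_pmf n (map_pmf h p) = map_pmf (map h) (replicate_pmf n p)"
  by (induction n) (simp_all add: map_bind_pmf bind_map_pmf)

text \<open>The given traces are needed as deletion patterns and the samples only as strings. Both
  are images of one sample of \<open>N + T\<close> patterns, so all events can be bounded in the
  same space.\<close>

lemma pair_replicate_pmf:
  "pair_pmf (replicate_pmf N p) (replicate_pmf T (map_pmf h p)) =
   map_pmf (\<lambda>xs. (take N xs, map h (drop N xs))) (replicate_pmf (N + T) p)"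
proof -
  have "map_pmf (\<lambda>xs. (take N xs, map h (drop N xs))) (replicate_pmf (N + T) p)
     = map_pmf (\<lambda>(u, v). (u, map h v)) (pair_pmf (replicate_pmf N p) (replicate_pmf T p))"
    unfolding replicate_pmf_append map_pmf_comp
    by (rule map_pmf_cong) (auto simp: set_replicate_pmf)
  also have "(\<lambda>(u, v). (u, map h v)) = (\<lambda>(u, v). (id u, map h v))" by auto
  also have "map_pmf (\<lambda>(u, v). (id u, map h v)) (pair_pmf (replicate_pmf N p) (replicate_pmf T p))
     = pair_pmf (map_pmf id (replicate_pmf N p)) (map_pmf (map h) (replicate_pmf T p))"
    by (simp only: map_pair)
  finally show ?thesis by (simp add: replicate_pmf_map)
qed

lemma prob_frequent:
  assumes p: "finite (set_pmf p)" and I: "I \<subseteq> {..<n}" and \<eta>: "measure_pmf.prob p {x. P x} \<le> \<eta>" and t: "0 \<le> t" "t \<le> 2"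
  shows "measure_pmf.prob (replicate_pmf n p) {xs. real (card I) * (\<eta> + t) \<le> real (card {i\<in>I. P (xs ! i)})}
    \<le> exp (- real (card I) * t\<^sup>2 / 4)"
proof -
  have fin: "finite I" using I finite_subset by blast
  have "real (card {i\<in>I. P (xs ! i)}) = (\<Sum>i\<in>I. of_bool (P (xs ! i)))" for xs :: "'a list"
    using fin by (simp add: Int_def)
  then show ?thesis
    using tail_bound[OF p I, of "\<lambda>x. of_bool (P x)" 1 \<eta> t] \<eta> t by (simp add: expect_of_bool)
qed

lemma card_split: "card {i\<in>{..<N}. \<not> P i} + card {i. i < N \<and> P i} = (N :: nat)"
proof -
  have "card ({i\<in>{..<N}. \<not> P i} \<union> {i. i < N \<and> P i}) = card {i\<in>{..<N}. \<not> P i} + card {i. i < N \<and> P i}"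
    by (rule card_Un_disjoint) auto
  moreover have "{i\<in>{..<N}. \<not> P i} \<union> {i. i < N \<and> P i} = {..<N}" by auto
  ultimately show ?thesis by simp
qed

section \<open>The probability of success\<close>

context desert_traces
begin

definition success :: "nat \<Rightarrow> nat \<Rightarrow> bool list list \<Rightarrow> bool" where
  "success N M bs \<longleftrightarrow> (\<forall>c<n. 9 * N \<le> 10 * card {i. i < N \<and> good c (bs ! i)}) \<and>
     9 * M \<le> 10 * card {i. i < M \<and> good e (bs ! i)} \<and> \<bar>\<Sum>i<M. score (bs ! i)\<bar> \<le> M / 20 \<and>
     6 * q * card {i. i < M \<and> \<not> regular (bs ! i)} \<le> M / 20"

text \<open>A union bound over n + 4 events of probability at most n^(-4) each: one for every
  location \<open>c\<close>, since the relevant one depends on the traces, and four for the sums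
  over all \<open>M\<close> traces.\<close>

lemma prob_success:
  assumes dev: "deviation_bounds n g \<delta> \<pi> \<beta>" and \<delta>0: "0 < \<delta>" "4 * m * \<delta> \<le> 1" and N: "N \<le> M" "6400 * ln n \<le> N"
    and M: "1000000 * (real q)\<^sup>2 * ln n \<le> M"
    and h: "\<pi> + (6 * m + 1) * \<delta> \<le> 1 / 20" "\<beta> + 2 * m * \<delta> \<le> 1 / 40"
      "240 * q * (\<pi> + ((k + 2) + (k * J + 1) * (k + J + 1)) * \<delta> + 3 * (4 * m * \<delta>) ^ (J + 1)) \<le> 1"
  shows "measure_pmf.prob (replicate_pmf M (survival_pmf \<delta> n)) {bs. \<not> success N M bs} \<le> 1 / real n ^ 2"
proof -
  let ?p = "survival_pmf \<delta> n"
  let ?P = "measure_pmf.prob (replicate_pmf M ?p)"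
  have n3: "3 \<le> n" using size by simp
  define v where "v = 1 / real n ^ 4"
  have v: "exp (- y) \<le> v" if "4 * ln n \<le> y" for y
  proof -
    have "exp (4 * ln (real n)) = real n ^ 4" using n3 exp_of_nat_mult[of 4 "ln (real n)"] by simp
    then have "v = exp (- (4 * ln (real n)))" unfolding v_def exp_minus by (simp add: divide_inverse)
    then show ?thesis using that by simp
  qed
  have q0: "1 \<le> real q" using q g by simp
  have ln0: "0 \<le> ln (real n)" using n3 by simp
  define A where "A c = {bs :: bool list list. real (card {..<N}) * (1/20 + 1/20) \<le> real (card {i\<in>{..<N}. \<not> good c (bs ! i)})}" for c
  define B where "B = {bs :: bool list list. real (card {..<M}) * (1/20 + 1/20) \<le> real (card {i\<in>{..<M}. \<not> good e (bs ! i)})}"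
  define S1 where "S1 = {bs :: bool list list. real (card {..<M}) * (1/40 + 1/40) \<le> (\<Sum>i\<in>{..<M}. score (bs ! i))}"
  define S2 where "S2 = {bs :: bool list list. real (card {..<M}) * (1/40 + 1/40) \<le> (\<Sum>i\<in>{..<M}. - score (bs ! i))}"
  \<comment> \<open>The tail parameter equals the bound on the mean. Outside this event at most
    \<open>M / (120 * q)\<close> traces are irregular, and \<open>6 * q\<close> times this number is
    M/20.\<close>
  define R where "R = {bs :: bool list list. real (card {..<M}) * (1/(240 * q) + 1/(240 * q)) \<le> real (card {i\<in>{..<M}. \<not> regular (bs ! i)})}"
  have pg: "measure_pmf.prob ?p {b. \<not> good c b} \<le> 1/20" for c
    using prob_not_good[OF dev, of c] h(1) by linarith
  have "?P (A c) \<le> exp (- (real N / 1600))" for c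
    unfolding A_def using prob_frequent[OF finite_survival_pmf _ pg, of "{..<N}" M "1/20" c] N(1) by (simp add: power2_eq_square)
  then have PA: "?P (A c) \<le> v" for c using order_trans[OF _ v[of "real N / 1600"]] N(2) by simp
  have MN: "6400 * ln n \<le> M" using N by linarith
  have "?P B \<le> exp (- (real M / 1600))"
    unfolding B_def using prob_frequent[OF finite_survival_pmf _ pg, of "{..<M}" M "1/20" e] by (simp add: power2_eq_square)
  also have "\<dots> \<le> v" by (rule v) (use MN in simp)
  finally have PB: "?P B \<le> v" .
  have sb: "\<bar>score b\<bar> \<le> real q" for b using score_bound[of b] g q by simp
  have es: "\<bar>expect ?p score\<bar> \<le> 1/40" using expect_score[OF dev] h(2) by linarith
  \<comment> \<open>Twice the deviation 1/40 makes up M/20 and gives the constant 6400. The constant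
    230400 = 4 * 240^2 belongs to the irregular traces, and 4 * 230400 is below 1000000.\<close>
  have Mq: "4 * ln n \<le> real M / (6400 * (real q)\<^sup>2)" "4 * ln n \<le> real M / (230400 * (real q)\<^sup>2)"
  proof -
    have "0 \<le> (real q)\<^sup>2 * ln n" using ln0 by simp
    then show "4 * ln n \<le> real M / (6400 * (real q)\<^sup>2)" "4 * ln n \<le> real M / (230400 * (real q)\<^sup>2)"
      using M q0 by (simp_all add: pos_le_divide_eq mult_ac)
  qed
  have "?P S1 \<le> exp (- (real M / (6400 * (real q)\<^sup>2)))"
    unfolding S1_def using tail_bound[OF finite_survival_pmf, of "{..<M}" M \<delta> n score "real q" "1/40" "1/40"] sb es q0
    by (simp add: power2_eq_square)
  also have "\<dots> \<le> v" by (rule v[OF Mq(1)])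
  finally have P1: "?P S1 \<le> v" .
  have "?P S2 \<le> exp (- (real M / (6400 * (real q)\<^sup>2)))"
    unfolding S2_def using tail_bound[OF finite_survival_pmf, of "{..<M}" M \<delta> n "\<lambda>b. - score b" "real q" "1/40" "1/40"] sb es q0
    by (simp add: power2_eq_square)
  also have "\<dots> \<le> v" by (rule v[OF Mq(1)])
  finally have P2: "?P S2 \<le> v" .
  have pr: "measure_pmf.prob ?p {b. \<not> regular b} \<le> 1 / (240 * q)"
  proof -
    have "measure_pmf.prob ?p {b. \<not> regular b} \<le> \<pi> + ((k + 2) + (k * J + 1) * (k + J + 1)) * \<delta> + 3 * (4 * m * \<delta>) ^ (J + 1)"
      by (rule prob_irregular[OF dev \<delta>0])
    also have "\<dots> \<le> 1 / (240 * q)" using h(3) q0 by (simp add: pos_le_divide_eq mult.commute)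
    finally show ?thesis .
  qed
  have "?P R \<le> exp (- real (card {..<M}) * (1 / (240 * real q))\<^sup>2 / 4)"
    unfolding R_def using prob_frequent[OF finite_survival_pmf _ pr, of "{..<M}" M "1 / (240 * q)"] q0 by (simp add: field_simps)
  also have "- real (card {..<M}) * (1 / (240 * real q))\<^sup>2 / 4 = - (real M / (230400 * (real q)\<^sup>2))"
    by (simp add: power_divide power_mult_distrib)
  also have "exp \<dots> \<le> v" by (rule v[OF Mq(2)])
  finally have PR: "?P R \<le> v" .
  have sub: "{bs. \<not> success N M bs} \<subseteq> (\<Union>c\<in>{..<n}. A c) \<union> B \<union> S1 \<union> S2 \<union> R"
  proof
    fix bs assume "bs \<in> {bs. \<not> success N M bs}"
    then consider c where "c < n" "10 * card {i. i < N \<and> good c (bs ! i)} < 9 * N"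
      | "10 * card {i. i < M \<and> good e (bs ! i)} < 9 * M"
      | "M / 20 < \<bar>\<Sum>i<M. score (bs ! i)\<bar>" | "M / 20 < 6 * q * card {i. i < M \<and> \<not> regular (bs ! i)}"
      unfolding success_def by (auto simp: not_le)
    then show "bs \<in> (\<Union>c\<in>{..<n}. A c) \<union> B \<union> S1 \<union> S2 \<union> R"
    proof cases
      case 1
      have "card {i\<in>{..<N}. \<not> good c (bs ! i)} + card {i. i < N \<and> good c (bs ! i)} = N"
        by (rule card_split)
      then have "bs \<in> A c" using 1(2) unfolding A_def by simp
      then show ?thesis using 1(1) by blast
    next
      case 2
      have "card {i\<in>{..<M}. \<not> good e (bs ! i)} + card {i. i < M \<and> good e (bs ! i)} = M"
        by (rule card_split)
      then have "bs \<in> B" using 2 unfolding B_def by simp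
      then show ?thesis by blast
    next
      case 3
      then have "bs \<in> S1 \<union> S2" unfolding S1_def S2_def by (auto simp: sum_negf abs_if split: if_splits)
      then show ?thesis by blast
    next
      case 4
      have eq: "{i\<in>{..<M}. \<not> regular (bs ! i)} = {i. i < M \<and> \<not> regular (bs ! i)}" by auto
      have "real M / 20 < 6 * real q * real (card {i. i < M \<and> \<not> regular (bs ! i)})" using 4 by simp
      then have "bs \<in> R" unfolding R_def eq using q0 by (simp add: field_simps)
      then show ?thesis by blast
    qed
  qed
  have "?P {bs. \<not> success N M bs} \<le> ?P ((\<Union>c\<in>{..<n}. A c) \<union> B \<union> S1 \<union> S2 \<union> R)"
    by (rule measure_pmf.finite_measure_mono[OF sub]) simp
  also have "\<dots> \<le> ?P (\<Union>c\<in>{..<n}. A c) + ?P B + ?P S1 + ?P S2 + ?P R"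
    using measure_Un_le[of "(\<Union>c\<in>{..<n}. A c) \<union> B \<union> S1 \<union> S2" "replicate_pmf M ?p" R]
      measure_Un_le[of "(\<Union>c\<in>{..<n}. A c) \<union> B \<union> S1" "replicate_pmf M ?p" S2]
      measure_Un_le[of "(\<Union>c\<in>{..<n}. A c) \<union> B" "replicate_pmf M ?p" S1]
      measure_Un_le[of "(\<Union>c\<in>{..<n}. A c)" "replicate_pmf M ?p" B] by simp
  also have "?P (\<Union>c\<in>{..<n}. A c) \<le> (\<Sum>c\<in>{..<n}. ?P (A c))" by (rule measure_UNION_le) auto
  also have "\<dots> \<le> (\<Sum>c\<in>{..<n}. v)" by (rule sum_mono) (rule PA)
  also have "\<dots> = n * v" by simp
  finally have "?P {bs. \<not> success N M bs} \<le> n * v + 4 * v" using PB P1 P2 PR by linarith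
  also have "\<dots> \<le> 1 / real n ^ 2"
  proof -
    have "real n + 4 \<le> real n ^ 2"
    proof -
      have "3 * real n \<le> real n * real n" using n3 by (intro mult_right_mono) auto
      then show ?thesis using n3 unfolding power2_eq_square by linarith
    qed
    then have "(real n + 4) * v \<le> real n ^ 2 * v" unfolding v_def by (intro mult_right_mono) auto
    also have "\<dots> = 1 / real n ^ 2" unfolding v_def using n3 by (simp add: eval_nat_numeral)
    finally show ?thesis by (simp add: distrib_right)
  qed
  finally show ?thesis .
qed

lemma prob_find_end:
  fixes N :: nat
  assumes ok: "parameters_ok n \<delta> N" and mg: "m = half_width n" "g = tolerance n \<delta>" and w: "w = word_size 10 n"
    and C: "deep C m x r" "desert_end C m x r e" "k = length (pattern C m x r)" "C \<le> 2 * m" and e: "4 * e \<le> 3 * n"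
    and N0: "0 < N"
    and dev: "deviation_bounds n g \<delta> \<pi> \<beta>" and \<delta>0: "0 < \<delta>" "4 * m * \<delta> \<le> 1" and N: "6400 * ln n \<le> N"
    and M: "1000000 * (real q)\<^sup>2 * ln n \<le> N + sample_count n \<delta>"
    and h: "\<pi> + (6 * m + 1) * \<delta> \<le> 1 / 20" "\<beta> + 2 * m * \<delta> \<le> 1 / 40"
      "240 * q * (\<pi> + ((k + 2) + (k * J + 1) * (k + J + 1)) * \<delta> + 3 * (4 * m * \<delta>) ^ (J + 1)) \<le> 1"
  shows "measure_pmf.prob
     (pair_pmf (replicate_pmf N (survival_pmf \<delta> n)) (replicate_pmf (sample_count n \<delta>) (Del \<delta> x)))
     {(bs, zs). \<exists>t s. exec w find_end (initial w (find_end_input w n \<delta> r (substring x 0 (r + m)) (map (trace_of x) bs)) zs) t s \<and>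
       out_b s = int e \<and> real (card {i\<in>{..<N}. out_l s i = last_loc e (bs ! i)}) \<ge> 0.9 * real N}
     \<ge> 1 - 1 / real n ^ 2"
proof -
  define T where "T = sample_count n \<delta>"
  let ?P = "replicate_pmf (N + T) (survival_pmf \<delta> n)"
  define Q where "Q bs zs \<longleftrightarrow> (\<exists>t s. exec w find_end (initial w (find_end_input w n \<delta> r (substring x 0 (r + m)) (map (trace_of x) bs)) zs) t s \<and>
       out_b s = int e \<and> real (card {i\<in>{..<N}. out_l s i = last_loc e (bs ! i)}) \<ge> 0.9 * real N)" for bs zs
  have "measure_pmf.prob ?P {bs. \<not> success N (N + T) bs} \<le> 1 / real n ^ 2"
    by (rule prob_success[OF dev \<delta>0 _ N _ h]) (use M in \<open>simp_all add: T_def\<close>)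
  moreover have "measure_pmf.prob ?P {bs. success N (N + T) bs} = 1 - measure_pmf.prob ?P {bs. \<not> success N (N + T) bs}"
    using measure_pmf.prob_compl[of "{bs. \<not> success N (N + T) bs}" ?P] by (simp add: Collect_neg_eq[symmetric] Compl_eq_Diff_UNIV[symmetric])
  moreover have "measure_pmf.prob ?P {bs. success N (N + T) bs} \<le> measure_pmf.prob ?P {xs. Q (take N xs) (map (trace_of x) (drop N xs))}"
  proof -
    have "measure_pmf.prob ?P {bs. success N (N + T) bs} = measure_pmf.prob ?P ({bs. success N (N + T) bs} \<inter> set_pmf ?P)"
      by (rule measure_Int_set_pmf[symmetric])
    also have "\<dots> \<le> measure_pmf.prob ?P {xs. Q (take N xs) (map (trace_of x) (drop N xs))}"
    proof (rule measure_pmf.finite_measure_mono)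
      show "{bs. success N (N + T) bs} \<inter> set_pmf ?P \<subseteq> {xs. Q (take N xs) (map (trace_of x) (drop N xs))}"
      proof clarify
        fix xs assume s: "success N (N + T) xs" and xs: "xs \<in> set_pmf ?P"
        have lx: "length xs = N + T" and ln: "\<And>b. b \<in> set xs \<Longrightarrow> length b = n"
          using xs survival_length by (auto simp: set_replicate_pmf)
        show "Q (take N xs) (map (trace_of x) (drop N xs))"
          unfolding Q_def
          by (rule find_end_correct[OF ok mg w C e N0])
            (use s lx ln in \<open>auto simp: success_def T_def[symmetric]\<close>)
      qed
    qed simp
    finally show ?thesis .
  qed
  moreover have "measure_pmf.prob ?P {xs. Q (take N xs) (map (trace_of x) (drop N xs))} =
     measure_pmf.prob (pair_pmf (replicate_pmf N (survival_pmf \<delta> n)) (replicate_pmf T (Del \<delta> x))) {(bs, zs). Q bs zs}"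
    unfolding Del_def len pair_replicate_pmf measure_map_pmf by (rule arg_cong[where f = "measure_pmf.prob _"]) auto
  ultimately show ?thesis unfolding Q_def T_def by linarith
qed

end

subsection \<open>Growth of the parameters\<close>

lemma bit_len_ln:
  assumes "2 \<le> n"
  shows "ln (real n) \<le> bit_len n" "bit_len n \<le> 3 * ln (real n)"
proof -
  have n: "ln 2 \<le> ln (real n)" "0 \<le> log 2 (real n)" using assms by simp_all
  then have "0 \<le> \<lceil>log 2 (real n)\<rceil>" by (simp add: ceiling_mono[of 0, simplified])
  then have c: "real (bit_len n) = \<lceil>log 2 (real n)\<rceil>"
    unfolding bit_len_def by (subst of_nat_nat) auto
  have l2: "2 / 3 \<le> ln (2::real)" "ln (2::real) \<le> 1" using ln2_ge_two_thirds ln_2_less_1 by auto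
  have ln0: "0 \<le> ln (real n)" using n l2 by linarith
  have "ln (real n) \<le> ln (real n) / ln 2"
    using ln0 l2 by (simp add: pos_le_divide_eq mult_left_le)
  then show "ln (real n) \<le> bit_len n" unfolding c log_def by linarith
  have "1 \<le> ln (real n) / ln 2" using n(1) l2 by (simp add: pos_le_divide_eq)
  then have "ln (real n) / ln 2 + 1 \<le> ln (real n) / ln 2 + ln (real n) / ln 2" by (rule add_left_mono)
  also have "\<dots> \<le> 3 * ln (real n)"
  proof -
    have "(2 / 3) * (3 * ln (real n)) \<le> ln 2 * (3 * ln (real n))" using ln0 l2 by (intro mult_right_mono) auto
    then show ?thesis using l2 by (simp add: pos_divide_le_eq mult.commute)
  qed
  finally show "bit_len n \<le> 3 * ln (real n)" unfolding c log_def by linarith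
qed

lemma spread_bounds:
  assumes P: "(10::nat) \<le> 2 ^ bit_len n" "n \<le> 2 ^ bit_len n" and \<delta>: "0 \<le> \<delta>"
  shows "real (spread n \<delta>) \<le> n * (real (bit_len n))\<^sup>2 * \<delta>"
    and "n * (real (bit_len n))\<^sup>2 * \<delta> \<le> spread n \<delta> + (real (bit_len n))\<^sup>2 / 20 + 1"
proof -
  define D where "D = int (2 ^ bit_len n) ^ 3"
  define d where "d = rate n \<delta>"
  define l where "l = real (bit_len n)"
  define \<rho> :: real where "\<rho> = of_int d / of_int D"
  define y where "y = real n * l\<^sup>2 * \<rho>"
  note R = rate_approx[OF P \<delta>, folded D_def d_def, folded \<rho>_def]
  have d0: "0 \<le> d" unfolding d_def by (rule rate_nonneg[OF \<delta>])
  have "0 \<le> (int n * int (bit_len n) * int (bit_len n) * d) div D"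
    using d0 by (intro pos_imp_zdiv_nonneg_iff[THEN iffD2]) (auto simp: D_def)
  then have "real (spread n \<delta>) = of_int ((int n * int (bit_len n) * int (bit_len n) * d) div D)"
    unfolding spread_def D_def[symmetric] d_def[symmetric] by simp
  also have "\<dots> = of_int \<lfloor>of_int (int n * int (bit_len n) * int (bit_len n) * d) / (of_int D :: real)\<rfloor>"
    by (simp only: floor_divide_of_int_eq)
  also have "of_int (int n * int (bit_len n) * int (bit_len n) * d) / (of_int D :: real) = y"
    by (simp add: y_def \<rho>_def l_def power2_eq_square mult.assoc)
  finally have v: "real (spread n \<delta>) = of_int \<lfloor>y\<rfloor>" .
  have "y \<le> n * l\<^sup>2 * \<delta>" unfolding y_def by (rule mult_left_mono[OF R(1)]) simp
  then show "real (spread n \<delta>) \<le> n * (real (bit_len n))\<^sup>2 * \<delta>" unfolding v l_def[symmetric] by linarith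
  have "(\<delta> - \<rho>) * n \<le> 1 / 20" using R(2) R(1) by simp
  then have "((\<delta> - \<rho>) * n) * l\<^sup>2 \<le> 1 / 20 * l\<^sup>2" by (rule mult_right_mono) simp
  then have "n * l\<^sup>2 * \<delta> \<le> y + l\<^sup>2 / 20" by (simp add: y_def algebra_simps)
  then show "n * (real (bit_len n))\<^sup>2 * \<delta> \<le> spread n \<delta> + (real (bit_len n))\<^sup>2 / 20 + 1"
    unfolding v l_def[symmetric] by linarith
qed

lemma spread_root_bounds:
  assumes "spread n \<delta> \<le> n"
  shows "spread n \<delta> \<le> (spread_root n \<delta>)\<^sup>2" "real (spread_root n \<delta>) \<le> sqrt (spread n \<delta>) + 1"
proof -
  define f where "f = first_from 0 (int n) (\<lambda>j. int (spread n \<delta>) < j * j + 1)"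
  define j where "j = spread_root n \<delta>"
  have j: "int j = f" unfolding j_def spread_root_def f_def by (rule int_first_from)
  have "int n \<le> f \<or> int (spread n \<delta>) < f * f + 1" unfolding f_def by (rule first_from_stop)
  then show "spread n \<delta> \<le> (spread_root n \<delta>)\<^sup>2"
  proof
    assume "int n \<le> f"
    then have "n \<le> j" using j by simp
    then have "n * 1 \<le> j * j" by (cases j) (auto intro: mult_mono)
    then show ?thesis using assms by (simp add: j_def power2_eq_square)
  next
    assume "int (spread n \<delta>) < f * f + 1"
    then have "int (spread n \<delta>) \<le> int (j * j)" using j by simp
    then show ?thesis unfolding of_nat_le_iff by (simp add: j_def power2_eq_square)
  qed
  show "real (spread_root n \<delta>) \<le> sqrt (spread n \<delta>) + 1"
  proof (cases j)
    case (Suc i)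
    have "int i < f" using j Suc by simp
    then have "\<not> int (spread n \<delta>) < int i * int i + 1"
      using first_from_least[of 0 "int i" "int n" "\<lambda>j. int (spread n \<delta>) < j * j + 1"] unfolding f_def by simp
    then have "int (i * i) \<le> int (spread n \<delta>)" by simp
    then have "i * i \<le> spread n \<delta>" by (simp only: of_nat_le_iff)
    then have "real (i * i) \<le> real (spread n \<delta>)" by (rule of_nat_mono)
    then have "real i \<le> sqrt (spread n \<delta>)" by (intro real_le_rsqrt) (simp add: power2_eq_square)
    then show ?thesis using Suc by (simp add: j_def[symmetric])
  qed (simp add: j_def[symmetric])
qed

text \<open>In order: an upper bound for the running time, a lower bound with the factor 4 that
  makes a deviation beyond the tolerance as rare as n^(-4), and two bounds on q^2 that tell how many
  samples suffice.\<close>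

lemma tolerance_bounds:
  assumes P: "(10::nat) \<le> 2 ^ bit_len n" "n \<le> 2 ^ bit_len n" and \<delta>: "0 \<le> \<delta>" and v: "spread n \<delta> \<le> n"
  shows "2 * real (tolerance n \<delta>) \<le> 30 + 10 * (bit_len n * sqrt (n * \<delta>))"
    and "1 \<le> n * \<delta> \<Longrightarrow> 4 * (bit_len n * sqrt (n * \<delta>)) \<le> tolerance n \<delta>"
    and "spread n \<delta> = 0 \<Longrightarrow> 2 * tolerance n \<delta> \<le> 30"
    and "spread n \<delta> \<noteq> 0 \<Longrightarrow> (2 * real (tolerance n \<delta>))\<^sup>2 \<le> 1600 * spread n \<delta>"
proof -
  define l where "l = real (bit_len n)"
  define j where "j = real (spread_root n \<delta>)"
  have t: "real (tolerance n \<delta>) = 5 * j + 10" by (simp add: tolerance_def j_def)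
  have "real (spread n \<delta>) \<le> real ((spread_root n \<delta>)\<^sup>2)" by (rule of_nat_mono) (rule spread_root_bounds(1)[OF v])
  then have j1: "real (spread n \<delta>) \<le> j\<^sup>2" by (simp add: j_def)
  have j2: "j \<le> sqrt (spread n \<delta>) + 1" unfolding j_def by (rule spread_root_bounds(2)[OF v])
  note s = spread_bounds[OF P \<delta>, folded l_def]
  have "sqrt (spread n \<delta>) \<le> sqrt (n * l\<^sup>2 * \<delta>)" using s(1) by simp
  also have "\<dots> = l * sqrt (n * \<delta>)" by (simp add: real_sqrt_mult l_def)
  finally show "2 * real (tolerance n \<delta>) \<le> 30 + 10 * (bit_len n * sqrt (n * \<delta>))"
    using j2 unfolding t l_def by simp
  show "4 * (bit_len n * sqrt (n * \<delta>)) \<le> tolerance n \<delta>" if n1: "1 \<le> n * \<delta>"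
  proof -
    have "l\<^sup>2 * 1 \<le> l\<^sup>2 * (n * \<delta>)" using n1 by (intro mult_left_mono) auto
    then have "(4 * (l * sqrt (n * \<delta>)))\<^sup>2 \<le> 25 * j\<^sup>2 + 100"
      using j1 s(2) n1 by (simp add: power_mult_distrib mult_ac)
    also have "\<dots> \<le> (5 * j + 10)\<^sup>2" by (simp add: power2_eq_square algebra_simps j_def)
    finally have "4 * (l * sqrt (n * \<delta>)) \<le> 5 * j + 10" by (rule power2_le_imp_le) (simp add: j_def)
    then show ?thesis unfolding t l_def .
  qed
  show "2 * tolerance n \<delta> \<le> 30" if "spread n \<delta> = 0"
    using j2 t that by simp
  show "(2 * real (tolerance n \<delta>))\<^sup>2 \<le> 1600 * spread n \<delta>" if "spread n \<delta> \<noteq> 0"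
  proof -
    define z where "z = sqrt (spread n \<delta>)"
    have "1 \<le> z" using that by (simp add: z_def)
    then have "10 * j + 20 \<le> 40 * z" using j2 unfolding z_def[symmetric] by linarith
    then have "2 * real (tolerance n \<delta>) \<le> 40 * sqrt (spread n \<delta>)" unfolding t z_def by simp
    then have "(2 * real (tolerance n \<delta>))\<^sup>2 \<le> (40 * sqrt (spread n \<delta>))\<^sup>2" by (intro power_mono) auto
    then show ?thesis by (simp add: power_mult_distrib)
  qed
qed

lemma half_width_bounds:
  "real (half_width n) \<le> real n powr (1/3)" "real n powr (1/3) \<le> half_width n + 1"
proof -
  have r: "root 3 (real n) = real n powr (1/3)"
    by (cases "n = 0") (simp_all add: root_powr_inverse)
  have "real (half_width n) = of_int \<lfloor>root 3 (real n)\<rfloor>" unfolding half_width_def by (simp add: r)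
  then show "real (half_width n) \<le> real n powr (1/3)" "real n powr (1/3) \<le> half_width n + 1"
    unfolding r by linarith+
qed

text \<open>Here \<open>y\<close> stands for n^(1/3). In the search, the last assumption fits
  tolerance and logarithms into a single factor \<open>y\<close>, beside \<open>n\<close> and
  \<open>m\<close>.\<close>

lemma time_bound_le:
  fixes y :: real
  assumes y: "1 \<le> y" "real n = y ^ 3" "real m \<le> y" "real q \<le> y" "real N \<le> y" "real T \<le> y ^ 2" "real (N + T + 1) \<le> y ^ 3"
    "(2 * real q + 1) * (real N + 1)\<^sup>2 \<le> y"
  shows "real (time_bound n m q N T) \<le> 30000 * y ^ 5"
proof -
  have p: "1 \<le> y ^ i" for i using y(1) by (rule one_le_power)
  have le: "y ^ i \<le> y ^ 5" if "i \<le> 5" for i using y(1) that by (intro power_increasing) auto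
  have 1: "500 * (real n + 1) \<le> 1000 * y ^ 5" using le[of 3] p[of 5] y(2) by simp
  have 2: "400 * (real m + 1) * (real m + 1) \<le> 1600 * y ^ 5"
  proof -
    have "(real m + 1) * (real m + 1) \<le> (2 * y) * (2 * y)" using y by (intro mult_mono) auto
    then have "400 * ((real m + 1) * (real m + 1)) \<le> 1600 * y ^ 5" using le[of 2] by (simp add: power2_eq_square)
    then show ?thesis by (simp only: mult.assoc)
  qed
  have 3: "1 + real N * (real n * 40 + 40) \<le> 81 * y ^ 5"
  proof -
    have "real N * (real n * 40 + 40) \<le> y * (80 * y ^ 3)" using y p[of 3] by (intro mult_mono) auto
    also have "\<dots> = 80 * y ^ 4" by (simp add: eval_nat_numeral)
    finally show ?thesis using le[of 4] p[of 5] by linarith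
  qed
  have 4: "1 + real T * (real n + 30) \<le> 32 * y ^ 5"
  proof -
    have "real T * (real n + 30) \<le> y ^ 2 * (31 * y ^ 3)" using y p[of 3] by (intro mult_mono) auto
    also have "\<dots> = 31 * y ^ 5" by (simp add: eval_nat_numeral)
    finally show ?thesis using p[of 5] by linarith
  qed
  have 5: "1400 * (real n + 2) * (real m + 1) * (2 * real q + 1) * (real N + 1) * (real N + 1) \<le> 8400 * y ^ 5"
  proof -
    have "(real n + 2) * (real m + 1) \<le> (3 * y ^ 3) * (2 * y)" using y p[of 3] by (intro mult_mono) auto
    then have "((real n + 2) * (real m + 1)) * ((2 * real q + 1) * (real N + 1)\<^sup>2) \<le> ((3 * y ^ 3) * (2 * y)) * y"
      by (rule mult_mono[OF _ y(8)]) (use y in auto)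
    also have "\<dots> = 6 * y ^ 5" by (simp add: eval_nat_numeral)
    finally have "1400 * (((real n + 2) * (real m + 1)) * ((2 * real q + 1) * (real N + 1)\<^sup>2)) \<le> 8400 * y ^ 5"
      by linarith
    then show ?thesis by (simp only: power2_eq_square mult.assoc)
  qed
  have 6: "1200 * (real m + 1) * (6 * real q + 1) * (real N + real T + 1) \<le> 16800 * y ^ 5"
  proof -
    have "(real m + 1) * (6 * real q + 1) \<le> (2 * y) * (7 * y)" using y by (intro mult_mono) auto
    then have "((real m + 1) * (6 * real q + 1)) * (real N + real T + 1) \<le> ((2 * y) * (7 * y)) * y ^ 3"
      by (rule mult_mono) (use y in auto)
    also have "\<dots> = 14 * y ^ 5" by (simp add: eval_nat_numeral)
    finally have "1200 * (((real m + 1) * (6 * real q + 1)) * (real N + real T + 1)) \<le> 16800 * y ^ 5" by linarith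
    then show ?thesis by (simp only: mult.assoc)
  qed
  have "real (time_bound n m q N T) = 500 * (real n + 1) + 400 * (real m + 1) * (real m + 1) + (1 + real N * (real n * 40 + 40)) +
     (1 + real T * (real n + 30)) + 1400 * (real n + 2) * (real m + 1) * (2 * real q + 1) * (real N + 1) * (real N + 1) +
     1200 * (real m + 1) * (6 * real q + 1) * (real N + real T + 1) + 200"
    unfolding time_bound_def by (simp only: of_nat_add of_nat_mult of_nat_numeral of_nat_1 add.assoc)
  then show ?thesis using 1 2 3 4 5 6 p[of 5] by linarith
qed

lemma eventually_growth_bounds:
  fixes \<epsilon> K c d :: real
  assumes \<epsilon>: "0 < \<epsilon>"
  shows "\<forall>\<^sub>F n in sequentially. 1000 \<le> n"
    and "\<forall>\<^sub>F n in sequentially. c \<le> real n powr (1/3)"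
    and "\<forall>\<^sub>F n in sequentially. c \<le> ln (real n)"
    and "\<forall>\<^sub>F n in sequentially. 1800 * (ln (real n) * real n powr (1/3 - \<epsilon> / 2)) \<le> real n powr (1/3)"
    and "\<forall>\<^sub>F n in sequentially. 81 * (real n powr (2/3 - \<epsilon>) * ln (real n) ^ 4) \<le> real n powr (2/3)"
    and "\<forall>\<^sub>F n in sequentially. K * ln (real n) + 2 \<le> ln (real n) ^ 2"
    and "\<forall>\<^sub>F n in sequentially. 122 * ln (real n) ^ 4 \<le> real n powr (1/3)"
    and "\<forall>\<^sub>F n in sequentially. 120 * (ln (real n) ^ 5 * real n powr (1/3 - \<epsilon> / 2)) \<le> real n powr (1/3)"
    and "0 < d \<Longrightarrow> \<forall>\<^sub>F n in sequentially. real n powr - \<epsilon> \<le> d"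
    and "0 < d \<Longrightarrow> \<forall>\<^sub>F n in sequentially. real n powr (-2/3) \<le> d"
    and "2/3 < \<epsilon> \<Longrightarrow> \<forall>\<^sub>F n in sequentially. ln (real n) * real n powr (1/3 - \<epsilon> / 2) \<le> 1"
    and "2/3 < \<epsilon> \<Longrightarrow> \<forall>\<^sub>F n in sequentially. real n powr (2/3 - \<epsilon>) \<le> 1 / 43200"
proof -
  have small: "\<forall>\<^sub>F n in sequentially. f n \<le> d" if "0 < d" "f \<longlonglongrightarrow> 0" for f :: "nat \<Rightarrow> real" and d
    using order_tendstoD(2)[OF that(2,1)] by (rule eventually_mono) simp
  have large: "\<forall>\<^sub>F n in sequentially. c \<le> f n" if "filterlim f at_top sequentially" for f :: "nat \<Rightarrow> real" and c
    using that by (simp add: filterlim_at_top)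
  show "\<forall>\<^sub>F n in sequentially. 1000 \<le> n" by (rule eventually_ge_at_top)
  show "\<forall>\<^sub>F n in sequentially. c \<le> real n powr (1/3)" by (rule large) real_asymp
  show "\<forall>\<^sub>F n in sequentially. c \<le> ln (real n)" by (rule large) real_asymp
  show "\<forall>\<^sub>F n in sequentially. 1800 * (ln (real n) * real n powr (1/3 - \<epsilon> / 2)) \<le> real n powr (1/3)"
    using \<epsilon> by real_asymp
  show "\<forall>\<^sub>F n in sequentially. 81 * (real n powr (2/3 - \<epsilon>) * ln (real n) ^ 4) \<le> real n powr (2/3)"
    using \<epsilon> by real_asymp
  show "\<forall>\<^sub>F n in sequentially. K * ln (real n) + 2 \<le> ln (real n) ^ 2"
    by real_asymp
  show "\<forall>\<^sub>F n in sequentially. 122 * ln (real n) ^ 4 \<le> real n powr (1/3)"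
    by real_asymp
  show "\<forall>\<^sub>F n in sequentially. 120 * (ln (real n) ^ 5 * real n powr (1/3 - \<epsilon> / 2)) \<le> real n powr (1/3)"
    using \<epsilon> by real_asymp
  show "\<forall>\<^sub>F n in sequentially. real n powr - \<epsilon> \<le> d" if "0 < d"
    by (rule small[OF that]) (use \<epsilon> in real_asymp)
  show "\<forall>\<^sub>F n in sequentially. real n powr (-2/3) \<le> d" if "0 < d"
    by (rule small[OF that]) real_asymp
  show "\<forall>\<^sub>F n in sequentially. ln (real n) * real n powr (1/3 - \<epsilon> / 2) \<le> 1" if "2/3 < \<epsilon>"
    by (rule small) (use that in \<open>simp, real_asymp\<close>)
  show "\<forall>\<^sub>F n in sequentially. real n powr (2/3 - \<epsilon>) \<le> 1 / 43200" if "2/3 < \<epsilon>"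
    by (rule small) (use that in \<open>simp, real_asymp\<close>)
qed

text \<open>Everything that is used about large \<open>n\<close>, so that the rest is explicit
  arithmetic. The value 1882 = 2 * (900 + 40 + 1) serves the size of the window; 720 = 3 * 240 gives
  each of three error terms a third, 2160 = 3 * 720 takes in the factor 3 of the tail bound, and
  43200 = 60 * 720 uses that \<open>q\<close> is at most 60 when deletions are rare.\<close>

locale large_n =
  fixes \<epsilon> K :: real and n :: nat
  assumes \<epsilon>: "0 < \<epsilon>" and K: "10 ^ 9 \<le> K"
    and large: "1000 \<le> n" "2 * real (nat \<lceil>100 / \<epsilon>\<rceil>) + 2 * real (nat \<lceil>1 / \<epsilon>\<rceil>) + 1882 \<le> real n powr (1/3)"
      "real (nat \<lceil>1 / \<epsilon>\<rceil>) \<le> ln (real n)" "1600000000 \<le> ln (real n)"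
    and powers: "1800 * (ln (real n) * real n powr (1/3 - \<epsilon> / 2)) \<le> real n powr (1/3)"
      "81 * (real n powr (2/3 - \<epsilon>) * ln (real n) ^ 4) \<le> real n powr (2/3)"
      "K * ln (real n) + 2 \<le> ln (real n) ^ 2" "122 * ln (real n) ^ 4 \<le> real n powr (1/3)"
      "120 * (ln (real n) ^ 5 * real n powr (1/3 - \<epsilon> / 2)) \<le> real n powr (1/3)"
    and vanish: "real n powr - \<epsilon> \<le> 1 / 1000"
      "real n powr - \<epsilon> \<le> 1 / (720 * (real (nat \<lceil>100 / \<epsilon>\<rceil>) + 2 +
         (real (nat \<lceil>100 / \<epsilon>\<rceil>) * real (nat \<lceil>1 / \<epsilon>\<rceil>) + 1) * (real (nat \<lceil>100 / \<epsilon>\<rceil>) + real (nat \<lceil>1 / \<epsilon>\<rceil>) + 1)))"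
      "real n powr (-2/3) \<le> 1 / (2160 * 4 ^ (nat \<lceil>1 / \<epsilon>\<rceil> + 1))"
    and sparse: "2/3 < \<epsilon> \<Longrightarrow> ln (real n) * real n powr (1/3 - \<epsilon> / 2) \<le> 1"
      "2/3 < \<epsilon> \<Longrightarrow> real n powr (2/3 - \<epsilon>) \<le> 1 / 43200"
begin

definition "C = nat \<lceil>100 / \<epsilon>\<rceil>"
definition "J = nat \<lceil>1 / \<epsilon>\<rceil>"
definition "\<delta> = real n powr - (1/3 + \<epsilon>)"
definition "N = nat \<lceil>K * ln (real n)\<rceil>"
definition "m = half_width n"
definition "g = tolerance n \<delta>"
definition "q = 2 * g"
definition "y = real n powr (1/3)"
definition "z = real n powr - \<epsilon>"
definition "l = ln (real n)"

lemma n0: "0 < real n" "1 \<le> real n" using large(1) by auto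

lemma y: "1000 \<le> y" "y ^ 2 = real n powr (2/3)" "y ^ 3 = real n" "y ^ 5 = real n powr (5/3)"
proof -
  show "1000 \<le> y" using large(2) unfolding y_def by linarith
qed (use n0 in \<open>simp_all add: y_def powr_power\<close>)

lemma l: "1600000000 \<le> l" "122 * l ^ 4 \<le> y" "K * l + 2 \<le> l ^ 2"
  using large(4) powers by (simp_all add: l_def y_def)

lemma l_powers: "l \<le> l ^ 2" "l ^ 2 \<le> l ^ 4" "1 \<le> l ^ 4" "l ^ 2 \<le> y" "3 * l \<le> y"
proof -
  show 1: "l \<le> l ^ 2" "l ^ 2 \<le> l ^ 4" "1 \<le> l ^ 4"
    using l(1) power_increasing[of 1 2 l] power_increasing[of 2 4 l] one_le_power[of l 4] by auto
  then show "l ^ 2 \<le> y" "3 * l \<le> y" using l(1,2) by linarith+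
qed

lemma L: "l \<le> bit_len n" "bit_len n \<le> 3 * l"
  using bit_len_ln[of n] large(1) by (simp_all add: l_def)

lemma yn: "y \<le> n" "y ^ 2 \<le> n" "2 * y ^ 2 \<le> n"
proof -
  have "2 * y ^ 2 \<le> y * y ^ 2" using y(1) by (intro mult_right_mono) auto
  then show 2: "2 * y ^ 2 \<le> n" using y(3) by (simp add: eval_nat_numeral)
  then show "y ^ 2 \<le> n" by simp
  have "y * 1 \<le> y * y" using y(1) by (intro mult_left_mono) auto
  then show "y \<le> n" using 2 by (simp add: power2_eq_square)
qed

lemma P: "(10::nat) \<le> 2 ^ bit_len n" "n \<le> 2 ^ bit_len n"
  using bit_len_bounds(1)[of n] large(1) by auto

lemma \<delta>: "0 < \<delta>" "\<delta> \<le> z" "y * \<delta> = z" "n * \<delta> = real n powr (2/3 - \<epsilon>)" "sqrt (n * \<delta>) = real n powr (1/3 - \<epsilon> / 2)"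
proof -
  show "0 < \<delta>" using n0 by (simp add: \<delta>_def)
  show "\<delta> \<le> z" unfolding \<delta>_def z_def using n0(2) by (intro powr_mono) auto
  show "y * \<delta> = z" unfolding y_def \<delta>_def z_def by (simp add: powr_add[symmetric])
  have "real n * \<delta> = real n powr 1 * \<delta>" using n0 by simp
  also have "\<dots> = real n powr (2/3 - \<epsilon>)" unfolding \<delta>_def powr_add[symmetric] by simp
  finally show nd: "n * \<delta> = real n powr (2/3 - \<epsilon>)" .
  show "sqrt (n * \<delta>) = real n powr (1/3 - \<epsilon> / 2)"
    unfolding nd by (simp add: powr_half_sqrt[symmetric] powr_powr diff_divide_distrib)
qed

lemma z: "0 < z" "z \<le> 1 / 1000" using vanish(1) n0 by (simp_all add: z_def)

lemma spread_le: "real (spread n \<delta>) \<le> 9 * (real n powr (2/3 - \<epsilon>) * l ^ 2)"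
proof -
  have "real (bit_len n) ^ 2 \<le> (3 * l) ^ 2" using L by (intro power_mono) auto
  then have "(n * \<delta>) * real (bit_len n) ^ 2 \<le> (n * \<delta>) * (3 * l) ^ 2" using \<delta>(1) by (intro mult_left_mono) auto
  then show ?thesis using spread_bounds(1)[OF P, of \<delta>] \<delta>(1) unfolding \<delta>(4) by (simp add: power_mult_distrib mult_ac flip: \<delta>(4))
qed

lemma sample_le: "real (sample_count n \<delta>) \<le> 81 * (real n powr (2/3 - \<epsilon>) * l ^ 4)"
proof -
  have "real (bit_len n) ^ 2 \<le> (3 * l) ^ 2" using L by (intro power_mono) auto
  then have "real (spread n \<delta>) * real (bit_len n) ^ 2 \<le> (9 * (real n powr (2/3 - \<epsilon>) * l ^ 2)) * (3 * l) ^ 2"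
    using spread_le by (intro mult_mono) auto
  also have "\<dots> = 81 * (real n powr (2/3 - \<epsilon>) * l ^ 4)" by (simp add: power_mult_distrib eval_nat_numeral)
  finally show ?thesis unfolding sample_count_def by (simp add: power2_eq_square mult.assoc)
qed

lemma T: "real (sample_count n \<delta>) \<le> y ^ 2"
  using sample_le powers(2) unfolding y(2) l_def by linarith

lemma spread_n: "spread n \<delta> \<le> n"
proof -
  have "real n powr (2/3 - \<epsilon>) * l ^ 2 \<le> real n powr (2/3 - \<epsilon>) * l ^ 4" using l_powers by (intro mult_left_mono) auto
  moreover have "0 \<le> real n powr (2/3 - \<epsilon>) * l ^ 4" by simp
  ultimately have "real (spread n \<delta>) \<le> y ^ 2" using spread_le powers(2) unfolding y(2) l_def by linarith
  then show ?thesis using yn(2) by simp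
qed

lemma N: "K * l \<le> N" "real N \<le> K * l + 1" "real N + 1 \<le> l ^ 2"
proof -
  have "0 \<le> K * l" using K l(1) by simp
  then show 1: "K * l \<le> N" "real N \<le> K * l + 1" unfolding N_def l_def by linarith+
  show "real N + 1 \<le> l ^ 2" using 1 l(3) by linarith
qed

lemma q_bound: "real q \<le> 30 + 30 * (l * sqrt (n * \<delta>))"
proof -
  have "bit_len n * sqrt (n * \<delta>) \<le> (3 * l) * sqrt (n * \<delta>)" using L \<delta>(1) by (intro mult_right_mono) auto
  then show ?thesis using tolerance_bounds(1)[OF P _ spread_n] \<delta>(1) unfolding q_def g_def by simp
qed

lemma m: "real m \<le> y" "y \<le> m + 1"
  unfolding m_def y_def by (rule half_width_bounds)+

lemma small: "30 * q + C + J + 40 \<le> m"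
proof -
  have "30 * real q \<le> 900 + y / 2"
    using q_bound powers(1) unfolding \<delta>(5) l_def y_def by linarith
  moreover have "real C + real J + 941 \<le> y / 2" using large(2) unfolding C_def J_def y_def by simp
  ultimately have "real (30 * q + C + J + 40) \<le> real m" using m(2) by simp
  then show ?thesis by (simp only: of_nat_le_iff)
qed

lemma qy: "real q \<le> y"
  using small m(1) by linarith

lemma size: "12 * m + 40 \<le> n"
proof -
  have "1000 * y \<le> y * y" using y(1) by (intro mult_right_mono) auto
  then have "12 * real m + 40 \<le> real n" using m(1) yn(2) y(1) unfolding power2_eq_square by linarith
  then show ?thesis by linarith
qed

lemma parameters: "parameters_ok n \<delta> N"
proof -
  have np: "real (2 ^ bit_len n) \<ge> n" using P(2) by (metis of_nat_le_iff)
  have "real (bit_len n) \<le> n" using L(2) l_powers(5) yn(1) by linarith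
  moreover have "\<delta> < 1" using \<delta>(2) z by linarith
  moreover have "sample_count n \<delta> \<le> 2 ^ bit_len n"
  proof -
    have "real (sample_count n \<delta>) \<le> real n" using T yn(2) by linarith
    then show ?thesis using P(2) by simp
  qed
  moreover have "N \<le> 2 ^ bit_len n"
  proof -
    have "real N \<le> real n" using N(3) l_powers(4) yn(1) by linarith
    then show ?thesis using P(2) by simp
  qed
  moreover have "6 * tolerance n \<delta> + 5 \<le> 2 ^ bit_len n"
    using small size P(2) unfolding q_def g_def by linarith
  moreover have "2 * half_width n \<le> n" using size unfolding m_def by linarith
  ultimately show ?thesis unfolding parameters_ok_def using P large(1) spread_n \<delta>(1) by auto
qed

lemma time: "real (time_bound n m q N (sample_count n \<delta>)) \<le> 30000 * real n powr (5/3)"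
  unfolding y(4)[symmetric]
proof (rule time_bound_le)
  show "1 \<le> y" "real n = y ^ 3" "real m \<le> y" "real q \<le> y" using y m qy by auto
  show "real N \<le> y" using N(3) l_powers(4) by linarith
  show "real (sample_count n \<delta>) \<le> y ^ 2" by (rule T)
  have "y \<le> y ^ 2" using y(1) power_increasing[of 1 2 y] by simp
  then have "real N + 1 \<le> y ^ 2" using N(3) l_powers(4) by linarith
  then show "real (N + sample_count n \<delta> + 1) \<le> y ^ 3" using T yn(3) unfolding y(3) by simp
  have "(real N + 1)\<^sup>2 \<le> (l ^ 2)\<^sup>2" using N(3) by (intro power_mono) auto
  moreover have q1: "2 * real q + 1 \<le> 61 + 60 * (l * sqrt (n * \<delta>))" using q_bound by simp
  ultimately have "(2 * real q + 1) * (real N + 1)\<^sup>2 \<le> (61 + 60 * (l * sqrt (n * \<delta>))) * (l ^ 2)\<^sup>2"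
    by (intro mult_mono) auto
  also have "\<dots> = 61 * l ^ 4 + 60 * (l ^ 5 * sqrt (n * \<delta>))" by (simp add: algebra_simps eval_nat_numeral)
  also have "\<dots> \<le> y" using l(2) powers(5) unfolding \<delta>(5) l_def[symmetric] y_def[symmetric] by linarith
  finally show "(2 * real q + 1) * (real N + 1)\<^sup>2 \<le> y" .
qed

text \<open>Since \<open>J\<close> is constant it falls below the tolerance, which exceeds ln n if
  deletions are frequent. Otherwise \<epsilon> > 2/3 makes \<open>J\<close> at most 2, and the
  constant 10 in the tolerance suffices.\<close>

lemma J_le_g: "J \<le> g"
proof (cases "\<epsilon> \<le> 2/3")
  case True
  have "1 \<le> n * \<delta>" unfolding \<delta>(4) using True n0 by (intro ge_one_powr_ge_zero) auto
  then have s: "1 \<le> sqrt (n * \<delta>)" by simp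
  have "l * 1 \<le> bit_len n * sqrt (n * \<delta>)" using L(1) l(1) s by (intro mult_mono) auto
  then have "l \<le> g" using tolerance_bounds(2)[OF P _ spread_n \<open>1 \<le> n * \<delta>\<close>] \<delta>(1) l(1) unfolding g_def by linarith
  then show ?thesis using large(3) unfolding J_def l_def by linarith
next
  case False
  then have "1 / \<epsilon> \<le> 2" by (simp add: field_simps)
  then have "J \<le> 2" unfolding J_def by linarith
  then show ?thesis unfolding g_def tolerance_def by simp
qed

definition "\<pi>' = (if \<epsilon> \<le> 2/3 then 12 / real n ^ 3 else n * \<delta>)"
definition "\<beta>' = (if \<epsilon> \<le> 2/3 then 12 / real n ^ 3 else 2 * n * \<delta>)"

lemma deviation: "deviation_bounds n g \<delta> \<pi>' \<beta>'"
proof (cases "\<epsilon> \<le> 2/3")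
  case True
  have nd: "1 \<le> n * \<delta>" unfolding \<delta>(4) using True n0 by (intro ge_one_powr_ge_zero) auto
  \<comment> \<open>With this value the variance term equals 1 and \<open>s * g\<close> is at least
    4 ln n, so the exponential is at most 3 n^(-4).\<close>
  define s where "s = 1 / sqrt (n * \<delta>)"
  have s: "0 < s" "s \<le> 1" using nd by (simp_all add: s_def)
  have e1: "n * \<delta> * s\<^sup>2 = 1" using nd n0 \<delta>(1) by (simp add: s_def power_divide)
  have "4 * l \<le> 4 * bit_len n" using L(1) by simp
  also have "\<dots> = s * (4 * (bit_len n * sqrt (n * \<delta>)))" using nd n0 \<delta>(1) by (simp add: s_def)
  also have "\<dots> \<le> s * g"
    using tolerance_bounds(2)[OF P _ spread_n nd] \<delta>(1) s unfolding g_def by (intro mult_left_mono) auto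
  finally have "n * \<delta> * s\<^sup>2 - s * g \<le> 1 + - (4 * l)" unfolding e1 by simp
  then have "exp (n * \<delta> * s\<^sup>2 - s * g) \<le> exp (1 + - (4 * l))" by simp
  also have "\<dots> = exp 1 * exp (- (4 * l))" by (rule exp_add)
  also have "\<dots> \<le> 3 * exp (- (4 * l))" using exp_le by (intro mult_right_mono) auto
  also have "exp (- (4 * l)) = 1 / real n ^ 4"
    using exp_of_nat_mult[of 4 l] n0 unfolding exp_minus l_def by (simp add: divide_inverse)
  finally have E: "exp (n * \<delta> * s\<^sup>2 - s * g) \<le> 3 * (1 / real n ^ 4)" .
  have E2: "real (n + 1) * (2 * exp (n * \<delta> * s\<^sup>2 - s * g)) \<le> 12 / real n ^ 3"
  proof -
    have "real (n + 1) * (2 * exp (n * \<delta> * s\<^sup>2 - s * g)) \<le> (2 * real n) * (2 * (3 * (1 / real n ^ 4)))"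
      using E n0 by (intro mult_mono) auto
    also have "\<dots> = 12 / real n ^ 3" using n0 by (simp add: eval_nat_numeral)
    finally show ?thesis .
  qed
  moreover have "real n * (2 * exp (n * \<delta> * s\<^sup>2 - s * g)) \<le> real (n + 1) * (2 * exp (n * \<delta> * s\<^sup>2 - s * g))"
    by (rule mult_right_mono) auto
  ultimately have "real n * (2 * exp (n * \<delta> * s\<^sup>2 - s * g)) \<le> 12 / real n ^ 3" by linarith
  then show ?thesis using E2 s True unfolding deviation_bounds_def \<pi>'_def \<beta>'_def by auto
next
  case False
  then have "n * \<delta> \<le> 10" using sparse(2) unfolding \<delta>(4) by simp
  then show ?thesis using False unfolding deviation_bounds_def \<pi>'_def \<beta>'_def by auto
qed

lemma n3: "12 / real n ^ 3 \<le> 1 / 1000" "real n * (12 / real n ^ 3) \<le> 1 / 1000"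
proof -
  have "real n * (12 / real n ^ 3) = 12 / real n ^ 2" using n0 by (simp add: eval_nat_numeral)
  also have "\<dots> \<le> 12 / 1000 ^ 2" using large(1) by (intro divide_left_mono power_mono) auto
  finally show 1: "real n * (12 / real n ^ 3) \<le> 1 / 1000" by simp
  have "1 * (12 / real n ^ 3) \<le> real n * (12 / real n ^ 3)" using n0 by (intro mult_right_mono) auto
  then show "12 / real n ^ 3 \<le> 1 / 1000" using 1 by linarith
qed

lemma \<pi>': "\<pi>' \<le> 1 / 1000" "\<beta>' \<le> 1 / 1000" "q * \<pi>' \<le> 1 / 720" "0 \<le> \<pi>'"
proof -
  show "\<pi>' \<le> 1 / 1000" "\<beta>' \<le> 1 / 1000" "0 \<le> \<pi>'"
  proof -
    have "n * \<delta> \<le> 1 / 43200" if "\<not> \<epsilon> \<le> 2/3" using sparse(2) that unfolding \<delta>(4) by simp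
    moreover have "0 \<le> n * \<delta>" using \<delta>(1) by simp
    moreover have "2 * real n * \<delta> = 2 * (n * \<delta>)" by simp
    ultimately show "\<pi>' \<le> 1 / 1000" "\<beta>' \<le> 1 / 1000" "0 \<le> \<pi>'"
      using n3 unfolding \<pi>'_def \<beta>'_def by (auto split: if_splits)
  qed
  show "q * \<pi>' \<le> 1 / 720"
  proof (cases "\<epsilon> \<le> 2/3")
    case True
    have "real q * (12 / real n ^ 3) \<le> real n * (12 / real n ^ 3)" using qy yn(1) by (intro mult_right_mono) auto
    then show ?thesis using True n3(2) unfolding \<pi>'_def by simp
  next
    case False
    then have "l * sqrt (n * \<delta>) \<le> 1" using sparse(1) unfolding \<delta>(5) l_def by simp
    then have "real q \<le> 60" using q_bound by linarith
    moreover have "n * \<delta> \<le> 1 / 43200" using sparse(2) False unfolding \<delta>(4) by simp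
    ultimately have "real q * (n * \<delta>) \<le> 60 * (1 / 43200)" using \<delta>(1) by (intro mult_mono) auto
    then show ?thesis using False unfolding \<pi>'_def by simp
  qed
qed

lemma m\<delta>: "real m * \<delta> \<le> z" "4 * m * \<delta> \<le> 1"
proof -
  show 1: "real m * \<delta> \<le> z" using mult_right_mono[OF m(1), of \<delta>] \<delta>(1,3) by simp
  then show "4 * m * \<delta> \<le> 1" using z by simp
qed

text \<open>By the choice of \<open>J\<close>, \<epsilon> (J + 1) is at least 1, so the power is
  O(1/n). The factor \<open>q \<le> n powr (1/3)\<close> then leaves n^(-2/3).\<close>

lemma many_deletions: "real q * (4 * m * \<delta>) ^ (J + 1) \<le> 1 / 2160"
proof -
  have "(4 * m * \<delta>) ^ (J + 1) \<le> (4 * z) ^ (J + 1)"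
    using m\<delta>(1) \<delta>(1) by (intro power_mono) auto
  also have "\<dots> = 4 ^ (J + 1) * real n powr (- \<epsilon> * (J + 1))"
    unfolding power_mult_distrib z_def using n0 by (simp add: powr_power mult.commute del: power_Suc)
  also have "\<dots> \<le> 4 ^ (J + 1) * real n powr - 1"
  proof -
    have "1 / \<epsilon> \<le> J" unfolding J_def by linarith
    then have "1 \<le> \<epsilon> * J" using \<epsilon> by (simp add: pos_divide_le_eq mult.commute)
    then have "1 \<le> \<epsilon> * (J + 1)" using \<epsilon> by (simp add: distrib_left)
    then show ?thesis using n0(2) by (intro mult_left_mono powr_mono) auto
  qed
  finally have "real q * (4 * m * \<delta>) ^ (J + 1) \<le> y * (4 ^ (J + 1) * real n powr - 1)"
    using qy \<delta>(1) y(1) by (intro mult_mono) auto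
  also have "\<dots> = 4 ^ (J + 1) * real n powr (-2/3)"
  proof -
    have "y * real n powr - 1 = real n powr (-2/3)" unfolding y_def powr_add[symmetric] by simp
    then show ?thesis by (metis mult.left_commute)
  qed
  also have "\<dots> \<le> 4 ^ (J + 1) * (1 / (2160 * 4 ^ (J + 1)))"
    using vanish(3) unfolding J_def by (intro mult_left_mono) auto
  also have "\<dots> = 1 / 2160" by simp
  finally show ?thesis .
qed

text \<open>The three sources of irregularity, namely atypical traces, deleted fragile positions and
  too many deletions, each get a third of the total budget 1.\<close>

lemma bias:
  assumes "k \<le> C"
  shows "\<pi>' + (6 * m + 1) * \<delta> \<le> 1 / 20" "\<beta>' + 2 * m * \<delta> \<le> 1 / 40"
    "240 * q * (\<pi>' + ((k + 2) + (k * J + 1) * (k + J + 1)) * \<delta> + 3 * (4 * m * \<delta>) ^ (J + 1)) \<le> 1"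
proof -
  show "\<pi>' + (6 * m + 1) * \<delta> \<le> 1 / 20" "\<beta>' + 2 * m * \<delta> \<le> 1 / 40"
    using \<pi>' m\<delta>(1) \<delta>(2) z by (simp_all add: distrib_right)
  define c where "c = real ((C + 2) + (C * J + 1) * (C + J + 1))"
  have c: "1 \<le> c" unfolding c_def by simp
  have "(k + 2) + (k * J + 1) * (k + J + 1) \<le> (C + 2) + (C * J + 1) * (C + J + 1)"
    using assms by (intro add_mono mult_mono) auto
  then have "real ((k + 2) + (k * J + 1) * (k + J + 1)) \<le> c" unfolding c_def by (rule of_nat_mono)
  then have "real ((k + 2) + (k * J + 1) * (k + J + 1)) * (real q * \<delta>) \<le> c * (y * \<delta>)"
    using qy \<delta>(1) c by (intro mult_mono) auto
  also have "\<dots> \<le> c * (1 / (720 * c))" unfolding \<delta>(3)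
  proof (rule mult_left_mono)
    have "c = real C + 2 + (real C * real J + 1) * (real C + real J + 1)" by (simp add: c_def algebra_simps)
    then show "z \<le> 1 / (720 * c)" using vanish(2)[folded C_def J_def z_def] by simp
  qed (use c in simp)
  also have "\<dots> = 1 / 720" using c by simp
  finally have 2: "real ((k + 2) + (k * J + 1) * (k + J + 1)) * (real q * \<delta>) \<le> 1 / 720" .
  define A where "A = real ((k + 2) + (k * J + 1) * (k + J + 1))"
  define B where "B = (4 * m * \<delta>) ^ (J + 1)"
  have "240 * real q * (\<pi>' + A * \<delta> + 3 * B) = 240 * (q * \<pi>') + 240 * (A * (real q * \<delta>)) + 720 * (real q * B)"
    by (simp add: algebra_simps)
  also have "\<dots> \<le> 1" using \<pi>'(3) 2 many_deletions unfolding A_def[symmetric] B_def[symmetric] by linarith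
  finally show "240 * q * (\<pi>' + ((k + 2) + (k * J + 1) * (k + J + 1)) * \<delta> + 3 * (4 * m * \<delta>) ^ (J + 1)) \<le> 1"
    unfolding A_def B_def by simp
qed

text \<open>If \<open>spread\<close> vanishes, then \<open>q \<le> 30\<close> and 10^6 * 900 ln n is
  covered by the given traces alone, whence the threshold 10^9 for \<open>K\<close>. Otherwise q^2
  is at most \<open>1600 * spread\<close>, and 1600000000 \<le> ln n lets one logarithm in the
  number of samples absorb the constant.\<close>

lemma N_large: "0 < N" "6400 * l \<le> N" "1000000 * (real q)\<^sup>2 * l \<le> N + sample_count n \<delta>"
proof -
  have "10 ^ 9 * l \<le> K * l" using K l(1) by (intro mult_right_mono) auto
  then have Nl: "10 ^ 9 * l \<le> N" using N(1) by linarith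
  then show "6400 * l \<le> N" "0 < N" using l(1) by (auto intro: Nat.gr0I)
  show "1000000 * (real q)\<^sup>2 * l \<le> N + sample_count n \<delta>"
  proof (cases "spread n \<delta> = 0")
    case True
    have "q \<le> 30" using tolerance_bounds(3)[OF P _ spread_n True] \<delta>(1) unfolding q_def g_def by simp
    then have "(real q)\<^sup>2 \<le> 30\<^sup>2" by (intro power_mono) auto
    then have "(real q)\<^sup>2 * l \<le> 900 * l" using l(1) by (intro mult_right_mono) auto
    moreover have "1000000000 * l \<le> real N" using Nl by simp
    ultimately have "1000000 * ((real q)\<^sup>2 * l) \<le> real N" using l(1) by linarith
    then show ?thesis unfolding mult.assoc by linarith
  next
    case False
    have "(real q)\<^sup>2 * l \<le> (1600 * spread n \<delta>) * l"
      using tolerance_bounds(4)[OF P _ spread_n False] \<delta>(1) l(1) unfolding q_def g_def by (intro mult_right_mono) auto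
    then have "1000000 * ((real q)\<^sup>2 * l) \<le> 1000000 * ((1600 * spread n \<delta>) * l)" by (rule mult_left_mono) simp
    then have "1000000 * (real q)\<^sup>2 * l \<le> spread n \<delta> * (1600000000 * l)" by (simp add: mult_ac)
    also have "1600000000 * l \<le> l * l" using l(1) by (intro mult_right_mono) auto
    also have "l * l \<le> real (bit_len n) * real (bit_len n)" using L(1) l(1) by (intro mult_mono) auto
    finally have "1000000 * (real q)\<^sup>2 * l \<le> spread n \<delta> * (real (bit_len n) * real (bit_len n))"
      by (simp add: mult_left_mono)
    then show ?thesis by (simp add: sample_count_def mult.assoc)
  qed
qed

lemma find_end_halts:
  assumes "real r \<le> 3 * real n / 4" "length u = r + m + 1" "length ys = N" "\<forall>y\<in>set ys. length y \<le> n"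
    "length x = n" "zs \<in> set_pmf (replicate_pmf (sample_count n \<delta>) (Del \<delta> x))" and w: "w = word_size 10 n"
  shows "\<exists>t s. exec w find_end (initial w (find_end_input w n \<delta> r u ys) zs) t s \<and>
    t \<le> time_bound n m q N (sample_count n \<delta>)"
proof -
  have zs: "length zs = sample_count n \<delta>" and zx: "set zs \<subseteq> set_pmf (Del \<delta> x)"
    using assms(6) by (auto simp: set_replicate_pmf)
  have "length v \<le> n" if "v \<in> set zs" for v
  proof -
    have "v \<in> trace_of x ` set_pmf (survival_pmf \<delta> n)" using zx that assms(5) unfolding Del_def by auto
    then obtain b where "v = trace_of x b" "length b = n" using survival_length by blast
    then show ?thesis using length_filter_le[of "\<lambda>i. b ! i" "[0..<n]"] by (simp add: trace_of_def survivors_def)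
  qed
  then show ?thesis
    using exec_find_end[OF parameters _ _ assms(3) _ zs _ m_def _ refl w, of r u q] assms(1,2,4)
    unfolding q_def g_def m_def by (simp, blast)
qed

lemma find_end_succeeds:
  assumes x: "length x = n" and "first_deep C m x r" and e: "desert_end C m x r e" "real e \<le> 3 * real n / 4"
    and w: "w = word_size 10 n"
  shows "measure_pmf.prob
     (pair_pmf (replicate_pmf N (survival_pmf \<delta> n)) (replicate_pmf (sample_count n \<delta>) (Del \<delta> x)))
     {(bs, zs). \<exists>t s. exec w find_end (initial w (find_end_input w n \<delta> r (substring x 0 (r + m)) (map (trace_of x) bs)) zs) t s \<and>
       out_b s = int e \<and> real (card {i\<in>{..<N}. out_l s i = last_loc e (bs ! i)}) \<ge> 0.9 * real N}
     \<ge> 1 - 1 / real n ^ 2"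
proof -
  have d: "deep C m x r" using assms(2) unfolding first_deep_def by blast
  have Cm: "C \<le> 2 * m" using small by linarith
  define k where "k = length (pattern C m x r)"
  note d0 = \<delta>(1) and kC = deep_pattern(1,2)[OF d Cm, folded k_def]
  note E = desert_end_periodic[OF d Cm e(1), folded k_def]
  have rm: "m \<le> r" using d unfolding deep_def by blast
  have e4: "4 * e \<le> 3 * n" using e(2) by linarith
  have m1: "1 \<le> real m" using small by linarith
  interpret desert_traces x n m k e r g q J \<delta>
  proof
    show "r + k \<le> i + m \<Longrightarrow> i \<le> e \<Longrightarrow> x ! i = x ! (i - k)" for i
      using E(4) rm unfolding periodic_on_def by auto
    show "e + 3 * m + 10 \<le> n" using e4 size by linarith
    show "30 * q + k + J + 40 \<le> m" using small kC(2) by linarith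
    show "10 \<le> g" unfolding g_def tolerance_def by simp
    show "\<delta> \<le> 1 / 2" "\<delta> * m \<le> 1" using \<delta>(2) z m\<delta>(1) by (simp_all add: mult.commute)
  qed (use x kC E rm q_def J_le_g \<delta>(1) in auto)
  show ?thesis
    by (rule prob_find_end[OF parameters m_def g_def w d e(1) k_def Cm e4 N_large(1) deviation d0 m\<delta>(2)
        N_large(2)[unfolded l_def] N_large(3)[unfolded l_def] bias[OF kC(2)]])
qed

end

lemma eventually_large_n:
  fixes \<epsilon> K :: real
  assumes "0 < \<epsilon>" "10 ^ 9 \<le> K"
  shows "\<forall>\<^sub>F n in sequentially. large_n \<epsilon> K n"
proof -
  define C where "C = nat \<lceil>100 / \<epsilon>\<rceil>"
  define J where "J = nat \<lceil>1 / \<epsilon>\<rceil>"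
  note E = eventually_growth_bounds[OF assms(1)]
  have pos: "0 < 1 / (720 * (real C + 2 + (real C * real J + 1) * (real C + real J + 1)))" "0 < 1 / (2160 * 4 ^ (J + 1) :: real)"
    by (simp_all add: add_nonneg_pos)
  have "\<forall>\<^sub>F n in sequentially. 2/3 < \<epsilon> \<longrightarrow> ln (real n) * real n powr (1/3 - \<epsilon> / 2) \<le> 1"
    "\<forall>\<^sub>F n in sequentially. 2/3 < \<epsilon> \<longrightarrow> real n powr (2/3 - \<epsilon>) \<le> 1 / 43200"
    using E(11,12) by (cases "2/3 < \<epsilon>"; simp)+
  with E(1) E(2)[of "2 * real C + 2 * real J + 1882"] E(3)[of "real J"] E(3)[of 1600000000] E(4,5) E(6)[of K] E(7,8)
    E(9)[of "1/1000", simplified] E(9)[OF pos(1)] E(10)[OF pos(2)]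
  show ?thesis
  proof eventually_elim
    case (elim n)
    show ?case by unfold_locales (use assms elim in \<open>simp_all add: C_def J_def\<close>)
  qed
qed

theorem theorem4:
  fixes \<epsilon> :: real
  assumes "\<epsilon> > 0"
  shows "\<exists>K0>0. \<forall>K\<ge>K0. \<exists>(P :: com) (\<kappa> :: nat) (T :: nat \<Rightarrow> nat) (\<tau> :: nat \<Rightarrow> nat) (c :: nat).
    (\<lambda>n. real (T n)) \<in> O(\<lambda>n. real n powr (2/3 - \<epsilon>) * ln (real n) ^ c) \<and>
    (\<lambda>n. real (\<tau> n)) \<in> O(\<lambda>n. real n powr (5/3)) \<and>
    (\<forall>\<^sub>F n in sequentially.
      let \<delta> = real n powr - (1/3 + \<epsilon>);
          N = nat \<lceil>K * ln (real n)\<rceil>;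
          C = nat \<lceil>100 / \<epsilon>\<rceil>;
          m = half_width n;
          w = word_size \<kappa> n
      in
        (\<forall>r u ys x zs.
          real r \<le> 3 * real n / 4 \<and> length u = r + m + 1 \<and>
          length ys = N \<and> (\<forall>y\<in>set ys. length y \<le> n) \<and>
          length x = n \<and> zs \<in> set_pmf (replicate_pmf (T n) (Del \<delta> x)) \<longrightarrow>
          (\<exists>t s. exec w P (initial w (find_end_input w n \<delta> r u ys) zs) t s \<and> t \<le> \<tau> n)) \<and>
        (\<forall>r u x e.
          length x = n \<and> real r \<le> 3 * real n / 4 \<and>
          first_deep C m x r \<and> u = substring x 0 (r + m) \<and>
          desert_end C m x r e \<and> real e \<le> 3 * real n / 4 \<longrightarrow>
          measure_pmf.prob
            (pair_pmf (replicate_pmf N (survival_pmf \<delta> n)) (replicate_pmf (T n) (Del \<delta> x)))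
            {(bs, zs). \<exists>t s.
               exec w P (initial w (find_end_input w n \<delta> r u (map (trace_of x) bs)) zs) t s \<and>
               out_b s = int e \<and>
               real (card {i\<in>{..<N}. out_l s i = last_loc e (bs ! i)}) \<ge> 0.9 * real N}
            \<ge> 1 - 1 / real n ^ 2))"

proof (rule exI[of _ "10 ^ 9"], intro conjI allI impI, goal_cases)
  case (2 K)
  define \<delta> where "\<delta> n = real n powr - (1/3 + \<epsilon>)" for n :: nat
  define N where "N n = nat \<lceil>K * ln (real n)\<rceil>" for n :: nat
  have ev: "\<forall>\<^sub>F n in sequentially. large_n \<epsilon> K n" by (rule eventually_large_n[OF assms 2])
  show ?case
  \<comment> \<open>The words have 10 \<open>bit_len\<close> bits, as the fixed-point computation
    demands. The exponent 4 of the logarithm in the number of samples consists of two from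
    \<open>spread\<close> and two from \<open>sample_count\<close>.\<close>
  proof (rule exI[of _ find_end], rule exI[of _ 10], rule exI[of _ "\<lambda>n. sample_count n (\<delta> n)"],
      rule exI[of _ "\<lambda>n. time_bound n (half_width n) (2 * tolerance n (\<delta> n)) (N n) (sample_count n (\<delta> n))"],
      rule exI[of _ 4], intro conjI, goal_cases)
    case 1
    show ?case
    proof (rule bigoI[of _ 81], rule eventually_mono[OF ev])
      fix n assume "large_n \<epsilon> K n"
      then interpret L: large_n \<epsilon> K n .
      show "norm (real (sample_count n (\<delta> n))) \<le> 81 * norm (real n powr (2/3 - \<epsilon>) * ln (real n) ^ 4)"
        using L.sample_le unfolding L.\<delta>_def \<delta>_def L.l_def by (simp add: abs_mult)
    qed
  next
    case 2
    show ?case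
    proof (rule bigoI[of _ 30000], rule eventually_mono[OF ev])
      fix n assume "large_n \<epsilon> K n"
      then interpret L: large_n \<epsilon> K n .
      show "norm (real (time_bound n (half_width n) (2 * tolerance n (\<delta> n)) (N n) (sample_count n (\<delta> n))))
        \<le> 30000 * norm (real n powr (5/3))"
        using L.time unfolding L.q_def L.g_def L.N_def L.m_def L.\<delta>_def \<delta>_def N_def by simp
    qed
  next
    case 3
    show ?case using ev
    proof eventually_elim
      case (elim n)
      then interpret L: large_n \<epsilon> K n .
      have eq: "\<delta> n = L.\<delta>" "N n = L.N" by (simp_all add: \<delta>_def L.\<delta>_def N_def L.N_def)
      show ?case
        unfolding Let_def eq L.\<delta>_def[symmetric] L.N_def[symmetric] L.C_def[symmetric] L.m_def[symmetric]
          L.g_def[symmetric] L.q_def[symmetric]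
        using L.find_end_halts L.find_end_succeeds by blast
    qed
  qed
qed simp

end
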